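(* Let $A$ be a commutative ring, let $f \in A$ be a regular element (nonzerodivisor), and fix some nonzerodivisor $g \in A$. For any $K \in D(A)$, there is a natural map \[ \alpha:L\eta_f(K) \otimes^L_A A/g \to L\eta_f(K \otimes^L_A A/g).\] This map is an isomorphism if $H^*(K \otimes^L_A A/f)$ has no $g$-torsion.
   Context: $D(A)$ is the unbounded derived category of $A$-modules. For a chain complex $K^\bullet$ of $f$-torsionfree $A$-modules, $\eta_f(K^\bullet)\subset K^\bullet[\frac1f]$ is the subcomplex with $\eta_f(K^\bullet)^i=\{\alpha\in f^iK^i\mid d(\alpha)\in f^{i+1}K^{i+1}\}$. Applying $\eta_f$ to representatives with $f$-torsionfree terms gives a well-defined (non-exact) functor $L\eta_f:D(A)\to D(A)$, with $H^i(L\eta_f(K))\simeq H^i(K)/H^i(K)[f]$. The map $\alpha$ is the one induced by base change from the map $L\eta_f(K)\to L\eta_f(K\otimes^L_AA/g)$ obtained by functoriality from $K\to K\otimes^L_AA/g$. *)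

theory Defs
  imports "HOL-Algebra.AbelCoset" "HOL-Algebra.Module"
begin

section \<open>Categories, localization and derived functors\<close>

record ('o, 'm) cat =
  Obj :: "'o set"
  Arr :: "'m set"
  Dom :: "'m \<Rightarrow> 'o"
  Cod :: "'m \<Rightarrow> 'o"
  Idn :: "'o \<Rightarrow> 'm"
  Cmp :: "'m \<Rightarrow> 'm \<Rightarrow> 'm"

definition Hom :: "('o, 'm) cat \<Rightarrow> 'o \<Rightarrow> 'o \<Rightarrow> 'm set" where
  "Hom C x y = {m \<in> Arr C. Dom C m = x \<and> Cod C m = y}"

definition is_iso_arr :: "('o, 'm) cat \<Rightarrow> 'm \<Rightarrow> bool" where
  "is_iso_arr C m \<longleftrightarrow> m \<in> Arr C \<and>
     (\<exists>n \<in> Hom C (Cod C m) (Dom C m). Cmp C n m = Idn C (Dom C m) \<and> Cmp C m n = Idn C (Cod C m))"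

definition inverse_arr :: "('o, 'm) cat \<Rightarrow> 'm \<Rightarrow> 'm" where
  "inverse_arr C m =
     (THE n. n \<in> Hom C (Cod C m) (Dom C m) \<and> Cmp C n m = Idn C (Dom C m) \<and> Cmp C m n = Idn C (Cod C m))"

record ('o, 'm, 'p, 'n) funct =
  fob :: "'o \<Rightarrow> 'p"
  far :: "'m \<Rightarrow> 'n"

definition is_functor :: "('o, 'm) cat \<Rightarrow> ('p, 'n) cat \<Rightarrow> ('o, 'm, 'p, 'n) funct \<Rightarrow> bool" where
  "is_functor C D F \<longleftrightarrow>
     (\<forall>x \<in> Obj C. fob F x \<in> Obj D \<and> far F (Idn C x) = Idn D (fob F x)) \<and>
     (\<forall>m \<in> Arr C. far F m \<in> Hom D (fob F (Dom C m)) (fob F (Cod C m))) \<and>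
     (\<forall>m \<in> Arr C. \<forall>n \<in> Arr C. Cod C m = Dom C n \<longrightarrow>
        far F (Cmp C n m) = Cmp D (far F n) (far F m))"

definition fid :: "('o, 'm, 'o, 'm) funct" where
  "fid = \<lparr>fob = \<lambda>x. x, far = \<lambda>m. m\<rparr>"

definition funct_comp ::
  "('p, 'n, 'q, 'k) funct \<Rightarrow> ('o, 'm, 'p, 'n) funct \<Rightarrow> ('o, 'm, 'q, 'k) funct" where
  "funct_comp G F = \<lparr>fob = \<lambda>x. fob G (fob F x), far = \<lambda>m. far G (far F m)\<rparr>"

definition nat_trans :: "('o, 'm) cat \<Rightarrow> ('p, 'n) cat \<Rightarrow>
    ('o, 'm, 'p, 'n) funct \<Rightarrow> ('o, 'm, 'p, 'n) funct \<Rightarrow> ('o \<Rightarrow> 'n) \<Rightarrow> bool" where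
  "nat_trans C D F G \<tau> \<longleftrightarrow>
     \<tau> \<in> extensional (Obj C) \<and>
     (\<forall>x \<in> Obj C. \<tau> x \<in> Hom D (fob F x) (fob G x)) \<and>
     (\<forall>m \<in> Arr C. Cmp D (\<tau> (Cod C m)) (far F m) = Cmp D (far G m) (\<tau> (Dom C m)))"

text \<open>
  The localization \<open>C[W\<^sup>-\<^sup>1]\<close> of Gabriel and Zisman: arrows are zigzags of arrows of \<open>C\<close>, those
  pointing backwards being in \<open>W\<close>, modulo the congruence that makes \<open>C \<rightarrow> C[W\<^sup>-\<^sup>1]\<close> a functor
  and turns \<open>Bw m\<close> into an inverse of \<open>Fw m\<close>. Zigzags are read from left to right.
\<close>

datatype 'm zstep = Fw 'm | Bw 'm

inductive zigzag :: "('o, 'm) cat \<Rightarrow> 'm set \<Rightarrow> 'o \<Rightarrow> 'm zstep list \<Rightarrow> 'o \<Rightarrow> bool"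
  for C W where
  nil: "x \<in> Obj C \<Longrightarrow> zigzag C W x [] x"
| fw: "m \<in> Arr C \<Longrightarrow> zigzag C W (Cod C m) p y \<Longrightarrow> zigzag C W (Dom C m) (Fw m # p) y"
| bw: "m \<in> Arr C \<Longrightarrow> m \<in> W \<Longrightarrow> zigzag C W (Dom C m) p y \<Longrightarrow> zigzag C W (Cod C m) (Bw m # p) y"

inductive zrel :: "('o, 'm) cat \<Rightarrow> 'm set \<Rightarrow> 'm zstep list \<Rightarrow> 'm zstep list \<Rightarrow> bool"
  for C W where
  comp: "m \<in> Arr C \<Longrightarrow> n \<in> Arr C \<Longrightarrow> Cod C m = Dom C n \<Longrightarrow> zrel C W [Fw m, Fw n] [Fw (Cmp C n m)]"
| ident: "x \<in> Obj C \<Longrightarrow> zrel C W [Fw (Idn C x)] []"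
| fwbw: "m \<in> Arr C \<Longrightarrow> m \<in> W \<Longrightarrow> zrel C W [Fw m, Bw m] []"
| bwfw: "m \<in> Arr C \<Longrightarrow> m \<in> W \<Longrightarrow> zrel C W [Bw m, Fw m] []"

definition zmove ::
  "('o, 'm) cat \<Rightarrow> 'm set \<Rightarrow> 'o \<Rightarrow> 'o \<Rightarrow> ('m zstep list \<times> 'm zstep list) set" where
  "zmove C W x y = {(p, q). zigzag C W x p y \<and> zigzag C W x q y \<and>
     (\<exists>u v l r. p = u @ l @ v \<and> q = u @ r @ v \<and> zrel C W l r)}"

definition zclass ::
  "('o, 'm) cat \<Rightarrow> 'm set \<Rightarrow> 'o \<Rightarrow> 'm zstep list \<Rightarrow> 'o \<Rightarrow> 'm zstep list set" where
  "zclass C W x p y = {q. (p, q) \<in> (zmove C W x y \<union> (zmove C W x y)\<inverse>)\<^sup>*}"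

type_synonym ('o, 'm) loc_arr = "'o \<times> 'm zstep list set \<times> 'o"

definition localization :: "('o, 'm) cat \<Rightarrow> 'm set \<Rightarrow> ('o, ('o, 'm) loc_arr) cat" where
  "localization C W = \<lparr>
     Obj = Obj C,
     Arr = {(x, zclass C W x p y, y) | x p y. zigzag C W x p y},
     Dom = (\<lambda>(x, P, y). x),
     Cod = (\<lambda>(x, P, y). y),
     Idn = (\<lambda>x. (x, zclass C W x [] x, x)),
     Cmp = (\<lambda>(y, Q, z) (x, P, y'). (x, \<Union>p \<in> P. \<Union>q \<in> Q. zclass C W x (p @ q) z, z))\<rparr>"

definition loc_functor :: "('o, 'm) cat \<Rightarrow> 'm set \<Rightarrow> ('o, 'm, 'o, ('o, 'm) loc_arr) funct" where
  "loc_functor C W = \<lparr>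
     fob = \<lambda>x. x,
     far = \<lambda>m. (Dom C m, zclass C W (Dom C m) [Fw m] (Cod C m), Cod C m)\<rparr>"

text \<open>
  Total left derived functors of \<open>F : C \<rightarrow> D\<close>: terminal pairs of a functor \<open>T : C[W\<^sup>-\<^sup>1] \<rightarrow> D\<close> and a
  transformation from the restriction of \<open>T\<close> along \<open>C \<rightarrow> C[W\<^sup>-\<^sup>1]\<close> to \<open>F\<close>.
\<close>

definition is_left_derived :: "('o, 'm) cat \<Rightarrow> 'm set \<Rightarrow> ('p, 'n) cat \<Rightarrow>
    ('o, 'm, 'p, 'n) funct \<Rightarrow> ('o, ('o, 'm) loc_arr, 'p, 'n) funct \<Rightarrow> ('o \<Rightarrow> 'n) \<Rightarrow> bool" where
  "is_left_derived C W D F T \<epsilon> \<longleftrightarrow>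
     is_functor (localization C W) D T \<and>
     nat_trans C D (funct_comp T (loc_functor C W)) F \<epsilon> \<and>
     (\<forall>G \<eta>. is_functor (localization C W) D G \<and> nat_trans C D (funct_comp G (loc_functor C W)) F \<eta> \<longrightarrow>
        (\<exists>!\<theta>. nat_trans (localization C W) D G T \<theta> \<and>
              (\<forall>x \<in> Obj C. Cmp D (\<epsilon> x) (\<theta> x) = \<eta> x)))"


section \<open>Modules\<close>

text \<open>
  HOL has no type of all \<open>A\<close>-modules, so a universe is needed: all modules have their elements in
  the type \<open>('a, 'b) univ\<close>, where \<open>'a\<close> is the type of the scalars. It contains a copy of the
  arbitrary type \<open>'b\<close>, hence of every \<open>A\<close>-module on a subset of \<open>'b\<close>, and it is closed under forming
  finite sequences of elements and scalars, so that kernels, quotients, direct sums, localizations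
  and free modules are again available inside it.
\<close>

datatype ('a, 'b) univ =
    Atom 'b
  | Scalar 'a
  | Duo (lft: "('a, 'b) univ") (rgt: "('a, 'b) univ")
  | Frac (num: "('a, 'b) univ") (den: nat)
  | Tuple "('a, 'b) univ list"

type_synonym ('a, 'b) umod = "('a, ('a, 'b) univ) module"

definition nonzerodivisor :: "('a, 'r) ring_scheme \<Rightarrow> 'a \<Rightarrow> bool" where
  "nonzerodivisor A f \<longleftrightarrow>
     f \<in> carrier A \<and> (\<forall>x \<in> carrier A. f \<otimes>\<^bsub>A\<^esub> x = \<zero>\<^bsub>A\<^esub> \<longrightarrow> x = \<zero>\<^bsub>A\<^esub>)"

definition torsionfree :: "'a \<Rightarrow> ('a, 'u) module \<Rightarrow> bool" where
  "torsionfree f M \<longleftrightarrow> (\<forall>x \<in> carrier M. f \<odot>\<^bsub>M\<^esub> x = \<zero>\<^bsub>M\<^esub> \<longrightarrow> x = \<zero>\<^bsub>M\<^esub>)"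

text \<open>Linear maps are extensional, so that equal maps are equal as HOL functions.\<close>

definition lin_maps ::
  "('a, 'r) ring_scheme \<Rightarrow> ('a, 'u) module \<Rightarrow> ('a, 'v) module \<Rightarrow> ('u \<Rightarrow> 'v) set" where
  "lin_maps A M N = {h \<in> carrier M \<rightarrow>\<^sub>E carrier N.
     (\<forall>x \<in> carrier M. \<forall>y \<in> carrier M. h (x \<oplus>\<^bsub>M\<^esub> y) = h x \<oplus>\<^bsub>N\<^esub> h y) \<and>
     (\<forall>a \<in> carrier A. \<forall>x \<in> carrier M. h (a \<odot>\<^bsub>M\<^esub> x) = a \<odot>\<^bsub>N\<^esub> h x)}"

text \<open>
  The quotient \<open>M/N\<close> by a submodule. To stay in the type of \<open>M\<close>, its elements are not the cosets
  but one chosen representative of each coset; \<open>qrep M N\<close> is the projection \<open>M \<rightarrow> M/N\<close>.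
\<close>

definition qrep :: "('a, 'u) module \<Rightarrow> 'u set \<Rightarrow> 'u \<Rightarrow> 'u" where
  "qrep M N x = (SOME y. y \<in> N +>\<^bsub>M\<^esub> x)"

definition quot_mod :: "('a, 'u) module \<Rightarrow> 'u set \<Rightarrow> ('a, 'u) module" where
  "quot_mod M N = \<lparr>
     carrier = qrep M N ` carrier M,
     mult = undefined, one = undefined,
     zero = qrep M N \<zero>\<^bsub>M\<^esub>,
     add = (\<lambda>x y. qrep M N (x \<oplus>\<^bsub>M\<^esub> y)),
     smult = (\<lambda>a x. qrep M N (a \<odot>\<^bsub>M\<^esub> x))\<rparr>"

definition scaled :: "'a \<Rightarrow> ('a, 'u) module \<Rightarrow> 'u set" where
  "scaled g M = (\<lambda>x. g \<odot>\<^bsub>M\<^esub> x) ` carrier M"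

definition dsum :: "('a, 'b) umod \<Rightarrow> ('a, 'b) umod \<Rightarrow> ('a, 'b) umod" where
  "dsum M N = \<lparr>
     carrier = {Duo x y | x y. x \<in> carrier M \<and> y \<in> carrier N},
     mult = undefined, one = undefined,
     zero = Duo \<zero>\<^bsub>M\<^esub> \<zero>\<^bsub>N\<^esub>,
     add = (\<lambda>u v. Duo (lft u \<oplus>\<^bsub>M\<^esub> lft v) (rgt u \<oplus>\<^bsub>N\<^esub> rgt v)),
     smult = (\<lambda>a u. Duo (a \<odot>\<^bsub>M\<^esub> lft u) (a \<odot>\<^bsub>N\<^esub> rgt u))\<rparr>"

text \<open>
  The localization \<open>M[1/f]\<close>: the element \<open>x/f\<^sup>n\<close> is \<open>mfrac A f M x n\<close>, a fixed \<open>Frac y m\<close> among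
  those with \<open>y/f\<^sup>m = x/f\<^sup>n\<close>.
\<close>

definition mfrac ::
  "('a, 'r) ring_scheme \<Rightarrow> 'a \<Rightarrow> ('a, 'b) umod \<Rightarrow> ('a, 'b) univ \<Rightarrow> nat \<Rightarrow> ('a, 'b) univ" where
  "mfrac A f M x n = (SOME u. \<exists>y m. u = Frac y m \<and> y \<in> carrier M \<and>
     (\<exists>k::nat. (f [^]\<^bsub>A\<^esub> (k + n)) \<odot>\<^bsub>M\<^esub> y = (f [^]\<^bsub>A\<^esub> (k + m)) \<odot>\<^bsub>M\<^esub> x))"

definition loc_mod :: "('a, 'r) ring_scheme \<Rightarrow> 'a \<Rightarrow> ('a, 'b) umod \<Rightarrow> ('a, 'b) umod" where
  "loc_mod A f M = \<lparr>
     carrier = {mfrac A f M x n | x n. x \<in> carrier M},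
     mult = undefined, one = undefined,
     zero = mfrac A f M \<zero>\<^bsub>M\<^esub> 0,
     add = (\<lambda>u v. mfrac A f M
       ((f [^]\<^bsub>A\<^esub> den v) \<odot>\<^bsub>M\<^esub> num u \<oplus>\<^bsub>M\<^esub> (f [^]\<^bsub>A\<^esub> den u) \<odot>\<^bsub>M\<^esub> num v) (den u + den v)),
     smult = (\<lambda>a u. mfrac A f M (a \<odot>\<^bsub>M\<^esub> num u) (den u))\<rparr>"

text \<open>The map \<open>M[1/f] \<rightarrow> N[1/f]\<close> induced by \<open>h : M \<rightarrow> N\<close>.\<close>

definition loc_map :: "('a, 'r) ring_scheme \<Rightarrow> 'a \<Rightarrow> ('a, 'b) umod \<Rightarrow>
    (('a, 'b) univ \<Rightarrow> ('a, 'b) univ) \<Rightarrow> ('a, 'b) univ \<Rightarrow> ('a, 'b) univ" where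
  "loc_map A f N h u = mfrac A f N (h (num u)) (den u)"

text \<open>The subset \<open>f\<^sup>iM\<close> of \<open>M[1/f]\<close>, where \<open>i\<close> may be negative.\<close>

definition fpow_mod ::
  "('a, 'r) ring_scheme \<Rightarrow> 'a \<Rightarrow> int \<Rightarrow> ('a, 'b) umod \<Rightarrow> ('a, 'b) univ set" where
  "fpow_mod A f i M = {mfrac A f M ((f [^]\<^bsub>A\<^esub> nat i) \<odot>\<^bsub>M\<^esub> x) (nat (- i)) | x. x \<in> carrier M}"


section \<open>Complexes and the derived category\<close>

record ('a, 'b) cplx =
  trm :: "int \<Rightarrow> ('a, 'b) umod"
  dif :: "int \<Rightarrow> ('a, 'b) univ \<Rightarrow> ('a, 'b) univ"

definition is_cplx :: "('a, 'r) ring_scheme \<Rightarrow> ('a, 'b) cplx \<Rightarrow> bool" where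
  "is_cplx A X \<longleftrightarrow> (\<forall>i. module A (trm X i) \<and> dif X i \<in> lin_maps A (trm X i) (trm X (i + 1)) \<and>
     (\<forall>x \<in> carrier (trm X i). dif X (i + 1) (dif X i x) = \<zero>\<^bsub>trm X (i + 1 + 1)\<^esub>))"

type_synonym ('a, 'b) chmap =
  "('a, 'b) cplx \<times> (int \<Rightarrow> ('a, 'b) univ \<Rightarrow> ('a, 'b) univ) \<times> ('a, 'b) cplx"

definition is_chmap :: "('a, 'r) ring_scheme \<Rightarrow> ('a, 'b) chmap \<Rightarrow> bool" where
  "is_chmap A = (\<lambda>(X, \<phi>, Y). is_cplx A X \<and> is_cplx A Y \<and>
     (\<forall>i. \<phi> i \<in> lin_maps A (trm X i) (trm Y i) \<and>
        (\<forall>x \<in> carrier (trm X i). \<phi> (i + 1) (dif X i x) = dif Y i (\<phi> i x))))"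

definition Ch :: "('a, 'r) ring_scheme \<Rightarrow> (('a, 'b) cplx, ('a, 'b) chmap) cat" where
  "Ch A = \<lparr>
     Obj = {X. is_cplx A X},
     Arr = {m. is_chmap A m},
     Dom = (\<lambda>(X, \<phi>, Y). X),
     Cod = (\<lambda>(X, \<phi>, Y). Y),
     Idn = (\<lambda>X. (X, \<lambda>i. \<lambda>x \<in> carrier (trm X i). x, X)),
     Cmp = (\<lambda>(Y, \<psi>, Z) (X, \<phi>, Y'). (X, \<lambda>i. compose (carrier (trm X i)) (\<psi> i) (\<phi> i), Z))\<rparr>"

definition cocycles :: "('a, 'b) cplx \<Rightarrow> int \<Rightarrow> ('a, 'b) umod" where
  "cocycles X i = (trm X i)\<lparr>carrier := {x \<in> carrier (trm X i). dif X i x = \<zero>\<^bsub>trm X (i + 1)\<^esub>}\<rparr>"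

definition coboundaries :: "('a, 'b) cplx \<Rightarrow> int \<Rightarrow> ('a, 'b) univ set" where
  "coboundaries X i = dif X (i - 1) ` carrier (trm X (i - 1))"

definition cohomology :: "('a, 'b) cplx \<Rightarrow> int \<Rightarrow> ('a, 'b) umod" where
  "cohomology X i = quot_mod (cocycles X i) (coboundaries X i)"

definition qis :: "('a, 'r) ring_scheme \<Rightarrow> ('a, 'b) chmap set" where
  "qis A = {(X, \<phi>, Y). is_chmap A (X, \<phi>, Y) \<and>
     (\<forall>i. bij_betw (\<lambda>x. qrep (cocycles Y i) (coboundaries Y i) (\<phi> i x))
            (carrier (cohomology X i)) (carrier (cohomology Y i)))}"

type_synonym ('a, 'b) darr = "(('a, 'b) cplx, ('a, 'b) chmap) loc_arr"

definition DA :: "('a, 'r) ring_scheme \<Rightarrow> (('a, 'b) cplx, ('a, 'b) darr) cat" where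
  "DA A = localization (Ch A) (qis A)"

definition toD ::
  "('a, 'r) ring_scheme \<Rightarrow> (('a, 'b) cplx, ('a, 'b) chmap, ('a, 'b) cplx, ('a, 'b) darr) funct" where
  "toD A = loc_functor (Ch A) (qis A)"

type_synonym ('a, 'b) chfunct =
  "(('a, 'b) cplx, ('a, 'b) chmap, ('a, 'b) cplx, ('a, 'b) chmap) funct"

type_synonym ('a, 'b) dfunct =
  "(('a, 'b) cplx, ('a, 'b) darr, ('a, 'b) cplx, ('a, 'b) darr) funct"


section \<open>The derived tensor product with \<open>A/g\<close>\<close>

text \<open>For an \<open>A\<close>-module \<open>M\<close> one has \<open>M \<otimes>\<^sub>A A/g = M/gM\<close>.\<close>

definition tensor_cplx :: "'a \<Rightarrow> ('a, 'b) cplx \<Rightarrow> ('a, 'b) cplx" where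
  "tensor_cplx g X = \<lparr>
     trm = (\<lambda>i. quot_mod (trm X i) (scaled g (trm X i))),
     dif = (\<lambda>i. \<lambda>x \<in> carrier (quot_mod (trm X i) (scaled g (trm X i))).
              qrep (trm X (i + 1)) (scaled g (trm X (i + 1))) (dif X i x))\<rparr>"

definition tensor_functor :: "'a \<Rightarrow> ('a, 'b) chfunct" where
  "tensor_functor g = \<lparr>
     fob = tensor_cplx g,
     far = (\<lambda>(X, \<phi>, Y). (tensor_cplx g X,
       \<lambda>i. \<lambda>x \<in> carrier (trm (tensor_cplx g X) i). qrep (trm Y i) (scaled g (trm Y i)) (\<phi> i x),
       tensor_cplx g Y))\<rparr>"

text \<open>The projection \<open>X \<rightarrow> X \<otimes>\<^sub>A A/g\<close>.\<close>

definition tensor_proj :: "'a \<Rightarrow> ('a, 'b) cplx \<Rightarrow> ('a, 'b) chmap" where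
  "tensor_proj g X =
     (X, \<lambda>i. \<lambda>x \<in> carrier (trm X i). qrep (trm X i) (scaled g (trm X i)) x, tensor_cplx g X)"

text \<open>
  The functor \<open>K \<mapsto> K \<otimes>\<^sup>L\<^sub>A A/g\<close> on \<open>D(A)\<close>, as the total left derived functor of \<open>K \<mapsto> K \<otimes>\<^sub>A A/g\<close>,
  with its comparison map \<open>K \<otimes>\<^sup>L\<^sub>A A/g \<rightarrow> K \<otimes>\<^sub>A A/g\<close> and the map \<open>K \<rightarrow> K \<otimes>\<^sup>L\<^sub>A A/g\<close> that lifts the
  projection \<open>K \<rightarrow> K \<otimes>\<^sub>A A/g\<close>.
\<close>

definition dtensor_pair ::
  "('a, 'r) ring_scheme \<Rightarrow> 'a \<Rightarrow> ('a, 'b) dfunct \<times> (('a, 'b) cplx \<Rightarrow> ('a, 'b) darr)" where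
  "dtensor_pair A g = (SOME (T, \<epsilon>).
     is_left_derived (Ch A) (qis A) (DA A) (funct_comp (toD A) (tensor_functor g)) T \<epsilon>)"

definition dtensor :: "('a, 'r) ring_scheme \<Rightarrow> 'a \<Rightarrow> ('a, 'b) dfunct" where
  "dtensor A g = fst (dtensor_pair A g)"

definition dtensor_cmp :: "('a, 'r) ring_scheme \<Rightarrow> 'a \<Rightarrow> ('a, 'b) cplx \<Rightarrow> ('a, 'b) darr" where
  "dtensor_cmp A g = snd (dtensor_pair A g)"

definition dtensor_unit :: "('a, 'r) ring_scheme \<Rightarrow> 'a \<Rightarrow> ('a, 'b) cplx \<Rightarrow> ('a, 'b) darr" where
  "dtensor_unit A g = (THE \<theta>. nat_trans (DA A) (DA A) fid (dtensor A g) \<theta> \<and>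
     (\<forall>X \<in> Obj (DA A). Cmp (DA A) (dtensor_cmp A g X) (\<theta> X) = far (toD A) (tensor_proj g X)))"


section \<open>The functor \<open>L\<eta>\<^sub>f\<close>\<close>

definition ChTf :: "('a, 'r) ring_scheme \<Rightarrow> 'a \<Rightarrow> (('a, 'b) cplx, ('a, 'b) chmap) cat" where
  "ChTf A f = (Ch A)\<lparr>
     Obj := {X \<in> Obj (Ch A). \<forall>i. torsionfree f (trm X i)},
     Arr := {(X, \<phi>, Y) | X \<phi> Y. (X, \<phi>, Y) \<in> Arr (Ch A) \<and>
               (\<forall>i. torsionfree f (trm X i)) \<and> (\<forall>i. torsionfree f (trm Y i))}\<rparr>"

definition eta_carrier ::
  "('a, 'r) ring_scheme \<Rightarrow> 'a \<Rightarrow> ('a, 'b) cplx \<Rightarrow> int \<Rightarrow> ('a, 'b) univ set" where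
  "eta_carrier A f X i = {u \<in> fpow_mod A f i (trm X i).
     loc_map A f (trm X (i + 1)) (dif X i) u \<in> fpow_mod A f (i + 1) (trm X (i + 1))}"

definition eta :: "('a, 'r) ring_scheme \<Rightarrow> 'a \<Rightarrow> ('a, 'b) cplx \<Rightarrow> ('a, 'b) cplx" where
  "eta A f X = \<lparr>
     trm = (\<lambda>i. (loc_mod A f (trm X i))\<lparr>carrier := eta_carrier A f X i\<rparr>),
     dif = (\<lambda>i. \<lambda>u \<in> eta_carrier A f X i. loc_map A f (trm X (i + 1)) (dif X i) u)\<rparr>"

definition eta_functor :: "('a, 'r) ring_scheme \<Rightarrow> 'a \<Rightarrow> ('a, 'b) chfunct" where
  "eta_functor A f = \<lparr>
     fob = eta A f,
     far = (\<lambda>(X, \<phi>, Y). (eta A f X,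
       \<lambda>i. \<lambda>u \<in> eta_carrier A f X i. loc_map A f (trm Y i) (\<phi> i) u,
       eta A f Y))\<rparr>"

text \<open>
  \<open>L\<eta>\<^sub>f\<close> is the functor on \<open>D(A)\<close> that is given by \<open>\<eta>\<^sub>f\<close>, naturally, on the complexes with
  \<open>f\<close>-torsionfree terms. As every complex is quasi-isomorphic to one of these, this determines the
  pair of \<open>L\<eta>\<^sub>f\<close> and \<open>\<kappa>\<^sub>P : L\<eta>\<^sub>f(P) \<cong> \<eta>\<^sub>f(P)\<close> up to unique isomorphism.
\<close>

definition is_Leta :: "('a, 'r) ring_scheme \<Rightarrow> 'a \<Rightarrow>
    ('a, 'b) dfunct \<Rightarrow> (('a, 'b) cplx \<Rightarrow> ('a, 'b) darr) \<Rightarrow> bool" where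
  "is_Leta A f T \<kappa> \<longleftrightarrow>
     is_functor (DA A) (DA A) T \<and>
     nat_trans (ChTf A f) (DA A) (funct_comp T (toD A)) (funct_comp (toD A) (eta_functor A f)) \<kappa> \<and>
     (\<forall>P \<in> Obj (ChTf A f). is_iso_arr (DA A) (\<kappa> P))"

definition Leta_pair ::
  "('a, 'r) ring_scheme \<Rightarrow> 'a \<Rightarrow> ('a, 'b) dfunct \<times> (('a, 'b) cplx \<Rightarrow> ('a, 'b) darr)" where
  "Leta_pair A f = (SOME (T, \<kappa>). is_Leta A f T \<kappa>)"

definition Leta :: "('a, 'r) ring_scheme \<Rightarrow> 'a \<Rightarrow> ('a, 'b) dfunct" where
  "Leta A f = fst (Leta_pair A f)"

definition Leta_cmp :: "('a, 'r) ring_scheme \<Rightarrow> 'a \<Rightarrow> ('a, 'b) cplx \<Rightarrow> ('a, 'b) darr" where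
  "Leta_cmp A f = snd (Leta_pair A f)"


section \<open>The base change map\<close>

text \<open>
  Let \<open>B = (A \<rightarrow> A)\<close> be the Koszul complex of \<open>g\<close>, in degrees \<open>-1\<close> and \<open>0\<close>. As \<open>g\<close> is a
  nonzerodivisor, this commutative differential graded \<open>A\<close>-algebra is a resolution of \<open>A/g\<close> by free
  \<open>A\<close>-modules. Below is \<open>X \<otimes>\<^sub>A B\<close>; here \<open>Duo x y\<close> is \<open>x \<otimes> 1 \<plusminus> y \<otimes> e\<close> with the generator \<open>e\<close> in
  degree \<open>-1\<close>, the sign being that of the degree of \<open>y\<close>.
\<close>

definition koszul :: "'a \<Rightarrow> ('a, 'b) cplx \<Rightarrow> ('a, 'b) cplx" where
  "koszul g X = \<lparr>
     trm = (\<lambda>i. dsum (trm X i) (trm X (i + 1))),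
     dif = (\<lambda>i. \<lambda>u \<in> carrier (dsum (trm X i) (trm X (i + 1))).
       Duo (dif X i (lft u) \<oplus>\<^bsub>trm X (i + 1)\<^esub> g \<odot>\<^bsub>trm X (i + 1)\<^esub> rgt u)
           (\<ominus>\<^bsub>trm X (i + 1 + 1)\<^esub> dif X (i + 1) (rgt u)))\<rparr>"

text \<open>
  The map \<open>X \<otimes>\<^sub>A B \<rightarrow> X \<otimes>\<^sub>A A/g\<close>, a quasi-isomorphism if the terms of \<open>X\<close> are \<open>g\<close>-torsionfree.
\<close>

definition koszul_proj :: "'a \<Rightarrow> ('a, 'b) cplx \<Rightarrow> ('a, 'b) chmap" where
  "koszul_proj g X = (koszul g X,
     \<lambda>i. \<lambda>u \<in> carrier (trm (koszul g X) i). qrep (trm X i) (scaled g (trm X i)) (lft u),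
     tensor_cplx g X)"

text \<open>
  For \<open>P\<close> with \<open>f\<close>-torsionfree terms, \<open>\<eta>\<^sub>f(P \<otimes>\<^sub>A B)\<close> is a differential graded \<open>B\<close>-submodule of
  \<open>(P \<otimes>\<^sub>A B)[1/f]\<close>. So the map \<open>\<eta>\<^sub>f(P) \<rightarrow> \<eta>\<^sub>f(P \<otimes>\<^sub>A B)\<close> given by functoriality has a \<open>B\<close>-linear
  extension \<open>\<eta>\<^sub>f(P) \<otimes>\<^sub>A B \<rightarrow> \<eta>\<^sub>f(P \<otimes>\<^sub>A B)\<close>. It sends \<open>(x/f\<^sup>m, y/f\<^sup>n)\<close> to \<open>(f\<^sup>n x, f\<^sup>m y)/f\<^sup>m\<^sup>+\<^sup>n\<close>.
\<close>

definition koszul_eta :: "('a, 'r) ring_scheme \<Rightarrow> 'a \<Rightarrow> 'a \<Rightarrow> ('a, 'b) cplx \<Rightarrow> ('a, 'b) chmap" where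
  "koszul_eta A f g P = (koszul g (eta A f P),
     \<lambda>i. \<lambda>u \<in> carrier (trm (koszul g (eta A f P)) i).
       mfrac A f (trm (koszul g P) i)
         (Duo ((f [^]\<^bsub>A\<^esub> den (rgt u)) \<odot>\<^bsub>trm P i\<^esub> num (lft u))
              ((f [^]\<^bsub>A\<^esub> den (lft u)) \<odot>\<^bsub>trm P (i + 1)\<^esub> num (rgt u)))
         (den (lft u) + den (rgt u)),
     eta A f (koszul g P))"

text \<open>
  The map \<open>\<alpha>\<close> induced by base change. For \<open>P\<close> with \<open>f\<close>- and \<open>g\<close>-torsionfree terms, it is
  \<open>koszul_eta A f g P\<close> up to the identifications
  \<open>L\<eta>\<^sub>f(P) \<otimes>\<^sup>L\<^sub>A A/g \<rightarrow> \<eta>\<^sub>f(P) \<otimes>\<^sup>L\<^sub>A A/g \<rightarrow> \<eta>\<^sub>f(P) \<otimes>\<^sub>A A/g \<leftarrow> \<eta>\<^sub>f(P) \<otimes>\<^sub>A B\<close> on the left and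
  \<open>L\<eta>\<^sub>f(P \<otimes>\<^sup>L\<^sub>A A/g) \<rightarrow> L\<eta>\<^sub>f(P \<otimes>\<^sub>A A/g) \<leftarrow> L\<eta>\<^sub>f(P \<otimes>\<^sub>A B) \<rightarrow> \<eta>\<^sub>f(P \<otimes>\<^sub>A B)\<close> on the right, all of
  which are isomorphisms in \<open>D(A)\<close>. As every complex is quasi-isomorphic to such a \<open>P\<close>, this
  determines the natural transformation \<open>\<alpha>\<close>.
\<close>

definition is_base_change ::
  "('a, 'r) ring_scheme \<Rightarrow> 'a \<Rightarrow> 'a \<Rightarrow> (('a, 'b) cplx \<Rightarrow> ('a, 'b) darr) \<Rightarrow> bool" where
  "is_base_change A f g \<alpha> \<longleftrightarrow>
     (\<forall>K \<in> Obj (DA A).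
        Cmp (DA A) (\<alpha> K) (dtensor_unit A g (fob (Leta A f) K)) = far (Leta A f) (dtensor_unit A g K)) \<and>
     (\<forall>P \<in> Obj (Ch A). (\<forall>i. torsionfree f (trm P i) \<and> torsionfree g (trm P i)) \<longrightarrow>
        (let left_id = Cmp (DA A)
               (inverse_arr (DA A)
                 (Cmp (DA A) (dtensor_cmp A g (eta A f P)) (far (dtensor A g) (Leta_cmp A f P))))
               (far (toD A) (koszul_proj g (eta A f P)));
             right_id = Cmp (DA A)
               (far (Leta A f) (far (toD A) (koszul_proj g P)))
               (inverse_arr (DA A) (Leta_cmp A f (koszul g P)))
         in Cmp (DA A) (far (Leta A f) (dtensor_cmp A g P)) (Cmp (DA A) (\<alpha> P) left_id) =
            Cmp (DA A) right_id (far (toD A) (koszul_eta A f g P))))"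

end

theory Submission
  imports Defs
begin

text \<open>
  Every complex \<open>X\<close> has a functorial quasi-isomorphism \<open>RX \<rightarrow> X\<close> from a complex with \<open>f\<close>- and
  \<open>g\<close>-torsionfree terms (\<open>resolved_Ch\<close>). So functors on \<open>D(A)\<close>, and transformations between them, are
  determined by what they do on such complexes, and there they can be constructed with chain maps alone
  (\<open>nat_trans_eqI\<close>, \<open>nat_trans_extend\<close>, \<open>left_derivedI\<close>). Reduction modulo \<open>g\<close> preserves
  quasi-isomorphisms between \<open>g\<close>-torsionfree complexes (\<open>qis_tensor\<close>) and \<open>\<eta>\<^sub>f\<close> preserves those between
  \<open>f\<close>-torsionfree complexes (\<open>qis_eta\<close>); hence \<open>X \<mapsto> RX/g\<close> and \<open>X \<mapsto> \<eta>\<^sub>f(RX)\<close> descend to \<open>D(A)\<close>, and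
  the functors \<open>K \<otimes>\<^sup>L A/g\<close> and \<open>L\<eta>\<^sub>f\<close> exist (\<open>left_derived_dtensor\<close>, \<open>is_Leta_Leta\<close>).
  
  Let \<open>P\<close> be a complex with \<open>f\<close>- and \<open>g\<close>-torsionfree terms and \<open>B\<close> the Koszul complex of \<open>g\<close>. All the
  identifications between \<open>L\<eta>\<^sub>f(P) \<otimes>\<^sup>L A/g\<close> and \<open>\<eta>\<^sub>f(P) \<otimes> B\<close>, and between \<open>L\<eta>\<^sub>f(P \<otimes>\<^sup>L A/g)\<close> and
  \<open>\<eta>\<^sub>f(P \<otimes> B)\<close>, are isomorphisms, since \<open>X \<otimes> B \<rightarrow> X/g\<close> is a quasi-isomorphism when \<open>X\<close> is
  \<open>g\<close>-torsionfree (\<open>qis_koszul_proj\<close>) and \<open>\<eta>\<^sub>f(P) \<subseteq> P[1/f]\<close> is again \<open>g\<close>-torsionfree. So \<open>\<alpha>\<close> at \<open>P\<close> has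
  to be the composite \<open>\<tau>\<close> of these identifications with the comparison map
  \<open>\<eta>\<^sub>f(P) \<otimes> B \<rightarrow> \<eta>\<^sub>f(P \<otimes> B)\<close>. All factors are natural in \<open>P\<close>, hence \<open>\<tau>\<close> extends to a natural
  transformation on \<open>D(A)\<close> (\<open>base_change_map\<close>). It is compatible with the units \<open>X \<rightarrow> X \<otimes>\<^sup>L A/g\<close> because
  the comparison map is compatible with the units \<open>X \<rightarrow> X \<otimes> B\<close> (\<open>koszul_eta_unit\<close>).
  
  It remains to see when the comparison map is a quasi-isomorphism (\<open>qis_koszul_eta\<close>). Dividing the
  degree \<open>i\<close> part by \<open>f\<^sup>i\<close> identifies \<open>\<eta>\<^sub>f(X)\<^sup>i\<close> with \<open>{x \<in> X\<^sup>i. dx \<in> fX\<^sup>i\<^sup>+\<^sup>1}\<close>, the differential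
  becoming \<open>d/f\<close>, and the comparison map becomes \<open>(x, y) \<mapsto> (x, fy)\<close>. A cocycle \<open>(x, y)\<close> of
  \<open>\<eta>\<^sub>f(P \<otimes> B)\<close> satisfies \<open>dy = 0\<close> and \<open>gy = -dx\<close>, so \<open>y\<close> represents a \<open>g\<close>-torsion class in
  \<open>H\<^sup>*(P/f)\<close>. If there is no such torsion, then \<open>y = fv + dw\<close>, and up to a coboundary \<open>(x, y)\<close> is the
  image \<open>(x + gw, fv)\<close> of \<open>(x + gw, v)\<close>. Injectivity on cohomology is similar. Finally,
  \<open>H\<^sup>*(K \<otimes>\<^sup>L A/f)\<close> is isomorphic to \<open>H\<^sup>*(RK/f)\<close>, because cohomology is a functor on \<open>D(A)\<close>.
\<close>

section \<open>Isomorphisms, squares and functors\<close>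

locale category =
  fixes C :: "('o, 'm) cat"
  assumes Dom_Obj: "m \<in> Arr C \<Longrightarrow> Dom C m \<in> Obj C"
    and Cod_Obj: "m \<in> Arr C \<Longrightarrow> Cod C m \<in> Obj C"
    and Idn_Hom: "x \<in> Obj C \<Longrightarrow> Idn C x \<in> Hom C x x"
    and Cmp_Hom: "m \<in> Hom C x y \<Longrightarrow> n \<in> Hom C y z \<Longrightarrow> Cmp C n m \<in> Hom C x z"
    and Cmp_assoc: "m \<in> Hom C x y \<Longrightarrow> n \<in> Hom C y z \<Longrightarrow> k \<in> Hom C z w \<Longrightarrow>
      Cmp C (Cmp C k n) m = Cmp C k (Cmp C n m)"
    and Idn_left: "m \<in> Hom C x y \<Longrightarrow> Cmp C (Idn C y) m = m"
    and Idn_right: "m \<in> Hom C x y \<Longrightarrow> Cmp C m (Idn C x) = m"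
begin

lemma Hom_Obj: "m \<in> Hom C x y \<Longrightarrow> x \<in> Obj C" "m \<in> Hom C x y \<Longrightarrow> y \<in> Obj C"
  using Dom_Obj Cod_Obj by (auto simp: Hom_def)

lemma Arr_Hom: "m \<in> Arr C \<Longrightarrow> m \<in> Hom C (Dom C m) (Cod C m)"
  by (auto simp: Hom_def)

definition iso :: "'o \<Rightarrow> 'o \<Rightarrow> 'm \<Rightarrow> bool" where
  "iso x y m \<longleftrightarrow> m \<in> Hom C x y \<and> is_iso_arr C m"

lemma isoI:
  assumes "m \<in> Hom C x y" "n \<in> Hom C y x" "Cmp C n m = Idn C x" "Cmp C m n = Idn C y"
  shows "iso x y m" "inverse_arr C m = n"
proof -
  show iso: "iso x y m"
    using assms by (auto simp: iso_def is_iso_arr_def Hom_def)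
  have n: "n' = n" if n': "n' \<in> Hom C y x" "Cmp C n' m = Idn C x" for n'
  proof -
    have "n' = Cmp C n' (Cmp C m n)" using assms(4) Idn_right[OF n'(1)] by simp
    also have "\<dots> = Cmp C (Cmp C n' m) n" using Cmp_assoc[OF assms(2,1) n'(1)] by simp
    also have "\<dots> = n" using n'(2) Idn_left[OF assms(2)] by simp
    finally show ?thesis .
  qed
  have d: "Dom C m = x" "Cod C m = y" using assms(1) by (auto simp: Hom_def)
  show "inverse_arr C m = n"
    unfolding inverse_arr_def d by (rule the_equality) (use assms n in blast)+
qed

lemma iso_inverse:
  assumes "iso x y m"
  shows "m \<in> Hom C x y" "inverse_arr C m \<in> Hom C y x" "Cmp C (inverse_arr C m) m = Idn C x"
    "Cmp C m (inverse_arr C m) = Idn C y" "iso y x (inverse_arr C m)"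
proof -
  show m: "m \<in> Hom C x y" using assms by (simp add: iso_def)
  then have "Dom C m = x" "Cod C m = y" by (auto simp: Hom_def)
  then obtain n where n: "n \<in> Hom C y x" "Cmp C n m = Idn C x" "Cmp C m n = Idn C y"
    using assms by (auto simp: iso_def is_iso_arr_def)
  note isoI(2)[OF m n]
  then show "inverse_arr C m \<in> Hom C y x" "Cmp C (inverse_arr C m) m = Idn C x"
    "Cmp C m (inverse_arr C m) = Idn C y"
    using n by auto
  then show "iso y x (inverse_arr C m)" using isoI(1) m by blast
qed

lemma Cmp_inverse_left:
  assumes "iso y z m" "n \<in> Hom C x y"
  shows "Cmp C (inverse_arr C m) (Cmp C m n) = n"
  using Cmp_assoc[OF assms(2) iso_inverse(1,2)[OF assms(1)]] iso_inverse(3)[OF assms(1)]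
    Idn_left[OF assms(2)] by simp

lemma Cmp_inverse_left':
  assumes "iso z y m" "n \<in> Hom C x y"
  shows "Cmp C m (Cmp C (inverse_arr C m) n) = n"
  using Cmp_assoc[OF assms(2) iso_inverse(2,1)[OF assms(1)]] iso_inverse(4)[OF assms(1)]
    Idn_left[OF assms(2)] by simp

lemma Cmp_inverse_right:
  assumes "iso x y m" "n \<in> Hom C x z"
  shows "Cmp C (Cmp C n (inverse_arr C m)) m = n"
  using Cmp_assoc[OF iso_inverse(1,2)[OF assms(1)] assms(2)] iso_inverse(3)[OF assms(1)]
    Idn_right[OF assms(2)] by simp

lemma Cmp_inverse_right':
  assumes "iso x y m" "n \<in> Hom C y z"
  shows "Cmp C (Cmp C n m) (inverse_arr C m) = n"
  using Cmp_assoc[OF iso_inverse(2,1)[OF assms(1)] assms(2)] iso_inverse(4)[OF assms(1)]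
    Idn_right[OF assms(2)] by simp

lemma iso_cancel_left:
  assumes "iso y z m" "n \<in> Hom C x y" "k \<in> Hom C x y" "Cmp C m n = Cmp C m k"
  shows "n = k"
  using Cmp_inverse_left[OF assms(1,2)] Cmp_inverse_left[OF assms(1,3)] unfolding assms(4)
  by (rule trans[OF sym])

lemma iso_cancel_right:
  assumes "iso x y m" "n \<in> Hom C y z" "k \<in> Hom C y z" "Cmp C n m = Cmp C k m"
  shows "n = k"
  using Cmp_inverse_right'[OF assms(1,2)] Cmp_inverse_right'[OF assms(1,3)] unfolding assms(4)
  by (rule trans[OF sym])

lemma iso_Cmp:
  assumes m: "iso x y m" and n: "iso y z n"
  shows "iso x z (Cmp C n m)"
    "inverse_arr C (Cmp C n m) = Cmp C (inverse_arr C m) (inverse_arr C n)"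
proof -
  note [simp] = iso_inverse[OF m] iso_inverse[OF n]
  let ?m = "inverse_arr C m" and ?n = "inverse_arr C n"
  have 1: "Cmp C n m \<in> Hom C x z" "Cmp C ?m ?n \<in> Hom C z x"
    by (rule Cmp_Hom[of _ _ y]; simp)+
  have "Cmp C (Cmp C ?m ?n) (Cmp C n m) = Cmp C ?m (Cmp C ?n (Cmp C n m))"
    by (rule Cmp_assoc[OF 1(1) iso_inverse(2)[OF n] iso_inverse(2)[OF m]])
  then have 2: "Cmp C (Cmp C ?m ?n) (Cmp C n m) = Idn C x"
    using Cmp_inverse_left[OF n, of m x] by simp
  have "Cmp C (Cmp C n m) (Cmp C ?m ?n) = Cmp C n (Cmp C m (Cmp C ?m ?n))"
    by (rule Cmp_assoc[OF 1(2) iso_inverse(1)[OF m] iso_inverse(1)[OF n]])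
  then have 3: "Cmp C (Cmp C n m) (Cmp C ?m ?n) = Idn C z"
    using Cmp_inverse_left'[OF m, of ?n z] by simp
  show "iso x z (Cmp C n m)" "inverse_arr C (Cmp C n m) = Cmp C ?m ?n"
    using isoI[OF 1 2 3] by auto
qed

lemma iso_cancel_Cmp:
  assumes "m \<in> Hom C x y" "iso y z n" "iso x z (Cmp C n m)"
  shows "iso x y m"
  using iso_Cmp(1)[OF assms(3) iso_inverse(5)[OF assms(2)]] Cmp_inverse_left[OF assms(2,1)] by simp

text \<open>
  A commutative square with the arrows \<open>a\<close>, \<open>b\<close> from the left edge \<open>u\<close> to the right edge \<open>v\<close>.
  Naturality is a statement about squares, and squares can be pasted and their horizontal arrows
  inverted, so a composite of natural transformations and inverses of such is handled by
  pasting alone.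
\<close>

definition square :: "'m \<Rightarrow> 'm \<Rightarrow> 'm \<Rightarrow> 'm \<Rightarrow> bool" where
  "square u a b v \<longleftrightarrow> u \<in> Arr C \<and> v \<in> Arr C \<and> a \<in> Hom C (Dom C u) (Dom C v) \<and>
     b \<in> Hom C (Cod C u) (Cod C v) \<and> Cmp C b u = Cmp C v a"

lemma squareI:
  assumes "u \<in> Hom C x x'" "v \<in> Hom C y y'" "a \<in> Hom C x y" "b \<in> Hom C x' y'" "Cmp C b u = Cmp C v a"
  shows "square u a b v"
  using assms by (auto simp: square_def Hom_def)

lemma square_Cmp: "square u a b v \<Longrightarrow> Cmp C b u = Cmp C v a"
  by (simp add: square_def)

lemma square_paste:
  assumes "square u a b v" "square v c d w"
  shows "square u (Cmp C c a) (Cmp C d b) w"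
proof -
  note 1 = assms(1)[unfolded square_def] and 2 = assms(2)[unfolded square_def]
  have u: "u \<in> Hom C (Dom C u) (Cod C u)" and v: "v \<in> Hom C (Dom C v) (Cod C v)"
    and w: "w \<in> Hom C (Dom C w) (Cod C w)"
    and a: "a \<in> Hom C (Dom C u) (Dom C v)" and b: "b \<in> Hom C (Cod C u) (Cod C v)"
    and c: "c \<in> Hom C (Dom C v) (Dom C w)" and d: "d \<in> Hom C (Cod C v) (Cod C w)"
    using 1 2 Arr_Hom by blast+
  have "Cmp C (Cmp C d b) u = Cmp C w (Cmp C c a)"
    using Cmp_assoc[OF u b d] Cmp_assoc[OF a v d] Cmp_assoc[OF a c w] 1 2 by simp
  then show ?thesis
    by (rule squareI[OF u w Cmp_Hom[OF a c] Cmp_Hom[OF b d]])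
qed

lemma square_inverse:
  assumes s: "square u a b v" and a: "is_iso_arr C a" and b: "is_iso_arr C b"
  shows "square v (inverse_arr C a) (inverse_arr C b) u"
proof -
  note 1 = s[unfolded square_def]
  have u: "u \<in> Hom C (Dom C u) (Cod C u)" and v: "v \<in> Hom C (Dom C v) (Cod C v)"
    using 1 Arr_Hom by blast+
  have ia: "iso (Dom C u) (Dom C v) a" and ib: "iso (Cod C u) (Cod C v) b"
    using 1 a b by (auto simp: iso_def)
  note A = iso_inverse[OF ia] and B = iso_inverse[OF ib]
  have "Cmp C (inverse_arr C b) v = Cmp C u (inverse_arr C a)"
  proof (rule iso_cancel_right[OF ia Cmp_Hom[OF v B(2)] Cmp_Hom[OF A(2) u]])
    show "Cmp C (Cmp C (inverse_arr C b) v) a = Cmp C (Cmp C u (inverse_arr C a)) a"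
      using Cmp_assoc[OF A(1) v B(2)] Cmp_inverse_left[OF ib u] Cmp_inverse_right[OF ia u] 1 by simp
  qed
  then show ?thesis
    by (rule squareI[OF v u A(2) B(2)])
qed

end

lemma functor_Obj: "is_functor C D F \<Longrightarrow> x \<in> Obj C \<Longrightarrow> fob F x \<in> Obj D"
  and functor_Idn: "is_functor C D F \<Longrightarrow> x \<in> Obj C \<Longrightarrow> far F (Idn C x) = Idn D (fob F x)"
  and functor_Hom: "is_functor C D F \<Longrightarrow> m \<in> Hom C x y \<Longrightarrow> far F m \<in> Hom D (fob F x) (fob F y)"
  and functor_Cmp: "is_functor C D F \<Longrightarrow> m \<in> Hom C x y \<Longrightarrow> n \<in> Hom C y z \<Longrightarrow>
    far F (Cmp C n m) = Cmp D (far F n) (far F m)"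
  by (auto simp: is_functor_def Hom_def)

lemma functor_iso:
  assumes "category C" "category D" "is_functor C D F" "category.iso C x y m"
  shows "category.iso D (fob F x) (fob F y) (far F m)"
    "inverse_arr D (far F m) = far F (inverse_arr C m)"
proof -
  interpret C: category C by fact
  interpret D: category D by fact
  note I = C.iso_inverse[OF assms(4)]
  note O = C.Hom_Obj[OF I(1)]
  note F = functor_Hom[OF assms(3)] functor_Cmp[OF assms(3), symmetric] functor_Idn[OF assms(3)]
  show "D.iso (fob F x) (fob F y) (far F m)" "inverse_arr D (far F m) = far F (inverse_arr C m)"
    using D.isoI[of "far F m" "fob F x" "fob F y" "far F (inverse_arr C m)"] I O F by auto
qed

lemma functor_square:
  assumes "category C" "category D" "is_functor C D F" "category.square C u a b v"
  shows "category.square D (far F u) (far F a) (far F b) (far F v)"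
proof -
  interpret C: category C by fact
  interpret D: category D by fact
  note 1 = assms(4)[unfolded C.square_def]
  have "Cmp D (far F b) (far F u) = Cmp D (far F v) (far F a)"
    using 1 C.Arr_Hom functor_Cmp[OF assms(3)] by metis
  then show ?thesis
    using D.squareI functor_Hom[OF assms(3)] 1 C.Arr_Hom by metis
qed

lemma is_functor_comp:
  assumes "is_functor C D F" "is_functor D E G"
  shows "is_functor C E (funct_comp G F)"
  using assms unfolding is_functor_def funct_comp_def Hom_def by auto

lemma fob_comp [simp]: "fob (funct_comp G F) x = fob G (fob F x)"
  and far_comp [simp]: "far (funct_comp G F) m = far G (far F m)"
  by (auto simp: funct_comp_def)

lemma nat_trans_Hom: "nat_trans C D F G \<tau> \<Longrightarrow> x \<in> Obj C \<Longrightarrow> \<tau> x \<in> Hom D (fob F x) (fob G x)"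
  by (simp add: nat_trans_def)

lemma nat_trans_square:
  assumes "category D" "is_functor C D F" "is_functor C D G" "nat_trans C D F G \<tau>" "m \<in> Arr C"
    "Dom C m \<in> Obj C" "Cod C m \<in> Obj C"
  shows "category.square D (far F m) (\<tau> (Dom C m)) (\<tau> (Cod C m)) (far G m)"
proof -
  interpret D: category D by fact
  have "m \<in> Hom C (Dom C m) (Cod C m)" using assms by (simp add: Hom_def)
  then show ?thesis
    using assms functor_Hom by (intro D.squareI) (auto simp: nat_trans_def)
qed

section \<open>Localization\<close>

definition zarr :: "('o, 'm) cat \<Rightarrow> 'm set \<Rightarrow> 'o \<Rightarrow> 'm zstep list \<Rightarrow> 'o \<Rightarrow> ('o, 'm) loc_arr" where
  "zarr C W x p y = (x, zclass C W x p y, y)"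

definition zeq :: "('o, 'm) cat \<Rightarrow> 'm set \<Rightarrow> 'o \<Rightarrow> 'o \<Rightarrow> ('m zstep list \<times> 'm zstep list) set" where
  "zeq C W x y = (zmove C W x y \<union> (zmove C W x y)\<inverse>)\<^sup>*"

lemma zclass_zeq: "zclass C W x p y = {q. (p, q) \<in> zeq C W x y}"
  by (simp add: zclass_def zeq_def)

lemma zeq_sym: "(p, q) \<in> zeq C W x y \<Longrightarrow> (q, p) \<in> zeq C W x y"
  unfolding zeq_def by (rule symD[OF sym_rtrancl]) (auto simp: sym_def)

lemma zeq_trans: "(p, q) \<in> zeq C W x y \<Longrightarrow> (q, r) \<in> zeq C W x y \<Longrightarrow> (p, r) \<in> zeq C W x y"
  unfolding zeq_def by (rule rtrancl_trans)

lemma zeq_refl: "(p, p) \<in> zeq C W x y"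
  by (simp add: zeq_def)

lemma zarr_eqI: "(p, q) \<in> zeq C W x y \<Longrightarrow> zarr C W x p y = zarr C W x q y"
  unfolding zarr_def zclass_zeq by (auto intro: zeq_sym zeq_trans)

lemma zeq_zigzag: "(p, q) \<in> zeq C W x y \<Longrightarrow> zigzag C W x p y \<Longrightarrow> zigzag C W x q y"
  unfolding zeq_def by (induction rule: rtrancl_induct) (auto simp: zmove_def)

lemma zigzag_append: "zigzag C W x p y \<Longrightarrow> zigzag C W y q z \<Longrightarrow> zigzag C W x (p @ q) z"
  by (induction rule: zigzag.induct) (auto intro: zigzag.intros)

lemma zmove_context:
  assumes "(p, q) \<in> zmove C W x y" "zigzag C W x' u x" "zigzag C W y v y'"
  shows "(u @ p @ v, u @ q @ v) \<in> zmove C W x' y'"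
proof -
  obtain a b l r where *: "p = a @ l @ b" "q = a @ r @ b" "zrel C W l r"
    "zigzag C W x p y" "zigzag C W x q y"
    using assms(1) by (auto simp: zmove_def)
  have 1: "u @ p @ v = (u @ a) @ l @ (b @ v)" "u @ q @ v = (u @ a) @ r @ (b @ v)" using * by auto
  have 2: "zigzag C W x' (u @ p @ v) y'" "zigzag C W x' (u @ q @ v) y'"
    using *(4,5) assms(2,3) zigzag_append by metis+
  have "\<exists>a b l r. u @ p @ v = a @ l @ b \<and> u @ q @ v = a @ r @ b \<and> zrel C W l r"
    using 1 *(3) by metis
  then show ?thesis
    unfolding zmove_def using 2 by simp
qed

lemma zeq_context:
  assumes "(p, q) \<in> zeq C W x y" "zigzag C W x' u x" "zigzag C W y v y'"
  shows "(u @ p @ v, u @ q @ v) \<in> zeq C W x' y'"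
  using assms(1) unfolding zeq_def
proof (induction rule: rtrancl_induct)
  case (step q r)
  from step.hyps(2) have "(u @ q @ v, u @ r @ v) \<in> zmove C W x' y' \<union> (zmove C W x' y')\<inverse>"
    by (auto dest: zmove_context[OF _ assms(2,3)])
  with step.IH show ?case by (rule rtrancl_into_rtrancl)
qed simp

lemma zeq_append:
  assumes "(p, p') \<in> zeq C W x y" "(q, q') \<in> zeq C W y z" "zigzag C W x p y" "zigzag C W y q z"
    "category C"
  shows "(p @ q, p' @ q') \<in> zeq C W x z"
proof -
  interpret category C by fact
  have obj: "x \<in> Obj C" "z \<in> Obj C" if "zigzag C W x p z" for x p z
    using that by (induction rule: zigzag.induct) (auto simp: Dom_Obj Cod_Obj)
  note n = zigzag.nil[of _ C W]
  have "(p @ q, p' @ q) \<in> zeq C W x z"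
    using zeq_context[OF assms(1) n assms(4)] obj[OF assms(3)] by simp
  moreover have "(p' @ q, p' @ q') \<in> zeq C W x z"
    using zeq_context[OF assms(2) zeq_zigzag[OF assms(1,3)] n] obj[OF assms(4)] by simp
  ultimately show ?thesis by (rule zeq_trans)
qed

primrec zeval :: "('o, 'm) cat \<Rightarrow> ('p, 'n) cat \<Rightarrow> ('o, 'm, 'p, 'n) funct \<Rightarrow> 'o \<Rightarrow> 'm zstep list \<Rightarrow> 'n"
  where
  "zeval C D F x [] = Idn D (fob F x)"
| "zeval C D F x (s # p) = (case s of
      Fw m \<Rightarrow> Cmp D (zeval C D F (Cod C m) p) (far F m)
    | Bw m \<Rightarrow> Cmp D (zeval C D F (Dom C m) p) (inverse_arr D (far F m)))"

text \<open>
  The functor on \<open>C[W\<^sup>-\<^sup>1]\<close> that is induced by a functor \<open>F\<close> inverting \<open>W\<close>. An arrow of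
  \<open>C[W\<^sup>-\<^sup>1]\<close> is a class of zigzags; its value does not depend on the chosen member, as evaluation
  respects the generating relations.
\<close>

definition lift_functor :: "('o, 'm) cat \<Rightarrow> ('p, 'n) cat \<Rightarrow> ('o, 'm, 'p, 'n) funct \<Rightarrow>
    ('o, ('o, 'm) loc_arr, 'p, 'n) funct" where
  "lift_functor C D F = \<lparr>fob = fob F, far = (\<lambda>(x, P, y). zeval C D F x (SOME p. p \<in> P))\<rparr>"

locale localized = category C for C :: "('o, 'm) cat" +
  fixes W :: "'m set"
begin

abbreviation "L \<equiv> localization C W"
abbreviation "Q \<equiv> loc_functor C W"

lemma L_Obj [simp]: "Obj L = Obj C"
  by (simp add: localization_def)

lemma L_Arr: "Arr L = {zarr C W x p y | x p y. zigzag C W x p y}"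
  by (simp add: localization_def zarr_def)

lemma L_Hom: "m \<in> Hom L x y \<longleftrightarrow> (\<exists>p. zigzag C W x p y \<and> m = zarr C W x p y)"
  unfolding Hom_def L_Arr by (auto simp: localization_def zarr_def)

lemma L_Dom [simp]: "Dom L (zarr C W x p y) = x" and L_Cod [simp]: "Cod L (zarr C W x p y) = y"
  by (auto simp: localization_def zarr_def)

lemma L_Idn: "Idn L x = zarr C W x [] x"
  by (simp add: localization_def zarr_def)

lemma Q_fob [simp]: "fob Q x = x"
  by (simp add: loc_functor_def)

lemma Q_far: "far Q m = zarr C W (Dom C m) [Fw m] (Cod C m)"
  by (simp add: loc_functor_def zarr_def)

lemma zigzag_Obj: "zigzag C W x p y \<Longrightarrow> x \<in> Obj C \<and> y \<in> Obj C"
  by (induction rule: zigzag.induct) (auto simp: Dom_Obj Cod_Obj)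

text \<open>
  The composite is defined as a union over all representatives; since concatenation respects the
  congruence, all members of this union are equal.
\<close>

lemma L_Cmp:
  assumes "zigzag C W x p y" "zigzag C W y q z"
  shows "Cmp L (zarr C W y q z) (zarr C W x p y) = zarr C W x (p @ q) z"
proof -
  have "(\<Union>p' \<in> zclass C W x p y. \<Union>q' \<in> zclass C W y q z. zclass C W x (p' @ q') z)
      = zclass C W x (p @ q) z"
  proof -
    have "zclass C W x (p' @ q') z = zclass C W x (p @ q) z"
      if "p' \<in> zclass C W x p y" "q' \<in> zclass C W y q z" for p' q'
      using zeq_append[of p p' C W x y q q' z] assms that zarr_eqI[of "p @ q" "p' @ q'" C W x z]
        category_axioms by (auto simp: zclass_zeq zarr_def)
    moreover have "p \<in> zclass C W x p y" "q \<in> zclass C W y q z"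
      by (auto simp: zclass_zeq zeq_refl)
    ultimately show ?thesis by fast
  qed
  then show ?thesis by (simp add: localization_def zarr_def)
qed

lemma category_L: "category L"
proof (unfold_locales, goal_cases)
  case (1 m)
  then show ?case using zigzag_Obj by (auto simp: L_Arr)
next
  case (2 m)
  then show ?case using zigzag_Obj by (auto simp: L_Arr)
next
  case (3 x)
  then show ?case using zigzag.nil by (force simp: L_Hom L_Idn)
next
  case (4 m x y n z)
  then show ?case by (auto simp: L_Hom L_Cmp intro: zigzag_append)
next
  case (5 m x y n z k w)
  then show ?case by (auto simp: L_Hom L_Cmp zigzag_append)
next
  case (6 m x y)
  then show ?case using zigzag_Obj by (auto simp: L_Hom L_Cmp L_Idn zigzag.nil)
next
  case (7 m x y)
  then show ?case using zigzag_Obj by (auto simp: L_Hom L_Cmp L_Idn zigzag.nil)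
qed

sublocale L: category L by (rule category_L)

lemma zigzag_Fw: "m \<in> Hom C x y \<Longrightarrow> zigzag C W x [Fw m] y"
  using zigzag.fw[of m C W "[]" y] zigzag.nil[of y C W] Cod_Obj by (auto simp: Hom_def)

lemma zigzag_Bw: "m \<in> Hom C x y \<Longrightarrow> m \<in> W \<Longrightarrow> zigzag C W y [Bw m] x"
  using zigzag.bw[of m C W "[]" x] zigzag.nil[of x C W] Dom_Obj by (auto simp: Hom_def)

lemma zrel_zeq:
  assumes "zigzag C W x l y" "zigzag C W x r y" "zrel C W l r"
  shows "zarr C W x l y = zarr C W x r y"
proof -
  have "(l, r) \<in> zmove C W x y"
    unfolding zmove_def using assms by (force intro: exI[of _ "[]"])
  then show ?thesis
    by (intro zarr_eqI) (auto simp: zeq_def)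
qed

lemma functor_Q: "is_functor C L Q"
  unfolding is_functor_def
proof (intro conjI ballI impI, goal_cases)
  case (1 x)
  then show ?case by simp
next
  case (2 x)
  then have "Idn C x \<in> Hom C x x" by (rule Idn_Hom)
  moreover from this have "Dom C (Idn C x) = x" "Cod C (Idn C x) = x" by (auto simp: Hom_def)
  ultimately show ?case
    using zrel_zeq[OF _ zigzag.nil zrel.ident] zigzag_Fw 2
    by (auto simp: Q_far L_Idn)
next
  case (3 m)
  then show ?case using zigzag_Fw[OF Arr_Hom] by (auto simp: L_Hom Q_far)
next
  case (4 m n)
  have m: "m \<in> Hom C (Dom C m) (Cod C m)" and n: "n \<in> Hom C (Cod C m) (Cod C n)"
    using 4 by (auto simp: Hom_def)
  note nm = Cmp_Hom[OF m n]
  have "zarr C W (Dom C m) [Fw m, Fw n] (Cod C n) = zarr C W (Dom C m) [Fw (Cmp C n m)] (Cod C n)"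
    using zigzag_append[OF zigzag_Fw[OF m] zigzag_Fw[OF n]] zigzag_Fw[OF nm] zrel.comp[OF 4]
    by (intro zrel_zeq) auto
  then show ?case
    using L_Cmp[OF zigzag_Fw[OF m] zigzag_Fw[OF n]] nm 4(3) by (simp add: Q_far Hom_def)
qed

lemma Q_Hom: "m \<in> Hom C x y \<Longrightarrow> far Q m \<in> Hom L x y"
  using functor_Hom[OF functor_Q] by fastforce

lemma Q_iso:
  assumes "m \<in> Hom C x y" "m \<in> W"
  shows "L.iso x y (far Q m)" "inverse_arr L (far Q m) = zarr C W y [Bw m] x"
proof -
  have m: "far Q m = zarr C W x [Fw m] y" using assms(1) by (simp add: Q_far Hom_def)
  have A: "m \<in> Arr C" using assms(1) by (simp add: Hom_def)
  note f = zigzag_Fw[OF assms(1)] and b = zigzag_Bw[OF assms]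
  have o: "x \<in> Obj C" "y \<in> Obj C" using Hom_Obj assms(1) by auto
  have 1: "far Q m \<in> Hom L x y" "zarr C W y [Bw m] x \<in> Hom L y x"
    using Q_Hom[OF assms(1)] b by (auto simp: L_Hom)
  have 2: "Cmp L (zarr C W y [Bw m] x) (far Q m) = Idn L x"
    using zrel_zeq[OF zigzag_append[OF f b] zigzag.nil[of x]] zrel.fwbw[OF A assms(2)] o
    by (simp add: m L_Cmp[OF f b] L_Idn)
  have 3: "Cmp L (far Q m) (zarr C W y [Bw m] x) = Idn L y"
    using zrel_zeq[OF zigzag_append[OF b f] zigzag.nil[of y]] zrel.bwfw[OF A assms(2)] o
    by (simp add: m L_Cmp[OF b f] L_Idn)
  show "L.iso x y (far Q m)" "inverse_arr L (far Q m) = zarr C W y [Bw m] x"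
    using L.isoI[OF 1 2 3] by auto
qed

lemma L_Arr_induct [consumes 1, case_names Idn Fw Bw]:
  assumes "n \<in> Hom L x y"
    and "\<And>x. x \<in> Obj C \<Longrightarrow> P x x (Idn L x)"
    and "\<And>m x y z n. m \<in> Hom C x y \<Longrightarrow> n \<in> Hom L y z \<Longrightarrow> P y z n \<Longrightarrow> P x z (Cmp L n (far Q m))"
    and "\<And>m x y z n. m \<in> Hom C x y \<Longrightarrow> m \<in> W \<Longrightarrow> n \<in> Hom L x z \<Longrightarrow> P x z n \<Longrightarrow>
      P y z (Cmp L n (inverse_arr L (far Q m)))"
  shows "P x y n"
proof -
  have "P x y (zarr C W x p y)" if "zigzag C W x p y" for p
    using that
  proof (induction rule: zigzag.induct)
    case (nil x)
    then show ?case using assms(2) by (simp add: L_Idn)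
  next
    case (fw m p y)
    note m = Arr_Hom[OF fw(1)]
    have "zarr C W (Cod C m) p y \<in> Hom L (Cod C m) y" using fw by (auto simp: L_Hom)
    from assms(3)[OF m this fw.IH] show ?case
      using L_Cmp[OF zigzag_Fw[OF m] fw(2)] by (simp add: Q_far)
  next
    case (bw m p y)
    note m = Arr_Hom[OF bw(1)]
    have "zarr C W (Dom C m) p y \<in> Hom L (Dom C m) y" using bw by (auto simp: L_Hom)
    from assms(4)[OF m bw(2) this bw.IH] show ?case
      using L_Cmp[OF zigzag_Bw[OF m bw(2)] bw(3)] Q_iso[OF m bw(2)] by simp
  qed
  then show ?thesis using assms(1) by (auto simp: L_Hom)
qed

text \<open>
  Naturality need only be checked on the arrows that come from \<open>C\<close>: every arrow of \<open>C[W\<^sup>-\<^sup>1]\<close> is a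
  composite of such arrows and of inverses of such arrows, and a naturality square may be read backwards
  when its vertical arrows are invertible.
\<close>

lemma nat_trans_L:
  assumes D: "category D" and F: "is_functor L D F" and G: "is_functor L D G"
    and ext: "\<tau> \<in> extensional (Obj C)"
    and hom: "\<And>x. x \<in> Obj C \<Longrightarrow> \<tau> x \<in> Hom D (fob F x) (fob G x)"
    and nat: "\<And>m x y. m \<in> Hom C x y \<Longrightarrow>
      Cmp D (\<tau> y) (far F (far Q m)) = Cmp D (far G (far Q m)) (\<tau> x)"
  shows "nat_trans L D F G \<tau>"
proof -
  interpret D: category D by fact
  have sq: "D.square (far F n) (\<tau> x) (\<tau> y) (far G n)" if "n \<in> Hom L x y" for n x y
    using that
  proof (induction rule: L_Arr_induct)
    case (Idn x)
    then have "fob F x \<in> Obj D" "fob G x \<in> Obj D"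
      using functor_Obj[OF F] functor_Obj[OF G] by auto
    then show ?case
      using D.Idn_left[OF hom[OF Idn]] D.Idn_right[OF hom[OF Idn]] Idn
        functor_Idn[OF F, of x] functor_Idn[OF G, of x]
      by (intro D.squareI[of _ "fob F x" "fob F x" _ "fob G x" "fob G x"]) (auto simp: hom D.Idn_Hom)
  next
    case (Fw m x y z n)
    note m = Q_Hom[OF Fw(1)] and o = L.Hom_Obj[OF Fw(2)] L.Hom_Obj[OF Q_Hom[OF Fw(1)]]
    have 1: "D.square (far F (far Q m)) (\<tau> x) (\<tau> y) (far G (far Q m))"
      using nat[OF Fw(1)] functor_Hom[OF F m] functor_Hom[OF G m] hom o
      by (intro D.squareI) auto
    have "far F (Cmp L n (far Q m)) = Cmp D (far F n) (far F (far Q m))"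
      "far G (Cmp L n (far Q m)) = Cmp D (far G n) (far G (far Q m))"
      using functor_Cmp[OF F m Fw(2)] functor_Cmp[OF G m Fw(2)] by auto
    moreover have "D.square (\<tau> x) (far F (far Q m)) (far G (far Q m)) (\<tau> y)"
      "D.square (\<tau> y) (far F n) (far G n) (\<tau> z)"
      using 1 Fw(3) functor_Hom[OF F Fw(2)] functor_Hom[OF G Fw(2)] functor_Hom[OF F m]
        functor_Hom[OF G m] hom o by (auto simp: D.square_def Hom_def)
    ultimately have "D.square (\<tau> x) (far F (Cmp L n (far Q m))) (far G (Cmp L n (far Q m))) (\<tau> z)"
      using D.square_paste by simp
    then show ?case
      using hom[of x] hom[of z] o by (auto simp: D.square_def Hom_def)
  next
    case (Bw m x y z n)
    note m = Q_Hom[OF Bw(1)] and o = L.Hom_Obj[OF Bw(3)] L.Hom_Obj[OF Q_Hom[OF Bw(1)]]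
    note i = Q_iso(1)[OF Bw(1,2)]
    note j = L.iso_inverse(2)[OF i]
    note Fi = functor_iso[OF category_L D F i] and Gi = functor_iso[OF category_L D G i]
    have "D.square (\<tau> x) (far F (far Q m)) (far G (far Q m)) (\<tau> y)"
      using nat[OF Bw(1)] functor_Hom[OF F m] functor_Hom[OF G m] hom o
      by (auto simp: D.square_def Hom_def)
    from D.square_inverse[OF this]
    have "D.square (\<tau> y) (far F (inverse_arr L (far Q m))) (far G (inverse_arr L (far Q m))) (\<tau> x)"
      using Fi Gi by (auto simp: D.iso_def)
    moreover have "far F (Cmp L n (inverse_arr L (far Q m))) = Cmp D (far F n) (far F (inverse_arr L (far Q m)))"
      "far G (Cmp L n (inverse_arr L (far Q m))) = Cmp D (far G n) (far G (inverse_arr L (far Q m)))"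
      using functor_Cmp[OF F j Bw(3)] functor_Cmp[OF G j Bw(3)] by auto
    moreover have "D.square (\<tau> x) (far F n) (far G n) (\<tau> z)"
      using Bw(4) functor_Hom[OF F Bw(3)] functor_Hom[OF G Bw(3)] hom o
      by (auto simp: D.square_def Hom_def)
    ultimately have "D.square (\<tau> y) (far F (Cmp L n (inverse_arr L (far Q m))))
        (far G (Cmp L n (inverse_arr L (far Q m)))) (\<tau> z)"
      using D.square_paste by simp
    then show ?case
      using hom[of y] hom[of z] o by (auto simp: D.square_def Hom_def)
  qed
  show ?thesis
    unfolding nat_trans_def
    using ext hom sq[OF L.Arr_Hom] by (auto simp: D.square_def)
qed

lemma zigzag_simps:
  "zigzag C W x [] y \<longleftrightarrow> x = y \<and> x \<in> Obj C"
  "zigzag C W x (Fw m # p) y \<longleftrightarrow> m \<in> Arr C \<and> x = Dom C m \<and> zigzag C W (Cod C m) p y"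
  "zigzag C W x (Bw m # p) y \<longleftrightarrow> m \<in> Arr C \<and> m \<in> W \<and> x = Cod C m \<and> zigzag C W (Dom C m) p y"
  by (auto intro: zigzag.intros elim: zigzag.cases)

lemma zigzag_appendE:
  assumes "zigzag C W x (u @ v) z"
  obtains y where "zigzag C W x u y" "zigzag C W y v z"
proof -
  from assms have "\<exists>y. zigzag C W x u y \<and> zigzag C W y v z"
  proof (induction u arbitrary: x)
    case Nil
    then show ?case using zigzag_Obj by (auto simp: zigzag_simps)
  next
    case (Cons s u)
    then show ?case by (cases s) (auto simp: zigzag_simps)
  qed
  then show ?thesis using that by blast
qed

end

locale inverting = localized C W + D: category D
  for C :: "('o, 'm) cat" and W :: "'m set" and D :: "('p, 'n) cat" +
  fixes F :: "('o, 'm, 'p, 'n) funct"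
  assumes functor_F: "is_functor C D F"
    and inverts: "m \<in> Hom C x y \<Longrightarrow> m \<in> W \<Longrightarrow> is_iso_arr D (far F m)"
begin

abbreviation "ev \<equiv> zeval C D F"

lemma F_Hom: "m \<in> Arr C \<Longrightarrow> far F m \<in> Hom D (fob F (Dom C m)) (fob F (Cod C m))"
  using functor_Hom[OF functor_F Arr_Hom] .

lemma F_iso: "m \<in> Arr C \<Longrightarrow> m \<in> W \<Longrightarrow> D.iso (fob F (Dom C m)) (fob F (Cod C m)) (far F m)"
  using F_Hom inverts[OF Arr_Hom] by (auto simp: D.iso_def)

lemma zeval_Hom: "zigzag C W x p y \<Longrightarrow> ev x p \<in> Hom D (fob F x) (fob F y)"
proof (induction rule: zigzag.induct)
  case (nil x)
  then show ?case using D.Idn_Hom functor_Obj[OF functor_F] by simp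
next
  case (fw m p y)
  then show ?case using D.Cmp_Hom[OF F_Hom] by simp
next
  case (bw m p y)
  then show ?case using D.Cmp_Hom[OF D.iso_inverse(2)[OF F_iso]] by simp
qed

lemma zeval_append:
  "zigzag C W x p y \<Longrightarrow> zigzag C W y q z \<Longrightarrow> ev x (p @ q) = Cmp D (ev y q) (ev x p)"
proof (induction rule: zigzag.induct)
  case (nil x)
  then show ?case using D.Idn_right[OF zeval_Hom] by simp
next
  case (fw m p y)
  then show ?case using D.Cmp_assoc[OF F_Hom[OF fw(1)] zeval_Hom[OF fw(2)] zeval_Hom[OF fw(4)]] by simp
next
  case (bw m p y)
  then show ?case
    using D.Cmp_assoc[OF D.iso_inverse(2)[OF F_iso[OF bw(1,2)]] zeval_Hom[OF bw(3)] zeval_Hom[OF bw(5)]]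
    by simp
qed

lemma zrel_zeval:
  assumes "zrel C W l r" "zigzag C W x l y"
  shows "zigzag C W x r y \<and> ev x l = ev x r"
  using assms
proof (cases rule: zrel.cases)
  case (comp m n)
  have m: "m \<in> Hom C x (Cod C m)" and n: "n \<in> Hom C (Cod C m) y" and y: "y = Cod C n"
    using assms comp by (auto simp: zigzag_simps Hom_def)
  note F = functor_Hom[OF functor_F m] functor_Hom[OF functor_F n]
  note nm = Cmp_Hom[OF m n]
  have "ev x l = Cmp D (Cmp D (Idn D (fob F y)) (far F n)) (far F m)"
    using comp y by simp
  also have "\<dots> = far F (Cmp C n m)"
    using D.Idn_left[OF F(2)] functor_Cmp[OF functor_F m n] by simp
  also have "\<dots> = ev x r"
    using comp D.Idn_left[OF functor_Hom[OF functor_F nm]] nm by (simp add: Hom_def)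
  finally show ?thesis using zigzag_Fw[OF nm] comp by simp
next
  case (ident z)
  moreover from this have "Cod C (Idn C z) = z" "Dom C (Idn C z) = z"
    using Idn_Hom by (auto simp: Hom_def)
  ultimately show ?thesis
    using assms D.Idn_left[OF D.Idn_Hom[OF functor_Obj[OF functor_F]]] functor_Idn[OF functor_F]
    by (auto simp: zigzag_simps)
next
  case (fwbw m)
  then show ?thesis
    using assms D.iso_inverse[OF F_iso[of m]] D.Idn_left[OF D.iso_inverse(2)[OF F_iso[of m]]]
    by (auto simp: zigzag_simps)
next
  case (bwfw m)
  then show ?thesis
    using assms D.iso_inverse[OF F_iso[of m]] D.Idn_left[OF F_Hom[of m]] D.Cmp_assoc
    by (auto simp: zigzag_simps)
qed

lemma zmove_zeval:
  assumes "(p, q) \<in> zmove C W x y"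
  shows "ev x p = ev x q"
proof -
  obtain u v l r where *: "p = u @ l @ v" "q = u @ r @ v" "zrel C W l r" "zigzag C W x p y"
    using assms by (auto simp: zmove_def)
  obtain a where a: "zigzag C W x u a" "zigzag C W a (l @ v) y"
    using *(1,4) zigzag_appendE by metis
  obtain b where b: "zigzag C W a l b" "zigzag C W b v y"
    using a(2) zigzag_appendE by metis
  note r = zrel_zeval[OF *(3) b(1)]
  have "ev a (l @ v) = ev a (r @ v)"
    using zeval_append[OF b] zeval_append[of a r b v y] r b by simp
  then show ?thesis
    using zeval_append[OF a] zeval_append[OF a(1) zigzag_append[of C W a r b v y]] r b *(1,2) by simp
qed

lemma zeq_zeval: "(p, q) \<in> zeq C W x y \<Longrightarrow> ev x p = ev x q"
  unfolding zeq_def by (induction rule: rtrancl_induct) (auto dest: zmove_zeval)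

lemma lift_fob [simp]: "fob (lift_functor C D F) x = fob F x"
  by (simp add: lift_functor_def)

lemma lift_zarr: "far (lift_functor C D F) (zarr C W x p y) = ev x p"
proof -
  have "(p, SOME q. q \<in> zclass C W x p y) \<in> zeq C W x y"
    using someI[of "\<lambda>q. q \<in> zclass C W x p y" p] by (simp add: zclass_zeq zeq_refl)
  then show ?thesis by (simp add: lift_functor_def zarr_def zeq_zeval)
qed

lemma lift_Q: "m \<in> Arr C \<Longrightarrow> far (lift_functor C D F) (far Q m) = far F m"
  using D.Idn_left[OF F_Hom] by (simp add: Q_far lift_zarr)

lemma functor_lift: "is_functor L D (lift_functor C D F)"
  unfolding is_functor_def
proof (intro conjI ballI impI, goal_cases)
  case (1 x)
  then show ?case using functor_Obj[OF functor_F] by simp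
next
  case (2 x)
  then show ?case by (simp add: L_Idn lift_zarr)
next
  case (3 m)
  then show ?case using zeval_Hom by (auto simp: L_Arr lift_zarr)
next
  case (4 m n)
  then show ?case by (auto simp: L_Arr lift_zarr L_Cmp zeval_append)
qed

end

section \<open>Functorial resolutions\<close>

text \<open>
  A functorial resolution: every object \<open>X\<close> receives an arrow \<open>r X : RX \<rightarrow> X\<close> in \<open>W\<close> from
  an object of a full subcategory \<open>S\<close>. All that happens on \<open>C[W\<^sup>-\<^sup>1]\<close> is then determined by
  what happens on \<open>S\<close>.
\<close>

locale resolved = localized C W for C :: "('o, 'm) cat" and W +
  fixes S :: "'o set" and R :: "('o, 'm, 'o, 'm) funct" and r :: "'o \<Rightarrow> 'm"
  assumes S_Obj: "S \<subseteq> Obj C"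
    and functor_R: "is_functor C C R"
    and R_S: "X \<in> Obj C \<Longrightarrow> fob R X \<in> S"
    and r_Hom: "X \<in> Obj C \<Longrightarrow> r X \<in> Hom C (fob R X) X"
    and r_W: "X \<in> Obj C \<Longrightarrow> r X \<in> W"
    and r_nat: "m \<in> Hom C X Y \<Longrightarrow> Cmp C (r Y) (far R m) = Cmp C m (r X)"
begin

lemma Qr_iso: "X \<in> Obj C \<Longrightarrow> L.iso (fob R X) X (far Q (r X))"
  using Q_iso(1) r_Hom r_W by blast

lemma r_square: "m \<in> Hom C X Y \<Longrightarrow> square (far R m) (r X) (r Y) m"
  using squareI[OF functor_Hom[OF functor_R] _ r_Hom r_Hom r_nat] Hom_Obj by blast

text \<open>
  Naturality at \<open>r X : RX \<rightarrow> X\<close>, an isomorphism of \<open>C[W\<^sup>-\<^sup>1]\<close>, recovers the component at \<open>X\<close> from the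
  one at \<open>RX \<in> S\<close>.
\<close>

lemma nat_trans_eqI:
  assumes D: "category D" and F: "is_functor L D F" and G: "is_functor L D G"
    and n: "nat_trans L D F G \<tau>" "nat_trans L D F G \<sigma>" and eq: "\<And>X. X \<in> S \<Longrightarrow> \<tau> X = \<sigma> X"
  shows "\<tau> = \<sigma>"
proof (rule extensionalityI[of _ "Obj C"])
  interpret D: category D by fact
  fix X assume X: "X \<in> Obj C"
  note i = Qr_iso[OF X]
  have RX: "fob R X \<in> S" using R_S X by simp
  have *: "Cmp D (\<tau> X) (far F (far Q (r X))) = Cmp D (far G (far Q (r X))) (\<tau> (fob R X))"
    if "nat_trans L D F G \<tau>" for \<tau>
    using that L.iso_inverse(1)[OF i] by (auto simp: nat_trans_def Hom_def)
  show "\<tau> X = \<sigma> X"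
    using D.iso_cancel_right[OF functor_iso(1)[OF category_L D F i], of "\<tau> X" "fob G X" "\<sigma> X"]
      *[OF n(1)] *[OF n(2)] eq[OF RX] nat_trans_Hom[OF n(1), of X] nat_trans_Hom[OF n(2), of X] X
    by simp
qed (use n in \<open>auto simp: nat_trans_def\<close>)

text \<open>
  A transformation given on \<open>S\<close> and natural for the arrows of \<open>C\<close> extends to \<open>C[W\<^sup>-\<^sup>1]\<close>, by transport
  along the isomorphisms \<open>r X\<close>.
\<close>

lemma nat_trans_extend:
  assumes D: "category D" and F: "is_functor L D F" and G: "is_functor L D G"
    and hom: "\<And>P. P \<in> S \<Longrightarrow> \<tau> P \<in> Hom D (fob F P) (fob G P)"
    and nat: "\<And>m P P'. P \<in> S \<Longrightarrow> P' \<in> S \<Longrightarrow> m \<in> Hom C P P' \<Longrightarrow>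
      category.square D (far F (far Q m)) (\<tau> P) (\<tau> P') (far G (far Q m))"
  obtains \<sigma> where "nat_trans L D F G \<sigma>" "\<And>P. P \<in> S \<Longrightarrow> \<sigma> P = \<tau> P"
    "\<And>X. X \<in> Obj C \<Longrightarrow> is_iso_arr D (\<tau> (fob R X)) \<Longrightarrow> is_iso_arr D (\<sigma> X)"
proof -
  interpret D: category D by fact
  define \<sigma> where "\<sigma> = (\<lambda>X \<in> Obj C. Cmp D (Cmp D (far G (far Q (r X))) (\<tau> (fob R X)))
    (inverse_arr D (far F (far Q (r X)))))"
  have Fi: "D.iso (fob F (fob R X)) (fob F X) (far F (far Q (r X)))"
    and Gi: "D.iso (fob G (fob R X)) (fob G X) (far G (far Q (r X)))" if "X \<in> Obj C" for X
    using functor_iso(1)[OF category_L D _ Qr_iso[OF that]] F G by auto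
  have \<tau>R: "\<tau> (fob R X) \<in> Hom D (fob F (fob R X)) (fob G (fob R X))" if "X \<in> Obj C" for X
    using hom R_S that by blast
  have \<sigma>: "\<sigma> X \<in> Hom D (fob F X) (fob G X)" if "X \<in> Obj C" for X
    using D.Cmp_Hom[OF D.iso_inverse(2)[OF Fi[OF that]]
        D.Cmp_Hom[OF \<tau>R[OF that] D.iso_inverse(1)[OF Gi[OF that]]]] that
    by (simp add: \<sigma>_def)
  have sq: "D.square (far F (far Q m)) (\<sigma> X) (\<sigma> Y) (far G (far Q m))" if m: "m \<in> Hom C X Y" for m X Y
  proof -
    have o: "X \<in> Obj C" "Y \<in> Obj C" using Hom_Obj[OF m] by auto
    note s = functor_square[OF category_axioms category_L functor_Q r_square[OF m]]
    note sF = functor_square[OF category_L D F s] and sG = functor_square[OF category_L D G s]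
    have "D.square (far F (far Q m)) (inverse_arr D (far F (far Q (r X))))
        (inverse_arr D (far F (far Q (r Y)))) (far F (far Q (far R m)))"
      using D.square_inverse[OF sF] Fi o by (auto simp: D.iso_def)
    from D.square_paste[OF this D.square_paste[OF nat sG]] show ?thesis
      using o R_S functor_Hom[OF functor_R m] by (simp add: \<sigma>_def)
  qed
  have n: "nat_trans L D F G \<sigma>"
    using \<sigma> sq by (intro nat_trans_L[OF D F G]) (auto simp: \<sigma>_def D.square_def)
  have "\<sigma> P = \<tau> P" if P: "P \<in> S" for P
  proof -
    have o: "P \<in> Obj C" using P S_Obj by auto
    have "Cmp D (\<tau> P) (far F (far Q (r P))) = Cmp D (far G (far Q (r P))) (\<tau> (fob R P))"
      using D.square_Cmp[OF nat[OF R_S[OF o] P r_Hom[OF o]]] .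
    then show ?thesis
      using D.Cmp_inverse_right'[OF Fi[OF o] hom[OF P]] o by (simp add: \<sigma>_def)
  qed
  moreover have "is_iso_arr D (\<sigma> X)" if "X \<in> Obj C" "is_iso_arr D (\<tau> (fob R X))" for X
  proof -
    have "D.iso (fob F (fob R X)) (fob G (fob R X)) (\<tau> (fob R X))"
      using that \<tau>R by (simp add: D.iso_def)
    from D.iso_Cmp(1)[OF D.iso_inverse(5)[OF Fi] D.iso_Cmp(1)[OF this Gi]] show ?thesis
      using that by (simp add: \<sigma>_def D.iso_def)
  qed
  ultimately show ?thesis using that n by blast
qed

text \<open>
  A transformation \<open>T \<circ> Q \<rightarrow> F\<close> that is invertible on \<open>S\<close> is a left derived functor: the
  factorization of \<open>\<eta>\<close> is forced to be \<open>\<epsilon>\<^sup>-\<^sup>1 \<circ> \<eta>\<close> on \<open>S\<close>.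
\<close>

lemma left_derivedI:
  assumes D: "category D" and F: "is_functor C D F" and T: "is_functor L D T"
    and e: "nat_trans C D (funct_comp T Q) F \<epsilon>" and i: "\<And>P. P \<in> S \<Longrightarrow> is_iso_arr D (\<epsilon> P)"
  shows "is_left_derived C W D F T \<epsilon>"
  unfolding is_left_derived_def
proof (intro conjI allI impI)
  show "is_functor L D T" "nat_trans C D (funct_comp T Q) F \<epsilon>" by fact+
  interpret D: category D by fact
  fix G \<eta> assume "is_functor L D G \<and> nat_trans C D (funct_comp G Q) F \<eta>"
  then have G: "is_functor L D G" and h: "nat_trans C D (funct_comp G Q) F \<eta>" by auto
  have TQ: "is_functor C D (funct_comp T Q)" and GQ: "is_functor C D (funct_comp G Q)"
    using is_functor_comp[OF functor_Q] T G by auto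
  have \<epsilon>: "\<epsilon> X \<in> Hom D (fob T X) (fob F X)" and \<eta>: "\<eta> X \<in> Hom D (fob G X) (fob F X)" if "X \<in> Obj C" for X
    using nat_trans_Hom[OF e that] nat_trans_Hom[OF h that] by auto
  have ei: "D.iso (fob T P) (fob F P) (\<epsilon> P)" if "P \<in> S" for P
    using i[OF that] \<epsilon> S_Obj that by (auto simp: D.iso_def)
  define \<tau> where "\<tau> = (\<lambda>P. Cmp D (inverse_arr D (\<epsilon> P)) (\<eta> P))"
  have \<tau>: "\<tau> P \<in> Hom D (fob G P) (fob T P)" if "P \<in> S" for P
    unfolding \<tau>_def using D.Cmp_Hom[OF \<eta> D.iso_inverse(2)[OF ei]] that S_Obj by auto
  have sq: "D.square (far F m) (inverse_arr D (\<epsilon> P)) (inverse_arr D (\<epsilon> P')) (far T (far Q m))"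
    "D.square (far G (far Q m)) (\<eta> P) (\<eta> P') (far F m)"
    if m: "P \<in> S" "P' \<in> S" "m \<in> Hom C P P'" for m P P'
  proof -
    have *: "m \<in> Arr C" "Dom C m = P" "Cod C m = P'" "Dom C m \<in> Obj C" "Cod C m \<in> Obj C"
      using m S_Obj by (auto simp: Hom_def)
    show "D.square (far F m) (inverse_arr D (\<epsilon> P)) (inverse_arr D (\<epsilon> P')) (far T (far Q m))"
      using D.square_inverse[OF nat_trans_square[OF D TQ F e *(1,4,5)]] i m * by simp
    show "D.square (far G (far Q m)) (\<eta> P) (\<eta> P') (far F m)"
      using nat_trans_square[OF D GQ F h *(1,4,5)] * by simp
  qed
  obtain \<sigma> where s: "nat_trans L D G T \<sigma>" and s\<tau>: "\<And>P. P \<in> S \<Longrightarrow> \<sigma> P = \<tau> P"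
    using nat_trans_extend[OF D G T, of \<tau>] \<tau> D.square_paste[OF sq(2) sq(1)]
    unfolding \<tau>_def by metis
  have fac: "Cmp D (\<epsilon> X) (\<sigma> X) = \<eta> X" if X: "X \<in> Obj C" for X
  proof -
    note rX = r_Hom[OF X] and Qr = Q_Hom[OF r_Hom[OF X]] and RX = R_S[OF X]
    have A: "r X \<in> Arr C" "Dom C (r X) = fob R X" "Cod C (r X) = X" using rX by (auto simp: Hom_def)
    have RXo: "fob R X \<in> Obj C" using RX S_Obj by auto
    have 1: "Cmp D (\<sigma> X) (far G (far Q (r X))) = Cmp D (far T (far Q (r X))) (\<sigma> (fob R X))"
      using s Qr by (auto simp: nat_trans_def Hom_def)
    have 2: "Cmp D (\<epsilon> X) (far T (far Q (r X))) = Cmp D (far F (r X)) (\<epsilon> (fob R X))"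
      using e A by (auto simp: nat_trans_def)
    have 3: "Cmp D (\<eta> X) (far G (far Q (r X))) = Cmp D (far F (r X)) (\<eta> (fob R X))"
      using h A by (auto simp: nat_trans_def)
    have \<sigma>: "\<sigma> X \<in> Hom D (fob G X) (fob T X)" "\<sigma> (fob R X) \<in> Hom D (fob G (fob R X)) (fob T (fob R X))"
      using nat_trans_Hom[OF s] X RXo by auto
    have e\<sigma>: "Cmp D (\<epsilon> (fob R X)) (\<sigma> (fob R X)) = \<eta> (fob R X)"
      using s\<tau>[OF RX] D.Cmp_inverse_left'[OF ei[OF RX] \<eta>[OF RXo]] by (simp add: \<tau>_def)
    note Gr = functor_Hom[OF G Qr] and Tr = functor_Hom[OF T Qr] and Fr = functor_Hom[OF F rX]
    have "Cmp D (Cmp D (\<epsilon> X) (\<sigma> X)) (far G (far Q (r X))) = Cmp D (\<eta> X) (far G (far Q (r X)))"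
      using D.Cmp_assoc[OF Gr \<sigma>(1) \<epsilon>[OF X]] D.Cmp_assoc[OF \<sigma>(2) Tr \<epsilon>[OF X]]
        D.Cmp_assoc[OF \<sigma>(2) \<epsilon>[OF RXo] Fr] by (simp add: 1 2 3 e\<sigma>)
    with functor_iso(1)[OF category_L D G Qr_iso[OF X]] show ?thesis
      by (rule D.iso_cancel_right[OF _ D.Cmp_Hom[OF \<sigma>(1) \<epsilon>[OF X]] \<eta>[OF X]])
  qed
  show "\<exists>!\<theta>. nat_trans L D G T \<theta> \<and> (\<forall>x \<in> Obj C. Cmp D (\<epsilon> x) (\<theta> x) = \<eta> x)"
  proof (rule ex1I[of _ \<sigma>])
    show "nat_trans L D G T \<sigma> \<and> (\<forall>x \<in> Obj C. Cmp D (\<epsilon> x) (\<sigma> x) = \<eta> x)" using s fac by simp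
    fix \<theta> assume \<theta>: "nat_trans L D G T \<theta> \<and> (\<forall>x \<in> Obj C. Cmp D (\<epsilon> x) (\<theta> x) = \<eta> x)"
    have "\<theta> P = \<sigma> P" if P: "P \<in> S" for P
    proof (rule D.iso_cancel_left[OF ei[OF P]])
      show "\<theta> P \<in> Hom D (fob G P) (fob T P)" "\<sigma> P \<in> Hom D (fob G P) (fob T P)"
        using nat_trans_Hom[of L D G T _ P] \<theta> s P S_Obj by auto
      show "Cmp D (\<epsilon> P) (\<theta> P) = Cmp D (\<epsilon> P) (\<sigma> P)" using \<theta> fac P S_Obj by auto
    qed
    then show "\<theta> = \<sigma>" using nat_trans_eqI[OF D G T] \<theta> s by blast
  qed
qed

end

section \<open>Modules, linear maps and quotients\<close>

text \<open>
  These rules let the method \<open>algebra\<close> prove linear identities between elements of one module.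
\<close>

lemmas (in module) module_simprules
  [algebra "module" "zero M" "add M" "a_inv M" "a_minus M"] =
  M.a_closed M.zero_closed M.a_inv_closed M.minus_closed smult_closed M.a_lcomm M.a_comm M.a_assoc
  M.l_zero M.l_neg M.r_zero M.r_neg M.r_neg2 M.r_neg1 M.minus_add M.minus_minus M.minus_eq
  smult_r_distr smult_r_minus smult_r_null smult_l_null

lemma (in module) move_left:
  "x \<in> carrier M \<Longrightarrow> y \<in> carrier M \<Longrightarrow> z \<in> carrier M \<Longrightarrow> x = y \<oplus>\<^bsub>M\<^esub> z \<longleftrightarrow> y = x \<ominus>\<^bsub>M\<^esub> z"
  by (auto simp: M.minus_eq M.a_assoc M.r_neg M.l_neg)

lemma (in module) eq_of_minus:
  "x \<in> carrier M \<Longrightarrow> y \<in> carrier M \<Longrightarrow> x \<ominus>\<^bsub>M\<^esub> y = \<zero>\<^bsub>M\<^esub> \<Longrightarrow> x = y"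
  using move_left[of x y "\<zero>\<^bsub>M\<^esub>"] move_left[of x "\<zero>\<^bsub>M\<^esub>" y] by simp

lemma (in module) subtr_eq:
  "x \<in> carrier M \<Longrightarrow> y \<in> carrier M \<Longrightarrow> x \<ominus>\<^bsub>M\<^esub> y = \<zero>\<^bsub>M\<^esub> \<longleftrightarrow> x = y"
  using eq_of_minus by (auto simp: M.minus_eq M.r_neg)

lemma torsionfree_cancel:
  assumes "module A M" and "torsionfree a M" "a \<in> carrier A" "x \<in> carrier M" "y \<in> carrier M"
    "a \<odot>\<^bsub>M\<^esub> x = a \<odot>\<^bsub>M\<^esub> y"
  shows "x = y"
proof -
  interpret module A M by fact
  have "a \<odot>\<^bsub>M\<^esub> (x \<ominus>\<^bsub>M\<^esub> y) = a \<odot>\<^bsub>M\<^esub> x \<ominus>\<^bsub>M\<^esub> a \<odot>\<^bsub>M\<^esub> y"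
    using assms(3-5) by algebra
  also have "\<dots> = \<zero>\<^bsub>M\<^esub>" using assms(3-6) subtr_eq by simp
  finally have "x \<ominus>\<^bsub>M\<^esub> y = \<zero>\<^bsub>M\<^esub>" using assms(2,4,5) by (auto simp: torsionfree_def)
  then show ?thesis by (rule eq_of_minus[OF assms(4,5)])
qed

lemma torsionfree_pow:
  assumes "module A M" "torsionfree a M" "a \<in> carrier A"
  shows "torsionfree (a [^]\<^bsub>A\<^esub> (n::nat)) M"
proof -
  interpret module A M by fact
  show ?thesis
  proof (induction n)
    case (Suc n)
    show ?case unfolding torsionfree_def
    proof (intro ballI impI)
      fix x assume x: "x \<in> carrier M" "a [^]\<^bsub>A\<^esub> Suc n \<odot>\<^bsub>M\<^esub> x = \<zero>\<^bsub>M\<^esub>"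
      then have "a [^]\<^bsub>A\<^esub> n \<odot>\<^bsub>M\<^esub> (a \<odot>\<^bsub>M\<^esub> x) = \<zero>\<^bsub>M\<^esub>"
        using assms(3) by (simp add: smult_assoc1)
      then have "a \<odot>\<^bsub>M\<^esub> x = \<zero>\<^bsub>M\<^esub>"
        using Suc assms(3) x(1) unfolding torsionfree_def by blast
      then show "x = \<zero>\<^bsub>M\<^esub>" using assms(2) x(1) unfolding torsionfree_def by blast
    qed
  qed (simp add: torsionfree_def)
qed

text \<open>
  The module axioms are inherited by images. So they need not be checked again for quotients and for the
  terms of \<open>\<eta>\<^sub>f(X)\<close>, whose operations involve choices of representatives.
\<close>

lemma module_image:
  assumes "module A M" and c: "carrier N = s ` carrier M" and z: "s \<zero>\<^bsub>M\<^esub> = \<zero>\<^bsub>N\<^esub>"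
    and add: "\<And>x y. x \<in> carrier M \<Longrightarrow> y \<in> carrier M \<Longrightarrow> s (x \<oplus>\<^bsub>M\<^esub> y) = s x \<oplus>\<^bsub>N\<^esub> s y"
    and smult: "\<And>a x. a \<in> carrier A \<Longrightarrow> x \<in> carrier M \<Longrightarrow> s (a \<odot>\<^bsub>M\<^esub> x) = a \<odot>\<^bsub>N\<^esub> s x"
  shows "module A N"
proof -
  interpret module A M by fact
  note h = add[symmetric] smult[symmetric] z[symmetric]
  show ?thesis
  proof (rule moduleI)
    show "abelian_group N"
    proof (rule abelian_groupI, goal_cases)
      case (6 x)
      then obtain x' where "x = s x'" "x' \<in> carrier M" using c by auto
      then show ?case using c by (intro bexI[of _ "s (\<ominus>\<^bsub>M\<^esub> x')"]) (auto simp: h M.l_neg)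
    qed (auto simp: c h M.a_ac)
  qed (auto simp: c h R.cring_axioms smult_l_distr smult_r_distr smult_assoc1 R.is_cring)
qed

context
  fixes A :: "('a, 'r) ring_scheme" and M :: "('a, 'u) module" and N :: "('a, 'v) module" and h
  assumes M: "module A M" and N: "module A N" and h: "h \<in> lin_maps A M N"
begin

interpretation M: module A M by (rule M)
interpretation N: module A N by (rule N)

lemma lin_closed: "x \<in> carrier M \<Longrightarrow> h x \<in> carrier N"
  and lin_add: "x \<in> carrier M \<Longrightarrow> y \<in> carrier M \<Longrightarrow> h (x \<oplus>\<^bsub>M\<^esub> y) = h x \<oplus>\<^bsub>N\<^esub> h y"
  and lin_smult: "a \<in> carrier A \<Longrightarrow> x \<in> carrier M \<Longrightarrow> h (a \<odot>\<^bsub>M\<^esub> x) = a \<odot>\<^bsub>N\<^esub> h x"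
  using h by (auto simp: lin_maps_def)

lemma lin_zero: "h \<zero>\<^bsub>M\<^esub> = \<zero>\<^bsub>N\<^esub>"
  using lin_smult[of "\<zero>\<^bsub>A\<^esub>" "\<zero>\<^bsub>M\<^esub>"] lin_closed[of "\<zero>\<^bsub>M\<^esub>"] by simp

lemma lin_neg: "x \<in> carrier M \<Longrightarrow> h (\<ominus>\<^bsub>M\<^esub> x) = \<ominus>\<^bsub>N\<^esub> h x"
  using N.minus_equality[of "h (\<ominus>\<^bsub>M\<^esub> x)" "h x"] lin_add[of "\<ominus>\<^bsub>M\<^esub> x" x] lin_zero lin_closed
  by (simp add: M.l_neg)

lemma lin_minus: "x \<in> carrier M \<Longrightarrow> y \<in> carrier M \<Longrightarrow> h (x \<ominus>\<^bsub>M\<^esub> y) = h x \<ominus>\<^bsub>N\<^esub> h y"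
  by (simp add: a_minus_def lin_add lin_neg)

end

lemma submodule_carrier:
  assumes "module A M" "submodule N A M"
  shows "N \<subseteq> carrier M" "\<zero>\<^bsub>M\<^esub> \<in> N"
    "x \<in> N \<Longrightarrow> y \<in> N \<Longrightarrow> x \<oplus>\<^bsub>M\<^esub> y \<in> N" "x \<in> N \<Longrightarrow> \<ominus>\<^bsub>M\<^esub> x \<in> N"
    "a \<in> carrier A \<Longrightarrow> x \<in> N \<Longrightarrow> a \<odot>\<^bsub>M\<^esub> x \<in> N"
proof -
  interpret module A M by fact
  note s = submoduleE[OF assms(2)]
  show "N \<subseteq> carrier M" "x \<in> N \<Longrightarrow> y \<in> N \<Longrightarrow> x \<oplus>\<^bsub>M\<^esub> y \<in> N" "x \<in> N \<Longrightarrow> \<ominus>\<^bsub>M\<^esub> x \<in> N"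
    "a \<in> carrier A \<Longrightarrow> x \<in> N \<Longrightarrow> a \<odot>\<^bsub>M\<^esub> x \<in> N" using s by auto
  obtain n where n: "n \<in> N" using s(2) by auto
  then have "\<ominus>\<^bsub>M\<^esub> n \<oplus>\<^bsub>M\<^esub> n \<in> N" using s(3,5) by auto
  then show "\<zero>\<^bsub>M\<^esub> \<in> N" using n s(1) by (simp add: M.l_neg subset_iff)
qed

locale quotient = module A M for A (structure) and M :: "('a, 'u) module" (structure) +
  fixes N assumes sub: "submodule N A M"
begin

lemmas N_sub = submodule_carrier[OF module_axioms sub]

lemma N_carrier: "n \<in> N \<Longrightarrow> n \<in> carrier M"
  using N_sub(1) by auto

lemma qrep_add:
  assumes "x \<in> carrier M"
  obtains n where "n \<in> N" "qrep M N x = n \<oplus>\<^bsub>M\<^esub> x"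
proof -
  have "\<zero>\<^bsub>M\<^esub> \<oplus>\<^bsub>M\<^esub> x \<in> N +>\<^bsub>M\<^esub> x" using N_sub(2) by (auto simp: a_r_coset_def')
  then have "qrep M N x \<in> N +>\<^bsub>M\<^esub> x" unfolding qrep_def by (rule someI)
  then show ?thesis using that by (auto simp: a_r_coset_def')
qed

lemma qrep_closed: "x \<in> carrier M \<Longrightarrow> qrep M N x \<in> carrier M"
  by (rule qrep_add[of x]) (simp_all add: N_carrier)

lemma qrep_eq_iff:
  assumes x: "x \<in> carrier M" and y: "y \<in> carrier M"
  shows "qrep M N x = qrep M N y \<longleftrightarrow> (\<exists>n \<in> N. x = n \<oplus>\<^bsub>M\<^esub> y)"
proof
  assume eq: "qrep M N x = qrep M N y"
  obtain m n where mn: "m \<in> N" "n \<in> N" "m \<oplus>\<^bsub>M\<^esub> x = n \<oplus>\<^bsub>M\<^esub> y"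
    using qrep_add[OF x] qrep_add[OF y] eq by metis
  note c = N_carrier[OF mn(1)] N_carrier[OF mn(2)]
  have "x = \<ominus>\<^bsub>M\<^esub> m \<oplus>\<^bsub>M\<^esub> (m \<oplus>\<^bsub>M\<^esub> x)" using x c by algebra
  then have "x = (\<ominus>\<^bsub>M\<^esub> m \<oplus>\<^bsub>M\<^esub> n) \<oplus>\<^bsub>M\<^esub> y" using mn(3) x y c by (simp add: M.a_assoc)
  then show "\<exists>n \<in> N. x = n \<oplus>\<^bsub>M\<^esub> y" using mn N_sub(3,4) by blast
next
  assume "\<exists>n \<in> N. x = n \<oplus>\<^bsub>M\<^esub> y"
  then obtain n where n: "n \<in> N" "x = n \<oplus>\<^bsub>M\<^esub> y" by blast
  note c = N_carrier[OF n(1)]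
  have "N +>\<^bsub>M\<^esub> x = N +>\<^bsub>M\<^esub> y"
  proof (intro equalityI subsetI)
    fix z assume "z \<in> N +>\<^bsub>M\<^esub> x"
    then obtain m where m: "m \<in> N" "z = m \<oplus>\<^bsub>M\<^esub> x" by (auto simp: a_r_coset_def')
    then have "z = (m \<oplus>\<^bsub>M\<^esub> n) \<oplus>\<^bsub>M\<^esub> y" using n c y N_carrier[OF m(1)] by (simp add: M.a_assoc)
    then show "z \<in> N +>\<^bsub>M\<^esub> y" using N_sub(3) m n by (auto simp: a_r_coset_def')
  next
    fix z assume "z \<in> N +>\<^bsub>M\<^esub> y"
    then obtain m where m: "m \<in> N" "z = m \<oplus>\<^bsub>M\<^esub> y" by (auto simp: a_r_coset_def')
    then have "z = (m \<oplus>\<^bsub>M\<^esub> \<ominus>\<^bsub>M\<^esub> n) \<oplus>\<^bsub>M\<^esub> x" unfolding n(2)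
      using c y N_carrier[OF m(1)] by algebra
    then show "z \<in> N +>\<^bsub>M\<^esub> x" using N_sub(3,4) m n by (auto simp: a_r_coset_def')
  qed
  then show "qrep M N x = qrep M N y" by (simp add: qrep_def)
qed

lemma qrep_eqI: "n \<in> N \<Longrightarrow> y \<in> carrier M \<Longrightarrow> qrep M N (n \<oplus>\<^bsub>M\<^esub> y) = qrep M N y"
  using qrep_eq_iff[of "n \<oplus>\<^bsub>M\<^esub> y" y] N_carrier[of n] by auto

lemma qrep_N: "n \<in> N \<Longrightarrow> qrep M N n = qrep M N \<zero>\<^bsub>M\<^esub>"
  using qrep_eqI[of n "\<zero>\<^bsub>M\<^esub>"] N_carrier by simp

lemma qrep_N_iff: "x \<in> carrier M \<Longrightarrow> qrep M N x = qrep M N \<zero>\<^bsub>M\<^esub> \<longleftrightarrow> x \<in> N"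
  using qrep_eq_iff[of x "\<zero>\<^bsub>M\<^esub>"] N_carrier by auto

lemma qrep_qrep: "x \<in> carrier M \<Longrightarrow> qrep M N (qrep M N x) = qrep M N x"
  by (rule qrep_add[of x]) (simp_all add: qrep_eqI)

lemma qrep_add_qrep:
  assumes x: "x \<in> carrier M" and y: "y \<in> carrier M"
  shows "qrep M N (qrep M N x \<oplus>\<^bsub>M\<^esub> qrep M N y) = qrep M N (x \<oplus>\<^bsub>M\<^esub> y)"
proof -
  obtain m n where *: "m \<in> N" "n \<in> N" "qrep M N x = m \<oplus>\<^bsub>M\<^esub> x" "qrep M N y = n \<oplus>\<^bsub>M\<^esub> y"
    using qrep_add[OF x] qrep_add[OF y] by metis
  note c = N_carrier[OF *(1)] N_carrier[OF *(2)]
  have "(m \<oplus>\<^bsub>M\<^esub> x) \<oplus>\<^bsub>M\<^esub> (n \<oplus>\<^bsub>M\<^esub> y) = (m \<oplus>\<^bsub>M\<^esub> n) \<oplus>\<^bsub>M\<^esub> (x \<oplus>\<^bsub>M\<^esub> y)" using x y c by algebra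
  then show ?thesis using * qrep_eqI[of "m \<oplus>\<^bsub>M\<^esub> n" "x \<oplus>\<^bsub>M\<^esub> y"] N_sub(3) x y by simp
qed

lemma qrep_smult_qrep:
  assumes x: "x \<in> carrier M" and a: "a \<in> carrier A"
  shows "qrep M N (a \<odot>\<^bsub>M\<^esub> qrep M N x) = qrep M N (a \<odot>\<^bsub>M\<^esub> x)"
proof -
  obtain m where *: "m \<in> N" "qrep M N x = m \<oplus>\<^bsub>M\<^esub> x"
    using qrep_add[OF x] by metis
  then show ?thesis
    using qrep_eqI[of "a \<odot>\<^bsub>M\<^esub> m" "a \<odot>\<^bsub>M\<^esub> x"] N_sub(5) x a N_carrier[OF *(1)]
    by (simp add: smult_r_distr)
qed

lemma quot_mod_simps:
  "carrier (quot_mod M N) = qrep M N ` carrier M"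
  "\<zero>\<^bsub>quot_mod M N\<^esub> = qrep M N \<zero>\<^bsub>M\<^esub>"
  "x \<in> carrier M \<Longrightarrow> y \<in> carrier M \<Longrightarrow>
    qrep M N x \<oplus>\<^bsub>quot_mod M N\<^esub> qrep M N y = qrep M N (x \<oplus>\<^bsub>M\<^esub> y)"
  "a \<in> carrier A \<Longrightarrow> x \<in> carrier M \<Longrightarrow> a \<odot>\<^bsub>quot_mod M N\<^esub> qrep M N x = qrep M N (a \<odot>\<^bsub>M\<^esub> x)"
  by (simp_all add: quot_mod_def qrep_add_qrep qrep_smult_qrep)

lemma module_quot: "module A (quot_mod M N)"
  by (rule module_image[OF module_axioms, of _ "qrep M N"]) (simp_all add: quot_mod_simps)

end

text \<open>
  A linear map that carries \<open>N\<close> into \<open>N'\<close> descends to the quotients; on representatives the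
  induced map is bijective exactly under the two conditions used throughout.
\<close>

locale quotient_map = Q: quotient A M N + Q': quotient A M' N'
  for A :: "('a, 'r) ring_scheme" and M N and M' :: "('a, 'u) module" and N' +
  fixes h
  assumes h_closed: "x \<in> carrier M \<Longrightarrow> h x \<in> carrier M'"
    and h_add: "x \<in> carrier M \<Longrightarrow> y \<in> carrier M \<Longrightarrow> h (x \<oplus>\<^bsub>M\<^esub> y) = h x \<oplus>\<^bsub>M'\<^esub> h y"
    and h_smult: "a \<in> carrier A \<Longrightarrow> x \<in> carrier M \<Longrightarrow> h (a \<odot>\<^bsub>M\<^esub> x) = a \<odot>\<^bsub>M'\<^esub> h x"
    and h_N: "n \<in> N \<Longrightarrow> h n \<in> N'"
begin

lemma h_qrep: "x \<in> carrier M \<Longrightarrow> qrep M' N' (h (qrep M N x)) = qrep M' N' (h x)"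
  by (rule Q.qrep_add[of x]) (simp_all add: h_add Q'.qrep_eqI h_N h_closed Q.N_carrier)

lemma lin_quot:
  "(\<lambda>x \<in> carrier (quot_mod M N). qrep M' N' (h x)) \<in> lin_maps A (quot_mod M N) (quot_mod M' N')"
  unfolding lin_maps_def
  by (auto simp: Q.quot_mod_simps Q'.quot_mod_simps h_qrep h_closed h_add h_smult)

lemma bij_quot_iff:
  "bij_betw (\<lambda>x. qrep M' N' (h x)) (carrier (quot_mod M N)) (carrier (quot_mod M' N')) \<longleftrightarrow>
    (\<forall>z \<in> carrier M. h z \<in> N' \<longrightarrow> z \<in> N) \<and>
    (\<forall>w \<in> carrier M'. \<exists>z \<in> carrier M. \<exists>n \<in> N'. w = n \<oplus>\<^bsub>M'\<^esub> h z)"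
    (is "_ \<longleftrightarrow> ?inj \<and> ?surj")
proof -
  let ?h = "\<lambda>x. qrep M' N' (h x)"
  have "inj_on ?h (carrier (quot_mod M N)) \<longleftrightarrow> ?inj"
  proof
    assume inj: "inj_on ?h (carrier (quot_mod M N))"
    show ?inj
    proof (intro ballI impI)
      fix z assume z: "z \<in> carrier M" "h z \<in> N'"
      have 0: "h \<zero>\<^bsub>M\<^esub> \<in> N'" using h_N[OF Q.N_sub(2)] .
      have "?h (qrep M N z) = ?h (qrep M N \<zero>\<^bsub>M\<^esub>)"
        using Q'.qrep_N[OF z(2)] Q'.qrep_N[OF 0] z by (simp add: h_qrep)
      with inj have "qrep M N z = qrep M N \<zero>\<^bsub>M\<^esub>"
        using z by (auto simp: inj_on_def Q.quot_mod_simps)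
      then show "z \<in> N" using Q.qrep_N_iff z by simp
    qed
  next
    assume inj: ?inj
    show "inj_on ?h (carrier (quot_mod M N))"
    proof (rule inj_onI)
      fix x' y' assume "x' \<in> carrier (quot_mod M N)" "y' \<in> carrier (quot_mod M N)" and eq: "?h x' = ?h y'"
      then obtain x y where x: "x \<in> carrier M" "x' = qrep M N x" and y: "y \<in> carrier M" "y' = qrep M N y"
        by (auto simp: Q.quot_mod_simps)
      then have "qrep M' N' (h x) = qrep M' N' (h y)" using eq h_qrep by simp
      then obtain n where n: "n \<in> N'" "h x = n \<oplus>\<^bsub>M'\<^esub> h y"
        using Q'.qrep_eq_iff h_closed x(1) y(1) by blast
      have m: "x = (x \<ominus>\<^bsub>M\<^esub> y) \<oplus>\<^bsub>M\<^esub> y" using x(1) y(1) by algebra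
      have xy: "x \<ominus>\<^bsub>M\<^esub> y \<in> carrier M" using x(1) y(1) by simp
      have "h x = h (x \<ominus>\<^bsub>M\<^esub> y) \<oplus>\<^bsub>M'\<^esub> h y"
        using arg_cong[OF m, of h] h_add[OF xy y(1)] by simp
      then have "h (x \<ominus>\<^bsub>M\<^esub> y) = n"
        using n Q'.M.add.right_cancel[of "h y" "h (x \<ominus>\<^bsub>M\<^esub> y)" n] h_closed xy y(1) Q'.N_carrier by simp
      then have "x \<ominus>\<^bsub>M\<^esub> y \<in> N" using inj n xy by auto
      then show "x' = y'" using Q.qrep_eq_iff[OF x(1) y(1)] m x y by auto
    qed
  qed
  moreover have "?h ` carrier (quot_mod M N) = carrier (quot_mod M' N') \<longleftrightarrow> ?surj"
  proof -
    have im: "?h ` carrier (quot_mod M N) = ?h ` carrier M"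
      by (auto simp: Q.quot_mod_simps h_qrep image_image)
    have sub: "?h ` carrier M \<subseteq> carrier (quot_mod M' N')"
      using h_closed by (auto simp: Q'.quot_mod_simps)
    have "(qrep M' N' w \<in> ?h ` carrier M) \<longleftrightarrow> (\<exists>z \<in> carrier M. \<exists>n \<in> N'. w = n \<oplus>\<^bsub>M'\<^esub> h z)"
      if "w \<in> carrier M'" for w
      using Q'.qrep_eq_iff[OF that h_closed] by (auto simp: image_iff)
    then have "carrier (quot_mod M' N') \<subseteq> ?h ` carrier M \<longleftrightarrow> ?surj"
      by (auto simp: Q'.quot_mod_simps image_subset_iff)
    then show ?thesis using im sub by auto
  qed
  ultimately show ?thesis by (simp add: bij_betw_def)
qed

end

lemma submodule_scaled:
  assumes "module A M" "g \<in> carrier A"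
  shows "submodule (scaled g M) A M"
proof -
  interpret module A M by fact
  show ?thesis
  proof (rule submoduleI)
    show "\<zero>\<^bsub>M\<^esub> \<in> scaled g M"
      using assms(2) by (auto simp: scaled_def image_iff intro!: bexI[of _ "\<zero>\<^bsub>M\<^esub>"])
    show "\<ominus>\<^bsub>M\<^esub> a \<in> scaled g M" if "a \<in> scaled g M" for a
      using that assms(2) by (auto simp: scaled_def image_iff smult_r_minus[symmetric])
    show "a \<oplus>\<^bsub>M\<^esub> b \<in> scaled g M" if "a \<in> scaled g M" "b \<in> scaled g M" for a b
      using that assms(2) by (auto simp: scaled_def image_iff smult_r_distr[symmetric])
    show "a \<odot>\<^bsub>M\<^esub> x \<in> scaled g M" if ax: "a \<in> carrier A" "x \<in> scaled g M" for a x
    proof -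
      obtain y where y: "y \<in> carrier M" "x = g \<odot>\<^bsub>M\<^esub> y" using ax by (auto simp: scaled_def)
      then have "a \<odot>\<^bsub>M\<^esub> x = g \<odot>\<^bsub>M\<^esub> (a \<odot>\<^bsub>M\<^esub> y)"
        using ax assms(2) by (simp add: smult_assoc1[symmetric] R.m_comm)
      then show ?thesis using y ax by (auto simp: scaled_def)
    qed
  qed (use assms(2) in \<open>auto simp: scaled_def\<close>)
qed

lemma dsum_simps [simp]:
  "carrier (dsum M N) = {Duo x y | x y. x \<in> carrier M \<and> y \<in> carrier N}"
  "\<zero>\<^bsub>dsum M N\<^esub> = Duo \<zero>\<^bsub>M\<^esub> \<zero>\<^bsub>N\<^esub>"
  "Duo x y \<oplus>\<^bsub>dsum M N\<^esub> Duo x' y' = Duo (x \<oplus>\<^bsub>M\<^esub> x') (y \<oplus>\<^bsub>N\<^esub> y')"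
  "a \<odot>\<^bsub>dsum M N\<^esub> Duo x y = Duo (a \<odot>\<^bsub>M\<^esub> x) (a \<odot>\<^bsub>N\<^esub> y)"
  by (auto simp: dsum_def)

lemma module_dsum:
  assumes "module A M" "module A N"
  shows "module A (dsum M N)"
proof -
  interpret M: module A M by fact
  interpret N: module A N by fact
  show ?thesis
  proof (rule moduleI)
    show "abelian_group (dsum M N)"
    proof (rule abelian_groupI, goal_cases)
      case (6 u)
      then obtain x y where "u = Duo x y" "x \<in> carrier M" "y \<in> carrier N" by auto
      then show ?case
        by (intro bexI[of _ "Duo (\<ominus>\<^bsub>M\<^esub> x) (\<ominus>\<^bsub>N\<^esub> y)"]) (auto simp: M.M.l_neg N.M.l_neg)
    qed (auto simp: M.M.a_ac N.M.a_ac)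
  qed (auto simp: M.R.is_cring M.smult_l_distr M.smult_r_distr M.smult_assoc1
      N.smult_l_distr N.smult_r_distr N.smult_assoc1)
qed

lemma torsionfree_dsum:
  "torsionfree a M \<Longrightarrow> torsionfree a N \<Longrightarrow> torsionfree a (dsum M N)"
  by (auto simp: torsionfree_def)

section \<open>Complexes\<close>

locale complex =
  fixes A :: "('a, 'r) ring_scheme" and X :: "('a, 'b) cplx"
  assumes cplx: "is_cplx A X"
begin

lemma module: "module A (trm X i)"
  using cplx by (simp add: is_cplx_def)

sublocale M: module A "trm X i" for i by (rule module)

abbreviation "d \<equiv> dif X"

lemma d_lin: "d i \<in> lin_maps A (trm X i) (trm X (i + 1))"
  using cplx by (simp add: is_cplx_def)

lemma d_closed [simp]: "x \<in> carrier (trm X i) \<Longrightarrow> j = i + 1 \<Longrightarrow> d i x \<in> carrier (trm X j)"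
  using lin_closed[OF module module d_lin] by simp

lemma d_add: "x \<in> carrier (trm X i) \<Longrightarrow> y \<in> carrier (trm X i) \<Longrightarrow>
    d i (x \<oplus>\<^bsub>trm X i\<^esub> y) = d i x \<oplus>\<^bsub>trm X (i + 1)\<^esub> d i y"
  and d_smult: "a \<in> carrier A \<Longrightarrow> x \<in> carrier (trm X i) \<Longrightarrow>
    d i (a \<odot>\<^bsub>trm X i\<^esub> x) = a \<odot>\<^bsub>trm X (i + 1)\<^esub> d i x"
  and d_zero [simp]: "d i \<zero>\<^bsub>trm X i\<^esub> = \<zero>\<^bsub>trm X (i + 1)\<^esub>"
  and d_neg: "x \<in> carrier (trm X i) \<Longrightarrow> d i (\<ominus>\<^bsub>trm X i\<^esub> x) = \<ominus>\<^bsub>trm X (i + 1)\<^esub> d i x"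
  and d_minus: "x \<in> carrier (trm X i) \<Longrightarrow> y \<in> carrier (trm X i) \<Longrightarrow>
    d i (x \<ominus>\<^bsub>trm X i\<^esub> y) = d i x \<ominus>\<^bsub>trm X (i + 1)\<^esub> d i y"
  by (simp_all only: lin_add[OF module module d_lin] lin_smult[OF module module d_lin]
    lin_zero[OF module module d_lin] lin_neg[OF module module d_lin]
    lin_minus[OF module module d_lin])

lemma dd [simp]: "x \<in> carrier (trm X i) \<Longrightarrow> j = i + 1 \<Longrightarrow> d j (d i x) = \<zero>\<^bsub>trm X (j + 1)\<^esub>"
  using cplx by (simp add: is_cplx_def)

lemmas d_simps = d_add d_smult d_zero d_neg d_minus

lemma submodule_Z: "submodule {x \<in> carrier (trm X i). d i x = \<zero>\<^bsub>trm X (i + 1)\<^esub>} A (trm X i)"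
  by (rule M.submoduleI) (auto simp: d_simps)

lemma cocycles_simps [simp]:
  "carrier (cocycles X i) = {x \<in> carrier (trm X i). d i x = \<zero>\<^bsub>trm X (i + 1)\<^esub>}"
  "x \<oplus>\<^bsub>cocycles X i\<^esub> y = x \<oplus>\<^bsub>trm X i\<^esub> y" "\<zero>\<^bsub>cocycles X i\<^esub> = \<zero>\<^bsub>trm X i\<^esub>"
  "a \<odot>\<^bsub>cocycles X i\<^esub> x = a \<odot>\<^bsub>trm X i\<^esub> x"
  by (simp_all add: cocycles_def)

lemma module_cocycles: "module A (cocycles X i)"
  unfolding cocycles_def by (rule submodule.submodule_is_module[OF submodule_Z module])

lemma coboundaries_Suc: "coboundaries X (i + 1) = d i ` carrier (trm X i)"
  by (simp add: coboundaries_def)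

lemma quotient_cohomology: "quotient A (cocycles X i) (coboundaries X i)"
proof -
  obtain j where i: "i = j + 1" by (metis diff_add_cancel)
  interpret Z: module A "cocycles X i" by (rule module_cocycles)
  have neg: "\<ominus>\<^bsub>cocycles X i\<^esub> x = \<ominus>\<^bsub>trm X i\<^esub> x" if "x \<in> carrier (cocycles X i)" for x
  proof -
    from that have "\<ominus>\<^bsub>trm X i\<^esub> x \<in> carrier (cocycles X i)" by (simp add: d_simps)
    with that show ?thesis using Z.minus_equality[of "\<ominus>\<^bsub>trm X i\<^esub> x" x] by (simp add: M.M.l_neg)
  qed
  have "submodule (coboundaries X i) A (cocycles X i)"
    unfolding i coboundaries_Suc
  proof (rule Z.submoduleI[unfolded i], goal_cases)
    case 1
    then show ?case by auto
  next
    case 2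
    then show ?case using d_zero[of j] M.M.zero_closed[of j] by (metis cocycles_simps(3) imageI)
  next
    case (3 a)
    then obtain x where "x \<in> carrier (trm X j)" "a = d j x" by auto
    then show ?case using neg[unfolded i, of a] by (auto simp: d_neg[symmetric])
  next
    case (4 a b)
    then show ?case by (auto simp: d_add[symmetric])
  next
    case (5 a x)
    then show ?case by (auto simp: d_smult[symmetric])
  qed
  then show ?thesis by (intro quotient.intro quotient_axioms.intro module_cocycles)
qed

end

lemma complexI:
  assumes "\<And>i. module A (trm X i)" "\<And>i. dif X i \<in> lin_maps A (trm X i) (trm X (i + 1))"
    "\<And>i x. x \<in> carrier (trm X i) \<Longrightarrow> dif X (i + 1) (dif X i x) = \<zero>\<^bsub>trm X (i + 1 + 1)\<^esub>"
  shows "is_cplx A X"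
  using assms by (simp add: is_cplx_def)

locale chain_map = X: complex A X + Y: complex A Y
  for A :: "('a, 'r) ring_scheme" and X :: "('a, 'b) cplx" and Y :: "('a, 'b) cplx" +
  fixes \<phi>
  assumes chmap: "is_chmap A (X, \<phi>, Y)"
begin

lemma lin: "\<phi> i \<in> lin_maps A (trm X i) (trm Y i)"
  using chmap by (simp add: is_chmap_def)

lemma closed [simp]: "x \<in> carrier (trm X i) \<Longrightarrow> \<phi> i x \<in> carrier (trm Y i)"
  using lin_closed[OF X.module Y.module lin] .

lemma add: "x \<in> carrier (trm X i) \<Longrightarrow> y \<in> carrier (trm X i) \<Longrightarrow>
    \<phi> i (x \<oplus>\<^bsub>trm X i\<^esub> y) = \<phi> i x \<oplus>\<^bsub>trm Y i\<^esub> \<phi> i y"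
  and smult: "a \<in> carrier A \<Longrightarrow> x \<in> carrier (trm X i) \<Longrightarrow>
    \<phi> i (a \<odot>\<^bsub>trm X i\<^esub> x) = a \<odot>\<^bsub>trm Y i\<^esub> \<phi> i x"
  and zero [simp]: "\<phi> i \<zero>\<^bsub>trm X i\<^esub> = \<zero>\<^bsub>trm Y i\<^esub>"
  and neg: "x \<in> carrier (trm X i) \<Longrightarrow> \<phi> i (\<ominus>\<^bsub>trm X i\<^esub> x) = \<ominus>\<^bsub>trm Y i\<^esub> \<phi> i x"
  and minus: "x \<in> carrier (trm X i) \<Longrightarrow> y \<in> carrier (trm X i) \<Longrightarrow>
    \<phi> i (x \<ominus>\<^bsub>trm X i\<^esub> y) = \<phi> i x \<ominus>\<^bsub>trm Y i\<^esub> \<phi> i y"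
  by (simp_all only: lin_add[OF X.module Y.module lin] lin_smult[OF X.module Y.module lin]
    lin_zero[OF X.module Y.module lin] lin_neg[OF X.module Y.module lin]
    lin_minus[OF X.module Y.module lin])

lemma d_comm: "x \<in> carrier (trm X i) \<Longrightarrow> j = i + 1 \<Longrightarrow> \<phi> j (dif X i x) = dif Y i (\<phi> i x)"
  using chmap by (simp add: is_chmap_def)

lemma extensional: "\<phi> i \<in> extensional (carrier (trm X i))"
  using lin by (auto simp: lin_maps_def PiE_def)

lemmas simps = add smult zero neg minus

lemma quotient_map_cohomology:
  "quotient_map A (cocycles X i) (coboundaries X i) (cocycles Y i) (coboundaries Y i) (\<phi> i)"
proof -
  interpret Q: quotient A "cocycles X i" "coboundaries X i" by (rule X.quotient_cohomology)
  interpret Q': quotient A "cocycles Y i" "coboundaries Y i" by (rule Y.quotient_cohomology)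
  obtain j where i: "i = j + 1" by (metis diff_add_cancel)
  show ?thesis
  proof (unfold_locales, goal_cases)
    case (1 x)
    then show ?case using d_comm[of x i] zero by auto
  next
    case (4 n)
    then show ?case unfolding i X.coboundaries_Suc Y.coboundaries_Suc by (auto simp: d_comm)
  qed (auto simp: simps)
qed

text \<open>
  A map is bijective on cohomology iff cocycles that become coboundaries are coboundaries, and every
  cocycle of the target comes from one of the source up to a coboundary. Everything is stated for degree
  \<open>i + 1\<close>, so that coboundaries are images under \<open>d i\<close> and no index \<open>i - 1\<close> occurs.
\<close>

lemma qis_iff:
  "(X, \<phi>, Y) \<in> qis A \<longleftrightarrow>
    (\<forall>i. (\<forall>z \<in> carrier (trm X (i + 1)). dif X (i + 1) z = \<zero>\<^bsub>trm X (i + 1 + 1)\<^esub> \<longrightarrow>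
            (\<exists>y \<in> carrier (trm Y i). \<phi> (i + 1) z = dif Y i y) \<longrightarrow>
            (\<exists>x \<in> carrier (trm X i). z = dif X i x)) \<and>
         (\<forall>w \<in> carrier (trm Y (i + 1)). dif Y (i + 1) w = \<zero>\<^bsub>trm Y (i + 1 + 1)\<^esub> \<longrightarrow>
            (\<exists>z \<in> carrier (trm X (i + 1)). dif X (i + 1) z = \<zero>\<^bsub>trm X (i + 1 + 1)\<^esub> \<and>
            (\<exists>y \<in> carrier (trm Y i). w = dif Y i y \<oplus>\<^bsub>trm Y (i + 1)\<^esub> \<phi> (i + 1) z))))" (is "_ \<longleftrightarrow> ?rhs")
proof -
  have all: "(\<forall>i::int. P i) \<longleftrightarrow> (\<forall>i. P (i + 1))" for P by (metis diff_add_cancel)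
  have "(X, \<phi>, Y) \<in> qis A \<longleftrightarrow> (\<forall>i.
      (\<forall>z \<in> carrier (cocycles X i). \<phi> i z \<in> coboundaries Y i \<longrightarrow> z \<in> coboundaries X i) \<and>
      (\<forall>w \<in> carrier (cocycles Y i). \<exists>z \<in> carrier (cocycles X i). \<exists>n \<in> coboundaries Y i.
        w = n \<oplus>\<^bsub>cocycles Y i\<^esub> \<phi> i z))"
    using chmap quotient_map.bij_quot_iff[OF quotient_map_cohomology]
    by (simp add: qis_def cohomology_def)
  also have "\<dots> \<longleftrightarrow> (\<forall>i.
      (\<forall>z \<in> carrier (cocycles X (i + 1)). \<phi> (i + 1) z \<in> coboundaries Y (i + 1) \<longrightarrow>
        z \<in> coboundaries X (i + 1)) \<and>
      (\<forall>w \<in> carrier (cocycles Y (i + 1)). \<exists>z \<in> carrier (cocycles X (i + 1)).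
        \<exists>n \<in> coboundaries Y (i + 1). w = n \<oplus>\<^bsub>cocycles Y (i + 1)\<^esub> \<phi> (i + 1) z))"
    by (rule all)
  also have "\<dots> \<longleftrightarrow> ?rhs"
  proof -
    have sets: "(\<forall>z \<in> {x \<in> C. P x}. P' z) \<longleftrightarrow> (\<forall>z \<in> C. P z \<longrightarrow> P' z)"
      "(\<exists>z \<in> {x \<in> C. P x}. P' z) \<longleftrightarrow> (\<exists>z \<in> C. P z \<and> P' z)"
      "(\<exists>n \<in> f ` C. P n) \<longleftrightarrow> (\<exists>y \<in> C. P (f y))"
      "z \<in> f ` C \<longleftrightarrow> (\<exists>x \<in> C. z = f x)"
      for C P P' and f :: "('a, 'b) univ \<Rightarrow> ('a, 'b) univ" and z
      by blast+
    show ?thesis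
      by (simp only: X.coboundaries_Suc Y.coboundaries_Suc X.cocycles_simps Y.cocycles_simps sets)
  qed
  finally show ?thesis .
qed

end

context chain_map
begin

lemma qis_inj:
  assumes "(X, \<phi>, Y) \<in> qis A" "z \<in> carrier (trm X (i + 1))" "dif X (i + 1) z = \<zero>\<^bsub>trm X (i + 1 + 1)\<^esub>"
    "y \<in> carrier (trm Y i)" "\<phi> (i + 1) z = dif Y i y"
  obtains x where "x \<in> carrier (trm X i)" "z = dif X i x"
  using assms(1)[unfolded qis_iff, rule_format, of i] assms(2-5) that by blast

lemma qis_surj:
  assumes "(X, \<phi>, Y) \<in> qis A" "w \<in> carrier (trm Y (i + 1))" "dif Y (i + 1) w = \<zero>\<^bsub>trm Y (i + 1 + 1)\<^esub>"
  obtains z y where "z \<in> carrier (trm X (i + 1))" "dif X (i + 1) z = \<zero>\<^bsub>trm X (i + 1 + 1)\<^esub>"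
    "y \<in> carrier (trm Y i)" "w = dif Y i y \<oplus>\<^bsub>trm Y (i + 1)\<^esub> \<phi> (i + 1) z"
  using assms(1)[unfolded qis_iff, rule_format, of i] assms(2-3) that by blast

lemma qisI:
  assumes "\<And>i z y. z \<in> carrier (trm X (i + 1)) \<Longrightarrow> dif X (i + 1) z = \<zero>\<^bsub>trm X (i + 1 + 1)\<^esub> \<Longrightarrow>
      y \<in> carrier (trm Y i) \<Longrightarrow> \<phi> (i + 1) z = dif Y i y \<Longrightarrow> \<exists>x \<in> carrier (trm X i). z = dif X i x"
    and "\<And>i w. w \<in> carrier (trm Y (i + 1)) \<Longrightarrow> dif Y (i + 1) w = \<zero>\<^bsub>trm Y (i + 1 + 1)\<^esub> \<Longrightarrow>
      \<exists>z \<in> carrier (trm X (i + 1)). dif X (i + 1) z = \<zero>\<^bsub>trm X (i + 1 + 1)\<^esub> \<and>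
        (\<exists>y \<in> carrier (trm Y i). w = dif Y i y \<oplus>\<^bsub>trm Y (i + 1)\<^esub> \<phi> (i + 1) z)"
  shows "(X, \<phi>, Y) \<in> qis A"
  unfolding qis_iff using assms by blast

end

lemma chain_mapI: "is_chmap A (X, \<phi>, Y) \<Longrightarrow> chain_map A X Y \<phi>"
  by (simp add: chain_map_def complex_def chain_map_axioms_def is_chmap_def)

lemma chmapI:
  assumes "is_cplx A X" "is_cplx A Y" "\<And>i. \<phi> i \<in> lin_maps A (trm X i) (trm Y i)"
    "\<And>i x. x \<in> carrier (trm X i) \<Longrightarrow> \<phi> (i + 1) (dif X i x) = dif Y i (\<phi> i x)"
  shows "is_chmap A (X, \<phi>, Y)"
  using assms by (simp add: is_chmap_def)

lemma chmap_eqI: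
  assumes "\<And>i. \<phi> i \<in> extensional (carrier (trm X i))" "\<And>i. \<psi> i \<in> extensional (carrier (trm X i))"
    "\<And>i x. x \<in> carrier (trm X i) \<Longrightarrow> \<phi> i x = \<psi> i x"
  shows "(X, \<phi>, Y) = (X, \<psi>, Y)"
proof -
  have "\<phi> i = \<psi> i" for i using extensionalityI[of "\<phi> i" _ "\<psi> i"] assms by blast
  then show ?thesis by auto
qed

lemma Ch_Hom: "m \<in> Hom (Ch A) X Y \<longleftrightarrow> (\<exists>\<phi>. m = (X, \<phi>, Y) \<and> is_chmap A (X, \<phi>, Y))"
  by (cases m) (auto simp: Hom_def Ch_def)

lemma Ch_HomI: "is_chmap A (X, \<phi>, Y) \<Longrightarrow> (X, \<phi>, Y) \<in> Hom (Ch A) X Y"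
  by (simp add: Ch_Hom)

lemma Ch_simps [simp]:
  "X \<in> Obj (Ch A) \<longleftrightarrow> is_cplx A X" "m \<in> Arr (Ch A) \<longleftrightarrow> is_chmap A m"
  "Dom (Ch A) (X, \<phi>, Y) = X" "Cod (Ch A) (X, \<phi>, Y) = Y"
  "Idn (Ch A) X = (X, \<lambda>i. \<lambda>x \<in> carrier (trm X i). x, X)"
  "Cmp (Ch A) (Y, \<psi>, Z) (X, \<phi>, Y') = (X, \<lambda>i. compose (carrier (trm X i)) (\<psi> i) (\<phi> i), Z)"
  by (auto simp: Ch_def)

lemma lin_compose:
  assumes "module A M" "module A N" "module A K" "h \<in> lin_maps A M N" "k \<in> lin_maps A N K"
  shows "compose (carrier M) k h \<in> lin_maps A M K"
proof -
  interpret M: module A M by fact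
  note l = lin_closed[OF assms(1,2,4)] lin_closed[OF assms(2,3,5)] lin_add[OF assms(1,2,4)]
    lin_add[OF assms(2,3,5)] lin_smult[OF assms(1,2,4)] lin_smult[OF assms(2,3,5)]
  show ?thesis
    unfolding lin_maps_def[of A M K]
  proof (intro CollectI conjI ballI)
    show "compose (carrier M) k h \<in> carrier M \<rightarrow>\<^sub>E carrier K"
      using l(1,2) by (auto simp: compose_def)
  qed (simp_all add: compose_eq l)
qed

lemma chmap_comp:
  assumes "is_chmap A (X, \<phi>, Y)" "is_chmap A (Y, \<psi>, Z)"
  shows "is_chmap A (X, \<lambda>i. compose (carrier (trm X i)) (\<psi> i) (\<phi> i), Z)"
proof -
  interpret f: chain_map A X Y \<phi> by (rule chain_mapI) fact
  interpret g: chain_map A Y Z \<psi> by (rule chain_mapI) fact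
  show ?thesis
  proof (rule chmapI)
    show "is_cplx A X" "is_cplx A Z" by (rule f.X.cplx g.Y.cplx)+
    show "compose (carrier (trm X i)) (\<psi> i) (\<phi> i) \<in> lin_maps A (trm X i) (trm Z i)" for i
      by (rule lin_compose[OF f.X.module f.Y.module g.Y.module f.lin g.lin])
    show "compose (carrier (trm X (i + 1))) (\<psi> (i + 1)) (\<phi> (i + 1)) (dif X i x) =
        dif Z i (compose (carrier (trm X i)) (\<psi> i) (\<phi> i) x)" if "x \<in> carrier (trm X i)" for i x
      using that by (simp add: compose_eq f.d_comm g.d_comm)
  qed
qed

lemma category_Ch: "category (Ch A)"
proof (unfold_locales, goal_cases)
  case (1 m)
  then show ?case by (cases m) (simp add: is_chmap_def)
next
  case (2 m)
  then show ?case by (cases m) (simp add: is_chmap_def)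
next
  case (3 X)
  then interpret complex A X by unfold_locales simp
  have "is_chmap A (X, \<lambda>i. \<lambda>x \<in> carrier (trm X i). x, X)"
    by (rule chmapI[OF cplx cplx]) (auto simp: lin_maps_def)
  then show ?case by (simp add: Ch_Hom)
next
  case (4 m X Y n Z)
  then show ?case by (auto simp: Ch_Hom chmap_comp)
next
  case (5 m X Y n Z k W)
  then obtain \<phi> \<psi> \<chi> where *: "m = (X, \<phi>, Y)" "n = (Y, \<psi>, Z)" "k = (Z, \<chi>, W)" "is_chmap A (X, \<phi>, Y)"
    by (auto simp: Ch_Hom)
  interpret f: chain_map A X Y \<phi> by (rule chain_mapI) fact
  show ?case by (auto simp: * compose_def fun_eq_iff)
next
  case (6 m X Y)
  then obtain \<phi> where *: "m = (X, \<phi>, Y)" "is_chmap A (X, \<phi>, Y)"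
    by (auto simp: Ch_Hom)
  interpret f: chain_map A X Y \<phi> by (rule chain_mapI) fact
  show ?case unfolding * Ch_simps by (rule chmap_eqI) (auto simp: compose_def f.extensional)
next
  case (7 m X Y)
  then obtain \<phi> where *: "m = (X, \<phi>, Y)" "is_chmap A (X, \<phi>, Y)"
    by (auto simp: Ch_Hom)
  interpret f: chain_map A X Y \<phi> by (rule chain_mapI) fact
  show ?case unfolding * Ch_simps by (rule chmap_eqI) (auto simp: compose_def f.extensional)
qed

section \<open>Cohomology as a functor on the derived category\<close>

text \<open>
  Cohomology is treated as a functor, not just as a family of modules, so that it can be lifted to the
  localization \<open>D(A)\<close>; this is its target.
\<close>

definition Modules :: "('a, 'r) ring_scheme \<Rightarrow>
    (('a, 'u) module, ('a, 'u) module \<times> ('u \<Rightarrow> 'u) \<times> ('a, 'u) module) cat" where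
  "Modules A = \<lparr>
     Obj = {M. module A M},
     Arr = {(M, h, N). module A M \<and> module A N \<and> h \<in> lin_maps A M N},
     Dom = (\<lambda>(M, h, N). M),
     Cod = (\<lambda>(M, h, N). N),
     Idn = (\<lambda>M. (M, \<lambda>x \<in> carrier M. x, M)),
     Cmp = (\<lambda>(N, k, K) (M, h, N'). (M, compose (carrier M) k h, K))\<rparr>"

lemma Modules_Hom:
  "m \<in> Hom (Modules A) M N \<longleftrightarrow> (\<exists>h. m = (M, h, N) \<and> module A M \<and> module A N \<and> h \<in> lin_maps A M N)"
  by (auto simp: Hom_def Modules_def)

lemma Modules_simps [simp]:
  "M \<in> Obj (Modules A) \<longleftrightarrow> module A M"
  "(M, h, N) \<in> Arr (Modules A) \<longleftrightarrow> module A M \<and> module A N \<and> h \<in> lin_maps A M N"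
  "Dom (Modules A) (M, h, N) = M" "Cod (Modules A) (M, h, N) = N"
  "Idn (Modules A) M = (M, \<lambda>x \<in> carrier M. x, M)"
  "Cmp (Modules A) (N, k, K) (M, h, N') = (M, compose (carrier M) k h, K)"
  by (auto simp: Modules_def)

lemma category_Modules: "category (Modules A)"
proof (unfold_locales, goal_cases)
  case (1 m)
  then show ?case by (cases m) simp
next
  case (2 m)
  then show ?case by (cases m) simp
next
  case (3 M)
  then interpret module A M by simp
  have "(\<lambda>x \<in> carrier M. x) \<in> lin_maps A M M" by (auto simp: lin_maps_def)
  then show ?case using module_axioms by (simp add: Modules_Hom)
next
  case (4 m X Y n Z)
  then show ?case by (auto simp: Modules_Hom lin_compose)
next
  case (5 m X Y n Z k W)
  then obtain h h' h'' where *: "m = (X, h, Y)" "n = (Y, h', Z)" "k = (Z, h'', W)"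
    "module A X" "module A Y" "h \<in> lin_maps A X Y"
    by (auto simp: Modules_Hom)
  show ?case using lin_closed[OF *(4-6)] by (auto simp: * compose_def fun_eq_iff)
next
  case (6 m X Y)
  then show ?case by (auto simp: Modules_Hom lin_maps_def PiE_def intro: Id_compose)
next
  case (7 m X Y)
  then show ?case by (auto simp: Modules_Hom lin_maps_def PiE_def compose_def fun_eq_iff extensional_def)
qed

lemma bij_lin_iso:
  assumes "module A M" "module A N" "h \<in> lin_maps A M N" "bij_betw h (carrier M) (carrier N)"
  shows "is_iso_arr (Modules A) (M, h, N)"
proof -
  interpret Modules: category "Modules A" by (rule category_Modules)
  interpret M: module A M by fact
  interpret N: module A N by fact
  define k where "k = (\<lambda>y \<in> carrier N. inv_into (carrier M) h y)"
  note lin = lin_closed[OF assms(1-3)] lin_add[OF assms(1-3)] lin_smult[OF assms(1-3)]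
  have k_closed: "k y \<in> carrier M" if "y \<in> carrier N" for y
    using that assms(4) bij_betw_imp_surj_on[OF assms(4)] by (auto simp: k_def intro: inv_into_into)
  have hk: "h (k y) = y" if "y \<in> carrier N" for y
    using that bij_betw_inv_into_right[OF assms(4)] by (simp add: k_def)
  have kh: "k (h x) = x" if "x \<in> carrier M" for x
    using that bij_betw_inv_into_left[OF assms(4)] lin(1) by (simp add: k_def)
  have "k \<in> lin_maps A N M"
    unfolding lin_maps_def
  proof (intro CollectI conjI ballI PiE_I)
    fix x y assume xy: "x \<in> carrier N" "y \<in> carrier N"
    then show "k (x \<oplus>\<^bsub>N\<^esub> y) = k x \<oplus>\<^bsub>M\<^esub> k y"
      using kh[of "k x \<oplus>\<^bsub>M\<^esub> k y"] k_closed hk by (simp add: lin)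
  next
    fix a x assume "a \<in> carrier A" "x \<in> carrier N"
    then show "k (a \<odot>\<^bsub>N\<^esub> x) = a \<odot>\<^bsub>M\<^esub> k x"
      using kh[of "a \<odot>\<^bsub>M\<^esub> k x"] k_closed hk by (simp add: lin)
  qed (use k_closed in \<open>auto simp: k_def\<close>)
  then have k: "(N, k, M) \<in> Hom (Modules A) N M" and h: "(M, h, N) \<in> Hom (Modules A) M N"
    using assms by (auto simp: Modules_Hom)
  have "Cmp (Modules A) (N, k, M) (M, h, N) = Idn (Modules A) M"
    "Cmp (Modules A) (M, h, N) (N, k, M) = Idn (Modules A) N"
    using kh hk lin(1) k_closed by (auto simp: compose_def fun_eq_iff)
  then show ?thesis
    using Modules.isoI(1)[OF h k] by (simp add: Modules.iso_def)
qed

lemma iso_torsionfree: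
  assumes "category.iso (Modules A) M N m" "torsionfree g M" "g \<in> carrier A"
  shows "torsionfree g N"
proof -
  interpret Modules: category "Modules A" by (rule category_Modules)
  note I = Modules.iso_inverse[OF assms(1)]
  obtain h k where h: "m = (M, h, N)" "h \<in> lin_maps A M N" and k: "inverse_arr (Modules A) m = (N, k, M)"
    "k \<in> lin_maps A N M" and M: "module A M" and N: "module A N"
    using I(1,2) by (auto simp: Modules_Hom)
  have hk: "h (k x) = x" if "x \<in> carrier N" for x
  proof -
    have "Cmp (Modules A) (M, h, N) (N, k, M) = Idn (Modules A) N"
      using I(4) unfolding k(1) unfolding h(1) .
    then have "compose (carrier N) h k x = restrict (\<lambda>x. x) (carrier N) x" by simp
    then show ?thesis using that by (simp add: compose_eq)
  qed
  show ?thesis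
    unfolding torsionfree_def
  proof (intro ballI impI)
    fix x assume x: "x \<in> carrier N" "g \<odot>\<^bsub>N\<^esub> x = \<zero>\<^bsub>N\<^esub>"
    then have "g \<odot>\<^bsub>M\<^esub> k x = \<zero>\<^bsub>M\<^esub>"
      using lin_smult[OF N M k(2) assms(3), of x] lin_zero[OF N M k(2)] by simp
    then have "k x = \<zero>\<^bsub>M\<^esub>" using assms(2) lin_closed[OF N M k(2)] x by (simp add: torsionfree_def)
    then show "x = \<zero>\<^bsub>N\<^esub>" using hk[of x] x lin_zero[OF M N h(2)] by simp
  qed
qed

lemma Ch_functorI:
  assumes "\<And>X. is_cplx A X \<Longrightarrow> fob F X \<in> Obj D"
    and "\<And>X. is_cplx A X \<Longrightarrow> far F (X, \<lambda>i. \<lambda>x \<in> carrier (trm X i). x, X) = Idn D (fob F X)"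
    and "\<And>X \<phi> Y. is_chmap A (X, \<phi>, Y) \<Longrightarrow> far F (X, \<phi>, Y) \<in> Hom D (fob F X) (fob F Y)"
    and "\<And>X \<phi> Y \<psi> Z. is_chmap A (X, \<phi>, Y) \<Longrightarrow> is_chmap A (Y, \<psi>, Z) \<Longrightarrow>
      far F (X, \<lambda>i. compose (carrier (trm X i)) (\<psi> i) (\<phi> i), Z) =
        Cmp D (far F (Y, \<psi>, Z)) (far F (X, \<phi>, Y))"
  shows "is_functor (Ch A) D F"
  unfolding is_functor_def
proof (intro conjI ballI impI, goal_cases)
  case (3 m)
  then show ?case using assms(3) by (cases m) simp
next
  case (4 m n)
  obtain X \<phi> Y where m: "m = (X, \<phi>, Y)" by (cases m)
  obtain Y' \<psi> Z where n: "n = (Y', \<psi>, Z)" by (cases n)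
  have "Y' = Y" using 4(3) by (simp add: m n)
  then show ?case using 4(1,2) assms(4) by (simp add: m n)
qed (use assms(1,2) in simp_all)

definition cohomology_functor :: "int \<Rightarrow> (('a, 'b) cplx, ('a, 'b) chmap, ('a, 'b) umod,
    ('a, 'b) umod \<times> (('a, 'b) univ \<Rightarrow> ('a, 'b) univ) \<times> ('a, 'b) umod) funct" where
  "cohomology_functor i = \<lparr>
     fob = (\<lambda>X. cohomology X i),
     far = (\<lambda>(X, \<phi>, Y). (cohomology X i,
       \<lambda>x \<in> carrier (cohomology X i). qrep (cocycles Y i) (coboundaries Y i) (\<phi> i x),
       cohomology Y i))\<rparr>"

lemma functor_cohomology:
  "is_functor (Ch A) (Modules A) (cohomology_functor i)"
proof (rule Ch_functorI, goal_cases)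
  case (1 X)
  then interpret complex A X by unfold_locales
  interpret Q: quotient A "cocycles X i" "coboundaries X i" by (rule quotient_cohomology)
  show ?case using Q.module_quot by (simp add: cohomology_functor_def cohomology_def)
next
  case (2 X)
  then interpret complex A X by unfold_locales
  interpret Q: quotient A "cocycles X i" "coboundaries X i" by (rule quotient_cohomology)
  have "qrep (cocycles X i) (coboundaries X i) (restrict (\<lambda>x. x) (carrier (trm X i)) u) = u"
    if u: "u \<in> carrier (cohomology X i)" for u
  proof -
    obtain x where x: "x \<in> carrier (cocycles X i)" "u = qrep (cocycles X i) (coboundaries X i) x"
      using u by (auto simp: cohomology_def Q.quot_mod_simps)
    moreover have "u \<in> carrier (trm X i)" using Q.qrep_closed[OF x(1)] x(2) by simp
    ultimately show ?thesis using Q.qrep_qrep by simp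
  qed
  then show ?case by (auto simp: cohomology_functor_def fun_eq_iff)
next
  case (3 X \<phi> Y)
  interpret chain_map A X Y \<phi> by (rule chain_mapI) fact
  interpret Q: quotient_map A "cocycles X i" "coboundaries X i" "cocycles Y i" "coboundaries Y i" "\<phi> i"
    by (rule quotient_map_cohomology)
  show ?case
    using Q.lin_quot Q.Q.module_quot Q.Q'.module_quot
    by (simp add: Modules_Hom cohomology_functor_def cohomology_def)
next
  case (4 X \<phi> Y \<psi> Z)
  interpret f: chain_map A X Y \<phi> by (rule chain_mapI) fact
  interpret g: chain_map A Y Z \<psi> by (rule chain_mapI) fact
  interpret F: quotient_map A "cocycles X i" "coboundaries X i" "cocycles Y i" "coboundaries Y i" "\<phi> i"
    by (rule f.quotient_map_cohomology)
  interpret G: quotient_map A "cocycles Y i" "coboundaries Y i" "cocycles Z i" "coboundaries Z i" "\<psi> i"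
    by (rule g.quotient_map_cohomology)
  have "qrep (cocycles Z i) (coboundaries Z i) (compose (carrier (trm X i)) (\<psi> i) (\<phi> i) u) =
      qrep (cocycles Z i) (coboundaries Z i) (\<psi> i (qrep (cocycles Y i) (coboundaries Y i) (\<phi> i u)))"
    "qrep (cocycles Y i) (coboundaries Y i) (\<phi> i u) \<in> carrier (cohomology Y i)"
    if u': "u \<in> carrier (cohomology X i)" for u
  proof -
    have u: "u \<in> carrier (cocycles X i)"
      using F.Q.qrep_closed u' by (auto simp only: cohomology_def F.Q.quot_mod_simps)
    then have "u \<in> carrier (trm X i)" by simp
    with G.h_qrep[OF F.h_closed[OF u]]
    show "qrep (cocycles Z i) (coboundaries Z i) (compose (carrier (trm X i)) (\<psi> i) (\<phi> i) u) =
      qrep (cocycles Z i) (coboundaries Z i) (\<psi> i (qrep (cocycles Y i) (coboundaries Y i) (\<phi> i u)))"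
      by (simp add: compose_eq)
    show "qrep (cocycles Y i) (coboundaries Y i) (\<phi> i u) \<in> carrier (cohomology Y i)"
      using F.h_closed[OF u] by (simp only: cohomology_def F.Q'.quot_mod_simps imageI)
  qed
  then show ?case by (simp add: cohomology_functor_def fun_eq_iff compose_def)
qed

lemma qis_iso_cohomology:
  assumes "m \<in> qis A"
  shows "is_iso_arr (Modules A) (far (cohomology_functor i) m)"
proof -
  obtain X \<phi> Y where m: "m = (X, \<phi>, Y)" "is_chmap A (X, \<phi>, Y)" using assms by (auto simp: qis_def)
  interpret chain_map A X Y \<phi> by (rule chain_mapI) fact
  interpret Q: quotient_map A "cocycles X i" "coboundaries X i" "cocycles Y i" "coboundaries Y i" "\<phi> i"
    by (rule quotient_map_cohomology)
  have "bij_betw (\<lambda>x. qrep (cocycles Y i) (coboundaries Y i) (\<phi> i x))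
      (carrier (cohomology X i)) (carrier (cohomology Y i))"
    using assms by (simp add: m qis_def)
  then have "bij_betw (\<lambda>x \<in> carrier (cohomology X i). qrep (cocycles Y i) (coboundaries Y i) (\<phi> i x))
      (carrier (cohomology X i)) (carrier (cohomology Y i))"
    by (subst bij_betw_cong[of _ _ "\<lambda>x. qrep (cocycles Y i) (coboundaries Y i) (\<phi> i x)"]) auto
  then show ?thesis
    using bij_lin_iso[OF Q.Q.module_quot Q.Q'.module_quot Q.lin_quot]
    by (simp add: m cohomology_functor_def cohomology_def)
qed

lemma localized_Ch: "localized (Ch A)"
  by (simp add: localized_def category_Ch)

lemma category_DA: "category (DA A)"
  unfolding DA_def by (rule localized.category_L[OF localized_Ch])

text \<open>
  Cohomology inverts quasi-isomorphisms, so it lives on the derived category and isomorphisms there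
  preserve the torsion of cohomology modules.
\<close>

lemma DA_iso_torsionfree:
  assumes "category.iso (DA A) X Y m" "g \<in> carrier A" "torsionfree g (cohomology X i)"
  shows "torsionfree g (cohomology Y i)"
proof -
  interpret inverting "Ch A" "qis A" "Modules A" "cohomology_functor i"
    by (intro inverting.intro inverting_axioms.intro localized_Ch category_Modules functor_cohomology
        qis_iso_cohomology)
  have "D.iso (cohomology X i) (cohomology Y i)
      (far (lift_functor (Ch A) (Modules A) (cohomology_functor i)) m)"
    using functor_iso(1)[OF category_L category_Modules functor_lift, of X Y m] assms(1)
    by (simp add: DA_def) (simp add: cohomology_functor_def)
  then show ?thesis by (rule iso_torsionfree[OF _ assms(3,2)])
qed

section \<open>Reduction modulo \<open>g\<close>\<close>

abbreviation red :: "'a \<Rightarrow> ('a, 'b) cplx \<Rightarrow> int \<Rightarrow> ('a, 'b) univ \<Rightarrow> ('a, 'b) univ" where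
  "red g X i \<equiv> qrep (trm X i) (scaled g (trm X i))"

lemma quotient_scaled: "module A M \<Longrightarrow> g \<in> carrier A \<Longrightarrow> quotient A M (scaled g M)"
  by (intro quotient.intro quotient_axioms.intro submodule_scaled)

lemma quotient_map_scaled:
  assumes "module A M" "module A N" "h \<in> lin_maps A M N" "g \<in> carrier A"
  shows "quotient_map A M (scaled g M) N (scaled g N) h"
proof -
  interpret M: quotient A M "scaled g M" by (rule quotient_scaled) fact+
  interpret N: quotient A N "scaled g N" by (rule quotient_scaled) fact+
  note l = lin_closed[OF assms(1-3)] lin_add[OF assms(1-3)] lin_smult[OF assms(1-3)]
  show ?thesis
  proof (unfold_locales, goal_cases)
    case (4 n)
    then show ?case using assms(4) l by (auto simp: scaled_def)
  qed (simp_all add: l)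
qed

locale reduction = complex A X for A :: "('a, 'r) ring_scheme" and X :: "('a, 'b) cplx" +
  fixes g assumes g_closed [simp]: "g \<in> carrier A"
begin

sublocale q: quotient A "trm X i" "scaled g (trm X i)" for i
  by (rule quotient_scaled[OF module g_closed])

sublocale dq: quotient_map A "trm X i" "scaled g (trm X i)" "trm X (i + 1)" "scaled g (trm X (i + 1))" "d i"
  for i by (rule quotient_map_scaled[OF module module d_lin g_closed])

lemma red_eq_iff: "x \<in> carrier (trm X i) \<Longrightarrow> y \<in> carrier (trm X i) \<Longrightarrow>
    red g X i x = red g X i y \<longleftrightarrow> (\<exists>z \<in> carrier (trm X i). x = g \<odot>\<^bsub>trm X i\<^esub> z \<oplus>\<^bsub>trm X i\<^esub> y)"
  using q.qrep_eq_iff by (auto simp: scaled_def)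

lemma red_zero_iff: "x \<in> carrier (trm X i) \<Longrightarrow>
    red g X i x = \<zero>\<^bsub>trm (tensor_cplx g X) i\<^esub> \<longleftrightarrow> (\<exists>z \<in> carrier (trm X i). x = g \<odot>\<^bsub>trm X i\<^esub> z)"
  using q.qrep_N_iff[of x i] q.quot_mod_simps(2)[of i] by (simp add: scaled_def tensor_cplx_def image_iff)

lemma tensor_simps:
  "carrier (trm (tensor_cplx g X) i) = red g X i ` carrier (trm X i)"
  "x \<in> carrier (trm X i) \<Longrightarrow> y \<in> carrier (trm X i) \<Longrightarrow>
    red g X i x \<oplus>\<^bsub>trm (tensor_cplx g X) i\<^esub> red g X i y = red g X i (x \<oplus>\<^bsub>trm X i\<^esub> y)"
  "a \<in> carrier A \<Longrightarrow> x \<in> carrier (trm X i) \<Longrightarrow>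
    a \<odot>\<^bsub>trm (tensor_cplx g X) i\<^esub> red g X i x = red g X i (a \<odot>\<^bsub>trm X i\<^esub> x)"
  by (simp_all add: tensor_cplx_def q.quot_mod_simps)

lemma tensor_d: "x \<in> carrier (trm X i) \<Longrightarrow> dif (tensor_cplx g X) i (red g X i x) = red g X (i + 1) (d i x)"
  by (simp add: tensor_cplx_def q.quot_mod_simps dq.h_qrep)

lemma cplx_tensor: "is_cplx A (tensor_cplx g X)"
proof (rule complexI)
  show "module A (trm (tensor_cplx g X) i)" for i by (simp add: tensor_cplx_def q.module_quot)
  show "dif (tensor_cplx g X) i \<in> lin_maps A (trm (tensor_cplx g X) i) (trm (tensor_cplx g X) (i + 1))" for i
    using dq.lin_quot[of i] by (simp add: tensor_cplx_def)
  show "dif (tensor_cplx g X) (i + 1) (dif (tensor_cplx g X) i u) = \<zero>\<^bsub>trm (tensor_cplx g X) (i + 1 + 1)\<^esub>"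
    if u: "u \<in> carrier (trm (tensor_cplx g X) i)" for i u
  proof -
    obtain x where x: "x \<in> carrier (trm X i)" "u = red g X i x" using u by (auto simp: tensor_simps)
    have "dif (tensor_cplx g X) (i + 1) (dif (tensor_cplx g X) i u) = red g X (i + 1 + 1) \<zero>\<^bsub>trm X (i + 1 + 1)\<^esub>"
      unfolding x(2) tensor_d[OF x(1)] tensor_d[OF d_closed[OF x(1) refl]] dd[OF x(1) refl] ..
    then show ?thesis by (simp add: tensor_cplx_def q.quot_mod_simps)
  qed
qed

lemma chmap_tensor_proj: "is_chmap A (tensor_proj g X)"
  unfolding tensor_proj_def
proof (rule chmapI[OF cplx cplx_tensor])
  show "(\<lambda>x \<in> carrier (trm X i). red g X i x) \<in> lin_maps A (trm X i) (trm (tensor_cplx g X) i)" for i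
    unfolding lin_maps_def by (auto simp: tensor_simps)
qed (simp add: tensor_d)

end

locale reduced_map = chain_map A X Y \<phi> + X: reduction A X g + Y: reduction A Y g
  for A :: "('a, 'r) ring_scheme" and X :: "('a, 'b) cplx" and Y \<phi> g
begin

sublocale \<phi>q: quotient_map A "trm X i" "scaled g (trm X i)" "trm Y i" "scaled g (trm Y i)" "\<phi> i" for i
  by (rule quotient_map_scaled[OF X.module Y.module lin X.g_closed])

abbreviation "T\<phi> \<equiv> \<lambda>i. \<lambda>x \<in> carrier (trm (tensor_cplx g X) i). red g Y i (\<phi> i x)"

lemma tensor_map: "x \<in> carrier (trm X i) \<Longrightarrow> T\<phi> i (red g X i x) = red g Y i (\<phi> i x)"
  by (simp add: X.tensor_simps \<phi>q.h_qrep)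

lemma chmap_tensor: "is_chmap A (tensor_cplx g X, T\<phi>, tensor_cplx g Y)"
proof (rule chmapI[OF X.cplx_tensor Y.cplx_tensor])
  show "T\<phi> i \<in> lin_maps A (trm (tensor_cplx g X) i) (trm (tensor_cplx g Y) i)" for i
    using \<phi>q.lin_quot[of i] by (simp add: tensor_cplx_def)
  show "T\<phi> (i + 1) (dif (tensor_cplx g X) i u) = dif (tensor_cplx g Y) i (T\<phi> i u)"
    if u: "u \<in> carrier (trm (tensor_cplx g X) i)" for i u
  proof -
    obtain x where x: "x \<in> carrier (trm X i)" "u = red g X i x" using u by (auto simp: X.tensor_simps)
    show ?thesis
      unfolding x(2) X.tensor_d[OF x(1)] tensor_map[OF x(1)] tensor_map[OF X.d_closed[OF x(1) refl]]
        Y.tensor_d[OF closed[OF x(1)]] by (simp add: d_comm x(1))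
  qed
qed

sublocale T: chain_map A "tensor_cplx g X" "tensor_cplx g Y" T\<phi>
  by (rule chain_mapI[OF chmap_tensor])

text \<open>
  Reduction modulo \<open>g\<close> preserves quasi-isomorphisms between complexes with \<open>g\<close>-torsionfree terms:
  this is the five lemma for the long exact sequences of \<open>0 \<rightarrow> X \<rightarrow> X \<rightarrow> X/g \<rightarrow> 0\<close> and
  \<open>0 \<rightarrow> Y \<rightarrow> Y \<rightarrow> Y/g \<rightarrow> 0\<close>, with the diagram chases written out.
\<close>

lemma qis_tensor:
  assumes q: "(X, \<phi>, Y) \<in> qis A"
    and tX: "\<And>i. torsionfree g (trm X i)" and tY: "\<And>i. torsionfree g (trm Y i)"
  shows "(tensor_cplx g X, T\<phi>, tensor_cplx g Y) \<in> qis A"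
proof (rule T.qisI, goal_cases)
  case (1 i u w)
  let ?j = "i + 1" and ?k = "i + 1 + 1"
  obtain x where x: "x \<in> carrier (trm X ?j)" "u = red g X ?j x"
    using 1(1) by (auto simp: X.tensor_simps)
  obtain w' where w': "w' \<in> carrier (trm Y i)" "w = red g Y i w'"
    using 1(3) by (auto simp: Y.tensor_simps)
  obtain y where y: "y \<in> carrier (trm X ?k)" "dif X ?j x = g \<odot>\<^bsub>trm X ?k\<^esub> y"
    using 1(2) X.red_zero_iff[of "dif X ?j x" ?k] x by (auto simp: X.tensor_d)
  have "red g Y ?j (\<phi> ?j x) = red g Y ?j (dif Y i w')"
    using 1(4) unfolding x(2) w'(2) tensor_map[OF x(1)] Y.tensor_d[OF w'(1)] .
  then obtain v' where v': "v' \<in> carrier (trm Y ?j)"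
    "\<phi> ?j x = g \<odot>\<^bsub>trm Y ?j\<^esub> v' \<oplus>\<^bsub>trm Y ?j\<^esub> dif Y i w'"
    using Y.red_eq_iff[of "\<phi> ?j x" ?j "dif Y i w'"] x(1) w'(1) by auto
  have dy: "dif X ?k y = \<zero>\<^bsub>trm X (?k + 1)\<^esub>"
  proof (rule torsionfree_cancel[OF X.module tX X.g_closed])
    show "g \<odot>\<^bsub>trm X (?k + 1)\<^esub> dif X ?k y = g \<odot>\<^bsub>trm X (?k + 1)\<^esub> \<zero>\<^bsub>trm X (?k + 1)\<^esub>"
      using X.d_smult[OF X.g_closed y(1)] X.dd[OF x(1) refl] y(2) by simp
  qed (use y in simp_all)
  have \<phi>y: "\<phi> ?k y = dif Y ?j v'"
  proof (rule torsionfree_cancel[OF Y.module tY X.g_closed])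
    have "g \<odot>\<^bsub>trm Y ?k\<^esub> \<phi> ?k y = dif Y ?j (\<phi> ?j x)"
      using smult[OF X.g_closed y(1)] d_comm[OF x(1) refl] y(2) by simp
    also have "\<dots> = g \<odot>\<^bsub>trm Y ?k\<^esub> dif Y ?j v'"
      unfolding v'(2) using v'(1) w'(1) Y.dd[OF w'(1) refl] by (simp add: Y.d_add Y.d_smult)
    finally show "g \<odot>\<^bsub>trm Y ?k\<^esub> \<phi> ?k y = g \<odot>\<^bsub>trm Y ?k\<^esub> dif Y ?j v'" .
  qed (use y v' in simp_all)
  obtain v where v: "v \<in> carrier (trm X ?j)" "y = dif X ?j v"
    using qis_inj[OF q y(1) dy v'(1) \<phi>y] .
  \<comment> \<open>Changing \<open>v\<close> by a cocycle makes \<open>\<phi> v\<close> agree with \<open>v'\<close> up to a coboundary; then \<open>x - gv\<close> is a cocycle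
    whose image is a coboundary.\<close>
  have "dif Y ?j (\<phi> ?j v \<ominus>\<^bsub>trm Y ?j\<^esub> v') = \<zero>\<^bsub>trm Y ?k\<^esub>"
    using v v' \<phi>y d_comm[OF v(1) refl] by (simp add: Y.d_minus Y.M.subtr_eq)
  then obtain z c where z: "z \<in> carrier (trm X ?j)" "dif X ?j z = \<zero>\<^bsub>trm X ?k\<^esub>"
    "c \<in> carrier (trm Y i)" "\<phi> ?j v \<ominus>\<^bsub>trm Y ?j\<^esub> v' = dif Y i c \<oplus>\<^bsub>trm Y ?j\<^esub> \<phi> ?j z"
    using qis_surj[OF q, of "\<phi> ?j v \<ominus>\<^bsub>trm Y ?j\<^esub> v'" i] v v' by auto
  let ?v = "v \<ominus>\<^bsub>trm X ?j\<^esub> z"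
  have v1: "dif X ?j ?v = y" using v z by (simp add: X.d_minus) (simp add: X.M.minus_eq)
  have \<phi>v: "\<phi> ?j ?v = dif Y i c \<oplus>\<^bsub>trm Y ?j\<^esub> v'"
  proof -
    have c: "\<phi> ?j v \<in> carrier (trm Y ?j)" "\<phi> ?j z \<in> carrier (trm Y ?j)" "dif Y i c \<in> carrier (trm Y ?j)"
      using v z by auto
    have "\<phi> ?j ?v = (\<phi> ?j v \<ominus>\<^bsub>trm Y ?j\<^esub> v') \<oplus>\<^bsub>trm Y ?j\<^esub> v' \<ominus>\<^bsub>trm Y ?j\<^esub> \<phi> ?j z"
      unfolding minus[OF v(1) z(1)] using c v'(1) by algebra
    also have "\<dots> = dif Y i c \<oplus>\<^bsub>trm Y ?j\<^esub> v'"
      unfolding z(4) using c v'(1) by algebra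
    finally show ?thesis .
  qed
  let ?x = "x \<ominus>\<^bsub>trm X ?j\<^esub> g \<odot>\<^bsub>trm X ?j\<^esub> ?v"
  have "dif X ?j ?x = \<zero>\<^bsub>trm X ?k\<^esub>"
    using x v z v1 y by (simp add: X.d_minus X.d_smult X.M.subtr_eq)
  moreover have "\<phi> ?j ?x = dif Y i (w' \<ominus>\<^bsub>trm Y i\<^esub> g \<odot>\<^bsub>trm Y i\<^esub> c)"
  proof -
    have c: "dif Y i w' \<in> carrier (trm Y ?j)" "dif Y i c \<in> carrier (trm Y ?j)" using w' z by auto
    have "\<phi> ?j ?x = \<phi> ?j x \<ominus>\<^bsub>trm Y ?j\<^esub> g \<odot>\<^bsub>trm Y ?j\<^esub> \<phi> ?j ?v"
      using x v z by (simp add: minus smult)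
    also have "\<dots> = dif Y i w' \<ominus>\<^bsub>trm Y ?j\<^esub> g \<odot>\<^bsub>trm Y ?j\<^esub> dif Y i c"
      unfolding \<phi>v v'(2) using c v'(1) X.g_closed by algebra
    also have "\<dots> = dif Y i (w' \<ominus>\<^bsub>trm Y i\<^esub> g \<odot>\<^bsub>trm Y i\<^esub> c)"
      using w' z by (simp add: Y.d_minus Y.d_smult)
    finally show ?thesis .
  qed
  ultimately obtain e where e: "e \<in> carrier (trm X i)" "?x = dif X i e"
    using qis_inj[OF q, of ?x i "w' \<ominus>\<^bsub>trm Y i\<^esub> g \<odot>\<^bsub>trm Y i\<^esub> c"] x v z w' by auto
  have "x = g \<odot>\<^bsub>trm X ?j\<^esub> ?v \<oplus>\<^bsub>trm X ?j\<^esub> ?x"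
    using x v z X.g_closed by algebra
  then have "u = red g X ?j (dif X i e)"
    unfolding x(2) e(2) using X.red_eq_iff[of x ?j "dif X i e"] x(1) e(1) v z by auto
  then show ?case
    using e(1) by (intro bexI[of _ "red g X i e"]) (simp_all only: X.tensor_d X.tensor_simps(1) imageI)
next
  case (2 i u)
  let ?j = "i + 1" and ?k = "i + 1 + 1"
  obtain x' where x': "x' \<in> carrier (trm Y ?j)" "u = red g Y ?j x'"
    using 2(1) by (auto simp: Y.tensor_simps)
  obtain y' where y': "y' \<in> carrier (trm Y ?k)" "dif Y ?j x' = g \<odot>\<^bsub>trm Y ?k\<^esub> y'"
    using 2(2) Y.red_zero_iff[of "dif Y ?j x'" ?k] x' by (auto simp: Y.tensor_d)
  have dy': "dif Y ?k y' = \<zero>\<^bsub>trm Y (?k + 1)\<^esub>"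
  proof (rule torsionfree_cancel[OF Y.module tY X.g_closed])
    show "g \<odot>\<^bsub>trm Y (?k + 1)\<^esub> dif Y ?k y' = g \<odot>\<^bsub>trm Y (?k + 1)\<^esub> \<zero>\<^bsub>trm Y (?k + 1)\<^esub>"
      using Y.d_smult[OF X.g_closed y'(1)] Y.dd[OF x'(1) refl] y'(2) by simp
  qed (use y' in simp_all)
  obtain z c where z: "z \<in> carrier (trm X ?k)" "dif X ?k z = \<zero>\<^bsub>trm X (?k + 1)\<^esub>"
    "c \<in> carrier (trm Y ?j)" "y' = dif Y ?j c \<oplus>\<^bsub>trm Y ?k\<^esub> \<phi> ?k z"
    using qis_surj[OF q y'(1) dy'] .
  have dc: "dif Y ?j c \<in> carrier (trm Y ?k)" "\<phi> ?k z \<in> carrier (trm Y ?k)" using z by auto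
  have "\<phi> ?k (g \<odot>\<^bsub>trm X ?k\<^esub> z) = dif Y ?j (x' \<ominus>\<^bsub>trm Y ?j\<^esub> g \<odot>\<^bsub>trm Y ?j\<^esub> c)"
  proof -
    have "dif Y ?j (x' \<ominus>\<^bsub>trm Y ?j\<^esub> g \<odot>\<^bsub>trm Y ?j\<^esub> c) =
        g \<odot>\<^bsub>trm Y ?k\<^esub> y' \<ominus>\<^bsub>trm Y ?k\<^esub> g \<odot>\<^bsub>trm Y ?k\<^esub> dif Y ?j c"
      using x' z y' by (simp add: Y.d_minus Y.d_smult)
    also have "\<dots> = g \<odot>\<^bsub>trm Y ?k\<^esub> \<phi> ?k z" unfolding z(4) using dc X.g_closed by algebra
    finally show ?thesis using z by (simp add: smult)
  qed
  moreover have "dif X ?k (g \<odot>\<^bsub>trm X ?k\<^esub> z) = \<zero>\<^bsub>trm X (?k + 1)\<^esub>"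
    using z by (simp add: X.d_smult)
  ultimately obtain w where w: "w \<in> carrier (trm X ?j)" "g \<odot>\<^bsub>trm X ?k\<^esub> z = dif X ?j w"
    using qis_inj[OF q, of "g \<odot>\<^bsub>trm X ?k\<^esub> z" ?j "x' \<ominus>\<^bsub>trm Y ?j\<^esub> g \<odot>\<^bsub>trm Y ?j\<^esub> c"] z x' by auto
  \<comment> \<open>Modulo \<open>g\<close>, the element \<open>w\<close> is a cocycle that lifts \<open>x'\<close> up to the cocycle \<open>s\<close>, which itself lifts up
    to a coboundary.\<close>
  let ?s = "\<phi> ?j w \<ominus>\<^bsub>trm Y ?j\<^esub> x' \<oplus>\<^bsub>trm Y ?j\<^esub> g \<odot>\<^bsub>trm Y ?j\<^esub> c"
  have "dif Y ?j ?s = \<zero>\<^bsub>trm Y ?k\<^esub>"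
  proof -
    have "dif Y ?j ?s = \<phi> ?k (dif X ?j w) \<ominus>\<^bsub>trm Y ?k\<^esub> dif Y ?j x' \<oplus>\<^bsub>trm Y ?k\<^esub> g \<odot>\<^bsub>trm Y ?k\<^esub> dif Y ?j c"
      using w(1) x' z by (simp add: Y.d_minus Y.d_add Y.d_smult d_comm)
    also have "\<dots> = g \<odot>\<^bsub>trm Y ?k\<^esub> \<phi> ?k z \<ominus>\<^bsub>trm Y ?k\<^esub> g \<odot>\<^bsub>trm Y ?k\<^esub> (dif Y ?j c \<oplus>\<^bsub>trm Y ?k\<^esub> \<phi> ?k z)
        \<oplus>\<^bsub>trm Y ?k\<^esub> g \<odot>\<^bsub>trm Y ?k\<^esub> dif Y ?j c"
      unfolding w(2)[symmetric] y'(2) z(4)[symmetric] smult[OF X.g_closed z(1)] ..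
    also have "\<dots> = \<zero>\<^bsub>trm Y ?k\<^esub>" using dc X.g_closed by algebra
    finally show ?thesis .
  qed
  then obtain t e where t: "t \<in> carrier (trm X ?j)" "dif X ?j t = \<zero>\<^bsub>trm X ?k\<^esub>"
    "e \<in> carrier (trm Y i)" "?s = dif Y i e \<oplus>\<^bsub>trm Y ?j\<^esub> \<phi> ?j t"
    using qis_surj[OF q, of ?s i] w x' z by auto
  let ?x = "w \<ominus>\<^bsub>trm X ?j\<^esub> t" and ?e = "\<ominus>\<^bsub>trm Y i\<^esub> e"
  have x: "?x \<in> carrier (trm X ?j)" and e: "?e \<in> carrier (trm Y i)" using w t by auto
  have "dif X ?j ?x = g \<odot>\<^bsub>trm X ?k\<^esub> z"
    using w t by (simp add: X.d_minus) (simp add: X.M.minus_eq)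
  then have "dif (tensor_cplx g X) ?j (red g X ?j ?x) = \<zero>\<^bsub>trm (tensor_cplx g X) ?k\<^esub>"
    unfolding X.tensor_d[OF x] using X.red_zero_iff[of "dif X ?j ?x" ?k] x z(1) by auto
  moreover have "u = dif (tensor_cplx g Y) i (red g Y i ?e) \<oplus>\<^bsub>trm (tensor_cplx g Y) ?j\<^esub> T\<phi> ?j (red g X ?j ?x)"
  proof -
    have cl: "\<phi> ?j w \<in> carrier (trm Y ?j)" "\<phi> ?j t \<in> carrier (trm Y ?j)" "dif Y i e \<in> carrier (trm Y ?j)"
      using w t by auto
    have "x' = \<phi> ?j w \<ominus>\<^bsub>trm Y ?j\<^esub> ?s \<oplus>\<^bsub>trm Y ?j\<^esub> g \<odot>\<^bsub>trm Y ?j\<^esub> c"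
      using cl x'(1) z(3) X.g_closed by algebra
    also have "\<dots> = g \<odot>\<^bsub>trm Y ?j\<^esub> c \<oplus>\<^bsub>trm Y ?j\<^esub> (\<ominus>\<^bsub>trm Y ?j\<^esub> dif Y i e \<oplus>\<^bsub>trm Y ?j\<^esub> (\<phi> ?j w \<ominus>\<^bsub>trm Y ?j\<^esub> \<phi> ?j t))"
      unfolding t(4) using cl z(3) X.g_closed by algebra
    also have "\<dots> = g \<odot>\<^bsub>trm Y ?j\<^esub> c \<oplus>\<^bsub>trm Y ?j\<^esub> (dif Y i ?e \<oplus>\<^bsub>trm Y ?j\<^esub> \<phi> ?j ?x)"
      using w t by (simp add: Y.d_neg minus)
    finally have "red g Y ?j x' = red g Y ?j (dif Y i ?e \<oplus>\<^bsub>trm Y ?j\<^esub> \<phi> ?j ?x)"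
      using Y.red_eq_iff[of x' ?j "dif Y i ?e \<oplus>\<^bsub>trm Y ?j\<^esub> \<phi> ?j ?x"] x' z e x by auto
    then show ?thesis
      unfolding x'(2) Y.tensor_d[OF e] tensor_map[OF x]
      using Y.tensor_simps(2)[of "dif Y i ?e" ?j "\<phi> ?j ?x"] e x by simp
  qed
  ultimately show ?case
    using x e by (auto simp: X.tensor_simps(1) Y.tensor_simps(1))
qed

end

lemma reduced_mapI: "is_chmap A (X, \<phi>, Y) \<Longrightarrow> g \<in> carrier A \<Longrightarrow> reduced_map A X Y \<phi> g"
  by (simp add: reduced_map_def chain_mapI reduction_def reduction_axioms_def complex_def is_chmap_def)

lemma reductionI: "is_cplx A X \<Longrightarrow> g \<in> carrier A \<Longrightarrow> reduction A X g"
  by (simp add: reduction_def reduction_axioms_def complex_def)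

lemma far_tensor: "far (tensor_functor g) (X, \<phi>, Y) = (tensor_cplx g X,
    \<lambda>i. \<lambda>x \<in> carrier (trm (tensor_cplx g X) i). red g Y i (\<phi> i x), tensor_cplx g Y)"
  and fob_tensor [simp]: "fob (tensor_functor g) X = tensor_cplx g X"
  by (simp_all add: tensor_functor_def)

lemma functor_tensor:
  assumes g: "g \<in> carrier A"
  shows "is_functor (Ch A) (Ch A) (tensor_functor g)"
proof (rule Ch_functorI, goal_cases)
  case (1 X)
  then show ?case using reduction.cplx_tensor[OF reductionI[OF 1 g]] by simp
next
  case (2 X)
  interpret reduction A X g by (rule reductionI[OF 2 g])
  have "red g X i (restrict (\<lambda>x. x) (carrier (trm X i)) u) = u" if u: "u \<in> red g X i ` carrier (trm X i)" for u i
  proof -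
    obtain x where x: "x \<in> carrier (trm X i)" "u = red g X i x" using u by auto
    then show ?thesis using q.qrep_closed[OF x(1)] q.qrep_qrep[OF x(1)] by simp
  qed
  then show ?case
    unfolding far_tensor fob_tensor Ch_simps by (intro chmap_eqI) (auto simp: tensor_simps)
next
  case (3 X \<phi> Y)
  interpret reduced_map A X Y \<phi> g by (rule reduced_mapI[OF 3 g])
  show ?case unfolding far_tensor fob_tensor by (rule Ch_HomI[OF chmap_tensor])
next
  case (4 X \<phi> Y \<psi> Z)
  interpret f: reduced_map A X Y \<phi> g by (rule reduced_mapI[OF 4(1) g])
  interpret h: reduced_map A Y Z \<psi> g by (rule reduced_mapI[OF 4(2) g])
  interpret fh: reduced_map A X Z "\<lambda>i. compose (carrier (trm X i)) (\<psi> i) (\<phi> i)" g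
    by (rule reduced_mapI[OF chmap_comp[OF 4] g])
  show ?case
    unfolding far_tensor Ch_simps
  proof (rule chmap_eqI)
    fix i u assume u: "u \<in> carrier (trm (tensor_cplx g X) i)"
    then obtain x where x: "x \<in> carrier (trm X i)" "u = red g X i x" by (auto simp: f.X.tensor_simps)
    show "fh.T\<phi> i u = compose (carrier (trm (tensor_cplx g X) i)) (h.T\<phi> i) (f.T\<phi> i) u"
      unfolding compose_eq[OF u] unfolding x(2) fh.tensor_map[OF x(1)] f.tensor_map[OF x(1)]
        h.tensor_map[OF f.closed[OF x(1)]] by (simp add: compose_eq x(1))
  qed simp_all
qed

lemma tensor_proj_nat:
  assumes "m \<in> Hom (Ch A) X Y" and g: "g \<in> carrier A"
  shows "Cmp (Ch A) (tensor_proj g Y) m = Cmp (Ch A) (far (tensor_functor g) m) (tensor_proj g X)"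
proof -
  obtain \<phi> where m: "m = (X, \<phi>, Y)" "is_chmap A (X, \<phi>, Y)" using assms(1) by (auto simp: Ch_Hom)
  interpret reduced_map A X Y \<phi> g by (rule reduced_mapI[OF m(2) g])
  show ?thesis
    unfolding m tensor_proj_def far_tensor Ch_simps
    by (rule chmap_eqI) (simp_all add: compose_def X.tensor_simps(1) \<phi>q.h_qrep)
qed

section \<open>The functor \<open>\<eta>\<^sub>f\<close> on complexes with \<open>f\<close>-torsionfree terms\<close>

text \<open>
  For an \<open>f\<close>-torsionfree \<open>M\<close>, multiplication by \<open>f\<^sup>i\<close> is a bijection from \<open>M\<close> to \<open>f\<^sup>iM \<subseteq> M[1/f]\<close>.
  Writing elements of \<open>f\<^sup>iM\<close> as values of this bijection removes all fractions from what follows: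
  in degree \<open>i\<close>, \<open>\<eta>\<^sub>f(X)\<close> becomes the set of those \<open>x \<in> X\<^sup>i\<close> with \<open>dx \<in> fX\<^sup>i\<^sup>+\<^sup>1\<close>, with the differential
  \<open>dx/f\<close>.
\<close>

definition fscale ::
  "('a, 'r) ring_scheme \<Rightarrow> 'a \<Rightarrow> ('a, 'b) umod \<Rightarrow> int \<Rightarrow> ('a, 'b) univ \<Rightarrow> ('a, 'b) univ" where
  "fscale A f M i x = mfrac A f M ((f [^]\<^bsub>A\<^esub> nat i) \<odot>\<^bsub>M\<^esub> x) (nat (- i))"

lemma (in module) smult_comm:
  "a \<in> carrier R \<Longrightarrow> b \<in> carrier R \<Longrightarrow> x \<in> carrier M \<Longrightarrow>
    a \<odot>\<^bsub>M\<^esub> (b \<odot>\<^bsub>M\<^esub> x) = b \<odot>\<^bsub>M\<^esub> (a \<odot>\<^bsub>M\<^esub> x)"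
  using smult_assoc1[of a b x] smult_assoc1[of b a x] R.m_comm[of a b] by simp

locale torsionfree_module = module A M for A :: "('a, 'r) ring_scheme" and M :: "('a, 'b) umod" +
  fixes f
  assumes f_closed [simp]: "f \<in> carrier A" and tf: "torsionfree f M"
begin

abbreviation pow :: "nat \<Rightarrow> ('a, 'b) univ \<Rightarrow> ('a, 'b) univ" where
  "pow n x \<equiv> (f [^]\<^bsub>A\<^esub> n) \<odot>\<^bsub>M\<^esub> x"

lemma pow_closed [simp]: "x \<in> carrier M \<Longrightarrow> pow n x \<in> carrier M"
  by simp

lemma pow_add: "x \<in> carrier M \<Longrightarrow> pow (m + n) x = pow m (pow n x)"
  by (simp add: R.nat_pow_mult[symmetric] smult_assoc1)

lemma pow_comm: "x \<in> carrier M \<Longrightarrow> pow m (pow n x) = pow n (pow m x)"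
  using pow_add[of x m n] pow_add[of x n m] by (simp add: add.commute)

lemma pow_smult: "x \<in> carrier M \<Longrightarrow> a \<in> carrier A \<Longrightarrow> pow n (a \<odot>\<^bsub>M\<^esub> x) = a \<odot>\<^bsub>M\<^esub> pow n x"
  by (simp add: smult_comm)

lemma pow_cancel: "x \<in> carrier M \<Longrightarrow> y \<in> carrier M \<Longrightarrow> pow n x = pow n y \<longleftrightarrow> x = y"
  by (rule iffI, rule torsionfree_cancel[OF module_axioms torsionfree_pow[OF module_axioms tf f_closed]]) simp_all

lemma mfrac_alt:
  assumes "x \<in> carrier M"
  shows "mfrac A f M x n = (SOME u. \<exists>y m. u = Frac y m \<and> y \<in> carrier M \<and> pow n y = pow m x)"
proof -
  have "(\<exists>k. pow (k + n) y = pow (k + m) x) \<longleftrightarrow> pow n y = pow m x" if "y \<in> carrier M" for y m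
    using that assms by (simp add: pow_add pow_cancel)
  then show ?thesis unfolding mfrac_def by (simp cong: conj_cong)
qed

lemma mfrac_Frac:
  assumes "x \<in> carrier M"
  obtains y m where "mfrac A f M x n = Frac y m" "y \<in> carrier M" "pow n y = pow m x"
proof -
  have "\<exists>y m. mfrac A f M x n = Frac y m \<and> y \<in> carrier M \<and> pow n y = pow m x"
    unfolding mfrac_alt[OF assms] by (rule someI[of _ "Frac x n"]) (use assms in blast)
  then show ?thesis using that by blast
qed

lemma num_den:
  assumes "x \<in> carrier M"
  shows "num (mfrac A f M x n) \<in> carrier M"
    "pow n (num (mfrac A f M x n)) = pow (den (mfrac A f M x n)) x"
  using mfrac_Frac[OF assms, of n] by (metis univ.sel)+

lemma mfrac_eq_iff:
  assumes x: "x \<in> carrier M" and y: "y \<in> carrier M"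
  shows "mfrac A f M x n = mfrac A f M y m \<longleftrightarrow> pow m x = pow n y"
proof
  assume eq: "mfrac A f M x n = mfrac A f M y m"
  define z l where "z = num (mfrac A f M x n)" and "l = den (mfrac A f M x n)"
  have z: "z \<in> carrier M" "pow n z = pow l x" "pow m z = pow l y"
    using num_den[OF x, of n] num_den[OF y, of m] by (auto simp: z_def l_def eq)
  have "pow l (pow m x) = pow m (pow n z)" unfolding z(2) by (rule pow_comm[OF x])
  also have "\<dots> = pow n (pow l y)" unfolding pow_comm[OF z(1), of m n] z(3) ..
  also have "\<dots> = pow l (pow n y)" by (rule pow_comm[OF y])
  finally show "pow m x = pow n y" using x y by (simp add: pow_cancel)
next
  assume eq: "pow m x = pow n y"
  have "pow n z = pow l x \<longleftrightarrow> pow m z = pow l y" if z: "z \<in> carrier M" for z l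
  proof -
    have "pow n z = pow l x \<longleftrightarrow> pow m (pow n z) = pow m (pow l x)" using z x by (simp add: pow_cancel)
    also have "pow m (pow l x) = pow n (pow l y)"
      unfolding pow_comm[OF x, of m l] pow_comm[OF y, of n l] eq ..
    also have "pow m (pow n z) = pow n (pow m z)" by (rule pow_comm[OF z])
    finally show ?thesis using z y by (simp add: pow_cancel)
  qed
  then show "mfrac A f M x n = mfrac A f M y m"
    unfolding mfrac_alt[OF x] mfrac_alt[OF y] by (simp cong: conj_cong)
qed

lemma loc_mod_simps:
  assumes x: "x \<in> carrier M" and y: "y \<in> carrier M"
  shows "mfrac A f M x n \<oplus>\<^bsub>loc_mod A f M\<^esub> mfrac A f M y n = mfrac A f M (x \<oplus>\<^bsub>M\<^esub> y) n"
    "a \<in> carrier A \<Longrightarrow> a \<odot>\<^bsub>loc_mod A f M\<^esub> mfrac A f M x n = mfrac A f M (a \<odot>\<^bsub>M\<^esub> x) n"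
proof -
  define z k w l where "z = num (mfrac A f M x n)" and "k = den (mfrac A f M x n)"
    and "w = num (mfrac A f M y n)" and "l = den (mfrac A f M y n)"
  note zw = z_def[symmetric] k_def[symmetric] w_def[symmetric] l_def[symmetric]
  have z: "z \<in> carrier M" "pow n z = pow k x" and w: "w \<in> carrier M" "pow n w = pow l y"
    using num_den[OF x, of n] num_den[OF y, of n] by (auto simp: zw)
  have "pow n (pow l z \<oplus>\<^bsub>M\<^esub> pow k w) = pow l (pow n z) \<oplus>\<^bsub>M\<^esub> pow k (pow n w)"
    using smult_r_distr[of "f [^]\<^bsub>A\<^esub> n" "pow l z" "pow k w"] z(1) w(1)
    by (simp only: pow_closed pow_comm[of z n l] pow_comm[of w n k]) simp
  also have "\<dots> = pow (k + l) (x \<oplus>\<^bsub>M\<^esub> y)"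
    unfolding z(2) w(2) pow_comm[OF x, of l k] using x y by (simp add: smult_r_distr pow_add)
  finally show "mfrac A f M x n \<oplus>\<^bsub>loc_mod A f M\<^esub> mfrac A f M y n = mfrac A f M (x \<oplus>\<^bsub>M\<^esub> y) n"
    using z(1) w(1) x y by (simp add: loc_mod_def zw mfrac_eq_iff)
  show "a \<odot>\<^bsub>loc_mod A f M\<^esub> mfrac A f M x n = mfrac A f M (a \<odot>\<^bsub>M\<^esub> x) n" if a: "a \<in> carrier A"
    using z x a by (simp add: loc_mod_def zw mfrac_eq_iff pow_smult)
qed

abbreviation "s \<equiv> fscale A f M"

lemma fscale_eq_iff: "x \<in> carrier M \<Longrightarrow> y \<in> carrier M \<Longrightarrow> s i x = s i y \<longleftrightarrow> x = y"
  by (simp add: fscale_def mfrac_eq_iff pow_cancel)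

lemma fscale_Suc:
  assumes x: "x \<in> carrier M"
  shows "s (i + 1) x = s i (f \<odot>\<^bsub>M\<^esub> x)"
proof (cases "i \<ge> 0")
  case True
  then obtain n where "i = int n" by (rule nonneg_int_cases)
  moreover have "nat (int n + 1) = Suc n" by simp
  ultimately show ?thesis using x by (simp add: fscale_def smult_assoc1)
next
  case False
  define n where "n = nat (- (i + 1))"
  have e: "nat (- i) = Suc n" "nat (- (i + 1)) = n" "nat (i + 1) = 0" "nat i = 0"
    using False by (auto simp: n_def)
  show ?thesis using x unfolding fscale_def e by (simp add: mfrac_eq_iff smult_assoc1)
qed

lemma fscale_zero: "s i \<zero>\<^bsub>M\<^esub> = \<zero>\<^bsub>loc_mod A f M\<^esub>"
  by (simp add: fscale_def loc_mod_def mfrac_eq_iff)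

lemma fscale_add: "x \<in> carrier M \<Longrightarrow> y \<in> carrier M \<Longrightarrow>
    s i x \<oplus>\<^bsub>loc_mod A f M\<^esub> s i y = s i (x \<oplus>\<^bsub>M\<^esub> y)"
  by (simp add: fscale_def loc_mod_simps smult_r_distr)

lemma fscale_smult: "a \<in> carrier A \<Longrightarrow> x \<in> carrier M \<Longrightarrow>
    a \<odot>\<^bsub>loc_mod A f M\<^esub> s i x = s i (a \<odot>\<^bsub>M\<^esub> x)"
  by (simp add: fscale_def loc_mod_simps pow_smult)

lemma fscale_num_den:
  assumes "x \<in> carrier M"
  shows "num (s i x) \<in> carrier M" "pow (nat (- i)) (num (s i x)) = pow (den (s i x)) (pow (nat i) x)"
  unfolding fscale_def using num_den[of "pow (nat i) x"] assms by auto

lemma fpow_mod_fscale: "fpow_mod A f i M = s i ` carrier M"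
  by (auto simp: fpow_mod_def fscale_def)

end

lemma loc_map_fscale:
  assumes M: "torsionfree_module A M f" and N: "torsionfree_module A N f" and h: "h \<in> lin_maps A M N"
    and x: "x \<in> carrier M"
  shows "loc_map A f N h (fscale A f M i x) = fscale A f N i (h x)"
proof -
  interpret M: torsionfree_module A M f by fact
  interpret N: torsionfree_module A N f by fact
  note l = lin_closed[OF M.module_axioms N.module_axioms h] lin_smult[OF M.module_axioms N.module_axioms h]
  have p: "h (M.pow n y) = N.pow n (h y)" if "y \<in> carrier M" for n y using l that by simp
  note nd = M.fscale_num_den[OF x, of i]
  have "N.pow (nat (- i)) (h (num (M.s i x))) = N.pow (den (M.s i x)) (N.pow (nat i) (h x))"
    using arg_cong[OF nd(2), of h] nd(1) x by (simp only: p M.pow_closed)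
  then show ?thesis
    using l nd(1) x unfolding loc_map_def fscale_def[of A f N] by (subst N.mfrac_eq_iff) simp_all
qed

locale torsionfree_complex = complex A X for A :: "('a, 'r) ring_scheme" and X :: "('a, 'b) cplx" +
  fixes f
  assumes f_closed [simp]: "f \<in> carrier A" and tf: "\<And>i. torsionfree f (trm X i)"
begin

sublocale t: torsionfree_module A "trm X i" f for i
  by unfold_locales (rule f_closed tf)+

abbreviation "s j i \<equiv> fscale A f (trm X j) i"

text \<open>
  The elements of \<open>\<eta>\<^sub>f(X)\<^sup>i\<close> in these coordinates.
\<close>

definition E :: "int \<Rightarrow> ('a, 'b) univ set" where
  "E i = {x \<in> carrier (trm X i). \<exists>y \<in> carrier (trm X (i + 1)). d i x = f \<odot>\<^bsub>trm X (i + 1)\<^esub> y}"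

lemma E_closed: "x \<in> E i \<Longrightarrow> x \<in> carrier (trm X i)"
  by (simp add: E_def)

lemma E_cocycle: "x \<in> carrier (trm X i) \<Longrightarrow> d i x = \<zero>\<^bsub>trm X (i + 1)\<^esub> \<Longrightarrow> x \<in> E i"
  unfolding E_def by (auto intro!: bexI[of _ "\<zero>\<^bsub>trm X (i + 1)\<^esub>"])

lemma E_f: "x \<in> carrier (trm X i) \<Longrightarrow> f \<odot>\<^bsub>trm X i\<^esub> x \<in> E i"
  unfolding E_def by (auto simp: d_smult intro!: bexI[of _ "d i x"])

lemma div_cocycle:
  assumes "x \<in> carrier (trm X i)" "y \<in> carrier (trm X (i + 1))" "d i x = f \<odot>\<^bsub>trm X (i + 1)\<^esub> y"
  shows "d (i + 1) y = \<zero>\<^bsub>trm X (i + 1 + 1)\<^esub>"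
proof (rule torsionfree_cancel[OF module tf f_closed])
  show "f \<odot>\<^bsub>trm X (i + 1 + 1)\<^esub> d (i + 1) y = f \<odot>\<^bsub>trm X (i + 1 + 1)\<^esub> \<zero>\<^bsub>trm X (i + 1 + 1)\<^esub>"
    using d_smult[OF f_closed assms(2)] dd[OF assms(1) refl] assms(3) by simp
qed (use assms in simp_all)

lemma loc_map_d: "x \<in> carrier (trm X i) \<Longrightarrow>
    loc_map A f (trm X (i + 1)) (d i) (s i k x) = s (i + 1) k (d i x)"
  by (rule loc_map_fscale[OF t.torsionfree_module_axioms t.torsionfree_module_axioms d_lin])

lemma eta_carrier: "eta_carrier A f X i = s i i ` E i"
proof -
  have "s (i + 1) i (d i x) \<in> s (i + 1) (i + 1) ` carrier (trm X (i + 1)) \<longleftrightarrow> x \<in> E i"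
    if "x \<in> carrier (trm X i)" for x
    using that by (auto simp: E_def image_iff t.fscale_Suc t.fscale_eq_iff)
  then have "{x \<in> carrier (trm X i). loc_map A f (trm X (i + 1)) (d i) (s i i x)
      \<in> s (i + 1) (i + 1) ` carrier (trm X (i + 1))} =
      {x \<in> carrier (trm X i). x \<in> E i}"
    by (simp add: loc_map_d cong: conj_cong)
  moreover have "{x \<in> carrier (trm X i). x \<in> E i} = E i" using E_closed by auto
  moreover have "{u \<in> s i i ` carrier (trm X i). P u} = s i i ` {x \<in> carrier (trm X i). P (s i i x)}" for P
    by auto
  ultimately show ?thesis
    unfolding eta_carrier_def t.fpow_mod_fscale by simp
qed

lemma eta_simps:
  "carrier (trm (eta A f X) i) = s i i ` E i"
  "\<zero>\<^bsub>trm (eta A f X) i\<^esub> = s i k \<zero>\<^bsub>trm X i\<^esub>"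
  "x \<in> carrier (trm X i) \<Longrightarrow> y \<in> carrier (trm X i) \<Longrightarrow>
    s i k x \<oplus>\<^bsub>trm (eta A f X) i\<^esub> s i k y = s i k (x \<oplus>\<^bsub>trm X i\<^esub> y)"
  "a \<in> carrier A \<Longrightarrow> x \<in> carrier (trm X i) \<Longrightarrow>
    a \<odot>\<^bsub>trm (eta A f X) i\<^esub> s i k x = s i k (a \<odot>\<^bsub>trm X i\<^esub> x)"
  by (simp_all add: eta_def eta_carrier t.fscale_zero[symmetric] t.fscale_add[symmetric]
      t.fscale_smult[symmetric])

lemma eta_d: "x \<in> E i \<Longrightarrow> dif (eta A f X) i (s i i x) = s (i + 1) i (d i x)"
  using loc_map_d[OF E_closed] by (simp add: eta_def eta_carrier)

lemma eta_d_div: "x \<in> carrier (trm X i) \<Longrightarrow> y \<in> carrier (trm X (i + 1)) \<Longrightarrow>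
    d i x = f \<odot>\<^bsub>trm X (i + 1)\<^esub> y \<Longrightarrow> dif (eta A f X) i (s i i x) = s (i + 1) (i + 1) y"
  using eta_d[of x i] by (auto simp: E_def t.fscale_Suc)

lemma E_add: "x \<in> E i \<Longrightarrow> y \<in> E i \<Longrightarrow> x \<oplus>\<^bsub>trm X i\<^esub> y \<in> E i"
  unfolding E_def by (auto simp: d_add M.smult_r_distr[symmetric])

lemma E_smult: "a \<in> carrier A \<Longrightarrow> x \<in> E i \<Longrightarrow> a \<odot>\<^bsub>trm X i\<^esub> x \<in> E i"
  unfolding E_def by (auto simp: d_smult M.smult_comm[of a f])

lemma E_zero: "\<zero>\<^bsub>trm X i\<^esub> \<in> E i"
  by (rule E_cocycle) simp_all

lemma submodule_E: "submodule (E i) A (trm X i)"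
proof (rule M.submoduleI)
  show "\<ominus>\<^bsub>trm X i\<^esub> x \<in> E i" if "x \<in> E i" for x
    using E_smult[OF _ that, of "\<ominus>\<^bsub>A\<^esub> \<one>\<^bsub>A\<^esub>"] M.smult_l_minus[of "\<one>\<^bsub>A\<^esub>" x i] E_closed[OF that] by simp
qed (use E_closed E_add E_smult E_zero in auto)

lemma cplx_eta: "is_cplx A (eta A f X)"
proof (rule complexI)
  show "module A (trm (eta A f X) i)" for i
    by (rule module_image[OF submodule.submodule_is_module[OF submodule_E module], of _ "s i i"])
      (auto simp: eta_simps(1,3,4) eta_simps(2)[of i i] E_closed)
  fix i
  show "dif (eta A f X) i \<in> lin_maps A (trm (eta A f X) i) (trm (eta A f X) (i + 1))"
    unfolding lin_maps_def
  proof (intro CollectI conjI ballI PiE_I)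
    fix u assume "u \<in> carrier (trm (eta A f X) i)"
    then obtain x where x: "x \<in> E i" "u = s i i x" by (auto simp: eta_simps)
    then obtain y where y: "y \<in> carrier (trm X (i + 1))" "d i x = f \<odot>\<^bsub>trm X (i + 1)\<^esub> y" by (auto simp: E_def)
    show "dif (eta A f X) i u \<in> carrier (trm (eta A f X) (i + 1))"
      using eta_d_div[OF E_closed[OF x(1)] y] E_cocycle[OF y(1) div_cocycle[OF E_closed[OF x(1)] y]]
      by (simp add: x(2) eta_simps)
    fix v assume "v \<in> carrier (trm (eta A f X) i)"
    then obtain z where z: "z \<in> E i" "v = s i i z" by (auto simp: eta_simps)
    show "dif (eta A f X) i (u \<oplus>\<^bsub>trm (eta A f X) i\<^esub> v) =
        dif (eta A f X) i u \<oplus>\<^bsub>trm (eta A f X) (i + 1)\<^esub> dif (eta A f X) i v"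
      using x z E_closed by (simp add: eta_simps eta_d E_add d_add)
  next
    fix a u assume a: "a \<in> carrier A" and "u \<in> carrier (trm (eta A f X) i)"
    then obtain x where x: "x \<in> E i" "u = s i i x" by (auto simp: eta_simps)
    show "dif (eta A f X) i (a \<odot>\<^bsub>trm (eta A f X) i\<^esub> u) = a \<odot>\<^bsub>trm (eta A f X) (i + 1)\<^esub> dif (eta A f X) i u"
      using x a E_closed by (simp add: eta_simps eta_d E_smult d_smult)
  qed (simp add: eta_def eta_carrier eta_simps)
  fix u assume "u \<in> carrier (trm (eta A f X) i)"
  then obtain x where x: "x \<in> E i" "u = s i i x" by (auto simp: eta_simps)
  then obtain y where y: "y \<in> carrier (trm X (i + 1))" "d i x = f \<odot>\<^bsub>trm X (i + 1)\<^esub> y" by (auto simp: E_def)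
  note dy = div_cocycle[OF E_closed[OF x(1)] y]
  show "dif (eta A f X) (i + 1) (dif (eta A f X) i u) = \<zero>\<^bsub>trm (eta A f X) (i + 1 + 1)\<^esub>"
    unfolding x(2) eta_d_div[OF E_closed[OF x(1)] y] eta_d[OF E_cocycle[OF y(1) dy]] dy
    by (rule eta_simps(2)[symmetric])
qed

lemma torsionfree_eta:
  assumes "torsionfree g (trm X i)" "g \<in> carrier A"
  shows "torsionfree g (trm (eta A f X) i)"
  unfolding torsionfree_def
proof (intro ballI impI)
  fix u assume "u \<in> carrier (trm (eta A f X) i)" and 0: "g \<odot>\<^bsub>trm (eta A f X) i\<^esub> u = \<zero>\<^bsub>trm (eta A f X) i\<^esub>"
  then obtain x where x': "x \<in> E i" "u = s i i x" by (auto simp: eta_simps)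
  note x = E_closed[OF x'(1)] x'(2)
  have "s i i (g \<odot>\<^bsub>trm X i\<^esub> x) = s i i \<zero>\<^bsub>trm X i\<^esub>"
    using 0 x assms(2) by (simp add: eta_simps(4) eta_simps(2)[of i i])
  then have "g \<odot>\<^bsub>trm X i\<^esub> x = \<zero>\<^bsub>trm X i\<^esub>" using x(1) assms(2) by (simp add: t.fscale_eq_iff)
  then have "x = \<zero>\<^bsub>trm X i\<^esub>" using assms(1) x(1) unfolding torsionfree_def by blast
  then show "u = \<zero>\<^bsub>trm (eta A f X) i\<^esub>" unfolding x(2) eta_simps(2)[of i i] by simp
qed

end

lemma torsionfree_complexI: "is_cplx A X \<Longrightarrow> f \<in> carrier A \<Longrightarrow> (\<And>i. torsionfree f (trm X i)) \<Longrightarrow>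
    torsionfree_complex A X f"
  by (simp add: torsionfree_complex_def torsionfree_complex_axioms_def complex_def)

locale torsionfree_map = chain_map A X Y \<phi> + X: torsionfree_complex A X f + Y: torsionfree_complex A Y f
  for A :: "('a, 'r) ring_scheme" and X :: "('a, 'b) cplx" and Y \<phi> f
begin

abbreviation "\<eta>\<phi> \<equiv> \<lambda>i. \<lambda>u \<in> eta_carrier A f X i. loc_map A f (trm Y i) (\<phi> i) u"

lemma E_map: "x \<in> X.E i \<Longrightarrow> \<phi> i x \<in> Y.E i"
  unfolding X.E_def Y.E_def by (auto simp: d_comm[symmetric] smult)

lemma loc_map_\<phi>: "x \<in> carrier (trm X i) \<Longrightarrow> loc_map A f (trm Y i) (\<phi> i) (X.s i k x) = Y.s i k (\<phi> i x)"
  by (rule loc_map_fscale[OF X.t.torsionfree_module_axioms Y.t.torsionfree_module_axioms lin])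

lemma eta_map: "x \<in> X.E i \<Longrightarrow> \<eta>\<phi> i (X.s i i x) = Y.s i i (\<phi> i x)"
  by (simp add: X.eta_carrier loc_map_\<phi> X.E_closed)

lemma chmap_eta: "is_chmap A (eta A f X, \<eta>\<phi>, eta A f Y)"
proof (rule chmapI[OF X.cplx_eta Y.cplx_eta])
  fix i
  show "\<eta>\<phi> i \<in> lin_maps A (trm (eta A f X) i) (trm (eta A f Y) i)"
    unfolding lin_maps_def
  proof (intro CollectI conjI ballI PiE_I)
    fix u assume "u \<in> carrier (trm (eta A f X) i)"
    then obtain x where x: "x \<in> X.E i" "u = X.s i i x" by (auto simp: X.eta_simps)
    show "\<eta>\<phi> i u \<in> carrier (trm (eta A f Y) i)"
      unfolding x(2) eta_map[OF x(1)] by (simp add: Y.eta_simps E_map x)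
    fix v assume "v \<in> carrier (trm (eta A f X) i)"
    then obtain z where z: "z \<in> X.E i" "v = X.s i i z" by (auto simp: X.eta_simps)
    show "\<eta>\<phi> i (u \<oplus>\<^bsub>trm (eta A f X) i\<^esub> v) = \<eta>\<phi> i u \<oplus>\<^bsub>trm (eta A f Y) i\<^esub> \<eta>\<phi> i v"
      unfolding x(2) z(2) eta_map[OF x(1)] eta_map[OF z(1)] X.eta_simps(3)[OF X.E_closed[OF x(1)] X.E_closed[OF z(1)]]
        eta_map[OF X.E_add[OF x(1) z(1)]] using x(1) z(1) by (simp add: Y.eta_simps add X.E_closed)
  next
    fix a u assume a: "a \<in> carrier A" and "u \<in> carrier (trm (eta A f X) i)"
    then obtain x where x: "x \<in> X.E i" "u = X.s i i x" by (auto simp: X.eta_simps)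
    show "\<eta>\<phi> i (a \<odot>\<^bsub>trm (eta A f X) i\<^esub> u) = a \<odot>\<^bsub>trm (eta A f Y) i\<^esub> \<eta>\<phi> i u"
      unfolding x(2) eta_map[OF x(1)] X.eta_simps(4)[OF a X.E_closed[OF x(1)]]
        eta_map[OF X.E_smult[OF a x(1)]] using x(1) a by (simp add: Y.eta_simps smult X.E_closed)
  qed (simp add: X.eta_carrier X.eta_simps)
  fix u assume "u \<in> carrier (trm (eta A f X) i)"
  then obtain x where x: "x \<in> X.E i" "u = X.s i i x" by (auto simp: X.eta_simps)
  then obtain y where y: "y \<in> carrier (trm X (i + 1))" "dif X i x = f \<odot>\<^bsub>trm X (i + 1)\<^esub> y" by (auto simp: X.E_def)
  note xc = X.E_closed[OF x(1)]
  note Ey = X.E_cocycle[OF y(1) X.div_cocycle[OF xc y]]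
  have "dif Y i (\<phi> i x) = f \<odot>\<^bsub>trm Y (i + 1)\<^esub> \<phi> (i + 1) y"
    using d_comm[OF xc refl] y by (simp add: smult)
  then show "\<eta>\<phi> (i + 1) (dif (eta A f X) i u) = dif (eta A f Y) i (\<eta>\<phi> i u)"
    unfolding x(2) X.eta_d_div[OF xc y] eta_map[OF x(1)] eta_map[OF Ey]
    using Y.eta_d_div[OF closed[OF xc] closed[OF y(1)]] by simp
qed

sublocale \<eta>: chain_map A "eta A f X" "eta A f Y" \<eta>\<phi>
  by (rule chain_mapI[OF chmap_eta])

text \<open>
  A cocycle of \<open>\<eta>\<^sub>f(X)\<close> is a cocycle \<open>x\<close> of \<open>X\<close>, and it is a coboundary iff \<open>fx\<close> is one in \<open>X\<close>. So the
  cohomology of \<open>\<eta>\<^sub>f(X)\<close> is \<open>H\<^sup>i(X)/H\<^sup>i(X)[f]\<close>, and \<open>\<eta>\<^sub>f\<close> preserves quasi-isomorphisms.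
\<close>

lemma qis_eta:
  assumes q: "(X, \<phi>, Y) \<in> qis A"
  shows "(eta A f X, \<eta>\<phi>, eta A f Y) \<in> qis A"
proof (rule \<eta>.qisI, goal_cases)
  case (1 i u w)
  let ?j = "i + 1"
  obtain x where x: "x \<in> X.E ?j" "u = X.s ?j ?j x" using 1(1) by (auto simp: X.eta_simps)
  note xc = X.E_closed[OF x(1)]
  obtain w' where w': "w' \<in> Y.E i" "w = Y.s i i w'" using 1(3) by (auto simp: Y.eta_simps)
  obtain y where y: "y \<in> carrier (trm Y ?j)" "dif Y i w' = f \<odot>\<^bsub>trm Y ?j\<^esub> y" using w' by (auto simp: Y.E_def)
  have "X.s (?j + 1) ?j (dif X ?j x) = X.s (?j + 1) ?j \<zero>\<^bsub>trm X (?j + 1)\<^esub>"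
    using 1(2) X.eta_d[OF x(1)] X.eta_simps(2)[of "?j + 1" ?j] unfolding x(2) by simp
  then have dx: "dif X ?j x = \<zero>\<^bsub>trm X (?j + 1)\<^esub>"
    using X.t.fscale_eq_iff[of "dif X ?j x" "?j + 1" "\<zero>\<^bsub>trm X (?j + 1)\<^esub>" ?j] xc by simp
  have "Y.s ?j ?j (\<phi> ?j x) = Y.s ?j ?j y"
    using 1(4) unfolding x(2) w'(2) eta_map[OF x(1)] Y.eta_d_div[OF Y.E_closed[OF w'(1)] y] .
  then have "\<phi> ?j x = y" using Y.t.fscale_eq_iff xc y(1) by simp
  then have "\<phi> ?j (f \<odot>\<^bsub>trm X ?j\<^esub> x) = dif Y i w'" using smult[OF X.f_closed xc] y(2) by simp
  moreover have "dif X ?j (f \<odot>\<^bsub>trm X ?j\<^esub> x) = \<zero>\<^bsub>trm X (?j + 1)\<^esub>"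
    using X.d_smult[OF X.f_closed xc] dx by simp
  ultimately obtain e where e: "e \<in> carrier (trm X i)" "f \<odot>\<^bsub>trm X ?j\<^esub> x = dif X i e"
    using qis_inj[OF q, of "f \<odot>\<^bsub>trm X ?j\<^esub> x" i w'] xc Y.E_closed[OF w'(1)] by auto
  have "e \<in> X.E i" using e(1) xc unfolding X.E_def e(2)[symmetric] mem_Collect_eq
    by (intro conjI bexI[of _ x]) (simp_all add: e(2))
  then show ?case
    using X.eta_d_div[OF e(1) xc e(2)[symmetric]] x(2)
    by (intro bexI[of _ "X.s i i e"]) (simp_all add: X.eta_simps(1))
next
  case (2 i u)
  let ?j = "i + 1"
  obtain w where w: "w \<in> Y.E ?j" "u = Y.s ?j ?j w" using 2(1) by (auto simp: Y.eta_simps)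
  note wc = Y.E_closed[OF w(1)]
  have "Y.s (?j + 1) ?j (dif Y ?j w) = Y.s (?j + 1) ?j \<zero>\<^bsub>trm Y (?j + 1)\<^esub>"
    using 2(2) Y.eta_d[OF w(1)] Y.eta_simps(2)[of "?j + 1" ?j] unfolding w(2) by simp
  then have dw: "dif Y ?j w = \<zero>\<^bsub>trm Y (?j + 1)\<^esub>"
    using Y.t.fscale_eq_iff[of "dif Y ?j w" "?j + 1" "\<zero>\<^bsub>trm Y (?j + 1)\<^esub>" ?j] wc by simp
  obtain z c where z: "z \<in> carrier (trm X ?j)" "dif X ?j z = \<zero>\<^bsub>trm X (?j + 1)\<^esub>"
    "c \<in> carrier (trm Y i)" "w = dif Y i c \<oplus>\<^bsub>trm Y ?j\<^esub> \<phi> ?j z"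
    using qis_surj[OF q wc dw] .
  note Ez = X.E_cocycle[OF z(1,2)]
  let ?c = "f \<odot>\<^bsub>trm Y i\<^esub> c"
  have "dif (eta A f X) ?j (X.s ?j ?j z) = \<zero>\<^bsub>trm (eta A f X) (?j + 1)\<^esub>"
    using X.eta_d[OF Ez] z(2) X.eta_simps(2)[of "?j + 1" ?j] by simp
  moreover have "u = dif (eta A f Y) i (Y.s i i ?c) \<oplus>\<^bsub>trm (eta A f Y) ?j\<^esub> \<eta>\<phi> ?j (X.s ?j ?j z)"
  proof -
    have "dif (eta A f Y) i (Y.s i i ?c) = Y.s ?j ?j (dif Y i c)"
      using z(3) by (intro Y.eta_d_div) (simp_all add: Y.d_smult)
    then show ?thesis
      unfolding eta_map[OF Ez] w(2) z(4) using z(1,3) by (simp add: Y.eta_simps(3))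
  qed
  moreover have "X.s ?j ?j z \<in> carrier (trm (eta A f X) ?j)" "Y.s i i ?c \<in> carrier (trm (eta A f Y) i)"
    using Ez Y.E_f[OF z(3)] by (simp_all add: X.eta_simps(1) Y.eta_simps(1))
  ultimately show ?case by blast
qed

end

lemma torsionfree_mapI: "is_chmap A (X, \<phi>, Y) \<Longrightarrow> f \<in> carrier A \<Longrightarrow> (\<And>i. torsionfree f (trm X i)) \<Longrightarrow>
    (\<And>i. torsionfree f (trm Y i)) \<Longrightarrow> torsionfree_map A X Y \<phi> f"
  by (simp add: torsionfree_map_def chain_mapI torsionfree_complexI is_chmap_def)

lemma far_eta: "far (eta_functor A f) (X, \<phi>, Y) = (eta A f X,
    \<lambda>i. \<lambda>u \<in> eta_carrier A f X i. loc_map A f (trm Y i) (\<phi> i) u, eta A f Y)"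
  and fob_eta [simp]: "fob (eta_functor A f) X = eta A f X"
  by (simp_all add: eta_functor_def)

lemma ChTf_simps [simp]:
  "X \<in> Obj (ChTf A f) \<longleftrightarrow> is_cplx A X \<and> (\<forall>i. torsionfree f (trm X i))"
  "(X, \<phi>, Y) \<in> Arr (ChTf A f) \<longleftrightarrow> is_chmap A (X, \<phi>, Y) \<and>
    (\<forall>i. torsionfree f (trm X i)) \<and> (\<forall>i. torsionfree f (trm Y i))"
  "Dom (ChTf A f) = Dom (Ch A)" "Cod (ChTf A f) = Cod (Ch A)" "Idn (ChTf A f) = Idn (Ch A)"
  "Cmp (ChTf A f) = Cmp (Ch A)"
  by (simp_all add: ChTf_def)

lemma functor_eta:
  assumes f: "f \<in> carrier A"
  shows "is_functor (ChTf A f) (Ch A) (eta_functor A f)"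
  unfolding is_functor_def
proof (intro conjI ballI impI, goal_cases)
  case (1 X)
  then interpret torsionfree_complex A X f by (intro torsionfree_complexI f) auto
  show ?case by (simp add: cplx_eta)
next
  case (2 X)
  then interpret torsionfree_complex A X f by (intro torsionfree_complexI f) auto
  have *: "(\<lambda>x \<in> carrier (trm X i). x) \<in> lin_maps A (trm X i) (trm X i)" for i
    by (auto simp: lin_maps_def)
  have "loc_map A f (trm X i) (\<lambda>x \<in> carrier (trm X i). x) (s i i x) = s i i x" if "x \<in> E i" for i x
    using loc_map_fscale[OF t.torsionfree_module_axioms t.torsionfree_module_axioms * E_closed[OF that], of i]
      E_closed[OF that] by simp
  then show ?case
    unfolding ChTf_simps Ch_simps far_eta fob_eta by (intro chmap_eqI) (auto simp: eta_carrier eta_simps)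
next
  case (3 m)
  obtain X \<phi> Y where m: "m = (X, \<phi>, Y)" by (cases m)
  interpret torsionfree_map A X Y \<phi> f using 3 by (intro torsionfree_mapI f) (auto simp: m)
  show ?case unfolding m far_eta fob_eta ChTf_simps Ch_simps by (rule Ch_HomI[OF chmap_eta])
next
  case (4 m n)
  obtain X \<phi> Y where m: "m = (X, \<phi>, Y)" by (cases m)
  obtain Y' \<psi> Z where n: "n = (Y', \<psi>, Z)" by (cases n)
  have Y': "Y' = Y" using 4(3) by (simp add: m n)
  interpret p: torsionfree_map A X Y \<phi> f using 4 by (intro torsionfree_mapI f) (auto simp: m)
  interpret q: torsionfree_map A Y Z \<psi> f using 4 by (intro torsionfree_mapI f) (auto simp: n Y')
  interpret pq: torsionfree_map A X Z "\<lambda>i. compose (carrier (trm X i)) (\<psi> i) (\<phi> i)" f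
    by (intro torsionfree_mapI f chmap_comp[OF p.chmap q.chmap] p.X.tf q.Y.tf)
  show ?case
    unfolding m n Y' far_eta ChTf_simps Ch_simps
  proof (rule chmap_eqI)
    fix i u assume u: "u \<in> carrier (trm (eta A f X) i)"
    then obtain x where x: "x \<in> p.X.E i" "u = p.X.s i i x" by (auto simp: p.X.eta_simps)
    show "pq.\<eta>\<phi> i u = compose (carrier (trm (eta A f X) i)) (q.\<eta>\<phi> i) (p.\<eta>\<phi> i) u"
      unfolding compose_eq[OF u] unfolding x(2) pq.eta_map[OF x(1)] p.eta_map[OF x(1)]
        q.eta_map[OF p.E_map[OF x(1)]] by (simp add: compose_eq p.X.E_closed[OF x(1)])
  qed (simp_all add: p.X.eta_carrier p.X.eta_simps)
qed

section \<open>A functorial resolution by torsionfree modules\<close>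

text \<open>
  The free module on a set \<open>S\<close> consists of formal linear combinations, given as lists of pairs of a
  coefficient and an element of \<open>S\<close>. Two lists are identified when every function from the basis to the
  scalars, extended linearly, takes the same value on both; this makes the module laws and
  functoriality immediate.
\<close>

fun lcomb :: "('a, 'r) ring_scheme \<Rightarrow> ('u \<Rightarrow> 'a) \<Rightarrow> ('a \<times> 'u) list \<Rightarrow> 'a" where
  "lcomb A h [] = \<zero>\<^bsub>A\<^esub>"
| "lcomb A h ((a, x) # l) = a \<otimes>\<^bsub>A\<^esub> h x \<oplus>\<^bsub>A\<^esub> lcomb A h l"

fun lsum :: "('a, 'u) module \<Rightarrow> ('a \<times> 'u) list \<Rightarrow> 'u" where
  "lsum M [] = \<zero>\<^bsub>M\<^esub>"
| "lsum M ((a, x) # l) = a \<odot>\<^bsub>M\<^esub> x \<oplus>\<^bsub>M\<^esub> lsum M l"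

definition combs :: "('a, 'r) ring_scheme \<Rightarrow> 'u set \<Rightarrow> ('a \<times> 'u) list set" where
  "combs A S = lists (carrier A \<times> S)"

definition comb_eq :: "('a, 'r) ring_scheme \<Rightarrow> ('a \<times> 'u) list \<Rightarrow> ('a \<times> 'u) list \<Rightarrow> bool" where
  "comb_eq A l l' \<longleftrightarrow> (\<forall>h. (\<forall>x. h x \<in> carrier A) \<longrightarrow> lcomb A h l = lcomb A h l')"

definition scale_comb :: "('a, 'r) ring_scheme \<Rightarrow> 'a \<Rightarrow> ('a \<times> 'u) list \<Rightarrow> ('a \<times> 'u) list" where
  "scale_comb A a = map (\<lambda>(b, x). (a \<otimes>\<^bsub>A\<^esub> b, x))"

definition map_comb :: "('u \<Rightarrow> 'v) \<Rightarrow> ('a \<times> 'u) list \<Rightarrow> ('a \<times> 'v) list" where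
  "map_comb h = map (\<lambda>(b, x). (b, h x))"

fun scalar :: "('a, 'b) univ \<Rightarrow> 'a" where
  "scalar (Scalar a) = a"
| "scalar _ = undefined"

fun untuple :: "('a, 'b) univ \<Rightarrow> ('a, 'b) univ list" where
  "untuple (Tuple us) = us"
| "untuple _ = []"

definition encode :: "('a \<times> ('a, 'b) univ) list \<Rightarrow> ('a, 'b) univ" where
  "encode l = Tuple (map (\<lambda>(a, x). Duo (Scalar a) x) l)"

definition decode :: "('a, 'b) univ \<Rightarrow> ('a \<times> ('a, 'b) univ) list" where
  "decode u = map (\<lambda>v. (scalar (lft v), rgt v)) (untuple u)"

definition comb_class ::
  "('a, 'r) ring_scheme \<Rightarrow> ('a, 'b) univ set \<Rightarrow> ('a \<times> ('a, 'b) univ) list \<Rightarrow> ('a, 'b) univ" where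
  "comb_class A S l = encode (SOME l'. l' \<in> combs A S \<and> comb_eq A l' l)"

definition free_mod :: "('a, 'r) ring_scheme \<Rightarrow> ('a, 'b) univ set \<Rightarrow> ('a, 'b) umod" where
  "free_mod A S = \<lparr>
     carrier = comb_class A S ` combs A S,
     mult = undefined, one = undefined,
     zero = comb_class A S [],
     add = (\<lambda>u v. comb_class A S (decode u @ decode v)),
     smult = (\<lambda>a u. comb_class A S (scale_comb A a (decode u)))\<rparr>"

definition free_map :: "('a, 'r) ring_scheme \<Rightarrow> ('a, 'b) univ set \<Rightarrow>
    (('a, 'b) univ \<Rightarrow> ('a, 'b) univ) \<Rightarrow> ('a, 'b) univ \<Rightarrow> ('a, 'b) univ" where
  "free_map A S h u = comb_class A S (map_comb h (decode u))"

definition free_proj :: "('a, 'b) umod \<Rightarrow> ('a, 'b) univ \<Rightarrow> ('a, 'b) univ" where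
  "free_proj M u = lsum M (decode u)"

lemma decode_encode: "decode (encode l) = l"
  by (induction l) (auto simp: decode_def encode_def)

lemma combs_simps [simp]:
  "[] \<in> combs A S" "(a, x) # l \<in> combs A S \<longleftrightarrow> a \<in> carrier A \<and> x \<in> S \<and> l \<in> combs A S"
  "l @ l' \<in> combs A S \<longleftrightarrow> l \<in> combs A S \<and> l' \<in> combs A S"
  by (auto simp: combs_def)

lemma map_comb_simps [simp]:
  "map_comb h [] = []" "map_comb h ((a, x) # l) = (a, h x) # map_comb h l"
  "map_comb h (l @ l') = map_comb h l @ map_comb h l'"
  "map_comb k (map_comb h l) = map_comb (\<lambda>x. k (h x)) l"
  by (auto simp: map_comb_def)

lemma scale_comb_simps [simp]:
  "scale_comb A a [] = []" "scale_comb A a ((b, x) # l) = (a \<otimes>\<^bsub>A\<^esub> b, x) # scale_comb A a l"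
  "map_comb h (scale_comb A a l) = scale_comb A a (map_comb h l)"
  by (auto simp: scale_comb_def map_comb_def)

lemma combs_map: "l \<in> combs A S \<Longrightarrow> (\<And>x. x \<in> S \<Longrightarrow> h x \<in> S') \<Longrightarrow> map_comb h l \<in> combs A S'"
  by (induction l) auto

lemma comb_eq_refl: "comb_eq A l l"
  by (simp add: comb_eq_def)

lemma lcomb_map: "lcomb A h (map_comb k l) = lcomb A (\<lambda>x. h (k x)) l"
  by (induction l) auto

lemma comb_eq_map: "comb_eq A l l' \<Longrightarrow> comb_eq A (map_comb h l) (map_comb h l')"
  by (simp add: comb_eq_def lcomb_map)

context cring
begin

lemma lcomb_closed [simp]: "l \<in> combs R S \<Longrightarrow> (\<And>x. h x \<in> carrier R) \<Longrightarrow> lcomb R h l \<in> carrier R"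
  by (induction l) auto

lemma combs_scale [simp]: "l \<in> combs R S \<Longrightarrow> a \<in> carrier R \<Longrightarrow> scale_comb R a l \<in> combs R S"
  by (induction l) auto

lemma lcomb_append:
  "l \<in> combs R S \<Longrightarrow> l' \<in> combs R S' \<Longrightarrow> (\<And>x. h x \<in> carrier R) \<Longrightarrow>
    lcomb R h (l @ l') = lcomb R h l \<oplus> lcomb R h l'"
  by (induction l) (auto simp: a_assoc)

lemma lcomb_scale:
  "l \<in> combs R S \<Longrightarrow> a \<in> carrier R \<Longrightarrow> (\<And>x. h x \<in> carrier R) \<Longrightarrow>
    lcomb R h (scale_comb R a l) = a \<otimes> lcomb R h l"
  by (induction l) (auto simp: m_assoc r_distr)

lemmas lcomb_simps = lcomb_append lcomb_scale

lemma decode_class: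
  assumes "l \<in> combs R S"
  shows "decode (comb_class R S l) \<in> combs R S" "comb_eq R (decode (comb_class R S l)) l"
  using someI[of "\<lambda>l'. l' \<in> combs R S \<and> comb_eq R l' l" l] assms comb_eq_refl
  by (auto simp: comb_class_def decode_encode)

lemma class_eq_iff:
  assumes "l \<in> combs R S" "l' \<in> combs R S"
  shows "comb_class R S l = comb_class R S l' \<longleftrightarrow> comb_eq R l l'"
proof
  assume "comb_class R S l = comb_class R S l'"
  then show "comb_eq R l l'"
    using decode_class(2)[OF assms(1)] decode_class(2)[OF assms(2)] by (simp add: comb_eq_def)
next
  assume "comb_eq R l l'"
  then have "comb_eq R k l = comb_eq R k l'" for k by (simp add: comb_eq_def)
  then show "comb_class R S l = comb_class R S l'" by (simp add: comb_class_def)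
qed

lemma free_simps:
  "carrier (free_mod R S) = comb_class R S ` combs R S"
  "\<zero>\<^bsub>free_mod R S\<^esub> = comb_class R S []"
  "l \<in> combs R S \<Longrightarrow> l' \<in> combs R S \<Longrightarrow>
    comb_class R S l \<oplus>\<^bsub>free_mod R S\<^esub> comb_class R S l' = comb_class R S (l @ l')"
  "l \<in> combs R S \<Longrightarrow> a \<in> carrier R \<Longrightarrow>
    a \<odot>\<^bsub>free_mod R S\<^esub> comb_class R S l = comb_class R S (scale_comb R a l)"
  "l \<in> combs R S \<Longrightarrow> (\<And>x. x \<in> S \<Longrightarrow> h x \<in> S') \<Longrightarrow>
    free_map R S' h (comb_class R S l) = comb_class R S' (map_comb h l)"
proof -
  assume l: "l \<in> combs R S"
  note dl = decode_class[OF l]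
  { assume l': "l' \<in> combs R S"
    note dl' = decode_class[OF l']
    have "comb_eq R (decode (comb_class R S l) @ decode (comb_class R S l')) (l @ l')"
      using dl dl' l l' by (auto simp: comb_eq_def lcomb_append[where S = S and S' = S])
    then show "comb_class R S l \<oplus>\<^bsub>free_mod R S\<^esub> comb_class R S l' = comb_class R S (l @ l')"
      using dl(1) dl'(1) l l' by (simp add: free_mod_def class_eq_iff) }
  { assume a: "a \<in> carrier R"
    have "comb_eq R (scale_comb R a (decode (comb_class R S l))) (scale_comb R a l)"
      using dl l a by (auto simp: comb_eq_def lcomb_scale[where S = S])
    then show "a \<odot>\<^bsub>free_mod R S\<^esub> comb_class R S l = comb_class R S (scale_comb R a l)"
      using dl(1) l a by (simp add: free_mod_def class_eq_iff) }
  { assume h: "\<And>x. x \<in> S \<Longrightarrow> h x \<in> S'"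
    show "free_map R S' h (comb_class R S l) = comb_class R S' (map_comb h l)"
      using comb_eq_map[OF dl(2)] combs_map[OF dl(1), of h S'] combs_map[OF l, of h S'] h
      by (simp add: free_map_def class_eq_iff) }
qed (simp_all add: free_mod_def)

lemma class_eqI:
  assumes "l \<in> combs R S" "l' \<in> combs R S" "\<And>h. (\<And>x. h x \<in> carrier R) \<Longrightarrow> lcomb R h l = lcomb R h l'"
  shows "comb_class R S l = comb_class R S l'"
  using assms by (simp add: class_eq_iff comb_eq_def)

lemma module_free: "module R (free_mod R S)"
proof (rule moduleI)
  have neg: "comb_class R S (scale_comb R (\<ominus> \<one>) l @ l) = comb_class R S []" if "l \<in> combs R S" for l
    by (rule class_eqI) (use that in \<open>simp_all add: lcomb_simps[where S = S] lcomb_append[where S' = S] l_minus l_neg\<close>)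
  show "abelian_group (free_mod R S)"
  proof (rule abelian_groupI, goal_cases)
    case (4 x y)
    then show ?case
      by (auto simp: free_simps lcomb_append[where S = S and S' = S] a_comm intro!: class_eqI)
  next
    case (6 x)
    then obtain l where "l \<in> combs R S" "x = comb_class R S l" by (auto simp: free_simps)
    then show ?case
      using neg by (intro bexI[of _ "comb_class R S (scale_comb R (\<ominus> \<one>) l)"]) (auto simp: free_simps)
  qed (auto simp: free_simps)
next
  fix a b x assume ab: "a \<in> carrier R" "b \<in> carrier R" and "x \<in> carrier (free_mod R S)"
  then obtain l where l: "l \<in> combs R S" "x = comb_class R S l" by (auto simp: free_simps)
  show "(a \<oplus> b) \<odot>\<^bsub>free_mod R S\<^esub> x = a \<odot>\<^bsub>free_mod R S\<^esub> x \<oplus>\<^bsub>free_mod R S\<^esub> b \<odot>\<^bsub>free_mod R S\<^esub> x"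
    using ab l by (auto simp: free_simps lcomb_scale[where S = S] lcomb_append[where S = S and S' = S]
        l_distr intro!: class_eqI)
  show "(a \<otimes> b) \<odot>\<^bsub>free_mod R S\<^esub> x = a \<odot>\<^bsub>free_mod R S\<^esub> (b \<odot>\<^bsub>free_mod R S\<^esub> x)"
    using ab l by (auto simp: free_simps lcomb_scale[where S = S] m_assoc intro!: class_eqI)
next
  fix a x y assume a: "a \<in> carrier R" and "x \<in> carrier (free_mod R S)" "y \<in> carrier (free_mod R S)"
  then obtain l l' where l: "l \<in> combs R S" "x = comb_class R S l" "l' \<in> combs R S" "y = comb_class R S l'"
    by (auto simp: free_simps)
  show "a \<odot>\<^bsub>free_mod R S\<^esub> (x \<oplus>\<^bsub>free_mod R S\<^esub> y) = a \<odot>\<^bsub>free_mod R S\<^esub> x \<oplus>\<^bsub>free_mod R S\<^esub> a \<odot>\<^bsub>free_mod R S\<^esub> y"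
    using a l by (auto simp: free_simps lcomb_scale[where S = S] lcomb_append[where S = S and S' = S]
        r_distr intro!: class_eqI)
next
  fix x assume "x \<in> carrier (free_mod R S)"
  then obtain l where l: "l \<in> combs R S" "x = comb_class R S l" by (auto simp: free_simps)
  then show "\<one> \<odot>\<^bsub>free_mod R S\<^esub> x = x"
    by (auto simp: free_simps lcomb_scale[where S = S] intro!: class_eqI)
qed (auto simp: free_simps is_cring)

text \<open>
  A combination is determined by its values under functionals. These lie in the ring, where a
  nonzerodivisor can be cancelled.
\<close>

lemma torsionfree_free:
  assumes "nonzerodivisor R f"
  shows "torsionfree f (free_mod R S)"
  unfolding torsionfree_def
proof (intro ballI impI)
  have f: "f \<in> carrier R" using assms by (simp add: nonzerodivisor_def)
  fix x assume "x \<in> carrier (free_mod R S)" and 0: "f \<odot>\<^bsub>free_mod R S\<^esub> x = \<zero>\<^bsub>free_mod R S\<^esub>"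
  then obtain l where l: "l \<in> combs R S" "x = comb_class R S l" by (auto simp: free_simps)
  have "comb_eq R (scale_comb R f l) []"
    using 0 l f by (simp add: free_simps class_eq_iff)
  then have "f \<otimes> lcomb R h l = \<zero>" if "\<forall>x. h x \<in> carrier R" for h
    using that f l(1) lcomb_scale[OF l(1) f] by (simp add: comb_eq_def)
  then have "lcomb R h l = \<zero>" if "\<forall>x. h x \<in> carrier R" for h
    using that assms l(1) by (simp add: nonzerodivisor_def)
  then show "x = \<zero>\<^bsub>free_mod R S\<^esub>"
    unfolding l(2) free_simps using l(1) by (intro class_eqI) auto
qed

end

lemma lsum_closed:
  "module A M \<Longrightarrow> l \<in> combs A (carrier M) \<Longrightarrow> lsum M l \<in> carrier M"
proof (induction l)
  case Nil
  interpret module A M by fact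
  show ?case by simp
next
  case (Cons p l)
  interpret module A M by fact
  show ?case using Cons by (cases p) auto
qed

text \<open>
  Collecting coefficients: the value of a formal combination in \<open>M\<close> only depends on the coefficients
  of the basis elements, and these are values of linear functionals.
\<close>

lemma lsum_coefficients:
  assumes M: "module A M" and S: "finite S" "S \<subseteq> carrier M" and l: "l \<in> combs A S"
  shows "lsum M l = (\<Oplus>\<^bsub>M\<^esub>x\<in>S. lcomb A (\<lambda>y. if y = x then \<one>\<^bsub>A\<^esub> else \<zero>\<^bsub>A\<^esub>) l \<odot>\<^bsub>M\<^esub> x)"
  using l
proof (induction l)
  case Nil
  interpret module A M by fact
  have "(\<Oplus>\<^bsub>M\<^esub>x\<in>S. \<zero>\<^bsub>A\<^esub> \<odot>\<^bsub>M\<^esub> x) = (\<Oplus>\<^bsub>M\<^esub>x\<in>S. \<zero>\<^bsub>M\<^esub>)"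
    using S by (intro M.finsum_cong') auto
  then show ?case by simp
next
  case (Cons p l)
  interpret module A M by fact
  let ?\<delta> = "\<lambda>x y. if y = x then \<one>\<^bsub>A\<^esub> else \<zero>\<^bsub>A\<^esub>"
  obtain a z where p: "p = (a, z)" by (cases p)
  have az: "a \<in> carrier A" "z \<in> S" "l \<in> combs A S" using Cons.prems by (auto simp: p)
  have cl: "lcomb A (?\<delta> x) l \<in> carrier A" for x using az(3) by (intro R.lcomb_closed) auto
  have "(\<Oplus>\<^bsub>M\<^esub>x\<in>S. lcomb A (?\<delta> x) (p # l) \<odot>\<^bsub>M\<^esub> x)
      = (\<Oplus>\<^bsub>M\<^esub>x\<in>S. (if z = x then a \<odot>\<^bsub>M\<^esub> x else \<zero>\<^bsub>M\<^esub>) \<oplus>\<^bsub>M\<^esub> lcomb A (?\<delta> x) l \<odot>\<^bsub>M\<^esub> x)"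
    using S az cl by (intro M.finsum_cong') (auto simp: p smult_l_distr subset_iff)
  also have "\<dots> = (\<Oplus>\<^bsub>M\<^esub>x\<in>S. if z = x then a \<odot>\<^bsub>M\<^esub> x else \<zero>\<^bsub>M\<^esub>) \<oplus>\<^bsub>M\<^esub> (\<Oplus>\<^bsub>M\<^esub>x\<in>S. lcomb A (?\<delta> x) l \<odot>\<^bsub>M\<^esub> x)"
    using S az cl by (intro M.finsum_addf) auto
  also have "(\<Oplus>\<^bsub>M\<^esub>x\<in>S. if z = x then a \<odot>\<^bsub>M\<^esub> x else \<zero>\<^bsub>M\<^esub>) = a \<odot>\<^bsub>M\<^esub> z"
    using M.finsum_singleton[of z S "\<lambda>x. a \<odot>\<^bsub>M\<^esub> x"] S az by auto
  finally show ?case using Cons.IH az by (simp add: p)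
qed

lemma lsum_cong:
  assumes M: "module A M" and l: "l \<in> combs A (carrier M)" "l' \<in> combs A (carrier M)" "comb_eq A l l'"
  shows "lsum M l = lsum M l'"
proof -
  interpret module A M by fact
  let ?S = "snd ` (set l \<union> set l')"
  have S: "finite ?S" "?S \<subseteq> carrier M" "l \<in> combs A ?S" "l' \<in> combs A ?S"
    using l(1,2) by (force simp: combs_def lists_eq_set)+
  show ?thesis
    unfolding lsum_coefficients[OF M S(1,2,3)] lsum_coefficients[OF M S(1,2,4)]
    using l(3) by (simp add: comb_eq_def)
qed

lemma free_proj_class:
  assumes "module A M" "l \<in> combs A (carrier M)"
  shows "free_proj M (comb_class A (carrier M) l) = lsum M l"
proof -
  interpret module A M by fact
  show ?thesis
    unfolding free_proj_def using lsum_cong[OF assms(1) R.decode_class(1)] R.decode_class(2) assms(2) by auto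
qed

context
  fixes A :: "('a, 'r) ring_scheme" and M :: "('a, 'b) umod"
  assumes M: "module A M"
begin

interpretation module A M by (rule M)

lemma lsum_append: "l \<in> combs A (carrier M) \<Longrightarrow> l' \<in> combs A (carrier M) \<Longrightarrow>
    lsum M (l @ l') = lsum M l \<oplus>\<^bsub>M\<^esub> lsum M l'"
  by (induction l) (auto simp: M.a_assoc lsum_closed[OF M])

lemma lsum_scale: "l \<in> combs A (carrier M) \<Longrightarrow> a \<in> carrier A \<Longrightarrow>
    lsum M (scale_comb A a l) = a \<odot>\<^bsub>M\<^esub> lsum M l"
  by (induction l) (auto simp: smult_assoc1 smult_r_distr lsum_closed[OF M])

lemma free_proj_closed: "u \<in> carrier (free_mod A (carrier M)) \<Longrightarrow> free_proj M u \<in> carrier M"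
  by (auto simp: R.free_simps free_proj_class[OF M] lsum_closed[OF M])

lemma free_proj_zero: "free_proj M \<zero>\<^bsub>free_mod A (carrier M)\<^esub> = \<zero>\<^bsub>M\<^esub>"
  by (simp add: R.free_simps free_proj_class[OF M])

lemma free_proj_add: "u \<in> carrier (free_mod A (carrier M)) \<Longrightarrow> v \<in> carrier (free_mod A (carrier M)) \<Longrightarrow>
    free_proj M (u \<oplus>\<^bsub>free_mod A (carrier M)\<^esub> v) = free_proj M u \<oplus>\<^bsub>M\<^esub> free_proj M v"
  by (auto simp: R.free_simps free_proj_class[OF M] lsum_append)

lemma free_proj_smult: "u \<in> carrier (free_mod A (carrier M)) \<Longrightarrow> a \<in> carrier A \<Longrightarrow>
    free_proj M (a \<odot>\<^bsub>free_mod A (carrier M)\<^esub> u) = a \<odot>\<^bsub>M\<^esub> free_proj M u"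
  by (auto simp: R.free_simps free_proj_class[OF M] lsum_scale)

lemma free_proj_surj:
  assumes "x \<in> carrier M"
  obtains u where "u \<in> carrier (free_mod A (carrier M))" "free_proj M u = x"
proof
  have l: "[(\<one>\<^bsub>A\<^esub>, x)] \<in> combs A (carrier M)" using assms by simp
  then show "comb_class A (carrier M) [(\<one>\<^bsub>A\<^esub>, x)] \<in> carrier (free_mod A (carrier M))"
    unfolding R.free_simps by (rule imageI)
  show "free_proj M (comb_class A (carrier M) [(\<one>\<^bsub>A\<^esub>, x)]) = x"
    using assms unfolding free_proj_class[OF M l] by simp
qed

end

context
  fixes A :: "('a, 'r) ring_scheme" and S S' :: "('a, 'b) univ set" and h
  assumes A: "cring A" and h: "\<And>x. x \<in> S \<Longrightarrow> h x \<in> S'"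
begin

interpretation cring A by (rule A)

lemma free_map_closed: "u \<in> carrier (free_mod A S) \<Longrightarrow> free_map A S' h u \<in> carrier (free_mod A S')"
  using h by (auto simp: free_simps combs_map)

lemma free_map_zero: "free_map A S' h \<zero>\<^bsub>free_mod A S\<^esub> = \<zero>\<^bsub>free_mod A S'\<^esub>"
  using free_simps(5)[of "[]" S h S'] h by (simp add: free_simps(2))

lemma free_map_add: "u \<in> carrier (free_mod A S) \<Longrightarrow> v \<in> carrier (free_mod A S) \<Longrightarrow>
    free_map A S' h (u \<oplus>\<^bsub>free_mod A S\<^esub> v) = free_map A S' h u \<oplus>\<^bsub>free_mod A S'\<^esub> free_map A S' h v"
  using h by (auto simp: free_simps combs_map)

lemma free_map_smult: "u \<in> carrier (free_mod A S) \<Longrightarrow> a \<in> carrier A \<Longrightarrow>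
    free_map A S' h (a \<odot>\<^bsub>free_mod A S\<^esub> u) = a \<odot>\<^bsub>free_mod A S'\<^esub> free_map A S' h u"
  using h by (auto simp: free_simps combs_map)

end

lemma free_map_id:
  assumes "cring A" "u \<in> carrier (free_mod A S)" "\<And>x. x \<in> S \<Longrightarrow> h x = x"
  shows "free_map A S h u = u"
proof -
  interpret cring A by fact
  obtain l where l: "l \<in> combs A S" "u = comb_class A S l" using assms(2) by (auto simp: free_simps)
  have "map_comb h l = l" using l(1) assms(3) by (induction l) auto
  then show ?thesis using l assms(3) by (simp add: free_simps)
qed

lemma free_map_comp:
  assumes "cring A" "u \<in> carrier (free_mod A S)" "\<And>x. x \<in> S \<Longrightarrow> h x \<in> S'" "\<And>x. x \<in> S' \<Longrightarrow> k x \<in> S''"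
    "\<And>x. x \<in> S \<Longrightarrow> kh x = k (h x)"
  shows "free_map A S'' kh u = free_map A S'' k (free_map A S' h u)"
proof -
  interpret cring A by fact
  obtain l where l: "l \<in> combs A S" "u = comb_class A S l" using assms(2) by (auto simp: free_simps)
  have "map_comb kh l = map_comb (\<lambda>x. k (h x)) l" using l(1) assms(5) by (induction l) auto
  then show ?thesis
    using l assms(3-5) combs_map[OF l(1), of h S'] by (simp add: free_simps(5)[where S' = S'] free_simps(5)[where S' = S''])
qed

lemma free_proj_map:
  assumes "module A M" "module A N" "h \<in> lin_maps A M N" "u \<in> carrier (free_mod A (carrier M))"
  shows "free_proj N (free_map A (carrier N) h u) = h (free_proj M u)"
proof -
  interpret M: module A M by fact
  note lin = lin_closed[OF assms(1-3)] lin_add[OF assms(1-3)] lin_smult[OF assms(1-3)] lin_zero[OF assms(1-3)]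
  obtain l where l: "l \<in> combs A (carrier M)" "u = comb_class A (carrier M) l"
    using assms(4) by (auto simp: M.R.free_simps)
  have "lsum N (map_comb h l) = h (lsum M l)"
    using l(1) by (induction l) (auto simp: lin lsum_closed[OF assms(1)])
  then show ?thesis
    using l lin(1) combs_map[OF l(1), of h "carrier N"]
    by (simp add: M.R.free_simps free_proj_class[OF assms(1)] free_proj_class[OF assms(2)])
qed

text \<open>
  Let \<open>\<pi> : F(M) \<rightarrow> M\<close> be the projection from the free module on the set \<open>M\<close>. The pairs \<open>(b, a)\<close> in
  \<open>F(X\<^sup>i) \<oplus> F(X\<^sup>i\<^sup>+\<^sup>1)\<close> with \<open>\<pi>(a) = d\<pi>(b)\<close>, with the differential \<open>(b, a) \<mapsto> (a, 0)\<close>, form a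
  complex. Its cocycles are the \<open>(b, 0)\<close> with \<open>\<pi>(b)\<close> a cocycle, its coboundaries the \<open>(b, 0)\<close> with \<open>\<pi>(b)\<close> a
  coboundary, so \<open>(b, a) \<mapsto> \<pi>(b)\<close> is a quasi-isomorphism to \<open>X\<close>. (It is the shift of the kernel of a
  surjection to \<open>X\<close> from a contractible complex with free terms.)
\<close>

definition resolution :: "('a, 'r) ring_scheme \<Rightarrow> ('a, 'b) cplx \<Rightarrow> ('a, 'b) cplx" where
  "resolution A X = (let
     F = (\<lambda>i. free_mod A (carrier (trm X i)));
     P = (\<lambda>i. {Duo b a | b a. b \<in> carrier (F i) \<and> a \<in> carrier (F (i + 1)) \<and>
           free_proj (trm X (i + 1)) a = dif X i (free_proj (trm X i) b)})
   in \<lparr>trm = (\<lambda>i. (dsum (F i) (F (i + 1)))\<lparr>carrier := P i\<rparr>),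
       dif = (\<lambda>i. \<lambda>u \<in> P i. Duo (rgt u) \<zero>\<^bsub>F (i + 1 + 1)\<^esub>)\<rparr>)"

definition resolution_functor :: "('a, 'r) ring_scheme \<Rightarrow> ('a, 'b) chfunct" where
  "resolution_functor A = \<lparr>
     fob = resolution A,
     far = (\<lambda>(X, \<phi>, Y). (resolution A X,
       \<lambda>i. \<lambda>u \<in> carrier (trm (resolution A X) i).
         Duo (free_map A (carrier (trm Y i)) (\<phi> i) (lft u))
             (free_map A (carrier (trm Y (i + 1))) (\<phi> (i + 1)) (rgt u)),
       resolution A Y))\<rparr>"

definition resolution_proj :: "('a, 'r) ring_scheme \<Rightarrow> ('a, 'b) cplx \<Rightarrow> ('a, 'b) chmap" where
  "resolution_proj A X = (resolution A X,
     \<lambda>i. \<lambda>u \<in> carrier (trm (resolution A X) i). free_proj (trm X i) (lft u), X)"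

context complex
begin

abbreviation "F i \<equiv> free_mod A (carrier (trm X i))"
abbreviation "\<pi> i \<equiv> free_proj (trm X i)"

sublocale F: module A "F i" for i
  by (rule cring.module_free[OF M.R.is_cring])

lemmas \<pi>_simps [simp] = free_proj_closed[OF module] free_proj_zero[OF module] free_proj_add[OF module]
  free_proj_smult[OF module]

lemma resolution_simps [simp]:
  "carrier (trm (resolution A X) i) = {Duo b a | b a. b \<in> carrier (F i) \<and> a \<in> carrier (F (i + 1)) \<and>
     \<pi> (i + 1) a = d i (\<pi> i b)}"
  "\<zero>\<^bsub>trm (resolution A X) i\<^esub> = Duo \<zero>\<^bsub>F i\<^esub> \<zero>\<^bsub>F (i + 1)\<^esub>"
  "Duo b a \<oplus>\<^bsub>trm (resolution A X) i\<^esub> Duo b' a' = Duo (b \<oplus>\<^bsub>F i\<^esub> b') (a \<oplus>\<^bsub>F (i + 1)\<^esub> a')"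
  "c \<odot>\<^bsub>trm (resolution A X) i\<^esub> Duo b a = Duo (c \<odot>\<^bsub>F i\<^esub> b) (c \<odot>\<^bsub>F (i + 1)\<^esub> a)"
  "Duo b a \<in> carrier (trm (resolution A X) i) \<Longrightarrow>
     dif (resolution A X) i (Duo b a) = Duo a \<zero>\<^bsub>F (i + 1 + 1)\<^esub>"
  by (simp_all add: resolution_def Let_def)

lemma resolution_ext: "dif (resolution A X) i \<in> extensional (carrier (trm (resolution A X) i))"
  by (simp add: resolution_def Let_def)

lemma module_resolution: "module A (trm (resolution A X) i)"
proof -
  interpret D: module A "dsum (F i) (F (i + 1))"
    by (rule module_dsum[OF F.module_axioms F.module_axioms])
  have neg: "\<ominus>\<^bsub>dsum (F i) (F (i + 1))\<^esub> Duo b a = Duo (\<ominus>\<^bsub>F i\<^esub> b) (\<ominus>\<^bsub>F (i + 1)\<^esub> a)"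
    if "b \<in> carrier (F i)" "a \<in> carrier (F (i + 1))" for b a
    using that by (intro D.minus_equality) (auto simp: F.M.l_neg)
  have \<pi>_neg: "\<pi> k (\<ominus>\<^bsub>F k\<^esub> b) = \<ominus>\<^bsub>trm X k\<^esub> \<pi> k b" if b: "b \<in> carrier (F k)" for k b
    using \<pi>_simps(3)[of "\<ominus>\<^bsub>F k\<^esub> b" k b] b
    by (intro M.minus_equality[symmetric]) (simp_all add: F.M.l_neg)
  have "submodule (carrier (trm (resolution A X) i)) A (dsum (F i) (F (i + 1)))"
    by (rule D.submoduleI) (auto simp: neg \<pi>_neg d_simps)
  then have "module A ((dsum (F i) (F (i + 1)))\<lparr>carrier := carrier (trm (resolution A X) i)\<rparr>)"
    by (rule submodule.submodule_is_module[OF _ D.module_axioms])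
  then show ?thesis by (simp add: resolution_def Let_def)
qed

lemma resolution_closed: "Duo b a \<in> carrier (trm (resolution A X) i) \<Longrightarrow>
    Duo a \<zero>\<^bsub>F (i + 1 + 1)\<^esub> \<in> carrier (trm (resolution A X) (i + 1))"
  by (auto simp: F.M.zero_closed)

lemma cplx_resolution: "is_cplx A (resolution A X)"
proof (rule complexI)
  fix i
  show "module A (trm (resolution A X) i)" by (rule module_resolution)
  interpret R: module A "trm (resolution A X) i" by (rule module_resolution)
  show "dif (resolution A X) i \<in> lin_maps A (trm (resolution A X) i) (trm (resolution A X) (i + 1))"
    unfolding lin_maps_def
  proof (intro CollectI conjI ballI PiE_I)
    fix u assume u: "u \<in> carrier (trm (resolution A X) i)"
    then obtain b a where ba: "u = Duo b a" by auto
    show "dif (resolution A X) i u \<in> carrier (trm (resolution A X) (i + 1))"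
      using resolution_closed[of b a i] u unfolding ba by (simp only: resolution_simps(5))
    fix v assume v: "v \<in> carrier (trm (resolution A X) i)"
    then obtain b' a' where ba': "v = Duo b' a'" by auto
    show "dif (resolution A X) i (u \<oplus>\<^bsub>trm (resolution A X) i\<^esub> v) =
        dif (resolution A X) i u \<oplus>\<^bsub>trm (resolution A X) (i + 1)\<^esub> dif (resolution A X) i v"
      using R.M.a_closed[OF u v] resolution_simps(5) u v unfolding ba ba' resolution_simps(3)
      by (simp only: resolution_simps(3) resolution_simps(5)) simp
  next
    fix c u assume c: "c \<in> carrier A" and u: "u \<in> carrier (trm (resolution A X) i)"
    then obtain b a where ba: "u = Duo b a" by auto
    show "dif (resolution A X) i (c \<odot>\<^bsub>trm (resolution A X) i\<^esub> u) =
        c \<odot>\<^bsub>trm (resolution A X) (i + 1)\<^esub> dif (resolution A X) i u"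
      using R.smult_closed[OF c u] u c unfolding ba resolution_simps(4)
      by (simp only: resolution_simps(4) resolution_simps(5)) simp
  qed (use resolution_ext in \<open>auto simp: extensional_def\<close>)
  fix u assume u: "u \<in> carrier (trm (resolution A X) i)"
  then obtain b a where ba: "u = Duo b a" by auto
  show "dif (resolution A X) (i + 1) (dif (resolution A X) i u) = \<zero>\<^bsub>trm (resolution A X) (i + 1 + 1)\<^esub>"
    using u resolution_closed[of b a i] unfolding ba by (simp only: resolution_simps(5) resolution_simps(2))
qed

lemma torsionfree_resolution:
  assumes "nonzerodivisor A f"
  shows "torsionfree f (trm (resolution A X) i)"
  using cring.torsionfree_free[OF M.R.is_cring assms, of "carrier (trm X i)"]
    cring.torsionfree_free[OF M.R.is_cring assms, of "carrier (trm X (i + 1))"]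
  unfolding torsionfree_def by auto

lemma chmap_resolution_proj: "is_chmap A (resolution_proj A X)"
  unfolding resolution_proj_def
proof (rule chmapI[OF cplx_resolution cplx])
  fix i
  show "(\<lambda>u \<in> carrier (trm (resolution A X) i). \<pi> i (lft u)) \<in> lin_maps A (trm (resolution A X) i) (trm X i)"
    unfolding lin_maps_def by (auto simp: d_simps)
  fix u assume u: "u \<in> carrier (trm (resolution A X) i)"
  then obtain b a where ba: "u = Duo b a" "\<pi> (i + 1) a = d i (\<pi> i b)" by auto
  show "restrict (\<lambda>u. \<pi> (i + 1) (lft u)) (carrier (trm (resolution A X) (i + 1))) (dif (resolution A X) i u) =
      d i (restrict (\<lambda>u. \<pi> i (lft u)) (carrier (trm (resolution A X) i)) u)"
    using u resolution_closed[of b a i] ba(2) unfolding ba(1)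
    by (simp only: resolution_simps(5) restrict_apply' univ.sel)
qed

lemma qis_resolution_proj: "resolution_proj A X \<in> qis A"
proof -
  let ?r = "\<lambda>i. \<lambda>u \<in> carrier (trm (resolution A X) i). \<pi> i (lft u)"
  interpret r: chain_map A "resolution A X" X ?r
    by (rule chain_mapI) (rule chmap_resolution_proj[unfolded resolution_proj_def])
  have "(resolution A X, ?r, X) \<in> qis A"
  proof (rule r.qisI, goal_cases)
    case (1 i u y)
    obtain b a where ba: "u = Duo b a" using 1(1) by auto
    have a: "a = \<zero>\<^bsub>F (i + 1 + 1)\<^esub>"
      using 1(1,2) unfolding ba by (simp only: resolution_simps(5) resolution_simps(2) univ.inject)
    have b: "b \<in> carrier (F (i + 1))" "\<pi> (i + 1) b = d i y" using 1(1,4) by (auto simp: ba)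
    obtain c where c: "c \<in> carrier (F i)" "\<pi> i c = y" using free_proj_surj[OF module 1(3)] by blast
    then have "Duo c b \<in> carrier (trm (resolution A X) i)" using b by simp
    moreover from this have "u = dif (resolution A X) i (Duo c b)"
      unfolding ba a by (simp only: resolution_simps(5))
    ultimately show ?case by blast
  next
    case (2 i w)
    obtain b where b: "b \<in> carrier (F (i + 1))" "\<pi> (i + 1) b = w" using free_proj_surj[OF module 2(1)] by blast
    let ?z = "Duo b \<zero>\<^bsub>F (i + 1 + 1)\<^esub>"
    have z: "?z \<in> carrier (trm (resolution A X) (i + 1))" using b 2(2) F.M.zero_closed by simp
    moreover have "dif (resolution A X) (i + 1) ?z = \<zero>\<^bsub>trm (resolution A X) (i + 1 + 1)\<^esub>"
      using z by (simp only: resolution_simps(5) resolution_simps(2))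
    moreover have "w = d i \<zero>\<^bsub>trm X i\<^esub> \<oplus>\<^bsub>trm X (i + 1)\<^esub> ?r (i + 1) ?z"
      using z b(2) 2(1) by (simp only: restrict_apply' univ.sel d_zero) simp
    ultimately show ?case using M.M.zero_closed[of i] by blast
  qed
  then show ?thesis by (simp add: resolution_proj_def)
qed

end

lemma far_resolution: "far (resolution_functor A) (X, \<phi>, Y) = (resolution A X,
    \<lambda>i. \<lambda>u \<in> carrier (trm (resolution A X) i).
      Duo (free_map A (carrier (trm Y i)) (\<phi> i) (lft u))
          (free_map A (carrier (trm Y (i + 1))) (\<phi> (i + 1)) (rgt u)), resolution A Y)"
  and fob_resolution [simp]: "fob (resolution_functor A) X = resolution A X"
  by (simp_all add: resolution_functor_def)

context chain_map
begin

abbreviation "F\<phi> i \<equiv> free_map A (carrier (trm Y i)) (\<phi> i)"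
abbreviation "R\<phi> \<equiv> \<lambda>i. \<lambda>u \<in> carrier (trm (resolution A X) i). Duo (F\<phi> i (lft u)) (F\<phi> (i + 1) (rgt u))"

lemmas F\<phi>_simps [simp] =
  free_map_closed[where A = A and S = "carrier (trm X i)" and S' = "carrier (trm Y i)" and h = "\<phi> i" for i,
    OF X.M.R.is_cring closed]
  free_map_zero[where A = A and S = "carrier (trm X i)" and S' = "carrier (trm Y i)" and h = "\<phi> i" for i,
    OF X.M.R.is_cring closed]
  free_map_add[where A = A and S = "carrier (trm X i)" and S' = "carrier (trm Y i)" and h = "\<phi> i" for i,
    OF X.M.R.is_cring closed]
  free_map_smult[where A = A and S = "carrier (trm X i)" and S' = "carrier (trm Y i)" and h = "\<phi> i" for i,
    OF X.M.R.is_cring closed]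

lemma \<pi>_F\<phi>: "u \<in> carrier (X.F i) \<Longrightarrow> Y.\<pi> i (F\<phi> i u) = \<phi> i (X.\<pi> i u)"
  by (rule free_proj_map[OF X.module Y.module lin])

lemma R\<phi>_closed: "Duo b a \<in> carrier (trm (resolution A X) i) \<Longrightarrow>
    Duo (F\<phi> i b) (F\<phi> (i + 1) a) \<in> carrier (trm (resolution A Y) i)"
  by (auto simp: \<pi>_F\<phi> d_comm)

lemma chmap_resolution: "is_chmap A (resolution A X, R\<phi>, resolution A Y)"
proof (rule chmapI[OF X.cplx_resolution Y.cplx_resolution])
  fix i
  interpret R: module A "trm (resolution A X) i" by (rule X.module_resolution)
  show "R\<phi> i \<in> lin_maps A (trm (resolution A X) i) (trm (resolution A Y) i)"
    unfolding lin_maps_def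
  proof (intro CollectI conjI ballI PiE_I)
    fix u assume u: "u \<in> carrier (trm (resolution A X) i)"
    then obtain b a where ba: "u = Duo b a" "b \<in> carrier (X.F i)" "a \<in> carrier (X.F (i + 1))" by auto
    show "R\<phi> i u \<in> carrier (trm (resolution A Y) i)"
      using R\<phi>_closed[of b a i] u unfolding ba(1) by (simp only: restrict_apply' univ.sel)
    fix v assume v: "v \<in> carrier (trm (resolution A X) i)"
    then obtain b' a' where ba': "v = Duo b' a'" "b' \<in> carrier (X.F i)" "a' \<in> carrier (X.F (i + 1))" by auto
    show "R\<phi> i (u \<oplus>\<^bsub>trm (resolution A X) i\<^esub> v) = R\<phi> i u \<oplus>\<^bsub>trm (resolution A Y) i\<^esub> R\<phi> i v"
      using R.M.a_closed[OF u v] u v ba(2,3) ba'(2,3) unfolding ba(1) ba'(1)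
      by (simp only: restrict_apply' X.resolution_simps(3) Y.resolution_simps(3) univ.sel F\<phi>_simps)
  next
    fix c u assume c: "c \<in> carrier A" and u: "u \<in> carrier (trm (resolution A X) i)"
    then obtain b a where ba: "u = Duo b a" "b \<in> carrier (X.F i)" "a \<in> carrier (X.F (i + 1))" by auto
    show "R\<phi> i (c \<odot>\<^bsub>trm (resolution A X) i\<^esub> u) = c \<odot>\<^bsub>trm (resolution A Y) i\<^esub> R\<phi> i u"
      using R.smult_closed[OF c u] u c ba(2,3) unfolding ba(1)
      by (simp only: restrict_apply' X.resolution_simps(4) Y.resolution_simps(4) univ.sel F\<phi>_simps)
  qed (simp del: X.resolution_simps)
  fix u assume u: "u \<in> carrier (trm (resolution A X) i)"
  then obtain b a where ba: "u = Duo b a" by auto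
  note c = X.resolution_closed[of b a i] R\<phi>_closed[of b a i]
  show "R\<phi> (i + 1) (dif (resolution A X) i u) = dif (resolution A Y) i (R\<phi> i u)"
    using u c unfolding ba
    by (simp only: X.resolution_simps(5) Y.resolution_simps(5) restrict_apply' univ.sel F\<phi>_simps)
qed

end

lemma functor_resolution: "is_functor (Ch A) (Ch A) (resolution_functor A)"
proof (rule Ch_functorI, goal_cases)
  case (1 X)
  then interpret complex A X by unfold_locales
  show ?case by (simp add: cplx_resolution)
next
  case (2 X)
  then interpret complex A X by unfold_locales
  have "Duo (free_map A (carrier (trm X i)) (\<lambda>x \<in> carrier (trm X i). x) b)
      (free_map A (carrier (trm X (i + 1))) (\<lambda>x \<in> carrier (trm X (i + 1)). x) a) = Duo b a"
    if "Duo b a \<in> carrier (trm (resolution A X) i)" for b a i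
    using that by (simp add: free_map_id[OF M.R.is_cring])
  then show ?case
    unfolding far_resolution fob_resolution Ch_simps by (intro chmap_eqI) auto
next
  case (3 X \<phi> Y)
  interpret chain_map A X Y \<phi> by (rule chain_mapI) fact
  show ?case unfolding far_resolution fob_resolution by (rule Ch_HomI[OF chmap_resolution])
next
  case (4 X \<phi> Y \<psi> Z)
  interpret p: chain_map A X Y \<phi> by (rule chain_mapI) fact
  interpret q: chain_map A Y Z \<psi> by (rule chain_mapI) fact
  interpret pq: chain_map A X Z "\<lambda>i. compose (carrier (trm X i)) (\<psi> i) (\<phi> i)"
    by (rule chain_mapI[OF chmap_comp[OF 4]])
  have *: "pq.F\<phi> i b = q.F\<phi> i (p.F\<phi> i b)" if "b \<in> carrier (p.X.F i)" for b i
    by (rule free_map_comp[OF p.X.M.R.is_cring that]) (simp_all add: compose_eq)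
  show ?case
    unfolding far_resolution Ch_simps
  proof (rule chmap_eqI)
    fix i u assume u: "u \<in> carrier (trm (resolution A X) i)"
    then obtain b a where ba: "u = Duo b a" "b \<in> carrier (p.X.F i)" "a \<in> carrier (p.X.F (i + 1))" by auto
    show "pq.R\<phi> i u = compose (carrier (trm (resolution A X) i)) (q.R\<phi> i) (p.R\<phi> i) u"
      using u p.R\<phi>_closed[of b a i] ba(2,3) unfolding ba(1)
      by (simp only: compose_eq restrict_apply' univ.sel *)
  qed simp_all
qed

lemma resolution_proj_nat:
  assumes "m \<in> Hom (Ch A) X Y"
  shows "Cmp (Ch A) (resolution_proj A Y) (far (resolution_functor A) m) = Cmp (Ch A) m (resolution_proj A X)"
proof -
  obtain \<phi> where m: "m = (X, \<phi>, Y)" "is_chmap A (X, \<phi>, Y)" using assms by (auto simp: Ch_Hom)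
  interpret chain_map A X Y \<phi> by (rule chain_mapI[OF m(2)])
  show ?thesis
    unfolding m resolution_proj_def far_resolution Ch_simps
  proof (rule chmap_eqI)
    fix i u assume u: "u \<in> carrier (trm (resolution A X) i)"
    then obtain b a where ba: "u = Duo b a" "b \<in> carrier (X.F i)" by auto
    show "compose (carrier (trm (resolution A X) i))
        (\<lambda>u \<in> carrier (trm (resolution A Y) i). Y.\<pi> i (lft u)) (R\<phi> i) u =
      compose (carrier (trm (resolution A X) i)) (\<phi> i) (\<lambda>u \<in> carrier (trm (resolution A X) i). X.\<pi> i (lft u)) u"
      using u R\<phi>_closed[of b a i] \<pi>_F\<phi>[OF ba(2)] unfolding ba(1)
      by (simp only: compose_eq restrict_apply' univ.sel)
  qed simp_all
qed

lemma resolved_Ch: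
  assumes "\<And>f. f \<in> G \<Longrightarrow> nonzerodivisor A f"
  shows "resolved (Ch A) (qis A) {X. is_cplx A X \<and> (\<forall>f \<in> G. \<forall>i. torsionfree f (trm X i))}
    (resolution_functor A) (resolution_proj A)"
proof (intro resolved.intro resolved_axioms.intro localized_Ch functor_resolution resolution_proj_nat, goal_cases)
  case (2 X)
  then interpret complex A X by unfold_locales simp
  show ?case using assms torsionfree_resolution cplx_resolution by simp
next
  case (3 X)
  then interpret complex A X by unfold_locales simp
  show ?case using chmap_resolution_proj by (simp add: resolution_proj_def Ch_HomI)
next
  case (4 X)
  then interpret complex A X by unfold_locales simp
  show ?case by (rule qis_resolution_proj)
qed auto

section \<open>The Koszul complex\<close>

definition koszul_functor :: "'a \<Rightarrow> ('a, 'b) chfunct" where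
  "koszul_functor g = \<lparr>
     fob = koszul g,
     far = (\<lambda>(X, \<phi>, Y). (koszul g X,
       \<lambda>i. \<lambda>u \<in> carrier (trm (koszul g X) i). Duo (\<phi> i (lft u)) (\<phi> (i + 1) (rgt u)), koszul g Y))\<rparr>"

definition koszul_unit :: "'a \<Rightarrow> ('a, 'b) cplx \<Rightarrow> ('a, 'b) chmap" where
  "koszul_unit g X = (X, \<lambda>i. \<lambda>x \<in> carrier (trm X i). Duo x \<zero>\<^bsub>trm X (i + 1)\<^esub>, koszul g X)"

lemma far_koszul: "far (koszul_functor g) (X, \<phi>, Y) = (koszul g X,
    \<lambda>i. \<lambda>u \<in> carrier (trm (koszul g X) i). Duo (\<phi> i (lft u)) (\<phi> (i + 1) (rgt u)), koszul g Y)"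
  and fob_koszul [simp]: "fob (koszul_functor g) X = koszul g X"
  by (simp_all add: koszul_functor_def)

lemma koszul_trm [simp]: "trm (koszul g X) i = dsum (trm X i) (trm X (i + 1))"
  by (simp add: koszul_def)

lemma koszul_d [simp]: "x \<in> carrier (trm X i) \<Longrightarrow> y \<in> carrier (trm X (i + 1)) \<Longrightarrow>
    dif (koszul g X) i (Duo x y) =
      Duo (dif X i x \<oplus>\<^bsub>trm X (i + 1)\<^esub> g \<odot>\<^bsub>trm X (i + 1)\<^esub> y)
          (\<ominus>\<^bsub>trm X (i + 1 + 1)\<^esub> dif X (i + 1) y)"
  by (simp add: koszul_def)

lemma (in module) a_inv_zero [simp]: "\<ominus>\<^bsub>M\<^esub> \<zero>\<^bsub>M\<^esub> = \<zero>\<^bsub>M\<^esub>"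
  by (rule M.minus_equality) simp_all

context reduction
begin

lemma cplx_koszul: "is_cplx A (koszul g X)"
proof (rule complexI)
  fix i
  show "module A (trm (koszul g X) i)" by (simp add: module_dsum module)
  show "dif (koszul g X) i \<in> lin_maps A (trm (koszul g X) i) (trm (koszul g X) (i + 1))"
    unfolding lin_maps_def
  proof (intro CollectI conjI ballI PiE_I)
    fix u assume "u \<in> carrier (trm (koszul g X) i)"
    then obtain x y where u: "u = Duo x y" "x \<in> carrier (trm X i)" "y \<in> carrier (trm X (i + 1))" by auto
    note dxy = d_closed[OF u(2) refl] d_closed[OF u(3) refl]
    show "dif (koszul g X) i u \<in> carrier (trm (koszul g X) (i + 1))"
      unfolding u(1) koszul_d[OF u(2,3)] using u dxy by simp
    fix v assume "v \<in> carrier (trm (koszul g X) i)"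
    then obtain x' y' where v: "v = Duo x' y'" "x' \<in> carrier (trm X i)" "y' \<in> carrier (trm X (i + 1))" by auto
    note dxy' = d_closed[OF v(2) refl] d_closed[OF v(3) refl]
    have 1: "dif X i x \<oplus>\<^bsub>trm X (i + 1)\<^esub> dif X i x' \<oplus>\<^bsub>trm X (i + 1)\<^esub> g \<odot>\<^bsub>trm X (i + 1)\<^esub> (y \<oplus>\<^bsub>trm X (i + 1)\<^esub> y') =
        dif X i x \<oplus>\<^bsub>trm X (i + 1)\<^esub> g \<odot>\<^bsub>trm X (i + 1)\<^esub> y \<oplus>\<^bsub>trm X (i + 1)\<^esub>
        (dif X i x' \<oplus>\<^bsub>trm X (i + 1)\<^esub> g \<odot>\<^bsub>trm X (i + 1)\<^esub> y')"
      using u v dxy dxy' g_closed by algebra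
    have 2: "\<ominus>\<^bsub>trm X (i + 1 + 1)\<^esub> (dif X (i + 1) y \<oplus>\<^bsub>trm X (i + 1 + 1)\<^esub> dif X (i + 1) y') =
        \<ominus>\<^bsub>trm X (i + 1 + 1)\<^esub> dif X (i + 1) y \<oplus>\<^bsub>trm X (i + 1 + 1)\<^esub> \<ominus>\<^bsub>trm X (i + 1 + 1)\<^esub> dif X (i + 1) y'"
      using dxy dxy' by algebra
    show "dif (koszul g X) i (u \<oplus>\<^bsub>trm (koszul g X) i\<^esub> v) =
        dif (koszul g X) i u \<oplus>\<^bsub>trm (koszul g X) (i + 1)\<^esub> dif (koszul g X) i v"
      unfolding u(1) v(1) koszul_trm dsum_simps koszul_d[OF u(2,3)] koszul_d[OF v(2,3)]
        koszul_d[OF M.M.a_closed[OF u(2) v(2)] M.M.a_closed[OF u(3) v(3)]]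
        d_add[OF u(2) v(2)] d_add[OF u(3) v(3)] 1 2 ..
  next
    fix a u assume a: "a \<in> carrier A" and "u \<in> carrier (trm (koszul g X) i)"
    then obtain x y where u: "u = Duo x y" "x \<in> carrier (trm X i)" "y \<in> carrier (trm X (i + 1))" by auto
    note dxy = d_closed[OF u(2) refl] d_closed[OF u(3) refl]
    show "dif (koszul g X) i (a \<odot>\<^bsub>trm (koszul g X) i\<^esub> u) =
        a \<odot>\<^bsub>trm (koszul g X) (i + 1)\<^esub> dif (koszul g X) i u"
      unfolding u(1) koszul_trm dsum_simps koszul_d[OF u(2,3)]
        koszul_d[OF M.smult_closed[OF a u(2)] M.smult_closed[OF a u(3)]]
      using u dxy a by (simp add: d_smult M.smult_r_distr M.smult_r_minus M.smult_comm[of g a])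
  qed (auto simp: koszul_def)
  fix u assume "u \<in> carrier (trm (koszul g X) i)"
  then obtain x y where u: "u = Duo x y" "x \<in> carrier (trm X i)" "y \<in> carrier (trm X (i + 1))" by auto
  note dxy = d_closed[OF u(2) refl] d_closed[OF u(3) refl]
  have c: "dif X i x \<oplus>\<^bsub>trm X (i + 1)\<^esub> g \<odot>\<^bsub>trm X (i + 1)\<^esub> y \<in> carrier (trm X (i + 1))"
    "\<ominus>\<^bsub>trm X (i + 1 + 1)\<^esub> dif X (i + 1) y \<in> carrier (trm X (i + 1 + 1))"
    using u dxy by simp_all
  have "d (i + 1) (d i x \<oplus>\<^bsub>trm X (i + 1)\<^esub> g \<odot>\<^bsub>trm X (i + 1)\<^esub> y) = g \<odot>\<^bsub>trm X (i + 1 + 1)\<^esub> d (i + 1) y"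
    unfolding d_add[OF dxy(1) M.smult_closed[OF g_closed u(3)]] dd[OF u(2) refl] d_smult[OF g_closed u(3)]
    using dxy by simp
  moreover have "g \<odot>\<^bsub>trm X (i + 1 + 1)\<^esub> d (i + 1) y \<oplus>\<^bsub>trm X (i + 1 + 1)\<^esub>
      g \<odot>\<^bsub>trm X (i + 1 + 1)\<^esub> \<ominus>\<^bsub>trm X (i + 1 + 1)\<^esub> d (i + 1) y = \<zero>\<^bsub>trm X (i + 1 + 1)\<^esub>"
    using dxy g_closed by algebra
  moreover have "\<ominus>\<^bsub>trm X (i + 1 + 1 + 1)\<^esub> d (i + 1 + 1) (\<ominus>\<^bsub>trm X (i + 1 + 1)\<^esub> d (i + 1) y) =
      \<zero>\<^bsub>trm X (i + 1 + 1 + 1)\<^esub>"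
    unfolding d_neg[OF dxy(2)] dd[OF u(3) refl] by simp
  ultimately show "dif (koszul g X) (i + 1) (dif (koszul g X) i u) = \<zero>\<^bsub>trm (koszul g X) (i + 1 + 1)\<^esub>"
    unfolding u(1) koszul_d[OF u(2,3)] koszul_d[OF c] koszul_trm dsum_simps by simp
qed

lemma chmap_koszul_unit: "is_chmap A (koszul_unit g X)"
  unfolding koszul_unit_def
proof (rule chmapI[OF cplx cplx_koszul])
  fix i
  show "(\<lambda>x \<in> carrier (trm X i). Duo x \<zero>\<^bsub>trm X (i + 1)\<^esub>) \<in> lin_maps A (trm X i) (trm (koszul g X) i)"
    by (auto simp: lin_maps_def)
  fix x assume x: "x \<in> carrier (trm X i)"
  show "(\<lambda>x \<in> carrier (trm X (i + 1)). Duo x \<zero>\<^bsub>trm X (i + 1 + 1)\<^esub>) (d i x) =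
      dif (koszul g X) i ((\<lambda>x \<in> carrier (trm X i). Duo x \<zero>\<^bsub>trm X (i + 1)\<^esub>) x)"
    unfolding restrict_apply'[OF x] restrict_apply'[OF d_closed[OF x refl]] koszul_d[OF x M.M.zero_closed]
    using d_closed[OF x refl] by simp
qed

lemma red_add_g:
  assumes x: "x \<in> carrier (trm X i)" and y: "y \<in> carrier (trm X i)"
  shows "red g X i (x \<oplus>\<^bsub>trm X i\<^esub> g \<odot>\<^bsub>trm X i\<^esub> y) = red g X i x"
proof -
  have gy: "g \<odot>\<^bsub>trm X i\<^esub> y \<in> carrier (trm X i)" using y by simp
  show ?thesis
    unfolding M.M.a_comm[OF x gy] by (rule q.qrep_eqI[OF _ x]) (use y in \<open>simp add: scaled_def\<close>)
qed

lemma chmap_koszul_proj: "is_chmap A (koszul_proj g X)"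
  unfolding koszul_proj_def
proof (rule chmapI[OF cplx_koszul cplx_tensor])
  fix i
  show "(\<lambda>u \<in> carrier (trm (koszul g X) i). red g X i (lft u)) \<in>
      lin_maps A (trm (koszul g X) i) (trm (tensor_cplx g X) i)" (is "?p \<in> _")
  proof -
    have p: "?p (Duo x y) = red g X i x" if "x \<in> carrier (trm X i)" "y \<in> carrier (trm X (i + 1))" for x y
      using that by simp
    show ?thesis
      unfolding lin_maps_def
    proof (intro CollectI conjI ballI PiE_I)
      fix u assume "u \<in> carrier (trm (koszul g X) i)"
      then obtain x y where u: "u = Duo x y" "x \<in> carrier (trm X i)" "y \<in> carrier (trm X (i + 1))" by auto
      show "?p u \<in> carrier (trm (tensor_cplx g X) i)"
        unfolding u(1) p[OF u(2,3)] tensor_simps(1) by (rule imageI) (rule u)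
      fix v assume "v \<in> carrier (trm (koszul g X) i)"
      then obtain x' y' where v: "v = Duo x' y'" "x' \<in> carrier (trm X i)" "y' \<in> carrier (trm X (i + 1))" by auto
      show "?p (u \<oplus>\<^bsub>trm (koszul g X) i\<^esub> v) = ?p u \<oplus>\<^bsub>trm (tensor_cplx g X) i\<^esub> ?p v"
      proof -
        have s: "Duo x y \<oplus>\<^bsub>trm (koszul g X) i\<^esub> Duo x' y' = Duo (x \<oplus>\<^bsub>trm X i\<^esub> x') (y \<oplus>\<^bsub>trm X (i + 1)\<^esub> y')"
          by simp
        show ?thesis
          unfolding u(1) v(1) s p[OF u(2,3)] p[OF v(2,3)] tensor_simps(2)[OF u(2) v(2)]
          by (rule p[OF M.M.a_closed[OF u(2) v(2)] M.M.a_closed[OF u(3) v(3)]])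
      qed
    next
      fix a u assume a: "a \<in> carrier A" and "u \<in> carrier (trm (koszul g X) i)"
      then obtain x y where u: "u = Duo x y" "x \<in> carrier (trm X i)" "y \<in> carrier (trm X (i + 1))" by auto
      show "?p (a \<odot>\<^bsub>trm (koszul g X) i\<^esub> u) = a \<odot>\<^bsub>trm (tensor_cplx g X) i\<^esub> ?p u"
      proof -
        have s: "a \<odot>\<^bsub>trm (koszul g X) i\<^esub> Duo x y = Duo (a \<odot>\<^bsub>trm X i\<^esub> x) (a \<odot>\<^bsub>trm X (i + 1)\<^esub> y)"
          by simp
        show ?thesis
          unfolding u(1) s p[OF u(2,3)] tensor_simps(3)[OF a u(2)]
          by (rule p[OF M.smult_closed[OF a u(2)] M.smult_closed[OF a u(3)]])
      qed
    qed (simp del: koszul_trm)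
  qed
  fix u assume u': "u \<in> carrier (trm (koszul g X) i)"
  then obtain x y where u: "u = Duo x y" "x \<in> carrier (trm X i)" "y \<in> carrier (trm X (i + 1))" by auto
  interpret K: complex A "koszul g X" by unfold_locales (rule cplx_koszul)
  note du = K.d_closed[OF u' refl]
  show "restrict (\<lambda>u. red g X (i + 1) (lft u)) (carrier (trm (koszul g X) (i + 1))) (dif (koszul g X) i u) =
      dif (tensor_cplx g X) i (restrict (\<lambda>u. red g X i (lft u)) (carrier (trm (koszul g X) i)) u)"
    unfolding restrict_apply'[OF u'] restrict_apply'[OF du]
    unfolding u(1) koszul_d[OF u(2,3)] univ.sel tensor_d[OF u(2)]
    by (rule red_add_g[OF d_closed[OF u(2) refl] u(3)])
qed

text \<open>
  A cocycle \<open>(x, y)\<close> of the Koszul complex satisfies \<open>dx = -gy\<close>. If \<open>X\<close> is \<open>g\<close>-torsionfree, then \<open>x\<close>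
  determines \<open>y\<close> and \<open>x\<close> may be any cocycle modulo \<open>g\<close>.
\<close>

lemma qis_koszul_proj:
  assumes t: "\<And>i. torsionfree g (trm X i)"
  shows "koszul_proj g X \<in> qis A"
proof -
  let ?p = "\<lambda>i. \<lambda>u \<in> carrier (trm (koszul g X) i). red g X i (lft u)"
  interpret p: chain_map A "koszul g X" "tensor_cplx g X" ?p
    by (rule chain_mapI) (rule chmap_koszul_proj[unfolded koszul_proj_def])
  have "(koszul g X, ?p, tensor_cplx g X) \<in> qis A"
  proof (rule p.qisI, goal_cases)
    case (1 i u w')
    let ?j = "i + 1" and ?k = "i + 1 + 1"
    obtain x y where u: "u = Duo x y" "x \<in> carrier (trm X ?j)" "y \<in> carrier (trm X ?k)" using 1(1) by auto
    obtain w where w: "w \<in> carrier (trm X i)" "w' = red g X i w" using 1(3) by (auto simp: tensor_simps)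
    note dx = d_closed[OF u(2) refl] and dw = d_closed[OF w(1) refl]
    have z: "d ?j x \<oplus>\<^bsub>trm X ?k\<^esub> g \<odot>\<^bsub>trm X ?k\<^esub> y = \<zero>\<^bsub>trm X ?k\<^esub>"
      using 1(2) unfolding u(1) koszul_d[OF u(2,3)] koszul_trm dsum_simps univ.inject by (rule conjunct1)
    have "red g X ?j x = red g X ?j (d i w)"
      using 1(4) unfolding w(2) tensor_d[OF w(1)] u(1) restrict_apply'[OF 1(1)[unfolded u(1)]] univ.sel .
    then obtain v where v: "v \<in> carrier (trm X ?j)" "x = g \<odot>\<^bsub>trm X ?j\<^esub> v \<oplus>\<^bsub>trm X ?j\<^esub> d i w"
      unfolding red_eq_iff[OF u(2) dw] by (rule bexE)
    note dv = d_closed[OF v(1) refl]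
    have dxv: "d ?j x = g \<odot>\<^bsub>trm X ?k\<^esub> d ?j v"
      unfolding v(2) d_add[OF M.smult_closed[OF g_closed v(1)] dw] dd[OF w(1) refl] d_smult[OF g_closed v(1)]
      using dv by simp
    have "y = \<ominus>\<^bsub>trm X ?k\<^esub> d ?j v"
    proof (rule torsionfree_cancel[OF module t g_closed u(3) M.M.a_inv_closed[OF dv]])
      have "g \<odot>\<^bsub>trm X ?k\<^esub> y = (g \<odot>\<^bsub>trm X ?k\<^esub> d ?j v \<oplus>\<^bsub>trm X ?k\<^esub> g \<odot>\<^bsub>trm X ?k\<^esub> y) \<ominus>\<^bsub>trm X ?k\<^esub> g \<odot>\<^bsub>trm X ?k\<^esub> d ?j v"
        using dv u(3) g_closed by algebra
      also have "\<dots> = g \<odot>\<^bsub>trm X ?k\<^esub> \<ominus>\<^bsub>trm X ?k\<^esub> d ?j v"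
        unfolding z[unfolded dxv] using dv g_closed by algebra
      finally show "g \<odot>\<^bsub>trm X ?k\<^esub> y = g \<odot>\<^bsub>trm X ?k\<^esub> \<ominus>\<^bsub>trm X ?k\<^esub> d ?j v" .
    qed
    moreover have "x = d i w \<oplus>\<^bsub>trm X ?j\<^esub> g \<odot>\<^bsub>trm X ?j\<^esub> v"
      using v dw M.M.a_comm[OF M.smult_closed[OF g_closed v(1)] dw] by simp
    ultimately have "u = dif (koszul g X) i (Duo w v)" unfolding u(1) koszul_d[OF w(1) v(1)] by simp
    then show ?case
      by (intro bexI[of _ "Duo w v"]) (simp_all add: w(1) v(1) del: koszul_d)
  next
    case (2 i u)
    let ?j = "i + 1" and ?k = "i + 1 + 1"
    obtain x where x: "x \<in> carrier (trm X ?j)" "u = red g X ?j x" using 2(1) by (auto simp: tensor_simps)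
    note dx = d_closed[OF x(1) refl]
    obtain y where y: "y \<in> carrier (trm X ?k)" "d ?j x = g \<odot>\<^bsub>trm X ?k\<^esub> y"
      using 2(2) red_zero_iff[OF dx] unfolding x(2) tensor_d[OF x(1)] by auto
    have dy: "d ?k y = \<zero>\<^bsub>trm X (?k + 1)\<^esub>"
    proof (rule torsionfree_cancel[OF module t g_closed])
      show "g \<odot>\<^bsub>trm X (?k + 1)\<^esub> d ?k y = g \<odot>\<^bsub>trm X (?k + 1)\<^esub> \<zero>\<^bsub>trm X (?k + 1)\<^esub>"
        using d_smult[OF g_closed y(1)] dd[OF x(1) refl] y(2) by simp
    qed (use y in simp_all)
    let ?z = "Duo x (\<ominus>\<^bsub>trm X ?k\<^esub> y)"
    have ny: "\<ominus>\<^bsub>trm X ?k\<^esub> y \<in> carrier (trm X ?k)" using y(1) by simp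
    have z: "?z \<in> carrier (trm (koszul g X) ?j)" using x(1) ny by simp
    have "g \<odot>\<^bsub>trm X ?k\<^esub> y \<oplus>\<^bsub>trm X ?k\<^esub> g \<odot>\<^bsub>trm X ?k\<^esub> \<ominus>\<^bsub>trm X ?k\<^esub> y = \<zero>\<^bsub>trm X ?k\<^esub>"
      using y(1) g_closed by algebra
    then have dz: "dif (koszul g X) ?j ?z = \<zero>\<^bsub>trm (koszul g X) ?k\<^esub>"
      unfolding koszul_d[OF x(1) ny] koszul_trm dsum_simps y(2) d_neg[OF y(1)] dy by simp
    have u: "u = dif (tensor_cplx g X) i \<zero>\<^bsub>trm (tensor_cplx g X) i\<^esub> \<oplus>\<^bsub>trm (tensor_cplx g X) ?j\<^esub> ?p ?j ?z"
      unfolding restrict_apply'[OF z] univ.sel p.Y.d_zero x(2)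
      by (rule p.Y.M.M.l_zero[symmetric]) (use x in \<open>simp add: tensor_simps\<close>)
    show ?case by (intro bexI conjI) (rule dz u p.Y.M.M.zero_closed z)+
  qed
  then show ?thesis by (simp add: koszul_proj_def)
qed

lemma koszul_proj_unit: "Cmp (Ch A) (koszul_proj g X) (koszul_unit g X) = tensor_proj g X"
  unfolding koszul_proj_def koszul_unit_def tensor_proj_def Ch_simps
  by (rule chmap_eqI) (simp_all add: compose_eq)

lemma torsionfree_koszul: "(\<And>i. torsionfree f (trm X i)) \<Longrightarrow> torsionfree f (trm (koszul g X) i)"
  by (simp add: torsionfree_dsum)

end

context reduced_map
begin

abbreviation "K\<phi> \<equiv> \<lambda>i. \<lambda>u \<in> carrier (trm (koszul g X) i). Duo (\<phi> i (lft u)) (\<phi> (i + 1) (rgt u))"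

lemma koszul_map: "x \<in> carrier (trm X i) \<Longrightarrow> y \<in> carrier (trm X (i + 1)) \<Longrightarrow>
    K\<phi> i (Duo x y) = Duo (\<phi> i x) (\<phi> (i + 1) y)"
  by simp

lemma chmap_koszul: "is_chmap A (koszul g X, K\<phi>, koszul g Y)"
proof (rule chmapI[OF X.cplx_koszul Y.cplx_koszul])
  fix i
  show "K\<phi> i \<in> lin_maps A (trm (koszul g X) i) (trm (koszul g Y) i)"
    unfolding lin_maps_def
  proof (intro CollectI conjI ballI PiE_I)
    fix u assume "u \<in> carrier (trm (koszul g X) i)"
    then obtain x y where u: "u = Duo x y" "x \<in> carrier (trm X i)" "y \<in> carrier (trm X (i + 1))" by auto
    show "K\<phi> i u \<in> carrier (trm (koszul g Y) i)"
      unfolding u(1) koszul_map[OF u(2,3)] using closed[OF u(2)] closed[OF u(3)] by simp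
    fix v assume "v \<in> carrier (trm (koszul g X) i)"
    then obtain x' y' where v: "v = Duo x' y'" "x' \<in> carrier (trm X i)" "y' \<in> carrier (trm X (i + 1))" by auto
    have s: "Duo a b \<oplus>\<^bsub>trm (koszul g Z) i\<^esub> Duo a' b' = Duo (a \<oplus>\<^bsub>trm Z i\<^esub> a') (b \<oplus>\<^bsub>trm Z (i + 1)\<^esub> b')"
      for a b a' b' and Z :: "('a, 'b) cplx" by simp
    show "K\<phi> i (u \<oplus>\<^bsub>trm (koszul g X) i\<^esub> v) = K\<phi> i u \<oplus>\<^bsub>trm (koszul g Y) i\<^esub> K\<phi> i v"
      unfolding u(1) v(1) s koszul_map[OF u(2,3)] koszul_map[OF v(2,3)]
        koszul_map[OF X.M.M.a_closed[OF u(2) v(2)] X.M.M.a_closed[OF u(3) v(3)]]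
        add[OF u(2) v(2)] add[OF u(3) v(3)] ..
  next
    fix a u assume a: "a \<in> carrier A" and "u \<in> carrier (trm (koszul g X) i)"
    then obtain x y where u: "u = Duo x y" "x \<in> carrier (trm X i)" "y \<in> carrier (trm X (i + 1))" by auto
    have s: "a \<odot>\<^bsub>trm (koszul g Z) i\<^esub> Duo x y = Duo (a \<odot>\<^bsub>trm Z i\<^esub> x) (a \<odot>\<^bsub>trm Z (i + 1)\<^esub> y)"
      for x y and Z :: "('a, 'b) cplx" by simp
    show "K\<phi> i (a \<odot>\<^bsub>trm (koszul g X) i\<^esub> u) = a \<odot>\<^bsub>trm (koszul g Y) i\<^esub> K\<phi> i u"
      unfolding u(1) s koszul_map[OF u(2,3)]
        koszul_map[OF X.M.smult_closed[OF a u(2)] X.M.smult_closed[OF a u(3)]]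
        smult[OF a u(2)] smult[OF a u(3)] ..
  qed (simp del: koszul_trm)
  fix u assume "u \<in> carrier (trm (koszul g X) i)"
  then obtain x y where u: "u = Duo x y" "x \<in> carrier (trm X i)" "y \<in> carrier (trm X (i + 1))" by auto
  note dxy = X.d_closed[OF u(2) refl] X.d_closed[OF u(3) refl]
  have c: "dif X i x \<oplus>\<^bsub>trm X (i + 1)\<^esub> g \<odot>\<^bsub>trm X (i + 1)\<^esub> y \<in> carrier (trm X (i + 1))"
    "\<ominus>\<^bsub>trm X (i + 1 + 1)\<^esub> dif X (i + 1) y \<in> carrier (trm X (i + 1 + 1))"
    using u dxy by simp_all
  show "K\<phi> (i + 1) (dif (koszul g X) i u) = dif (koszul g Y) i (K\<phi> i u)"
    unfolding u(1) koszul_d[OF u(2,3)] koszul_map[OF c] koszul_map[OF u(2,3)]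
      koszul_d[OF closed[OF u(2)] closed[OF u(3)]] d_comm[OF u(2) refl, symmetric] d_comm[OF u(3) refl, symmetric]
    using u dxy by (simp add: simps)
qed

sublocale K: chain_map A "koszul g X" "koszul g Y" K\<phi>
  by (rule chain_mapI[OF chmap_koszul])

end

lemma chmap_koszul_map:
  assumes "m \<in> Hom (Ch A) X Y" and g: "g \<in> carrier A"
  shows "far (koszul_functor g) m \<in> Hom (Ch A) (koszul g X) (koszul g Y)"
proof -
  obtain \<phi> where m: "m = (X, \<phi>, Y)" "is_chmap A (X, \<phi>, Y)" using assms by (auto simp: Ch_Hom)
  interpret reduced_map A X Y \<phi> g by (rule reduced_mapI[OF m(2) g])
  show ?thesis unfolding m far_koszul by (rule Ch_HomI[OF chmap_koszul])
qed

lemma koszul_proj_nat: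
  assumes "m \<in> Hom (Ch A) X Y" and g: "g \<in> carrier A"
  shows "Cmp (Ch A) (koszul_proj g Y) (far (koszul_functor g) m) =
    Cmp (Ch A) (far (tensor_functor g) m) (koszul_proj g X)"
proof -
  obtain \<phi> where m: "m = (X, \<phi>, Y)" "is_chmap A (X, \<phi>, Y)" using assms by (auto simp: Ch_Hom)
  interpret reduced_map A X Y \<phi> g by (rule reduced_mapI[OF m(2) g])
  show ?thesis
    unfolding m koszul_proj_def far_koszul far_tensor Ch_simps
  proof (rule chmap_eqI)
    fix i u assume u': "u \<in> carrier (trm (koszul g X) i)"
    then obtain x y where u: "u = Duo x y" "x \<in> carrier (trm X i)" "y \<in> carrier (trm X (i + 1))" by auto
    have K: "Duo (\<phi> i x) (\<phi> (i + 1) y) \<in> carrier (trm (koszul g Y) i)" using u by simp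
    show "compose (carrier (trm (koszul g X) i)) (\<lambda>u \<in> carrier (trm (koszul g Y) i). red g Y i (lft u)) (K\<phi> i) u =
      compose (carrier (trm (koszul g X) i)) (T\<phi> i) (\<lambda>u \<in> carrier (trm (koszul g X) i). red g X i (lft u)) u"
      unfolding compose_eq[OF u'] restrict_apply'[OF u'] unfolding u(1) univ.sel
        restrict_apply'[OF K] tensor_map[OF u(2)] ..
  qed simp_all
qed

section \<open>Comparing \<open>\<eta>\<^sub>f\<close> of the Koszul complex with the Koszul complex of \<open>\<eta>\<^sub>f\<close>\<close>

text \<open>
  From here on Koszul complexes of several complexes occur together, and their elements are written
  \<open>Duo x y\<close>. The terms are kept folded, so that facts about \<open>\<eta>\<^sub>f\<close> of a complex apply to \<open>koszul g X\<close>.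
\<close>

declare koszul_trm [simp del]

lemma koszul_simps:
  "carrier (trm (koszul g X) i) = {Duo x y | x y. x \<in> carrier (trm X i) \<and> y \<in> carrier (trm X (i + 1))}"
  "\<zero>\<^bsub>trm (koszul g X) i\<^esub> = Duo \<zero>\<^bsub>trm X i\<^esub> \<zero>\<^bsub>trm X (i + 1)\<^esub>"
  "Duo x y \<oplus>\<^bsub>trm (koszul g X) i\<^esub> Duo x' y' = Duo (x \<oplus>\<^bsub>trm X i\<^esub> x') (y \<oplus>\<^bsub>trm X (i + 1)\<^esub> y')"
  "a \<odot>\<^bsub>trm (koszul g X) i\<^esub> Duo x y = Duo (a \<odot>\<^bsub>trm X i\<^esub> x) (a \<odot>\<^bsub>trm X (i + 1)\<^esub> y)"
  by (simp_all add: koszul_trm)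

lemma koszul_closed: "x \<in> carrier (trm X i) \<Longrightarrow> y \<in> carrier (trm X (i + 1)) \<Longrightarrow>
    Duo x y \<in> carrier (trm (koszul g X) i)"
  by (simp add: koszul_simps)

text \<open>
  The element \<open>b\<close> is a cocycle of \<open>X/g\<close>, and \<open>hb\<close> is a coboundary there. So the class of \<open>b\<close> is
  \<open>h\<close>-torsion, hence zero: \<open>b\<close> itself is a coboundary modulo \<open>g\<close>.
\<close>

lemma (in reduction) torsionfree_cohomology_mod:
  assumes t: "torsionfree h (cohomology (tensor_cplx g X) (i + 1))" and h: "h \<in> carrier A"
    and b: "b \<in> carrier (trm X (i + 1))" and c: "c \<in> carrier (trm X (i + 1 + 1))"
    and a: "a \<in> carrier (trm X i)" and e: "e \<in> carrier (trm X (i + 1))"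
    and db: "d (i + 1) b = g \<odot>\<^bsub>trm X (i + 1 + 1)\<^esub> c"
    and hb: "h \<odot>\<^bsub>trm X (i + 1)\<^esub> b = g \<odot>\<^bsub>trm X (i + 1)\<^esub> e \<oplus>\<^bsub>trm X (i + 1)\<^esub> d i a"
  obtains v w where "v \<in> carrier (trm X (i + 1))" "w \<in> carrier (trm X i)"
    "b = g \<odot>\<^bsub>trm X (i + 1)\<^esub> v \<oplus>\<^bsub>trm X (i + 1)\<^esub> d i w"
proof -
  let ?T = "tensor_cplx g X" and ?j = "i + 1"
  interpret T: complex A ?T by unfold_locales (rule cplx_tensor)
  interpret Q: quotient A "cocycles ?T ?j" "coboundaries ?T ?j" by (rule T.quotient_cohomology)
  let ?b = "red g X ?j b" and ?cl = "qrep (cocycles ?T ?j) (coboundaries ?T ?j)"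
  note da = d_closed[OF a refl] and dbc = d_closed[OF b refl]
  have bT: "?b \<in> carrier (trm ?T ?j)" unfolding tensor_simps(1) by (rule imageI[OF b])
  have "dif ?T ?j ?b = \<zero>\<^bsub>trm ?T (?j + 1)\<^esub>"
    unfolding tensor_d[OF b] by (rule iffD2[OF red_zero_iff[OF dbc]]) (use db c in blast)
  then have bZ: "?b \<in> carrier (cocycles ?T ?j)" using bT by simp
  have "h \<odot>\<^bsub>cocycles ?T ?j\<^esub> ?b = red g X ?j (h \<odot>\<^bsub>trm X ?j\<^esub> b)"
    unfolding T.cocycles_simps tensor_simps(3)[OF h b] ..
  also have "\<dots> = dif ?T i (red g X i a)"
    unfolding tensor_d[OF a]
    by (rule iffD2[OF red_eq_iff[OF M.smult_closed[OF h b] da]]) (use hb e in blast)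
  finally have "h \<odot>\<^bsub>cocycles ?T ?j\<^esub> ?b \<in> coboundaries ?T ?j"
    unfolding T.coboundaries_Suc by (simp add: tensor_simps(1) a)
  then have "?cl (h \<odot>\<^bsub>cocycles ?T ?j\<^esub> ?b) = \<zero>\<^bsub>cohomology ?T ?j\<^esub>"
    unfolding cohomology_def Q.quot_mod_simps(2) by (rule Q.qrep_N)
  then have "h \<odot>\<^bsub>cohomology ?T ?j\<^esub> ?cl ?b = \<zero>\<^bsub>cohomology ?T ?j\<^esub>"
    unfolding cohomology_def Q.quot_mod_simps(4)[OF h bZ] .
  moreover have "?cl ?b \<in> carrier (cohomology ?T ?j)"
    unfolding cohomology_def Q.quot_mod_simps(1) by (rule imageI[OF bZ])
  ultimately have "?cl ?b = \<zero>\<^bsub>cohomology ?T ?j\<^esub>" using t unfolding torsionfree_def by blast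
  then have "?b \<in> coboundaries ?T ?j"
    unfolding cohomology_def Q.quot_mod_simps(2) Q.qrep_N_iff[OF bZ] .
  then obtain w where w: "w \<in> carrier (trm X i)" "?b = dif ?T i (red g X i w)"
    unfolding T.coboundaries_Suc tensor_simps(1) by blast
  note dw = d_closed[OF w(1) refl]
  show ?thesis
    using w(2) that w(1) unfolding tensor_d[OF w(1)] red_eq_iff[OF b dw] by blast
qed

locale koszul_eta_complex = torsionfree_complex A X f + reduction A X g
  for A :: "('a, 'r) ring_scheme" and X :: "('a, 'b) cplx" and f g
begin

sublocale K: torsionfree_complex A "koszul g X" f
  by (rule torsionfree_complexI[OF cplx_koszul f_closed torsionfree_koszul[OF tf]])

sublocale \<eta>: reduction A "eta A f X" g
  by (rule reductionI[OF cplx_eta g_closed])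

sublocale \<eta>K: complex A "eta A f (koszul g X)"
  by unfold_locales (rule K.cplx_eta)

sublocale K\<eta>: complex A "koszul g (eta A f X)"
  by unfold_locales (rule \<eta>.cplx_koszul)

abbreviation "ke \<equiv> \<lambda>i. \<lambda>u \<in> carrier (trm (koszul g (eta A f X)) i).
  mfrac A f (trm (koszul g X) i)
    (Duo ((f [^]\<^bsub>A\<^esub> den (rgt u)) \<odot>\<^bsub>trm X i\<^esub> num (lft u))
         ((f [^]\<^bsub>A\<^esub> den (lft u)) \<odot>\<^bsub>trm X (i + 1)\<^esub> num (rgt u)))
    (den (lft u) + den (rgt u))"

lemma koszul_eta_ke: "koszul_eta A f g X = (koszul g (eta A f X), ke, eta A f (koszul g X))"
  by (simp add: koszul_eta_def)

abbreviation "S i x \<equiv> s i i x"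
abbreviation "KS i u \<equiv> K.s i i u"

lemma S_eta: "x \<in> E i \<Longrightarrow> S i x \<in> carrier (trm (eta A f X) i)"
  unfolding eta_simps(1) by (rule imageI)

lemma K\<eta>_closed: "x \<in> E i \<Longrightarrow> y \<in> E (i + 1) \<Longrightarrow>
    Duo (S i x) (S (i + 1) y) \<in> carrier (trm (koszul g (eta A f X)) i)"
  by (rule koszul_closed[OF S_eta S_eta])

lemma K\<eta>_elem:
  assumes "u \<in> carrier (trm (koszul g (eta A f X)) i)"
  obtains x y where "x \<in> E i" "y \<in> E (i + 1)" "u = Duo (S i x) (S (i + 1) y)"
  using assms unfolding koszul_simps(1) eta_simps(1) by blast

text \<open>
  In terms of the bijections \<open>X\<^sup>i \<rightarrow> f\<^sup>iX\<^sup>i\<close>, the comparison map is \<open>(x, y) \<mapsto> (x, fy)\<close>: in degree \<open>i\<close>, the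
  second component is an element of \<open>f\<^sup>i\<^sup>+\<^sup>1X\<^sup>i\<^sup>+\<^sup>1\<close> on the left but of \<open>f\<^sup>iX\<^sup>i\<^sup>+\<^sup>1\<close> on the right.
\<close>

lemma ke_S:
  assumes x: "x \<in> E i" and y: "y \<in> E (i + 1)"
  shows "ke i (Duo (S i x) (S (i + 1) y)) = KS i (Duo x (f \<odot>\<^bsub>trm X (i + 1)\<^esub> y))"
proof -
  note xc = E_closed[OF x] and yc = E_closed[OF y]
  have fy: "f \<odot>\<^bsub>trm X (i + 1)\<^esub> y \<in> carrier (trm X (i + 1))" using yc by simp
  define n k where "n = num (S i x)" and "k = den (S i x)"
  define m l where "m = num (S (i + 1) y)" and "l = den (S (i + 1) y)"
  have n: "n \<in> carrier (trm X i)" "t.pow i (nat (- i)) n = t.pow i k (t.pow i (nat i) x)"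
    unfolding n_def k_def by (rule t.fscale_num_den[OF xc])+
  have m: "m \<in> carrier (trm X (i + 1))"
    "t.pow (i + 1) (nat (- i)) m = t.pow (i + 1) l (t.pow (i + 1) (nat i) (f \<odot>\<^bsub>trm X (i + 1)\<^esub> y))"
    unfolding m_def l_def t.fscale_Suc[OF yc] by (rule t.fscale_num_den[OF fy])+
  have 1: "t.pow i (nat (- i)) (t.pow i l n) = t.pow i (k + l) (t.pow i (nat i) x)"
    unfolding t.pow_comm[OF n(1), of "nat (- i)" l] n(2) t.pow_add[OF t.pow_closed[OF xc]]
    by (rule t.pow_comm) (use xc in simp)
  have 2: "t.pow (i + 1) (nat (- i)) (t.pow (i + 1) k m) =
      t.pow (i + 1) (k + l) (t.pow (i + 1) (nat i) (f \<odot>\<^bsub>trm X (i + 1)\<^esub> y))"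
    unfolding t.pow_comm[OF m(1), of "nat (- i)" k] m(2) t.pow_add[OF t.pow_closed[OF fy]] ..
  have c: "Duo (t.pow i l n) (t.pow (i + 1) k m) \<in> carrier (trm (koszul g X) i)"
    "Duo (t.pow i (nat i) x) (t.pow (i + 1) (nat i) (f \<odot>\<^bsub>trm X (i + 1)\<^esub> y)) \<in> carrier (trm (koszul g X) i)"
    by (rule koszul_closed[OF t.pow_closed[OF n(1)] t.pow_closed[OF m(1)]]
        koszul_closed[OF t.pow_closed[OF xc] t.pow_closed[OF fy]])+
  have "mfrac A f (trm (koszul g X) i) (Duo (t.pow i l n) (t.pow (i + 1) k m)) (k + l) =
      KS i (Duo x (f \<odot>\<^bsub>trm X (i + 1)\<^esub> y))"
    unfolding fscale_def koszul_simps(4) K.t.mfrac_eq_iff[OF c] 1 2 ..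
  then show ?thesis
    unfolding restrict_apply'[OF K\<eta>_closed[OF x y]] univ.sel n_def k_def m_def l_def .
qed

lemma eta_neg: "x \<in> E i \<Longrightarrow> \<ominus>\<^bsub>trm (eta A f X) i\<^esub> S i x = S i (\<ominus>\<^bsub>trm X i\<^esub> x)"
proof -
  assume x: "x \<in> E i"
  note xc = E_closed[OF x]
  have nx: "\<ominus>\<^bsub>trm X i\<^esub> x \<in> E i" using submodule_carrier(4)[OF module submodule_E x] .
  have "S i (\<ominus>\<^bsub>trm X i\<^esub> x) \<oplus>\<^bsub>trm (eta A f X) i\<^esub> S i x = \<zero>\<^bsub>trm (eta A f X) i\<^esub>"
    unfolding eta_simps(3)[OF E_closed[OF nx] xc] M.M.l_neg[OF xc] by (rule eta_simps(2)[symmetric])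
  then show ?thesis by (rule \<eta>.M.M.minus_equality[OF _ S_eta[OF x] S_eta[OF nx]])
qed

text \<open>
  The differential of \<open>\<eta>\<^sub>f(X \<otimes> B)\<close> in coordinates. It is the Koszul differential divided by \<open>f\<close>; as there
  is no operation for this division, the quotients \<open>a\<close>, \<open>b\<close> of its two components are parameters. The
  same convention is used for \<open>\<eta>\<^sub>f(X) \<otimes> B\<close> below, where the term \<open>gy\<close> is not divided: it is the
  second summand of a differential in \<open>\<eta>\<^sub>f(X)\<^sup>i\<^sup>+\<^sup>1\<close>, the degree that \<open>y\<close> already has.
\<close>

lemma K_d:
  assumes "x \<in> carrier (trm X i)" "y \<in> carrier (trm X (i + 1))" "a \<in> carrier (trm X (i + 1))"
    "b \<in> carrier (trm X (i + 1 + 1))"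
    "d i x \<oplus>\<^bsub>trm X (i + 1)\<^esub> g \<odot>\<^bsub>trm X (i + 1)\<^esub> y = f \<odot>\<^bsub>trm X (i + 1)\<^esub> a"
    "\<ominus>\<^bsub>trm X (i + 1 + 1)\<^esub> d (i + 1) y = f \<odot>\<^bsub>trm X (i + 1 + 1)\<^esub> b"
  shows "Duo x y \<in> K.E i" "dif (eta A f (koszul g X)) i (KS i (Duo x y)) = KS (i + 1) (Duo a b)"
proof -
  note c = koszul_closed[OF assms(1,2)] koszul_closed[OF assms(3,4)]
  have e: "dif (koszul g X) i (Duo x y) = f \<odot>\<^bsub>trm (koszul g X) (i + 1)\<^esub> Duo a b"
    unfolding koszul_d[OF assms(1,2)] koszul_simps(4) assms(5,6) ..
  show "Duo x y \<in> K.E i" unfolding K.E_def using c e by blast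
  show "dif (eta A f (koszul g X)) i (KS i (Duo x y)) = KS (i + 1) (Duo a b)"
    by (rule K.eta_d_div[OF c e])
qed

lemma K_E_elem:
  assumes "u \<in> K.E i"
  obtains x y a b where "u = Duo x y" "x \<in> carrier (trm X i)" "y \<in> carrier (trm X (i + 1))"
    "a \<in> carrier (trm X (i + 1))" "b \<in> carrier (trm X (i + 1 + 1))"
    "d i x \<oplus>\<^bsub>trm X (i + 1)\<^esub> g \<odot>\<^bsub>trm X (i + 1)\<^esub> y = f \<odot>\<^bsub>trm X (i + 1)\<^esub> a"
    "\<ominus>\<^bsub>trm X (i + 1 + 1)\<^esub> d (i + 1) y = f \<odot>\<^bsub>trm X (i + 1 + 1)\<^esub> b"
proof -
  obtain v where u: "u \<in> carrier (trm (koszul g X) i)" and v: "v \<in> carrier (trm (koszul g X) (i + 1))"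
    and e: "dif (koszul g X) i u = f \<odot>\<^bsub>trm (koszul g X) (i + 1)\<^esub> v"
    using assms unfolding K.E_def by blast
  obtain x y where xy: "u = Duo x y" "x \<in> carrier (trm X i)" "y \<in> carrier (trm X (i + 1))"
    using u unfolding koszul_simps(1) by blast
  obtain a b where ab: "v = Duo a b" "a \<in> carrier (trm X (i + 1))" "b \<in> carrier (trm X (i + 1 + 1))"
    using v unfolding koszul_simps(1) by blast
  show ?thesis
    using that[OF xy ab(2,3)] e unfolding xy(1) ab(1) koszul_d[OF xy(2,3)] koszul_simps(4) univ.inject by blast
qed

lemma K\<eta>_d:
  assumes x: "x \<in> carrier (trm X i)" "a \<in> carrier (trm X (i + 1))" "d i x = f \<odot>\<^bsub>trm X (i + 1)\<^esub> a"
    and y: "y \<in> carrier (trm X (i + 1))" "b \<in> carrier (trm X (i + 1 + 1))"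
      "d (i + 1) y = f \<odot>\<^bsub>trm X (i + 1 + 1)\<^esub> b"
  shows "x \<in> E i" "y \<in> E (i + 1)"
    "a \<oplus>\<^bsub>trm X (i + 1)\<^esub> g \<odot>\<^bsub>trm X (i + 1)\<^esub> y \<in> E (i + 1)" "\<ominus>\<^bsub>trm X (i + 1 + 1)\<^esub> b \<in> E (i + 1 + 1)"
    "dif (koszul g (eta A f X)) i (Duo (S i x) (S (i + 1) y)) =
      Duo (S (i + 1) (a \<oplus>\<^bsub>trm X (i + 1)\<^esub> g \<odot>\<^bsub>trm X (i + 1)\<^esub> y)) (S (i + 1 + 1) (\<ominus>\<^bsub>trm X (i + 1 + 1)\<^esub> b))"
proof -
  show xE: "x \<in> E i" and yE: "y \<in> E (i + 1)" unfolding E_def using x y by blast+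
  note aE = E_cocycle[OF x(2) div_cocycle[OF x]] and bE = E_cocycle[OF y(2) div_cocycle[OF y]]
  note gy = E_smult[OF g_closed yE]
  show "a \<oplus>\<^bsub>trm X (i + 1)\<^esub> g \<odot>\<^bsub>trm X (i + 1)\<^esub> y \<in> E (i + 1)" by (rule E_add[OF aE gy])
  show "\<ominus>\<^bsub>trm X (i + 1 + 1)\<^esub> b \<in> E (i + 1 + 1)" using submodule_carrier(4)[OF module submodule_E bE] .
  show "dif (koszul g (eta A f X)) i (Duo (S i x) (S (i + 1) y)) =
      Duo (S (i + 1) (a \<oplus>\<^bsub>trm X (i + 1)\<^esub> g \<odot>\<^bsub>trm X (i + 1)\<^esub> y)) (S (i + 1 + 1) (\<ominus>\<^bsub>trm X (i + 1 + 1)\<^esub> b))"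
    unfolding koszul_d[OF S_eta[OF xE] S_eta[OF yE]] eta_d_div[OF x] eta_d_div[OF y]
      eta_simps(4)[OF g_closed y(1)] eta_simps(3)[OF x(2) E_closed[OF gy]] eta_neg[OF bE] ..
qed

lemma K\<eta>_elem':
  assumes "u \<in> carrier (trm (koszul g (eta A f X)) i)"
  obtains x y a b where "u = Duo (S i x) (S (i + 1) y)"
    "x \<in> carrier (trm X i)" "a \<in> carrier (trm X (i + 1))" "d i x = f \<odot>\<^bsub>trm X (i + 1)\<^esub> a"
    "y \<in> carrier (trm X (i + 1))" "b \<in> carrier (trm X (i + 1 + 1))"
    "d (i + 1) y = f \<odot>\<^bsub>trm X (i + 1 + 1)\<^esub> b"
  by (rule K\<eta>_elem[OF assms]) (use that in \<open>auto simp only: E_def mem_Collect_eq\<close>)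

lemma ke_closed:
  assumes x: "x \<in> carrier (trm X i)" "a \<in> carrier (trm X (i + 1))" "d i x = f \<odot>\<^bsub>trm X (i + 1)\<^esub> a"
    and y: "y \<in> carrier (trm X (i + 1))" "b \<in> carrier (trm X (i + 1 + 1))"
      "d (i + 1) y = f \<odot>\<^bsub>trm X (i + 1 + 1)\<^esub> b"
  shows "Duo x (f \<odot>\<^bsub>trm X (i + 1)\<^esub> y) \<in> K.E i"
    "dif (eta A f (koszul g X)) i (KS i (Duo x (f \<odot>\<^bsub>trm X (i + 1)\<^esub> y))) =
      KS (i + 1) (Duo (a \<oplus>\<^bsub>trm X (i + 1)\<^esub> g \<odot>\<^bsub>trm X (i + 1)\<^esub> y)
        (f \<odot>\<^bsub>trm X (i + 1 + 1)\<^esub> \<ominus>\<^bsub>trm X (i + 1 + 1)\<^esub> b))"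
proof -
  note yd = d_closed[OF y(1) refl]
  have c: "f \<odot>\<^bsub>trm X (i + 1)\<^esub> y \<in> carrier (trm X (i + 1))"
    "a \<oplus>\<^bsub>trm X (i + 1)\<^esub> g \<odot>\<^bsub>trm X (i + 1)\<^esub> y \<in> carrier (trm X (i + 1))"
    "f \<odot>\<^bsub>trm X (i + 1 + 1)\<^esub> \<ominus>\<^bsub>trm X (i + 1 + 1)\<^esub> b \<in> carrier (trm X (i + 1 + 1))"
    using x y by simp_all
  have 1: "d i x \<oplus>\<^bsub>trm X (i + 1)\<^esub> g \<odot>\<^bsub>trm X (i + 1)\<^esub> (f \<odot>\<^bsub>trm X (i + 1)\<^esub> y) =
      f \<odot>\<^bsub>trm X (i + 1)\<^esub> (a \<oplus>\<^bsub>trm X (i + 1)\<^esub> g \<odot>\<^bsub>trm X (i + 1)\<^esub> y)"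
    unfolding x(3) M.smult_comm[OF g_closed f_closed y(1)]
    using x(2) y(1) f_closed g_closed by (simp add: M.smult_r_distr)
  have 2: "\<ominus>\<^bsub>trm X (i + 1 + 1)\<^esub> d (i + 1) (f \<odot>\<^bsub>trm X (i + 1)\<^esub> y) =
      f \<odot>\<^bsub>trm X (i + 1 + 1)\<^esub> (f \<odot>\<^bsub>trm X (i + 1 + 1)\<^esub> \<ominus>\<^bsub>trm X (i + 1 + 1)\<^esub> b)"
    unfolding d_smult[OF f_closed y(1)] y(3) using y(2) f_closed by algebra
  show "Duo x (f \<odot>\<^bsub>trm X (i + 1)\<^esub> y) \<in> K.E i"
    "dif (eta A f (koszul g X)) i (KS i (Duo x (f \<odot>\<^bsub>trm X (i + 1)\<^esub> y))) =
      KS (i + 1) (Duo (a \<oplus>\<^bsub>trm X (i + 1)\<^esub> g \<odot>\<^bsub>trm X (i + 1)\<^esub> y)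
        (f \<odot>\<^bsub>trm X (i + 1 + 1)\<^esub> \<ominus>\<^bsub>trm X (i + 1 + 1)\<^esub> b))"
    by (rule K_d[OF x(1) c(1,2,3) 1 2])+
qed

lemma chmap_koszul_eta: "is_chmap A (koszul_eta A f g X)"
  unfolding koszul_eta_ke
proof (rule chmapI[OF \<eta>.cplx_koszul K.cplx_eta])
  fix i
  show "ke i \<in> lin_maps A (trm (koszul g (eta A f X)) i) (trm (eta A f (koszul g X)) i)"
    unfolding lin_maps_def
  proof (intro CollectI conjI ballI PiE_I)
    fix u assume u: "u \<in> carrier (trm (koszul g (eta A f X)) i)"
    obtain x y a b where xy: "u = Duo (S i x) (S (i + 1) y)"
      and X: "x \<in> carrier (trm X i)" "a \<in> carrier (trm X (i + 1))" "d i x = f \<odot>\<^bsub>trm X (i + 1)\<^esub> a"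
      and Y: "y \<in> carrier (trm X (i + 1))" "b \<in> carrier (trm X (i + 1 + 1))"
        "d (i + 1) y = f \<odot>\<^bsub>trm X (i + 1 + 1)\<^esub> b"
      using K\<eta>_elem'[OF u] .
    note E = K\<eta>_d(1,2)[OF X Y]
    show "ke i u \<in> carrier (trm (eta A f (koszul g X)) i)"
      unfolding xy ke_S[OF E] K.eta_simps(1) by (rule imageI[OF ke_closed(1)[OF X Y]])
    fix v assume v: "v \<in> carrier (trm (koszul g (eta A f X)) i)"
    obtain x' y' where xy': "x' \<in> E i" "y' \<in> E (i + 1)" "v = Duo (S i x') (S (i + 1) y')"
      using K\<eta>_elem[OF v] .
    note c' = E_closed[OF xy'(1)] E_closed[OF xy'(2)]
    have uv: "u \<oplus>\<^bsub>trm (koszul g (eta A f X)) i\<^esub> v = Duo (S i (x \<oplus>\<^bsub>trm X i\<^esub> x')) (S (i + 1) (y \<oplus>\<^bsub>trm X (i + 1)\<^esub> y'))"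
      unfolding xy xy'(3) koszul_simps(3) eta_simps(3)[OF X(1) c'(1)] eta_simps(3)[OF Y(1) c'(2)] ..
    have f: "f \<odot>\<^bsub>trm X (i + 1)\<^esub> y \<in> carrier (trm X (i + 1))" "f \<odot>\<^bsub>trm X (i + 1)\<^esub> y' \<in> carrier (trm X (i + 1))"
      using Y c' by simp_all
    show "ke i (u \<oplus>\<^bsub>trm (koszul g (eta A f X)) i\<^esub> v) = ke i u \<oplus>\<^bsub>trm (eta A f (koszul g X)) i\<^esub> ke i v"
      unfolding uv ke_S[OF E_add[OF E(1) xy'(1)] E_add[OF E(2) xy'(2)]]
      unfolding xy xy'(3) ke_S[OF E] ke_S[OF xy'(1,2)]
        K.eta_simps(3)[OF koszul_closed[OF X(1) f(1)] koszul_closed[OF c'(1) f(2)]] koszul_simps(3)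
        M.smult_r_distr[OF f_closed Y(1) c'(2)] ..
  next
    fix c u assume c: "c \<in> carrier A" and u: "u \<in> carrier (trm (koszul g (eta A f X)) i)"
    obtain x y where xy: "x \<in> E i" "y \<in> E (i + 1)" "u = Duo (S i x) (S (i + 1) y)"
      using K\<eta>_elem[OF u] .
    note cl = E_closed[OF xy(1)] E_closed[OF xy(2)]
    have cu: "c \<odot>\<^bsub>trm (koszul g (eta A f X)) i\<^esub> u = Duo (S i (c \<odot>\<^bsub>trm X i\<^esub> x)) (S (i + 1) (c \<odot>\<^bsub>trm X (i + 1)\<^esub> y))"
      unfolding xy(3) koszul_simps(4) eta_simps(4)[OF c cl(1)] eta_simps(4)[OF c cl(2)] ..
    show "ke i (c \<odot>\<^bsub>trm (koszul g (eta A f X)) i\<^esub> u) = c \<odot>\<^bsub>trm (eta A f (koszul g X)) i\<^esub> ke i u"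
      unfolding cu ke_S[OF E_smult[OF c xy(1)] E_smult[OF c xy(2)]]
      unfolding xy(3) ke_S[OF xy(1,2)] K.eta_simps(4)[OF c koszul_closed[OF cl(1) M.smult_closed[OF f_closed cl(2)]]]
        koszul_simps(4) M.smult_comm[OF f_closed c cl(2)] ..
  qed simp
  fix u assume u: "u \<in> carrier (trm (koszul g (eta A f X)) i)"
  obtain x y a b where xy: "u = Duo (S i x) (S (i + 1) y)"
    and X: "x \<in> carrier (trm X i)" "a \<in> carrier (trm X (i + 1))" "d i x = f \<odot>\<^bsub>trm X (i + 1)\<^esub> a"
    and Y: "y \<in> carrier (trm X (i + 1))" "b \<in> carrier (trm X (i + 1 + 1))"
      "d (i + 1) y = f \<odot>\<^bsub>trm X (i + 1 + 1)\<^esub> b"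
    using K\<eta>_elem'[OF u] .
  note E = K\<eta>_d[OF X Y]
  show "ke (i + 1) (dif (koszul g (eta A f X)) i u) = dif (eta A f (koszul g X)) i (ke i u)"
    unfolding xy E(5) ke_S[OF E(1,2)] ke_S[OF E(3,4)] ke_closed(2)[OF X Y] ..
qed

sublocale ke: chain_map A "koszul g (eta A f X)" "eta A f (koszul g X)" ke
  by (rule chain_mapI) (rule chmap_koszul_eta[unfolded koszul_eta_ke])

text \<open>
  The comparison map is \<open>(x, y) \<mapsto> (x, fy)\<close>, and all differentials are divided by \<open>f\<close>. Injectivity: let
  \<open>(x, fy)\<close> be the coboundary of \<open>(a, b)\<close>, that is \<open>da + gb = fx\<close> and \<open>-db = f\<^sup>2y\<close>. Then \<open>gb\<close> is a
  coboundary modulo \<open>f\<close>, so \<open>b = fv + dw\<close> by the hypothesis, and \<open>(x, y)\<close> is the coboundary of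
  \<open>(a + gw, v)\<close>. Surjectivity: a cocycle \<open>(x, y)\<close> of \<open>\<eta>\<^sub>f(X \<otimes> B)\<close> satisfies \<open>dx + gy = 0\<close> and \<open>dy = 0\<close>.
  Again \<open>y = fv + dw\<close>, and subtracting the coboundary \<open>(-gw, dw)\<close> of \<open>(0, -fw)\<close> leaves
  \<open>(x + gw, fv)\<close>, which is the image of \<open>(x + gw, v)\<close>.
\<close>

lemma qis_koszul_eta:
  assumes tors: "\<And>i. torsionfree g (cohomology (tensor_cplx f X) i)"
  shows "koszul_eta A f g X \<in> qis A"
  unfolding koszul_eta_ke
proof (rule ke.qisI, goal_cases)
  case (1 i u u')
  let ?j = "i + 1" and ?k = "i + 1 + 1"
  interpret F: reduction A X f by (rule reductionI[OF cplx f_closed])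
  obtain x y where xy: "x \<in> E ?j" "y \<in> E ?k" "u = Duo (S ?j x) (S ?k y)" using K\<eta>_elem[OF 1(1)] .
  note xc = E_closed[OF xy(1)] and yc = E_closed[OF xy(2)]
  have fy: "f \<odot>\<^bsub>trm X ?k\<^esub> y \<in> carrier (trm X ?k)" using yc by simp
  obtain ab where ab: "ab \<in> K.E i" "u' = KS i ab" using 1(3) unfolding K.eta_simps(1) by blast
  obtain a b a1 b1 where "ab = Duo a b" and a: "a \<in> carrier (trm X i)" and b: "b \<in> carrier (trm X ?j)"
    and a1: "a1 \<in> carrier (trm X ?j)" and b1: "b1 \<in> carrier (trm X ?k)"
    and e1: "d i a \<oplus>\<^bsub>trm X ?j\<^esub> g \<odot>\<^bsub>trm X ?j\<^esub> b = f \<odot>\<^bsub>trm X ?j\<^esub> a1"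
    and e2: "\<ominus>\<^bsub>trm X ?k\<^esub> d ?j b = f \<odot>\<^bsub>trm X ?k\<^esub> b1"
    using K_E_elem[OF ab(1)] .
  note da = d_closed[OF a refl] and db = d_closed[OF b refl]
  have "KS ?j (Duo x (f \<odot>\<^bsub>trm X ?k\<^esub> y)) = KS ?j (Duo a1 b1)"
    using 1(4) unfolding ab(2) \<open>ab = Duo a b\<close> K_d(2)[OF a b a1 b1 e1 e2] xy(3) ke_S[OF xy(1,2)] .
  then have eq: "a1 = x" "b1 = f \<odot>\<^bsub>trm X ?k\<^esub> y"
    unfolding K.t.fscale_eq_iff[OF koszul_closed[OF xc fy] koszul_closed[OF a1 b1]] by simp_all
  have gb: "g \<odot>\<^bsub>trm X ?j\<^esub> b = f \<odot>\<^bsub>trm X ?j\<^esub> x \<oplus>\<^bsub>trm X ?j\<^esub> d i (\<ominus>\<^bsub>trm X i\<^esub> a)"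
  proof -
    have "g \<odot>\<^bsub>trm X ?j\<^esub> b = (d i a \<oplus>\<^bsub>trm X ?j\<^esub> g \<odot>\<^bsub>trm X ?j\<^esub> b) \<ominus>\<^bsub>trm X ?j\<^esub> d i a"
      using da b g_closed by algebra
    then show ?thesis unfolding e1 eq(1) d_neg[OF a] M.M.minus_eq .
  qed
  have db': "d ?j b = f \<odot>\<^bsub>trm X ?k\<^esub> (\<ominus>\<^bsub>trm X ?k\<^esub> (f \<odot>\<^bsub>trm X ?k\<^esub> y))"
  proof -
    have "d ?j b = \<ominus>\<^bsub>trm X ?k\<^esub> (\<ominus>\<^bsub>trm X ?k\<^esub> d ?j b)" using db by algebra
    also have "\<dots> = f \<odot>\<^bsub>trm X ?k\<^esub> (\<ominus>\<^bsub>trm X ?k\<^esub> (f \<odot>\<^bsub>trm X ?k\<^esub> y))"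
      unfolding e2 eq(2) using yc f_closed by algebra
    finally show ?thesis .
  qed
  obtain v w where v: "v \<in> carrier (trm X ?j)" and w: "w \<in> carrier (trm X i)"
    and bv: "b = f \<odot>\<^bsub>trm X ?j\<^esub> v \<oplus>\<^bsub>trm X ?j\<^esub> d i w"
    using F.torsionfree_cohomology_mod[OF tors g_closed b M.M.a_inv_closed[OF fy] M.M.a_inv_closed[OF a] xc db' gb] .
  note dw = d_closed[OF w refl] and dv = d_closed[OF v refl]
  have dv': "d ?j v = f \<odot>\<^bsub>trm X ?k\<^esub> \<ominus>\<^bsub>trm X ?k\<^esub> y"
  proof (rule torsionfree_cancel[OF module tf f_closed dv])
    have "f \<odot>\<^bsub>trm X ?k\<^esub> d ?j v = d ?j b"
      unfolding bv d_add[OF M.smult_closed[OF f_closed v] dw] dd[OF w refl] d_smult[OF f_closed v]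
      using dv by simp
    also have "\<dots> = f \<odot>\<^bsub>trm X ?k\<^esub> (f \<odot>\<^bsub>trm X ?k\<^esub> \<ominus>\<^bsub>trm X ?k\<^esub> y)"
      unfolding db' using yc f_closed by algebra
    finally show "f \<odot>\<^bsub>trm X ?k\<^esub> d ?j v = f \<odot>\<^bsub>trm X ?k\<^esub> (f \<odot>\<^bsub>trm X ?k\<^esub> \<ominus>\<^bsub>trm X ?k\<^esub> y)" .
  qed (use yc in simp)
  let ?a = "a \<oplus>\<^bsub>trm X i\<^esub> g \<odot>\<^bsub>trm X i\<^esub> w" and ?x = "x \<ominus>\<^bsub>trm X ?j\<^esub> g \<odot>\<^bsub>trm X ?j\<^esub> v"
  have ac: "?a \<in> carrier (trm X i)" and xc': "?x \<in> carrier (trm X ?j)" and nyc: "\<ominus>\<^bsub>trm X ?k\<^esub> y \<in> carrier (trm X ?k)"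
    using a w xc v yc by simp_all
  have "d i ?a = f \<odot>\<^bsub>trm X ?j\<^esub> ?x"
  proof -
    have "d i ?a = d i a \<oplus>\<^bsub>trm X ?j\<^esub> g \<odot>\<^bsub>trm X ?j\<^esub> d i w"
      unfolding d_add[OF a M.smult_closed[OF g_closed w]] d_smult[OF g_closed w] ..
    also have "\<dots> = (d i a \<oplus>\<^bsub>trm X ?j\<^esub> g \<odot>\<^bsub>trm X ?j\<^esub> b) \<ominus>\<^bsub>trm X ?j\<^esub> g \<odot>\<^bsub>trm X ?j\<^esub> (f \<odot>\<^bsub>trm X ?j\<^esub> v)"
      unfolding bv using da dw v f_closed g_closed by algebra
    also have "\<dots> = f \<odot>\<^bsub>trm X ?j\<^esub> ?x"
      unfolding e1 eq(1) M.smult_comm[OF g_closed f_closed v] using xc v f_closed g_closed by algebra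
    finally show ?thesis .
  qed
  note D = K\<eta>_d[OF ac xc' this v nyc dv']
  have "?x \<oplus>\<^bsub>trm X ?j\<^esub> g \<odot>\<^bsub>trm X ?j\<^esub> v = x" "\<ominus>\<^bsub>trm X ?k\<^esub> (\<ominus>\<^bsub>trm X ?k\<^esub> y) = y"
    using xc v yc g_closed by algebra+
  then have "u = dif (koszul g (eta A f X)) i (Duo (S i ?a) (S ?j v))"
    unfolding D(5) xy(3) by simp
  then show ?case by (rule bexI[OF _ K\<eta>_closed[OF D(1,2)]])
next
  case (2 i u)
  let ?j = "i + 1" and ?k = "i + 1 + 1"
  interpret F: reduction A X f by (rule reductionI[OF cplx f_closed])
  obtain xy where xy: "xy \<in> K.E ?j" "u = KS ?j xy" using 2(1) unfolding K.eta_simps(1) by blast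
  obtain x y x1 y1 where "xy = Duo x y" and x: "x \<in> carrier (trm X ?j)" and y: "y \<in> carrier (trm X ?k)"
    and x1: "x1 \<in> carrier (trm X ?k)" and y1: "y1 \<in> carrier (trm X (?k + 1))"
    and e1: "d ?j x \<oplus>\<^bsub>trm X ?k\<^esub> g \<odot>\<^bsub>trm X ?k\<^esub> y = f \<odot>\<^bsub>trm X ?k\<^esub> x1"
    and e2: "\<ominus>\<^bsub>trm X (?k + 1)\<^esub> d ?k y = f \<odot>\<^bsub>trm X (?k + 1)\<^esub> y1"
    using K_E_elem[OF xy(1)] .
  note dx = d_closed[OF x refl] and dy = d_closed[OF y refl]
  have z: "\<zero>\<^bsub>trm X j\<^esub> \<in> carrier (trm X j)" for j by simp
  have "KS ?k (Duo x1 y1) = KS ?k (Duo \<zero>\<^bsub>trm X ?k\<^esub> \<zero>\<^bsub>trm X (?k + 1)\<^esub>)"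
    using 2(2) unfolding xy(2) \<open>xy = Duo x y\<close> K_d(2)[OF x y x1 y1 e1 e2] K.eta_simps(2)[of ?k ?k] koszul_simps(2) .
  then have eq: "x1 = \<zero>\<^bsub>trm X ?k\<^esub>" "y1 = \<zero>\<^bsub>trm X (?k + 1)\<^esub>"
    unfolding K.t.fscale_eq_iff[OF koszul_closed[OF x1 y1] koszul_closed[OF z z]] by simp_all
  have gy: "g \<odot>\<^bsub>trm X ?k\<^esub> y = f \<odot>\<^bsub>trm X ?k\<^esub> \<zero>\<^bsub>trm X ?k\<^esub> \<oplus>\<^bsub>trm X ?k\<^esub> d ?j (\<ominus>\<^bsub>trm X ?j\<^esub> x)"
  proof -
    have "g \<odot>\<^bsub>trm X ?k\<^esub> y = (d ?j x \<oplus>\<^bsub>trm X ?k\<^esub> g \<odot>\<^bsub>trm X ?k\<^esub> y) \<ominus>\<^bsub>trm X ?k\<^esub> d ?j x"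
      using dx y g_closed by algebra
    then show ?thesis unfolding e1 eq(1) d_neg[OF x] M.M.minus_eq .
  qed
  have dy': "d ?k y = f \<odot>\<^bsub>trm X (?k + 1)\<^esub> \<zero>\<^bsub>trm X (?k + 1)\<^esub>"
  proof -
    have "d ?k y = \<ominus>\<^bsub>trm X (?k + 1)\<^esub> (\<ominus>\<^bsub>trm X (?k + 1)\<^esub> d ?k y)" using dy by algebra
    then show ?thesis unfolding e2 eq(2) by simp
  qed
  obtain v w where v: "v \<in> carrier (trm X ?k)" and w: "w \<in> carrier (trm X ?j)"
    and yv: "y = f \<odot>\<^bsub>trm X ?k\<^esub> v \<oplus>\<^bsub>trm X ?k\<^esub> d ?j w"
    using F.torsionfree_cohomology_mod[OF tors g_closed y z M.M.a_inv_closed[OF x] z dy' gy] .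
  note dw = d_closed[OF w refl] and dv = d_closed[OF v refl]
  have dv': "d ?k v = f \<odot>\<^bsub>trm X (?k + 1)\<^esub> \<zero>\<^bsub>trm X (?k + 1)\<^esub>"
  proof -
    have "d ?k v = \<zero>\<^bsub>trm X (?k + 1)\<^esub>"
    proof (rule torsionfree_cancel[OF module tf f_closed dv z])
      have "f \<odot>\<^bsub>trm X (?k + 1)\<^esub> d ?k v = d ?k y"
        unfolding yv d_add[OF M.smult_closed[OF f_closed v] dw] dd[OF w refl] d_smult[OF f_closed v]
        using dv by simp
      then show "f \<odot>\<^bsub>trm X (?k + 1)\<^esub> d ?k v = f \<odot>\<^bsub>trm X (?k + 1)\<^esub> \<zero>\<^bsub>trm X (?k + 1)\<^esub>"
        unfolding dy' .
    qed
    then show ?thesis by simp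
  qed
  let ?x = "x \<oplus>\<^bsub>trm X ?j\<^esub> g \<odot>\<^bsub>trm X ?j\<^esub> w" and ?a = "\<ominus>\<^bsub>trm X ?k\<^esub> (g \<odot>\<^bsub>trm X ?k\<^esub> v)"
  have xc: "?x \<in> carrier (trm X ?j)" and ac: "?a \<in> carrier (trm X ?k)" using x w v by simp_all
  have dx': "d ?j ?x = f \<odot>\<^bsub>trm X ?k\<^esub> ?a"
  proof -
    have "d ?j ?x = d ?j x \<oplus>\<^bsub>trm X ?k\<^esub> g \<odot>\<^bsub>trm X ?k\<^esub> d ?j w"
      unfolding d_add[OF x M.smult_closed[OF g_closed w]] d_smult[OF g_closed w] ..
    also have "\<dots> = (d ?j x \<oplus>\<^bsub>trm X ?k\<^esub> g \<odot>\<^bsub>trm X ?k\<^esub> y) \<ominus>\<^bsub>trm X ?k\<^esub> g \<odot>\<^bsub>trm X ?k\<^esub> (f \<odot>\<^bsub>trm X ?k\<^esub> v)"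
      unfolding yv using dx dw v f_closed g_closed by algebra
    also have "\<dots> = f \<odot>\<^bsub>trm X ?k\<^esub> ?a"
      unfolding e1 eq(1) M.smult_comm[OF g_closed f_closed v] using v f_closed g_closed by algebra
    finally show ?thesis .
  qed
  let ?z = "Duo (S ?j ?x) (S ?k v)"
  note D = K\<eta>_d[OF xc ac dx' v z dv']
  have "?a \<oplus>\<^bsub>trm X ?k\<^esub> g \<odot>\<^bsub>trm X ?k\<^esub> v = \<zero>\<^bsub>trm X ?k\<^esub>"
    "\<ominus>\<^bsub>trm X (?k + 1)\<^esub> \<zero>\<^bsub>trm X (?k + 1)\<^esub> = \<zero>\<^bsub>trm X (?k + 1)\<^esub>"
    using v g_closed by (algebra, simp)
  then have dz: "dif (koszul g (eta A f X)) ?j ?z = \<zero>\<^bsub>trm (koszul g (eta A f X)) ?k\<^esub>"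
    unfolding D(5) koszul_simps(2) eta_simps(2)[of ?k ?k] eta_simps(2)[of "?k + 1" "?k + 1"] by simp
  let ?w = "\<ominus>\<^bsub>trm X ?j\<^esub> (f \<odot>\<^bsub>trm X ?j\<^esub> w)" and ?gw = "\<ominus>\<^bsub>trm X ?j\<^esub> (g \<odot>\<^bsub>trm X ?j\<^esub> w)"
  have wc: "?w \<in> carrier (trm X ?j)" "?gw \<in> carrier (trm X ?j)" using w by simp_all
  have w1: "d i \<zero>\<^bsub>trm X i\<^esub> \<oplus>\<^bsub>trm X ?j\<^esub> g \<odot>\<^bsub>trm X ?j\<^esub> ?w = f \<odot>\<^bsub>trm X ?j\<^esub> ?gw"
  proof -
    have "g \<odot>\<^bsub>trm X ?j\<^esub> ?w = \<ominus>\<^bsub>trm X ?j\<^esub> (g \<odot>\<^bsub>trm X ?j\<^esub> (f \<odot>\<^bsub>trm X ?j\<^esub> w))"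
      using w f_closed g_closed by algebra
    also have "\<dots> = f \<odot>\<^bsub>trm X ?j\<^esub> ?gw"
      unfolding M.smult_comm[OF g_closed f_closed w] using w f_closed g_closed by algebra
    finally show ?thesis unfolding d_zero using wc by simp
  qed
  have w2: "\<ominus>\<^bsub>trm X ?k\<^esub> d ?j ?w = f \<odot>\<^bsub>trm X ?k\<^esub> d ?j w"
    unfolding d_neg[OF M.smult_closed[OF f_closed w]] d_smult[OF f_closed w] using dw f_closed by algebra
  note W = K_d[OF z wc dw w1 w2]
  have fv: "f \<odot>\<^bsub>trm X ?k\<^esub> v \<in> carrier (trm X ?k)" using v by simp
  have "?gw \<oplus>\<^bsub>trm X ?j\<^esub> ?x = x" using x w g_closed by algebra
  moreover have "d ?j w \<oplus>\<^bsub>trm X ?k\<^esub> f \<odot>\<^bsub>trm X ?k\<^esub> v = y" unfolding yv by (rule M.M.a_comm[OF dw fv])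
  ultimately have "u = dif (eta A f (koszul g X)) i (KS i (Duo \<zero>\<^bsub>trm X i\<^esub> ?w))
      \<oplus>\<^bsub>trm (eta A f (koszul g X)) ?j\<^esub> ke ?j ?z"
    unfolding W(2) ke_S[OF D(1,2)] K.eta_simps(3)[OF koszul_closed[OF wc(2) dw] koszul_closed[OF xc fv]]
      koszul_simps(3) xy(2) \<open>xy = Duo x y\<close> by simp
  moreover have "KS i (Duo \<zero>\<^bsub>trm X i\<^esub> ?w) \<in> carrier (trm (eta A f (koszul g X)) i)"
    unfolding K.eta_simps(1) by (rule imageI[OF W(1)])
  ultimately have "\<exists>y \<in> carrier (trm (eta A f (koszul g X)) i).
      u = dif (eta A f (koszul g X)) i y \<oplus>\<^bsub>trm (eta A f (koszul g X)) ?j\<^esub> ke ?j ?z"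
    by (rule bexI)
  with dz show ?case by (intro bexI[OF _ K\<eta>_closed[OF D(1,2)]] conjI)
qed

end

lemma koszul_eta_complexI: "is_cplx A X \<Longrightarrow> f \<in> carrier A \<Longrightarrow> g \<in> carrier A \<Longrightarrow>
    (\<And>i. torsionfree f (trm X i)) \<Longrightarrow> koszul_eta_complex A X f g"
  by (intro koszul_eta_complex.intro torsionfree_complexI reductionI)

lemma koszul_eta_nat:
  assumes m: "m \<in> Hom (Ch A) X Y" and f: "f \<in> carrier A" and g: "g \<in> carrier A"
    and X: "\<And>i. torsionfree f (trm X i)" and Y: "\<And>i. torsionfree f (trm Y i)"
  shows "Cmp (Ch A) (koszul_eta A f g Y) (far (koszul_functor g) (far (eta_functor A f) m)) =
    Cmp (Ch A) (far (eta_functor A f) (far (koszul_functor g) m)) (koszul_eta A f g X)"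
proof -
  obtain \<phi> where m: "m = (X, \<phi>, Y)" "is_chmap A (X, \<phi>, Y)" using m by (auto simp: Ch_Hom)
  have c: "is_cplx A X" "is_cplx A Y" using m(2) by (simp_all add: is_chmap_def)
  interpret X: koszul_eta_complex A X f g by (rule koszul_eta_complexI[OF c(1) f g X])
  interpret Y: koszul_eta_complex A Y f g by (rule koszul_eta_complexI[OF c(2) f g Y])
  interpret p: torsionfree_map A X Y \<phi> f by (rule torsionfree_mapI[OF m(2) f X Y])
  interpret q: reduced_map A X Y \<phi> g by (rule reduced_mapI[OF m(2) g])
  interpret \<eta>q: reduced_map A "eta A f X" "eta A f Y" p.\<eta>\<phi> g by (rule reduced_mapI[OF p.chmap_eta g])
  interpret Kp: torsionfree_map A "koszul g X" "koszul g Y" q.K\<phi> f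
    by (rule torsionfree_mapI[OF q.chmap_koszul f X.K.tf Y.K.tf])
  show ?thesis
    unfolding m far_eta far_koszul X.koszul_eta_ke Y.koszul_eta_ke Ch_simps
  proof (rule chmap_eqI)
    fix i u assume u: "u \<in> carrier (trm (koszul g (eta A f X)) i)"
    obtain x y where xy: "x \<in> X.E i" "y \<in> X.E (i + 1)" "u = Duo (X.S i x) (X.S (i + 1) y)"
      using X.K\<eta>_elem[OF u] .
    note cl = X.E_closed[OF xy(1)] X.E_closed[OF xy(2)]
    note S = X.S_eta[OF xy(1)] X.S_eta[OF xy(2)]
    have E: "Duo x (f \<odot>\<^bsub>trm X (i + 1)\<^esub> y) \<in> X.K.E i"
    proof -
      obtain a b where "a \<in> carrier (trm X (i + 1))" "dif X i x = f \<odot>\<^bsub>trm X (i + 1)\<^esub> a"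
        "b \<in> carrier (trm X (i + 1 + 1))" "dif X (i + 1) y = f \<odot>\<^bsub>trm X (i + 1 + 1)\<^esub> b"
        using xy(1,2) unfolding X.E_def by blast
      then show ?thesis using X.ke_closed(1)[OF cl(1) _ _ cl(2)] by blast
    qed
    show "compose (carrier (trm (koszul g (eta A f X)) i)) (Y.ke i) (\<eta>q.K\<phi> i) u =
        compose (carrier (trm (koszul g (eta A f X)) i)) (Kp.\<eta>\<phi> i) (X.ke i) u"
      unfolding compose_eq[OF u] unfolding xy(3) \<eta>q.koszul_map[OF S] p.eta_map[OF xy(1)] p.eta_map[OF xy(2)]
        X.ke_S[OF xy(1,2)] Y.ke_S[OF p.E_map[OF xy(1)] p.E_map[OF xy(2)]] Kp.eta_map[OF E]
        q.koszul_map[OF cl(1) X.M.smult_closed[OF f cl(2)]] p.smult[OF f cl(2)] ..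
  qed simp_all
qed

lemma koszul_eta_unit:
  assumes X: "is_cplx A X" and f: "f \<in> carrier A" and g: "g \<in> carrier A" and t: "\<And>i. torsionfree f (trm X i)"
  shows "Cmp (Ch A) (koszul_eta A f g X) (koszul_unit g (eta A f X)) = far (eta_functor A f) (koszul_unit g X)"
proof -
  interpret X: koszul_eta_complex A X f g by (rule koszul_eta_complexI[OF X f g t])
  let ?u = "\<lambda>i. \<lambda>x \<in> carrier (trm X i). Duo x \<zero>\<^bsub>trm X (i + 1)\<^esub>"
  interpret u: torsionfree_map A X "koszul g X" ?u f
    by (rule torsionfree_mapI[OF X.chmap_koszul_unit[unfolded koszul_unit_def] f t X.K.tf])
  show ?thesis
    unfolding X.koszul_eta_ke koszul_unit_def far_eta Ch_simps
  proof (rule chmap_eqI)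
    fix i v assume v: "v \<in> carrier (trm (eta A f X) i)"
    then obtain x where x: "x \<in> X.E i" "v = X.S i x" unfolding X.eta_simps(1) by blast
    have f0: "f \<odot>\<^bsub>trm X (i + 1)\<^esub> \<zero>\<^bsub>trm X (i + 1)\<^esub> = \<zero>\<^bsub>trm X (i + 1)\<^esub>" using f by simp
    show "compose (carrier (trm (eta A f X) i)) (X.ke i)
        (\<lambda>x \<in> carrier (trm (eta A f X) i). Duo x \<zero>\<^bsub>trm (eta A f X) (i + 1)\<^esub>) v = u.\<eta>\<phi> i v"
      unfolding compose_eq[OF v] restrict_apply'[OF v] unfolding x(2) u.eta_map[OF x(1)]
        X.eta_simps(2)[of "i + 1" "i + 1"] X.ke_S[OF x(1) X.E_zero] f0 restrict_apply'[OF X.E_closed[OF x(1)]] ..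
  qed (simp_all add: X.eta_carrier X.eta_simps(1))
qed

section \<open>The functors \<open>K \<otimes>\<^sup>L\<^sub>A A/g\<close> and \<open>L\<eta>\<^sub>f\<close>\<close>

lemma nat_trans_comp:
  assumes C: "category C" and D: "category D" and F: "is_functor C D F" and G: "is_functor C D G"
    and H: "is_functor C D H" and n: "nat_trans C D F G \<sigma>" "nat_trans C D G H \<tau>"
  shows "nat_trans C D F H (\<lambda>x \<in> Obj C. Cmp D (\<tau> x) (\<sigma> x))"
proof -
  interpret C: category C by fact
  interpret D: category D by fact
  show ?thesis
    unfolding nat_trans_def
  proof (intro conjI ballI)
    fix m assume m: "m \<in> Arr C"
    note o = C.Dom_Obj[OF m] C.Cod_Obj[OF m]
    have "D.square (far F m) (Cmp D (\<tau> (Dom C m)) (\<sigma> (Dom C m))) (Cmp D (\<tau> (Cod C m)) (\<sigma> (Cod C m))) (far H m)"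
      by (rule D.square_paste[OF nat_trans_square[OF D F G n(1) m o] nat_trans_square[OF D G H n(2) m o]])
    then show "Cmp D ((\<lambda>x \<in> Obj C. Cmp D (\<tau> x) (\<sigma> x)) (Cod C m)) (far F m) =
        Cmp D (far H m) ((\<lambda>x \<in> Obj C. Cmp D (\<tau> x) (\<sigma> x)) (Dom C m))"
      using o D.square_Cmp by simp
  qed (use D.Cmp_Hom[OF nat_trans_Hom[OF n(1)] nat_trans_Hom[OF n(2)]] in simp_all)
qed

lemma nat_trans_Idn:
  assumes C: "category C" and D: "category D" and F: "is_functor C D F"
  shows "nat_trans C D F F (\<lambda>x \<in> Obj C. Idn D (fob F x))"
proof -
  interpret C: category C by fact
  interpret D: category D by fact
  have "Cmp D (Idn D (fob F (Cod C m))) (far F m) = Cmp D (far F m) (Idn D (fob F (Dom C m)))"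
    if "m \<in> Arr C" for m
    using D.Idn_left[OF functor_Hom[OF F C.Arr_Hom[OF that]]]
      D.Idn_right[OF functor_Hom[OF F C.Arr_Hom[OF that]]] by simp
  then show ?thesis
    using functor_Obj[OF F] D.Idn_Hom C.Dom_Obj C.Cod_Obj by (simp add: nat_trans_def)
qed

text \<open>
  Two left derived functors of the same functor are isomorphic over it, so whether the comparison map
  is invertible at an object does not depend on the choice.
\<close>

lemma (in localized) left_derived_iso:
  assumes D: "category D" and F: "is_functor C D F"
    and T: "is_left_derived C W D F T \<epsilon>" and T': "is_left_derived C W D F T' \<epsilon>'"
    and x: "x \<in> Obj C" and i: "is_iso_arr D (\<epsilon> x)"
  shows "is_iso_arr D (\<epsilon>' x)"
proof -
  interpret D: category D by fact
  have fT: "is_functor L D T" and e: "nat_trans C D (funct_comp T Q) F \<epsilon>"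
    and fT': "is_functor L D T'" and e': "nat_trans C D (funct_comp T' Q) F \<epsilon>'"
    using T T' by (auto simp: is_left_derived_def)
  have uT: "\<exists>!\<theta>. nat_trans L D G T \<theta> \<and> (\<forall>x \<in> Obj C. Cmp D (\<epsilon> x) (\<theta> x) = \<eta> x)"
    if "is_functor L D G" "nat_trans C D (funct_comp G Q) F \<eta>" for G \<eta>
    using T that unfolding is_left_derived_def by blast
  have uT': "\<exists>!\<theta>. nat_trans L D G T' \<theta> \<and> (\<forall>x \<in> Obj C. Cmp D (\<epsilon>' x) (\<theta> x) = \<eta> x)"
    if "is_functor L D G" "nat_trans C D (funct_comp G Q) F \<eta>" for G \<eta>
    using T' that unfolding is_left_derived_def by blast
  have \<epsilon>: "\<epsilon> x \<in> Hom D (fob T x) (fob F x)" and \<epsilon>': "\<epsilon>' x \<in> Hom D (fob T' x) (fob F x)"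
    if "x \<in> Obj C" for x
    using nat_trans_Hom[OF e that] nat_trans_Hom[OF e' that] by auto
  obtain \<theta> where \<theta>: "nat_trans L D T' T \<theta>" "\<And>x. x \<in> Obj C \<Longrightarrow> Cmp D (\<epsilon> x) (\<theta> x) = \<epsilon>' x"
    using ex1_implies_ex[OF uT[OF fT' e']] by blast
  obtain \<theta>' where \<theta>': "nat_trans L D T T' \<theta>'" "\<And>x. x \<in> Obj C \<Longrightarrow> Cmp D (\<epsilon>' x) (\<theta>' x) = \<epsilon> x"
    using ex1_implies_ex[OF uT'[OF fT e]] by blast
  have H: "\<theta> x \<in> Hom D (fob T' x) (fob T x)" "\<theta>' x \<in> Hom D (fob T x) (fob T' x)" if "x \<in> Obj C" for x
    using nat_trans_Hom[OF \<theta>(1), of x] nat_trans_Hom[OF \<theta>'(1), of x] that by auto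
  have eq1: "(\<lambda>x \<in> Obj L. Cmp D (\<theta> x) (\<theta>' x)) = (\<lambda>x \<in> Obj L. Idn D (fob T x))"
  proof (rule ex1E[OF uT[OF fT e]])
    fix \<rho> assume u: "\<forall>y. nat_trans L D T T y \<and> (\<forall>x \<in> Obj C. Cmp D (\<epsilon> x) (y x) = \<epsilon> x) \<longrightarrow> y = \<rho>"
    have "(\<lambda>x \<in> Obj L. Cmp D (\<theta> x) (\<theta>' x)) = \<rho>"
      using u[rule_format, OF conjI, OF nat_trans_comp[OF category_L D fT fT' fT \<theta>'(1) \<theta>(1)]]
        D.Cmp_assoc[OF H(2) H(1) \<epsilon>, symmetric] \<theta>(2) \<theta>'(2) by simp
    moreover have "(\<lambda>x \<in> Obj L. Idn D (fob T x)) = \<rho>"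
      using u[rule_format, OF conjI, OF nat_trans_Idn[OF category_L D fT]] D.Idn_right[OF \<epsilon>] by simp
    ultimately show ?thesis by simp
  qed
  have 1: "Cmp D (\<theta> x) (\<theta>' x) = Idn D (fob T x)" using fun_cong[OF eq1, of x] x by simp
  have eq2: "(\<lambda>x \<in> Obj L. Cmp D (\<theta>' x) (\<theta> x)) = (\<lambda>x \<in> Obj L. Idn D (fob T' x))"
  proof (rule ex1E[OF uT'[OF fT' e']])
    fix \<rho> assume u: "\<forall>y. nat_trans L D T' T' y \<and> (\<forall>x \<in> Obj C. Cmp D (\<epsilon>' x) (y x) = \<epsilon>' x) \<longrightarrow> y = \<rho>"
    have "(\<lambda>x \<in> Obj L. Cmp D (\<theta>' x) (\<theta> x)) = \<rho>"
      using u[rule_format, OF conjI, OF nat_trans_comp[OF category_L D fT' fT fT' \<theta>(1) \<theta>'(1)]]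
        D.Cmp_assoc[OF H(1) H(2) \<epsilon>', symmetric] \<theta>(2) \<theta>'(2) by simp
    moreover have "(\<lambda>x \<in> Obj L. Idn D (fob T' x)) = \<rho>"
      using u[rule_format, OF conjI, OF nat_trans_Idn[OF category_L D fT']] D.Idn_right[OF \<epsilon>'] by simp
    ultimately show ?thesis by simp
  qed
  have 2: "Cmp D (\<theta>' x) (\<theta> x) = Idn D (fob T' x)" using fun_cong[OF eq2, of x] x by simp
  have "D.iso (fob T' x) (fob T x) (\<theta> x)" by (rule D.isoI(1)[OF H[OF x] 2 1])
  moreover have "D.iso (fob T x) (fob F x) (\<epsilon> x)" using i \<epsilon>[OF x] by (simp add: D.iso_def)
  ultimately have "D.iso (fob T' x) (fob F x) (Cmp D (\<epsilon> x) (\<theta> x))" by (rule D.iso_Cmp(1))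
  then show ?thesis using \<theta>(2)[OF x] by (simp add: D.iso_def)
qed

lemma Modules_iso_bij:
  assumes "is_iso_arr (Modules A) (M, h, N)"
  shows "bij_betw h (carrier M) (carrier N)"
proof -
  interpret Modules: category "Modules A" by (rule category_Modules)
  have "(M, h, N) \<in> Arr (Modules A)" using assms by (simp add: is_iso_arr_def)
  then have m: "(M, h, N) \<in> Hom (Modules A) M N" by (simp add: Hom_def)
  then have "Modules.iso M N (M, h, N)" using assms by (simp add: Modules.iso_def)
  note I = Modules.iso_inverse[OF this]
  obtain k where k: "inverse_arr (Modules A) (M, h, N) = (N, k, M)" "k \<in> lin_maps A N M"
    and h: "h \<in> lin_maps A M N" using I(2) m by (auto simp: Modules_Hom)
  have e: "compose (carrier M) k h = (\<lambda>x \<in> carrier M. x)" "compose (carrier N) h k = (\<lambda>x \<in> carrier N. x)"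
    using I(3,4) unfolding k(1) by simp_all
  have "k (h x) = x" if "x \<in> carrier M" for x
    using fun_cong[OF e(1), of x] that by (simp add: compose_eq)
  moreover have "h (k x) = x" if "x \<in> carrier N" for x
    using fun_cong[OF e(2), of x] that by (simp add: compose_eq)
  ultimately show ?thesis
    using h k(2) by (intro bij_betw_byWitness[where f' = k]) (auto simp: lin_maps_def)
qed

lemma qis_iff_iso:
  assumes "is_chmap A m"
  shows "m \<in> qis A \<longleftrightarrow> (\<forall>i. is_iso_arr (Modules A) (far (cohomology_functor i) m))"
proof
  show "m \<in> qis A \<Longrightarrow> \<forall>i. is_iso_arr (Modules A) (far (cohomology_functor i) m)"
    using qis_iso_cohomology by blast
  assume iso: "\<forall>i. is_iso_arr (Modules A) (far (cohomology_functor i) m)"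
  obtain X \<phi> Y where m: "m = (X, \<phi>, Y)" by (cases m)
  have "bij_betw (\<lambda>x. qrep (cocycles Y i) (coboundaries Y i) (\<phi> i x))
      (carrier (cohomology X i)) (carrier (cohomology Y i))" for i
  proof -
    have "bij_betw (\<lambda>x \<in> carrier (cohomology X i). qrep (cocycles Y i) (coboundaries Y i) (\<phi> i x))
        (carrier (cohomology X i)) (carrier (cohomology Y i))"
      using iso[rule_format, of i] unfolding m cohomology_functor_def
      by (intro Modules_iso_bij) simp
    then show ?thesis
      by (subst bij_betw_cong[of _ "\<lambda>x. qrep (cocycles Y i) (coboundaries Y i) (\<phi> i x)"
            "\<lambda>x \<in> carrier (cohomology X i). qrep (cocycles Y i) (coboundaries Y i) (\<phi> i x)"]) auto
  qed
  then show "m \<in> qis A" using assms by (simp add: qis_def m)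
qed

text \<open>
  By two out of three on cohomology, as \<open>RX \<rightarrow> X\<close> and \<open>RY \<rightarrow> Y\<close> are quasi-isomorphisms.
\<close>

lemma resolution_qis:
  assumes "m \<in> qis A" and m: "m \<in> Hom (Ch A) X Y"
  shows "far (resolution_functor A) m \<in> qis A"
proof -
  interpret Ch: category "Ch A" by (rule category_Ch)
  interpret Modules: category "Modules A" by (rule category_Modules)
  note o = Ch.Hom_Obj[OF m]
  interpret X: complex A X by unfold_locales (use o in simp)
  interpret Y: complex A Y by unfold_locales (use o in simp)
  have rX: "resolution_proj A X \<in> Hom (Ch A) (resolution A X) X"
    and rY: "resolution_proj A Y \<in> Hom (Ch A) (resolution A Y) Y"
    using X.chmap_resolution_proj Y.chmap_resolution_proj by (simp_all add: resolution_proj_def Ch_HomI)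
  have Rm: "far (resolution_functor A) m \<in> Hom (Ch A) (resolution A X) (resolution A Y)"
    using functor_Hom[OF functor_resolution m] by simp
  have "is_iso_arr (Modules A) (far (cohomology_functor i) (far (resolution_functor A) m))" for i
  proof -
    let ?H = "cohomology_functor i"
    note H = functor_Hom[OF functor_cohomology]
    have iso: "Modules.iso (fob ?H V) (fob ?H W) (far ?H n)" if "n \<in> qis A" "n \<in> Hom (Ch A) V W" for n V W
      using qis_iso_cohomology[OF that(1)] H[OF that(2)] by (simp add: Modules.iso_def)
    have "Cmp (Modules A) (far ?H (resolution_proj A Y)) (far ?H (far (resolution_functor A) m)) =
        Cmp (Modules A) (far ?H m) (far ?H (resolution_proj A X))"
      using arg_cong[OF resolution_proj_nat[OF m], of "far ?H"]
      unfolding functor_Cmp[OF functor_cohomology Rm rY] functor_Cmp[OF functor_cohomology rX m] .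
    then have "Modules.iso (fob ?H (resolution A X)) (fob ?H Y)
        (Cmp (Modules A) (far ?H (resolution_proj A Y)) (far ?H (far (resolution_functor A) m)))"
      using Modules.iso_Cmp(1)[OF iso[OF X.qis_resolution_proj rX] iso[OF assms(1) m]] by simp
    from Modules.iso_cancel_Cmp[OF H[OF Rm] iso[OF Y.qis_resolution_proj rY] this]
    show ?thesis by (simp add: Modules.iso_def)
  qed
  then show ?thesis using qis_iff_iso[of A "far (resolution_functor A) m"] Rm by (auto simp: Hom_def)
qed

lemma tensor_qis:
  assumes "m \<in> qis A" "m \<in> Hom (Ch A) X Y" "g \<in> carrier A" "\<And>i. torsionfree g (trm X i)"
    "\<And>i. torsionfree g (trm Y i)"
  shows "far (tensor_functor g) m \<in> qis A"
proof -
  obtain \<phi> where m: "m = (X, \<phi>, Y)" "is_chmap A (X, \<phi>, Y)" using assms(2) by (auto simp: Ch_Hom)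
  interpret reduced_map A X Y \<phi> g by (rule reduced_mapI[OF m(2) assms(3)])
  show ?thesis unfolding m(1) far_tensor by (rule qis_tensor[OF assms(1)[unfolded m(1)] assms(4,5)])
qed

lemma eta_qis:
  assumes "m \<in> qis A" "m \<in> Hom (Ch A) X Y" "f \<in> carrier A" "\<And>i. torsionfree f (trm X i)"
    "\<And>i. torsionfree f (trm Y i)"
  shows "far (eta_functor A f) m \<in> qis A"
proof -
  obtain \<phi> where m: "m = (X, \<phi>, Y)" "is_chmap A (X, \<phi>, Y)" using assms(2) by (auto simp: Ch_Hom)
  interpret torsionfree_map A X Y \<phi> f by (rule torsionfree_mapI[OF m(2) assms(3-5)])
  show ?thesis unfolding m(1) far_eta by (rule qis_eta[OF assms(1)[unfolded m(1)]])
qed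

lemma ChTf_Hom: "m \<in> Hom (ChTf A f) X Y \<longleftrightarrow> m \<in> Hom (Ch A) X Y \<and>
    (\<forall>i. torsionfree f (trm X i)) \<and> (\<forall>i. torsionfree f (trm Y i))"
  by (cases m) (auto simp: Hom_def)

lemma ChTf_Arr: "m \<in> Arr (ChTf A f) \<longleftrightarrow> m \<in> Hom (ChTf A f) (Dom (Ch A) m) (Cod (Ch A) m)"
  by (cases m) (auto simp: Hom_def)

lemma toD_iso: "m \<in> Hom (Ch A) X Y \<Longrightarrow> m \<in> qis A \<Longrightarrow> category.iso (DA A) X Y (far (toD A) m)"
  unfolding DA_def toD_def by (rule localized.Q_iso(1)[OF localized_Ch])

lemma functor_toD: "is_functor (Ch A) (DA A) (toD A)"
  unfolding DA_def toD_def by (rule localized.functor_Q[OF localized_Ch])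

lemma fob_toD [simp]: "fob (toD A) X = X"
  by (simp add: toD_def loc_functor_def)

lemma DA_Obj [simp]: "Obj (DA A) = Obj (Ch A)"
  by (simp add: DA_def localization_def)

lemma resolution_proj_simps:
  assumes "is_cplx A X"
  shows "resolution_proj A X \<in> Hom (Ch A) (resolution A X) X" "resolution_proj A X \<in> qis A"
    "is_cplx A (resolution A X)" "nonzerodivisor A g \<Longrightarrow> torsionfree g (trm (resolution A X) i)"
proof -
  interpret complex A X by unfold_locales fact
  show "resolution_proj A X \<in> Hom (Ch A) (resolution A X) X"
    using chmap_resolution_proj by (simp add: resolution_proj_def Ch_HomI)
qed (use complex.qis_resolution_proj complex.cplx_resolution complex.torsionfree_resolution assms
    in \<open>auto simp: complex_def\<close>)

text \<open>
  The functor \<open>X \<mapsto> RX/g\<close> inverts quasi-isomorphisms, since \<open>R\<close> preserves them and has \<open>g\<close>-torsionfree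
  values. So it lifts to \<open>D(A)\<close>, and the lift, with the comparison map induced by \<open>RX \<rightarrow> X\<close>, is a left
  derived functor. What holds for this one carries over to the chosen one.
\<close>

lemma left_derived_dtensor:
  assumes g: "nonzerodivisor A g"
  shows "is_left_derived (Ch A) (qis A) (DA A) (funct_comp (toD A) (tensor_functor g)) (dtensor A g)
      (dtensor_cmp A g :: ('a, 'b) cplx \<Rightarrow> ('a, 'b) darr)"
    and "is_cplx A (P :: ('a, 'b) cplx) \<Longrightarrow> (\<And>i. torsionfree g (trm P i)) \<Longrightarrow> is_iso_arr (DA A) (dtensor_cmp A g P)"
proof -
  have gA: "g \<in> carrier A" using g by (simp add: nonzerodivisor_def)
  let ?F = "funct_comp (toD A) (tensor_functor g) :: (('a, 'b) cplx, ('a, 'b) chmap, _, ('a, 'b) darr) funct"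
  let ?derived = "is_left_derived (Ch A) (qis A) (DA A) ?F"
  let ?S = "{X :: ('a, 'b) cplx. is_cplx A X \<and> (\<forall>f \<in> {g}. \<forall>i. torsionfree f (trm X i))}"
  interpret R: resolved "Ch A" "qis A" ?S "resolution_functor A" "resolution_proj A"
    by (rule resolved_Ch) (use g in simp)
  interpret D: category "DA A" by (rule category_DA)
  have F: "is_functor (Ch A) (DA A) ?F" by (rule is_functor_comp[OF functor_tensor[OF gA] functor_toD])
  have Fiso: "D.iso (fob ?F X) (fob ?F Y) (far ?F m)"
    if "m \<in> qis A" "m \<in> Hom (Ch A) X Y" "\<And>i. torsionfree g (trm X i)" "\<And>i. torsionfree g (trm Y i)" for m X Y
    using toD_iso[OF functor_Hom[OF functor_tensor[OF gA] that(2)] tensor_qis[OF that(1,2) gA that(3,4)]] by simp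
  interpret I: inverting "Ch A" "qis A" "DA A" "funct_comp ?F (resolution_functor A)"
  proof (intro inverting.intro inverting_axioms.intro localized_Ch category_DA
      is_functor_comp[OF functor_resolution F])
    fix m :: "('a, 'b) chmap" and X Y assume m: "m \<in> Hom (Ch A) X Y" "m \<in> qis A"
    have o: "is_cplx A X" "is_cplx A Y" using R.Hom_Obj[OF m(1)] by auto
    have "D.iso (fob ?F (resolution A X)) (fob ?F (resolution A Y)) (far ?F (far (resolution_functor A) m))"
      using functor_Hom[OF functor_resolution m(1)] resolution_qis[OF m(2,1)]
        resolution_proj_simps(4)[OF o(1) g] resolution_proj_simps(4)[OF o(2) g]
      by (intro Fiso) simp_all
    then show "is_iso_arr (DA A) (far (funct_comp ?F (resolution_functor A)) m)" by (simp add: D.iso_def)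
  qed
  let ?T = "lift_functor (Ch A) (DA A) (funct_comp ?F (resolution_functor A))"
  let ?\<epsilon> = "\<lambda>X \<in> Obj (Ch A). far ?F (resolution_proj A X)"
  have e: "nat_trans (Ch A) (DA A) (funct_comp ?T (toD A)) ?F ?\<epsilon>"
    unfolding nat_trans_def
  proof (intro conjI ballI)
    fix X :: "('a, 'b) cplx" assume "X \<in> Obj (Ch A)"
    then show "?\<epsilon> X \<in> Hom (DA A) (fob (funct_comp ?T (toD A)) X) (fob ?F X)"
      using functor_Hom[OF F resolution_proj_simps(1)[of A X]] by simp
  next
    fix m :: "('a, 'b) chmap" assume m: "m \<in> Arr (Ch A)"
    note mH = R.Arr_Hom[OF m]
    have o: "is_cplx A (Dom (Ch A) m)" "is_cplx A (Cod (Ch A) m)" using R.Dom_Obj[OF m] R.Cod_Obj[OF m] by simp_all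
    note r = resolution_proj_simps(1)[OF o(1)] resolution_proj_simps(1)[OF o(2)]
    have Rm: "far (resolution_functor A) m \<in>
        Hom (Ch A) (resolution A (Dom (Ch A) m)) (resolution A (Cod (Ch A) m))"
      using functor_Hom[OF functor_resolution mH] by simp
    have T: "far ?T (far (toD A) m) = far ?F (far (resolution_functor A) m)"
      using I.lift_Q[OF m] by (simp add: toD_def)
    show "Cmp (DA A) (?\<epsilon> (Cod (Ch A) m)) (far (funct_comp ?T (toD A)) m) =
        Cmp (DA A) (far ?F m) (?\<epsilon> (Dom (Ch A) m))"
      using arg_cong[OF resolution_proj_nat[OF mH], of "far ?F"] o
      unfolding functor_Cmp[OF F Rm r(2)] functor_Cmp[OF F r(1) mH]
      by (simp only: T far_comp[of ?T] restrict_apply' Ch_simps)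
  qed simp
  have i: "is_iso_arr (DA A) (?\<epsilon> P)" if "P \<in> ?S" for P
    using Fiso[OF resolution_proj_simps(2,1,4)] that g by (simp add: D.iso_def)
  have T: "?derived ?T ?\<epsilon>"
    by (rule R.left_derivedI[folded toD_def, OF category_DA F I.functor_lift e i])
  have "case dtensor_pair A g of (T, \<epsilon>) \<Rightarrow> ?derived T \<epsilon>"
    unfolding dtensor_pair_def by (rule someI[of _ "(?T, ?\<epsilon>)"]) (use T in simp)
  then show derived: "?derived (dtensor A g) (dtensor_cmp A g)"
    by (simp add: dtensor_def dtensor_cmp_def case_prod_beta)
  assume P: "is_cplx A P" "\<And>i. torsionfree g (trm P i)"
  show "is_iso_arr (DA A) (dtensor_cmp A g P)"
    by (rule R.left_derived_iso[OF category_DA F T derived _ i]) (use P in simp_all)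
qed

lemma dtensor_simps:
  assumes g: "nonzerodivisor A g"
  shows "is_functor (DA A) (DA A) (dtensor A g :: ('a, 'b) dfunct)"
    "nat_trans (Ch A) (DA A) (funct_comp (dtensor A g) (toD A)) (funct_comp (toD A) (tensor_functor g))
      (dtensor_cmp A g :: ('a, 'b) cplx \<Rightarrow> ('a, 'b) darr)"
    "nat_trans (DA A) (DA A) fid (dtensor A g) (dtensor_unit A g :: ('a, 'b) cplx \<Rightarrow> ('a, 'b) darr)"
    "is_cplx A (X :: ('a, 'b) cplx) \<Longrightarrow>
      Cmp (DA A) (dtensor_cmp A g X) (dtensor_unit A g X) = far (toD A) (tensor_proj g X)"
proof -
  note derived = left_derived_dtensor(1)[OF g, where 'b = 'b, folded DA_def, unfolded is_left_derived_def, folded DA_def toD_def]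
  show "is_functor (DA A) (DA A) (dtensor A g :: ('a, 'b) dfunct)"
    "nat_trans (Ch A) (DA A) (funct_comp (dtensor A g) (toD A)) (funct_comp (toD A) (tensor_functor g))
      (dtensor_cmp A g :: ('a, 'b) cplx \<Rightarrow> ('a, 'b) darr)"
    using derived by blast+
  have gA: "g \<in> carrier A" using g by (simp add: nonzerodivisor_def)
  interpret Ch: category "Ch A" by (rule category_Ch)
  interpret D: category "DA A" by (rule category_DA)
  let ?\<eta> = "\<lambda>X \<in> Obj (Ch A). far (toD A) (tensor_proj g X) :: ('a, 'b) darr"
  have p: "tensor_proj g X \<in> Hom (Ch A) X (tensor_cplx g X)" if "is_cplx A X" for X :: "('a, 'b) cplx"
    using reduction.chmap_tensor_proj[OF reductionI[OF that gA]] by (simp add: tensor_proj_def Ch_HomI)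
  have f: "is_functor (DA A) (DA A) (fid :: ('a, 'b) dfunct)"
    using D.Arr_Hom by (auto simp: is_functor_def fid_def)
  have "nat_trans (Ch A) (DA A) (funct_comp fid (toD A)) (funct_comp (toD A) (tensor_functor g)) ?\<eta>"
    unfolding nat_trans_def
  proof (intro conjI ballI)
    fix X :: "('a, 'b) cplx" assume "X \<in> Obj (Ch A)"
    then show "?\<eta> X \<in> Hom (DA A) (fob (funct_comp fid (toD A)) X) (fob (funct_comp (toD A) (tensor_functor g)) X)"
      using functor_Hom[OF functor_toD p[of X]] by (simp add: fid_def)
  next
    fix m :: "('a, 'b) chmap" assume m: "m \<in> Arr (Ch A)"
    note mH = Ch.Arr_Hom[OF m]
    have o: "is_cplx A (Dom (Ch A) m)" "is_cplx A (Cod (Ch A) m)"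
      using Ch.Dom_Obj[OF m] Ch.Cod_Obj[OF m] by simp_all
    note Tm = functor_Hom[OF functor_tensor[OF gA] mH, unfolded fob_tensor]
    show "Cmp (DA A) (?\<eta> (Cod (Ch A) m)) (far (funct_comp fid (toD A)) m) =
        Cmp (DA A) (far (funct_comp (toD A) (tensor_functor g)) m) (?\<eta> (Dom (Ch A) m))"
      using arg_cong[OF tensor_proj_nat[OF mH gA], of "far (toD A)"] o
      unfolding functor_Cmp[OF functor_toD mH p[OF o(2)]] functor_Cmp[OF functor_toD p[OF o(1)] Tm]
      by (simp add: fid_def)
  qed simp
  then have "\<exists>!\<theta>. nat_trans (DA A) (DA A) fid (dtensor A g) \<theta> \<and>
      (\<forall>X \<in> Obj (Ch A). Cmp (DA A) (dtensor_cmp A g X) (\<theta> X) = ?\<eta> X)"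
    using derived f by blast
  then have "\<exists>!\<theta>. nat_trans (DA A) (DA A) fid (dtensor A g) \<theta> \<and>
      (\<forall>X \<in> Obj (DA A). Cmp (DA A) (dtensor_cmp A g X) (\<theta> X) = far (toD A) (tensor_proj g X :: ('a, 'b) chmap))"
    by simp
  from theI'[OF this]
  show "nat_trans (DA A) (DA A) fid (dtensor A g) (dtensor_unit A g :: ('a, 'b) cplx \<Rightarrow> ('a, 'b) darr)"
    "is_cplx A (X :: ('a, 'b) cplx) \<Longrightarrow>
      Cmp (DA A) (dtensor_cmp A g X) (dtensor_unit A g X) = far (toD A) (tensor_proj g X)"
    unfolding dtensor_unit_def[symmetric] by simp_all
qed

text \<open>
  As for reduction modulo \<open>g\<close>, the functor \<open>X \<mapsto> \<eta>\<^sub>f(RX)\<close> lifts to \<open>D(A)\<close>. The map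
  \<open>\<eta>\<^sub>f(RP) \<rightarrow> \<eta>\<^sub>f(P)\<close> is defined only for \<open>f\<close>-torsionfree \<open>P\<close>, and there it is an isomorphism.
\<close>

lemma is_Leta_Leta:
  assumes f: "nonzerodivisor A f"
  shows "is_Leta A f (Leta A f) (Leta_cmp A f :: ('a, 'b) cplx \<Rightarrow> ('a, 'b) darr)"
proof -
  have fA: "f \<in> carrier A" using f by (simp add: nonzerodivisor_def)
  let ?F = "funct_comp (toD A) (eta_functor A f) :: (('a, 'b) cplx, ('a, 'b) chmap, _, ('a, 'b) darr) funct"
  let ?R = "resolution_functor A :: ('a, 'b) chfunct"
  interpret Ch: category "Ch A :: (('a, 'b) cplx, ('a, 'b) chmap) cat" by (rule category_Ch)
  interpret D: category "DA A" by (rule category_DA)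
  have F: "is_functor (ChTf A f) (DA A) ?F" by (rule is_functor_comp[OF functor_eta[OF fA] functor_toD])
  have R: "is_functor (Ch A) (ChTf A f) ?R"
    unfolding is_functor_def
  proof (intro conjI ballI impI)
    fix X :: "('a, 'b) cplx" assume X: "X \<in> Obj (Ch A)"
    show "fob ?R X \<in> Obj (ChTf A f)" using X resolution_proj_simps(3,4)[of A X] f by simp
    show "far ?R (Idn (Ch A) X) = Idn (ChTf A f) (fob ?R X)"
      unfolding ChTf_simps(5) by (rule functor_Idn[OF functor_resolution X])
  next
    fix m :: "('a, 'b) chmap" assume m: "m \<in> Arr (Ch A)"
    have o: "is_cplx A (Dom (Ch A) m)" "is_cplx A (Cod (Ch A) m)"
      using Ch.Dom_Obj[OF m] Ch.Cod_Obj[OF m] by simp_all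
    show "far ?R m \<in> Hom (ChTf A f) (fob ?R (Dom (Ch A) m)) (fob ?R (Cod (Ch A) m))"
      unfolding ChTf_Hom using functor_Hom[OF functor_resolution Ch.Arr_Hom[OF m]]
        resolution_proj_simps(4)[OF o(1) f] resolution_proj_simps(4)[OF o(2) f] by simp
    fix n assume "n \<in> Arr (Ch A)" "Cod (Ch A) m = Dom (Ch A) n"
    then show "far ?R (Cmp (Ch A) n m) = Cmp (ChTf A f) (far ?R n) (far ?R m)"
      unfolding ChTf_simps(6) using functor_resolution[of A, unfolded is_functor_def] m by blast
  qed
  have Fiso: "D.iso (fob ?F X) (fob ?F Y) (far ?F m)"
    if "m \<in> qis A" "m \<in> Hom (Ch A) X Y" "\<And>i. torsionfree f (trm X i)" "\<And>i. torsionfree f (trm Y i)" for m X Y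
  proof -
    have "m \<in> Hom (ChTf A f) X Y" using that by (simp add: ChTf_Hom)
    from toD_iso[OF functor_Hom[OF functor_eta[OF fA] this] eta_qis[OF that(1,2) fA that(3,4)]]
    show ?thesis by simp
  qed
  interpret I: inverting "Ch A" "qis A" "DA A" "funct_comp ?F ?R"
  proof (intro inverting.intro inverting_axioms.intro localized_Ch category_DA is_functor_comp[OF R F])
    fix m :: "('a, 'b) chmap" and X Y assume m: "m \<in> Hom (Ch A) X Y" "m \<in> qis A"
    have o: "is_cplx A X" "is_cplx A Y" using Ch.Hom_Obj[OF m(1)] by auto
    have "D.iso (fob ?F (resolution A X)) (fob ?F (resolution A Y)) (far ?F (far ?R m))"
      using functor_Hom[OF functor_resolution m(1)] resolution_qis[OF m(2,1)]
        resolution_proj_simps(4)[OF o(1) f] resolution_proj_simps(4)[OF o(2) f]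
      by (intro Fiso) simp_all
    then show "is_iso_arr (DA A) (far (funct_comp ?F ?R) m)" by (simp add: D.iso_def)
  qed
  let ?T = "lift_functor (Ch A) (DA A) (funct_comp ?F ?R)"
  let ?\<kappa> = "\<lambda>X \<in> Obj (ChTf A f). far ?F (resolution_proj A X)"
  have r: "resolution_proj A X \<in> Hom (ChTf A f) (resolution A X) X" if "X \<in> Obj (ChTf A f)" for X :: "('a, 'b) cplx"
    using that resolution_proj_simps(1,4)[of A X] f by (simp add: ChTf_Hom)
  have "nat_trans (ChTf A f) (DA A) (funct_comp ?T (toD A)) ?F ?\<kappa>"
    unfolding nat_trans_def
  proof (intro conjI ballI)
    fix X :: "('a, 'b) cplx" assume "X \<in> Obj (ChTf A f)"
    then show "?\<kappa> X \<in> Hom (DA A) (fob (funct_comp ?T (toD A)) X) (fob ?F X)"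
      using functor_Hom[OF F r] by simp
  next
    fix m :: "('a, 'b) chmap" assume m: "m \<in> Arr (ChTf A f)"
    let ?X = "Dom (Ch A) m" and ?Y = "Cod (Ch A) m"
    have mT: "m \<in> Hom (ChTf A f) ?X ?Y" using m by (simp only: ChTf_Arr)
    then have mH: "m \<in> Hom (Ch A) ?X ?Y" by (simp add: ChTf_Hom)
    then have mA: "m \<in> Arr (Ch A)" by (simp add: Hom_def)
    have o: "?X \<in> Obj (ChTf A f)" "?Y \<in> Obj (ChTf A f)"
      using mT Ch.Hom_Obj[OF mH] by (simp_all add: ChTf_Hom)
    note Rm = functor_Hom[OF R mH, unfolded fob_resolution]
    have T: "far ?T (far (toD A) m) = far ?F (far ?R m)"
      using I.lift_Q[OF mA] by (simp add: toD_def)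
    show "Cmp (DA A) (?\<kappa> (Cod (ChTf A f) m)) (far (funct_comp ?T (toD A)) m) =
        Cmp (DA A) (far ?F m) (?\<kappa> (Dom (ChTf A f) m))"
      using arg_cong[OF resolution_proj_nat[OF mH], of "far ?F"] o
        functor_Cmp[OF F Rm r[OF o(2)]] functor_Cmp[OF F r[OF o(1)] mT]
      by (simp only: T far_comp[of ?T] restrict_apply' ChTf_simps(3-6))
  qed simp
  moreover have "is_iso_arr (DA A) (?\<kappa> P)" if P: "P \<in> Obj (ChTf A f)" for P
    using Fiso[OF resolution_proj_simps(2,1,4), of P] P f by (simp add: D.iso_def)
  moreover have "is_functor (DA A) (DA A) ?T" using I.functor_lift by (simp add: DA_def)
  ultimately have T: "is_Leta A f ?T ?\<kappa>" unfolding is_Leta_def by blast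
  have "case Leta_pair A f of (T, \<kappa>) \<Rightarrow> is_Leta A f T (\<kappa> :: ('a, 'b) cplx \<Rightarrow> ('a, 'b) darr)"
    unfolding Leta_pair_def by (rule someI[of _ "(?T, ?\<kappa>)"]) (use T in simp)
  then show ?thesis by (simp add: Leta_def Leta_cmp_def case_prod_beta)
qed

section \<open>The base change map\<close>

lemma functor_ChTf:
  assumes "is_functor (Ch A) D F"
  shows "is_functor (ChTf A f) D F"
proof -
  have "m \<in> Arr (Ch A)" if "m \<in> Arr (ChTf A f)" for m :: "('a, 'b) chmap" using that by (cases m) simp
  moreover have "X \<in> Obj (Ch A)" if "X \<in> Obj (ChTf A f)" for X :: "('a, 'b) cplx" using that by simp
  ultimately show ?thesis using assms unfolding is_functor_def ChTf_simps(3-6) by blast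
qed

text \<open>
  The type \<open>'b\<close> of the atoms does not occur in \<open>A\<close>, \<open>f\<close>, \<open>g\<close>. The parameter \<open>universe\<close> fixes it, so
  that all facts below speak of the same derived category.
\<close>

locale base_change =
  fixes A :: "('a, 'r) ring_scheme" and f g :: 'a and universe :: "'b itself"
  assumes f: "nonzerodivisor A f" and g: "nonzerodivisor A g"
begin

lemma fA: "f \<in> carrier A" and gA: "g \<in> carrier A"
  using f g by (simp_all add: nonzerodivisor_def)

abbreviation D :: "(('a, 'b) cplx, ('a, 'b) darr) cat" where "D \<equiv> DA A"
abbreviation Q :: "('a, 'b) chmap \<Rightarrow> ('a, 'b) darr" where "Q \<equiv> far (toD A)"
abbreviation T :: "('a, 'b) dfunct" where "T \<equiv> dtensor A g"
abbreviation \<epsilon> :: "('a, 'b) cplx \<Rightarrow> ('a, 'b) darr" where "\<epsilon> \<equiv> dtensor_cmp A g"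
abbreviation u :: "('a, 'b) cplx \<Rightarrow> ('a, 'b) darr" where "u \<equiv> dtensor_unit A g"
abbreviation N :: "('a, 'b) dfunct" where "N \<equiv> Leta A f"
abbreviation \<kappa> :: "('a, 'b) cplx \<Rightarrow> ('a, 'b) darr" where "\<kappa> \<equiv> Leta_cmp A f"
abbreviation \<eta> :: "('a, 'b) cplx \<Rightarrow> ('a, 'b) cplx" where "\<eta> \<equiv> eta A f"
abbreviation K :: "('a, 'b) cplx \<Rightarrow> ('a, 'b) cplx" where "K \<equiv> koszul g"

abbreviation comp :: "('a, 'b) darr \<Rightarrow> ('a, 'b) darr \<Rightarrow> ('a, 'b) darr" (infixr "\<bullet>" 55)
  where "comp \<equiv> Cmp D"

definition S :: "('a, 'b) cplx set" where
  "S = {X. is_cplx A X \<and> (\<forall>h \<in> {f, g}. \<forall>i. torsionfree h (trm X i))}"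

sublocale R: resolved "Ch A :: (('a, 'b) cplx, ('a, 'b) chmap) cat" "qis A" S "resolution_functor A" "resolution_proj A"
  unfolding S_def by (rule resolved_Ch) (use f g in auto)

sublocale D: category D
  by (rule category_DA)

lemma S_simps: "P \<in> S \<longleftrightarrow> is_cplx A P \<and> (\<forall>i. torsionfree f (trm P i)) \<and> (\<forall>i. torsionfree g (trm P i))"
  by (auto simp: S_def)

lemma S_D:
  assumes "P \<in> S"
  shows "is_cplx A P" "torsionfree f (trm P i)" "torsionfree g (trm P i)"
  using assms by (auto simp: S_simps)

lemma N_facts: "is_functor D D N"
  "nat_trans (ChTf A f) D (funct_comp N (toD A)) (funct_comp (toD A) (eta_functor A f)) \<kappa>"
  "P \<in> Obj (ChTf A f) \<Longrightarrow> is_iso_arr D (\<kappa> P)"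
  using is_Leta_Leta[OF f, where 'b = 'b] unfolding is_Leta_def by blast+

lemmas T_facts = dtensor_simps[OF g, where 'b = 'b]

lemma NQ: "is_functor (ChTf A f) D (funct_comp N (toD A))"
  by (rule functor_ChTf[OF is_functor_comp[OF functor_toD N_facts(1)]])

lemma Q\<eta>: "is_functor (ChTf A f) D (funct_comp (toD A) (eta_functor A f))"
  by (rule is_functor_comp[OF functor_eta[OF fA] functor_toD])

lemma TQ: "is_functor (Ch A) D (funct_comp T (toD A))"
  by (rule is_functor_comp[OF functor_toD T_facts(1)])

lemma Q_tensor: "is_functor (Ch A) D (funct_comp (toD A) (tensor_functor g))"
  by (rule is_functor_comp[OF functor_tensor[OF gA] functor_toD])

lemmas Q_Hom = functor_Hom[OF functor_toD, unfolded fob_toD]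
lemmas Q_Cmp = functor_Cmp[OF functor_toD]

lemma \<kappa>_iso:
  assumes "is_cplx A P" "\<And>i. torsionfree f (trm P i)"
  shows "D.iso (fob N P) (\<eta> P) (\<kappa> P)"
proof -
  have P: "P \<in> Obj (ChTf A f)" using assms by simp
  show ?thesis using nat_trans_Hom[OF N_facts(2) P] N_facts(3)[OF P] by (simp add: D.iso_def)
qed

lemma \<kappa>_square:
  assumes m: "m \<in> Hom (Ch A) P P'" and P: "\<And>i. torsionfree f (trm P i)" "\<And>i. torsionfree f (trm P' i)"
  shows "D.square (far N (Q m)) (\<kappa> P) (\<kappa> P') (Q (far (eta_functor A f) m))"
proof -
  have mT: "m \<in> Hom (ChTf A f) P P'" using assms by (simp add: ChTf_Hom)
  have o: "P \<in> Obj (ChTf A f)" "P' \<in> Obj (ChTf A f)" using R.Hom_Obj[OF m] P by simp_all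
  have d: "m \<in> Arr (ChTf A f)" "Dom (ChTf A f) m = P" "Cod (ChTf A f) m = P'" using mT by (simp_all add: Hom_def)
  show ?thesis
    using nat_trans_square[OF category_DA NQ Q\<eta> N_facts(2) d(1), unfolded d(2,3), OF o] by simp
qed

lemma \<epsilon>_Hom: "is_cplx A P \<Longrightarrow> \<epsilon> P \<in> Hom D (fob T P) (tensor_cplx g P)"
  using nat_trans_Hom[OF T_facts(2), of P] by simp

lemma \<epsilon>_iso:
  assumes "is_cplx A P" "\<And>i. torsionfree g (trm P i)"
  shows "D.iso (fob T P) (tensor_cplx g P) (\<epsilon> P)"
  using \<epsilon>_Hom[OF assms(1)] left_derived_dtensor(2)[OF g assms] by (simp add: D.iso_def)

lemma \<epsilon>_square:
  assumes m: "m \<in> Hom (Ch A) P P'"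
  shows "D.square (far T (Q m)) (\<epsilon> P) (\<epsilon> P') (Q (far (tensor_functor g) m))"
proof -
  have d: "m \<in> Arr (Ch A)" "Dom (Ch A) m = P" "Cod (Ch A) m = P'" using m by (simp_all add: Hom_def)
  show ?thesis
    using nat_trans_square[OF category_DA TQ Q_tensor T_facts(2) d(1), unfolded d(2,3), OF R.Hom_Obj[OF m]] by simp
qed

lemma functor_fid: "is_functor D D fid"
  using D.Arr_Hom by (auto simp: is_functor_def fid_def)

lemma u_Hom: "is_cplx A X \<Longrightarrow> u X \<in> Hom D X (fob T X)"
  using nat_trans_Hom[OF T_facts(3), of X] by (simp add: fid_def)

lemma u_square:
  assumes m: "m \<in> Hom D X Y"
  shows "D.square m (u X) (u Y) (far T m)"
proof -
  have d: "m \<in> Arr D" "Dom D m = X" "Cod D m = Y" using m by (simp_all add: Hom_def)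
  show ?thesis
    using nat_trans_square[OF category_DA functor_fid T_facts(1,3) d(1), unfolded d(2,3), OF D.Hom_Obj[OF m]]
    by (simp add: fid_def)
qed

lemma \<eta>_S:
  assumes "P \<in> S"
  shows "is_cplx A (\<eta> P)" "torsionfree g (trm (\<eta> P) i)"
proof -
  interpret torsionfree_complex A P f by (rule torsionfree_complexI[OF S_D(1)[OF assms] fA S_D(2)[OF assms]])
  show "is_cplx A (\<eta> P)" by (rule cplx_eta)
  show "torsionfree g (trm (\<eta> P) i)" by (rule torsionfree_eta[OF S_D(3)[OF assms] gA])
qed

lemma K_cplx:
  assumes "is_cplx A X"
  shows "is_cplx A (K X)" "(\<And>i. torsionfree h (trm X i)) \<Longrightarrow> torsionfree h (trm (K X) i)"
    "koszul_proj g X \<in> Hom (Ch A) (K X) (tensor_cplx g X)"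
    "koszul_unit g X \<in> Hom (Ch A) X (K X)"
    "(\<And>i. torsionfree g (trm X i)) \<Longrightarrow> koszul_proj g X \<in> qis A"
    "Cmp (Ch A) (koszul_proj g X) (koszul_unit g X) = tensor_proj g X"
proof -
  interpret reduction A X g by (rule reductionI[OF assms gA])
  show "is_cplx A (K X)" by (rule cplx_koszul)
  show "(\<And>i. torsionfree h (trm X i)) \<Longrightarrow> torsionfree h (trm (K X) i)" by (rule torsionfree_koszul)
  show "koszul_proj g X \<in> Hom (Ch A) (K X) (tensor_cplx g X)"
    using chmap_koszul_proj by (simp add: koszul_proj_def Ch_HomI)
  show "koszul_unit g X \<in> Hom (Ch A) X (K X)"
    using chmap_koszul_unit by (simp add: koszul_unit_def Ch_HomI)
  show "(\<And>i. torsionfree g (trm X i)) \<Longrightarrow> koszul_proj g X \<in> qis A" by (rule qis_koszul_proj)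
  show "Cmp (Ch A) (koszul_proj g X) (koszul_unit g X) = tensor_proj g X" by (rule koszul_proj_unit)
qed

lemma koszul_eta_Hom:
  assumes "P \<in> S"
  shows "koszul_eta A f g P \<in> Hom (Ch A) (K (\<eta> P)) (\<eta> (K P))"
proof -
  interpret k: koszul_eta_complex A P f g
    by (rule koszul_eta_complexI[OF S_D(1)[OF assms] fA gA S_D(2)[OF assms]])
  show ?thesis using k.chmap_koszul_eta unfolding koszul_eta_def by (rule Ch_HomI)
qed

text \<open>
  On \<open>S\<close>, the two identifications that the base change map has to be compatible with are invertible, so
  the map is forced. It is the composite of \<open>proj_inv P : N(P) \<otimes>\<^sup>L A/g \<cong> \<eta>\<^sub>f(P) \<otimes> B\<close>, of the
  comparison of Koszul complexes, and of \<open>right P : \<eta>\<^sub>f(P \<otimes> B) \<cong> N(P \<otimes> A/g) \<cong> N(P \<otimes>\<^sup>L A/g)\<close>.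
\<close>

definition left_cmp :: "('a, 'b) cplx \<Rightarrow> ('a, 'b) darr" where
  "left_cmp P = \<epsilon> (\<eta> P) \<bullet> far T (\<kappa> P)"

definition proj_inv :: "('a, 'b) cplx \<Rightarrow> ('a, 'b) darr" where
  "proj_inv P = inverse_arr D (Q (koszul_proj g (\<eta> P))) \<bullet> left_cmp P"

definition right :: "('a, 'b) cplx \<Rightarrow> ('a, 'b) darr" where
  "right P = far N (Q (koszul_proj g P)) \<bullet> inverse_arr D (\<kappa> (K P))"

definition \<tau> :: "('a, 'b) cplx \<Rightarrow> ('a, 'b) darr" where
  "\<tau> P = inverse_arr D (far N (\<epsilon> P)) \<bullet> ((right P \<bullet> Q (koszul_eta A f g P)) \<bullet> proj_inv P)"

lemma left_cmp_iso:
  assumes P: "P \<in> S"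
  shows "D.iso (fob T (fob N P)) (tensor_cplx g (\<eta> P)) (left_cmp P)"
  unfolding left_cmp_def
  by (rule D.iso_Cmp(1)[OF functor_iso(1)[OF category_DA category_DA T_facts(1)
        \<kappa>_iso[OF S_D(1,2)[OF P]]] \<epsilon>_iso[OF \<eta>_S[OF P]]])

lemma proj_\<eta>_iso:
  assumes P: "P \<in> S"
  shows "D.iso (K (\<eta> P)) (tensor_cplx g (\<eta> P)) (Q (koszul_proj g (\<eta> P)))"
  by (rule toD_iso[OF K_cplx(3,5)[OF \<eta>_S(1)[OF P]]]) (rule \<eta>_S(2)[OF P])

lemma proj_inv_iso: "P \<in> S \<Longrightarrow> D.iso (fob T (fob N P)) (K (\<eta> P)) (proj_inv P)"
  unfolding proj_inv_def by (rule D.iso_Cmp(1)[OF left_cmp_iso D.iso_inverse(5)[OF proj_\<eta>_iso]])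

lemma N_proj_iso: "P \<in> S \<Longrightarrow> D.iso (fob N (K P)) (fob N (tensor_cplx g P)) (far N (Q (koszul_proj g P)))"
  by (rule functor_iso(1)[OF category_DA category_DA N_facts(1) toD_iso[OF K_cplx(3,5)]]) (auto simp: S_simps)

lemma \<kappa>K_iso: "P \<in> S \<Longrightarrow> D.iso (fob N (K P)) (\<eta> (K P)) (\<kappa> (K P))"
  by (rule \<kappa>_iso[OF K_cplx(1,2)]) (auto simp: S_simps)

lemma right_iso: "P \<in> S \<Longrightarrow> D.iso (\<eta> (K P)) (fob N (tensor_cplx g P)) (right P)"
  unfolding right_def by (rule D.iso_Cmp(1)[OF D.iso_inverse(5)[OF \<kappa>K_iso] N_proj_iso])

lemma N\<epsilon>_iso: "P \<in> S \<Longrightarrow> D.iso (fob N (fob T P)) (fob N (tensor_cplx g P)) (far N (\<epsilon> P))"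
  by (rule functor_iso(1)[OF category_DA category_DA N_facts(1) \<epsilon>_iso]) (auto simp: S_simps)

lemma right_eta_Hom: "P \<in> S \<Longrightarrow>
    right P \<bullet> Q (koszul_eta A f g P) \<in> Hom D (K (\<eta> P)) (fob N (tensor_cplx g P))"
  by (rule D.Cmp_Hom[OF Q_Hom[OF koszul_eta_Hom] D.iso_inverse(1)[OF right_iso]])

lemma \<tau>_Hom: "P \<in> S \<Longrightarrow> \<tau> P \<in> Hom D (fob T (fob N P)) (fob N (fob T P))"
  unfolding \<tau>_def
  by (rule D.Cmp_Hom[OF D.Cmp_Hom[OF D.iso_inverse(1)[OF proj_inv_iso] right_eta_Hom] D.iso_inverse(2)[OF N\<epsilon>_iso]])

lemma N\<epsilon>_\<tau>: "P \<in> S \<Longrightarrow> far N (\<epsilon> P) \<bullet> \<tau> P = (right P \<bullet> Q (koszul_eta A f g P)) \<bullet> proj_inv P"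
  unfolding \<tau>_def
  by (rule D.Cmp_inverse_left'[OF N\<epsilon>_iso D.Cmp_Hom[OF D.iso_inverse(1)[OF proj_inv_iso] right_eta_Hom]])

lemma \<tau>_iso:
  assumes "P \<in> S" "koszul_eta A f g P \<in> qis A"
  shows "is_iso_arr D (\<tau> P)"
proof -
  have "D.iso (K (\<eta> P)) (\<eta> (K P)) (Q (koszul_eta A f g P))"
    by (rule toD_iso[OF koszul_eta_Hom[OF assms(1)] assms(2)])
  from D.iso_Cmp(1)[OF this right_iso[OF assms(1)]]
  have "D.iso (fob T (fob N P)) (fob N (tensor_cplx g P)) ((right P \<bullet> Q (koszul_eta A f g P)) \<bullet> proj_inv P)"
    by (rule D.iso_Cmp(1)[OF proj_inv_iso[OF assms(1)]])
  from D.iso_Cmp(1)[OF this D.iso_inverse(5)[OF N\<epsilon>_iso[OF assms(1)]]]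
  show ?thesis by (simp add: \<tau>_def D.iso_def)
qed

text \<open>
  All factors of \<open>\<tau>\<close> are natural or inverses of natural isomorphisms, so the square of \<open>\<tau>\<close> is pasted
  from theirs.
\<close>

lemma \<tau>_square:
  assumes P: "P \<in> S" "P' \<in> S" and m: "m \<in> Hom (Ch A) P P'"
  shows "D.square (far T (far N (Q m))) (\<tau> P) (\<tau> P') (far N (far T (Q m)))"
proof -
  note f1 = S_D(2)[OF P(1)] and f2 = S_D(2)[OF P(2)]
  let ?\<eta>m = "far (eta_functor A f) m" and ?Km = "far (koszul_functor g) m"
  let ?K\<eta>m = "far (koszul_functor g) ?\<eta>m"
  have mT: "m \<in> Hom (ChTf A f) P P'" using m f1 f2 by (simp add: ChTf_Hom)
  have \<eta>m: "?\<eta>m \<in> Hom (Ch A) (\<eta> P) (\<eta> P')" using functor_Hom[OF functor_eta[OF fA] mT] by simp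
  have Km: "?Km \<in> Hom (Ch A) (K P) (K P')" by (rule chmap_koszul_map[OF m gA])
  have K\<eta>m: "?K\<eta>m \<in> Hom (Ch A) (K (\<eta> P)) (K (\<eta> P'))" by (rule chmap_koszul_map[OF \<eta>m gA])
  note Kf = K_cplx(2)[OF S_D(1)[OF P(1)] f1] K_cplx(2)[OF S_D(1)[OF P(2)] f2]
  have KmT: "?Km \<in> Hom (ChTf A f) (K P) (K P')" using Km Kf by (simp add: ChTf_Hom)
  have \<eta>Km: "far (eta_functor A f) ?Km \<in> Hom (Ch A) (\<eta> (K P)) (\<eta> (K P'))"
    using functor_Hom[OF functor_eta[OF fA] KmT] by simp
  have tm: "far (tensor_functor g) m \<in> Hom (Ch A) (tensor_cplx g P) (tensor_cplx g P')"
    using functor_Hom[OF functor_tensor[OF gA] m] by simp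
  have t\<eta>m: "far (tensor_functor g) ?\<eta>m \<in> Hom (Ch A) (tensor_cplx g (\<eta> P)) (tensor_cplx g (\<eta> P'))"
    using functor_Hom[OF functor_tensor[OF gA] \<eta>m] by simp
  note sQ = functor_square[OF category_Ch category_DA functor_toD]
  note sN = functor_square[OF category_DA category_DA N_facts(1)]
  note sT = functor_square[OF category_DA category_DA T_facts(1)]
  have left: "D.square (far T (far N (Q m))) (left_cmp P) (left_cmp P') (Q (far (tensor_functor g) ?\<eta>m))"
    unfolding left_cmp_def by (rule D.square_paste[OF sT[OF \<kappa>_square[OF m f1 f2]] \<epsilon>_square[OF \<eta>m]])
  have "R.square ?K\<eta>m (koszul_proj g (\<eta> P)) (koszul_proj g (\<eta> P')) (far (tensor_functor g) ?\<eta>m)"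
    by (rule R.squareI[OF K\<eta>m t\<eta>m K_cplx(3)[OF \<eta>_S(1)[OF P(1)]] K_cplx(3)[OF \<eta>_S(1)[OF P(2)]]
          koszul_proj_nat[OF \<eta>m gA]])
  from D.square_inverse[OF sQ[OF this]] proj_\<eta>_iso[OF P(1)] proj_\<eta>_iso[OF P(2)]
  have proj: "D.square (Q (far (tensor_functor g) ?\<eta>m)) (inverse_arr D (Q (koszul_proj g (\<eta> P))))
      (inverse_arr D (Q (koszul_proj g (\<eta> P')))) (Q ?K\<eta>m)"
    by (simp add: D.iso_def)
  have "R.square ?K\<eta>m (koszul_eta A f g P) (koszul_eta A f g P') (far (eta_functor A f) ?Km)"
    by (rule R.squareI[OF K\<eta>m \<eta>Km koszul_eta_Hom[OF P(1)] koszul_eta_Hom[OF P(2)]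
          koszul_eta_nat[OF m fA gA f1 f2]])
  note ke = sQ[OF this]
  have "D.square (Q (far (eta_functor A f) ?Km)) (inverse_arr D (\<kappa> (K P))) (inverse_arr D (\<kappa> (K P'))) (far N (Q ?Km))"
    using D.square_inverse[OF \<kappa>_square[OF Km Kf]] \<kappa>K_iso[OF P(1)] \<kappa>K_iso[OF P(2)] by (simp add: D.iso_def)
  moreover have "R.square ?Km (koszul_proj g P) (koszul_proj g P') (far (tensor_functor g) m)"
    by (rule R.squareI[OF Km tm K_cplx(3)[OF S_D(1)[OF P(1)]] K_cplx(3)[OF S_D(1)[OF P(2)]]
          koszul_proj_nat[OF m gA]])
  ultimately have right: "D.square (Q (far (eta_functor A f) ?Km)) (right P) (right P') (far N (Q (far (tensor_functor g) m)))"
    unfolding right_def using D.square_paste sN[OF sQ] by blast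
  have "D.square (far N (Q (far (tensor_functor g) m))) (inverse_arr D (far N (\<epsilon> P)))
      (inverse_arr D (far N (\<epsilon> P'))) (far N (far T (Q m)))"
    using D.square_inverse[OF sN[OF \<epsilon>_square[OF m]]] N\<epsilon>_iso[OF P(1)] N\<epsilon>_iso[OF P(2)] by (simp add: D.iso_def)
  with D.square_paste[OF D.square_paste[OF left proj] D.square_paste[OF ke right]]
  show ?thesis unfolding \<tau>_def proj_inv_def by (rule D.square_paste)
qed

text \<open>
  Both sides are computed by way of the units of the Koszul complexes: \<open>\<eta>\<^sub>f(P) \<rightarrow> \<eta>\<^sub>f(P) \<otimes> B\<close> followed by
  the comparison map is \<open>\<eta>\<^sub>f\<close> of \<open>P \<rightarrow> P \<otimes> B\<close>.
\<close>

lemma \<tau>_unit: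
  assumes P: "P \<in> S"
  shows "\<tau> P \<bullet> u (fob N P) = far N (u P)"
proof -
  note c = S_D(1)[OF P] and tf = S_D(2)[OF P]
  note \<eta>c = \<eta>_S(1)[OF P]
  let ?ku = "koszul_unit g P" and ?ku\<eta> = "koszul_unit g (\<eta> P)"
  let ?kp = "koszul_proj g P" and ?kp\<eta> = "koszul_proj g (\<eta> P)" and ?ke = "koszul_eta A f g P"
  note \<kappa> = D.iso_inverse(1)[OF \<kappa>_iso[OF c tf]]
  have NPc: "is_cplx A (fob N P)" using D.Hom_Obj[OF \<kappa>] by simp
  note uN = u_Hom[OF NPc] and T\<kappa> = functor_Hom[OF T_facts(1) \<kappa>] and \<epsilon>\<eta> = \<epsilon>_Hom[OF \<eta>c]
  note ku\<eta> = Q_Hom[OF K_cplx(4)[OF \<eta>c]] and kp\<eta> = Q_Hom[OF K_cplx(3)[OF \<eta>c]]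
  have "left_cmp P \<bullet> u (fob N P) = \<epsilon> (\<eta> P) \<bullet> (far T (\<kappa> P) \<bullet> u (fob N P))"
    unfolding left_cmp_def by (rule D.Cmp_assoc[OF uN T\<kappa> \<epsilon>\<eta>])
  also have "\<dots> = \<epsilon> (\<eta> P) \<bullet> (u (\<eta> P) \<bullet> \<kappa> P)"
    using D.square_Cmp[OF u_square[OF \<kappa>]] by simp
  also have "\<dots> = Q (tensor_proj g (\<eta> P)) \<bullet> \<kappa> P"
    unfolding D.Cmp_assoc[OF \<kappa> u_Hom[OF \<eta>c] \<epsilon>\<eta>, symmetric] T_facts(4)[OF \<eta>c] ..
  also have "\<dots> = Q ?kp\<eta> \<bullet> (Q ?ku\<eta> \<bullet> \<kappa> P)"
    unfolding K_cplx(6)[OF \<eta>c, symmetric] Q_Cmp[OF K_cplx(4)[OF \<eta>c] K_cplx(3)[OF \<eta>c]]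
    by (rule D.Cmp_assoc[OF \<kappa> ku\<eta> kp\<eta>])
  finally have "proj_inv P \<bullet> u (fob N P) = inverse_arr D (Q ?kp\<eta>) \<bullet> (Q ?kp\<eta> \<bullet> (Q ?ku\<eta> \<bullet> \<kappa> P))"
    unfolding proj_inv_def
    using D.Cmp_assoc[OF uN D.iso_inverse(1)[OF left_cmp_iso[OF P]] D.iso_inverse(2)[OF proj_\<eta>_iso[OF P]]] by simp
  then have 1: "proj_inv P \<bullet> u (fob N P) = Q ?ku\<eta> \<bullet> \<kappa> P"
    using D.Cmp_inverse_left[OF proj_\<eta>_iso[OF P] D.Cmp_Hom[OF \<kappa> ku\<eta>]] by simp
  note ke = Q_Hom[OF koszul_eta_Hom[OF P]]
  note ku = K_cplx(4)[OF c] and Kt = K_cplx(2)[OF c tf]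
  have 2: "Q ?ke \<bullet> (Q ?ku\<eta> \<bullet> \<kappa> P) = \<kappa> (K P) \<bullet> far N (Q ?ku)"
  proof -
    have "Q ?ke \<bullet> (Q ?ku\<eta> \<bullet> \<kappa> P) = Q (Cmp (Ch A) ?ke ?ku\<eta>) \<bullet> \<kappa> P"
      unfolding Q_Cmp[OF K_cplx(4)[OF \<eta>c] koszul_eta_Hom[OF P]] by (rule D.Cmp_assoc[OF \<kappa> ku\<eta> ke, symmetric])
    also have "\<dots> = Q (far (eta_functor A f) ?ku) \<bullet> \<kappa> P"
      unfolding koszul_eta_unit[OF c fA gA tf] ..
    also have "\<dots> = \<kappa> (K P) \<bullet> far N (Q ?ku)"
      by (rule D.square_Cmp[OF \<kappa>_square[OF ku tf Kt], symmetric])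
    finally show ?thesis .
  qed
  note Nku = functor_Hom[OF N_facts(1) Q_Hom[OF ku]]
  note N\<kappa> = D.iso_inverse(1)[OF \<kappa>K_iso[OF P]] D.iso_inverse(2)[OF \<kappa>K_iso[OF P]]
  note Nkp = D.iso_inverse(1)[OF N_proj_iso[OF P]]
  have 3: "right P \<bullet> (\<kappa> (K P) \<bullet> far N (Q ?ku)) = far N (\<epsilon> P) \<bullet> far N (u P)"
  proof -
    have "right P \<bullet> (\<kappa> (K P) \<bullet> far N (Q ?ku)) =
        far N (Q ?kp) \<bullet> (inverse_arr D (\<kappa> (K P)) \<bullet> (\<kappa> (K P) \<bullet> far N (Q ?ku)))"
      unfolding right_def by (rule D.Cmp_assoc[OF D.Cmp_Hom[OF Nku N\<kappa>(1)] N\<kappa>(2) Nkp])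
    also have "\<dots> = far N (Q ?kp) \<bullet> far N (Q ?ku)"
      unfolding D.Cmp_inverse_left[OF \<kappa>K_iso[OF P] Nku] ..
    also have "\<dots> = far N (Q (tensor_proj g P))"
      unfolding K_cplx(6)[OF c, symmetric] Q_Cmp[OF ku K_cplx(3)[OF c]]
      by (rule functor_Cmp[OF N_facts(1) Q_Hom[OF ku] Q_Hom[OF K_cplx(3)[OF c]], symmetric])
    also have "\<dots> = far N (\<epsilon> P) \<bullet> far N (u P)"
      unfolding T_facts(4)[OF c, symmetric] by (rule functor_Cmp[OF N_facts(1) u_Hom[OF c] \<epsilon>_Hom[OF c]])
    finally show ?thesis .
  qed
  note pu = D.Cmp_Hom[OF \<kappa> ku\<eta>]
  note N\<epsilon> = D.iso_inverse(1)[OF N\<epsilon>_iso[OF P]]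
  have "far N (\<epsilon> P) \<bullet> (\<tau> P \<bullet> u (fob N P)) = ((right P \<bullet> Q ?ke) \<bullet> proj_inv P) \<bullet> u (fob N P)"
    unfolding N\<epsilon>_\<tau>[OF P, symmetric] by (rule D.Cmp_assoc[OF uN \<tau>_Hom[OF P] N\<epsilon>, symmetric])
  also have "\<dots> = (right P \<bullet> Q ?ke) \<bullet> (Q ?ku\<eta> \<bullet> \<kappa> P)"
    unfolding 1[symmetric]
    by (rule D.Cmp_assoc[OF uN D.iso_inverse(1)[OF proj_inv_iso[OF P]] right_eta_Hom[OF P]])
  also have "\<dots> = right P \<bullet> (\<kappa> (K P) \<bullet> far N (Q ?ku))"
    unfolding 2[symmetric] by (rule D.Cmp_assoc[OF pu ke D.iso_inverse(1)[OF right_iso[OF P]]])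
  also have "\<dots> = far N (\<epsilon> P) \<bullet> far N (u P)" by (rule 3)
  finally show ?thesis
    by (rule D.iso_cancel_left[OF N\<epsilon>_iso[OF P] D.Cmp_Hom[OF uN \<tau>_Hom[OF P]]
          functor_Hom[OF N_facts(1) u_Hom[OF c]]])
qed

lemma functor_TN: "is_functor D D (funct_comp T N)" and functor_NT: "is_functor D D (funct_comp N T)"
  by (rule is_functor_comp[OF N_facts(1) T_facts(1)] is_functor_comp[OF T_facts(1) N_facts(1)])+

lemma base_change_map:
  obtains \<alpha> where "nat_trans D D (funct_comp T N) (funct_comp N T) \<alpha>" "\<And>P. P \<in> S \<Longrightarrow> \<alpha> P = \<tau> P"
    "\<And>X. is_cplx A X \<Longrightarrow> is_iso_arr D (\<tau> (resolution A X)) \<Longrightarrow> is_iso_arr D (\<alpha> X)"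
proof -
  note F = functor_TN and G = functor_NT
  obtain \<alpha> where "nat_trans D D (funct_comp T N) (funct_comp N T) \<alpha>" "\<And>P. P \<in> S \<Longrightarrow> \<alpha> P = \<tau> P"
    "\<And>X. X \<in> Obj (Ch A) \<Longrightarrow> is_iso_arr D (\<tau> (fob (resolution_functor A) X)) \<Longrightarrow> is_iso_arr D (\<alpha> X)"
  proof (rule R.nat_trans_extend[folded DA_def toD_def, OF category_DA F G])
    show "\<tau> P \<in> Hom D (fob (funct_comp T N) P) (fob (funct_comp N T) P)" if "P \<in> S" for P
      using \<tau>_Hom[OF that] by simp
    show "D.square (far (funct_comp T N) (Q m)) (\<tau> P) (\<tau> P') (far (funct_comp N T) (Q m))"
      if "P \<in> S" "P' \<in> S" "m \<in> Hom (Ch A) P P'" for m P P'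
      using \<tau>_square[OF that] by simp
  qed blast
  then show ?thesis using that by simp
qed

text \<open>
  Both sides are natural in \<open>X\<close>, so they agree as soon as they agree on \<open>S\<close>.
\<close>

lemma unit_compatible:
  assumes \<alpha>: "nat_trans D D (funct_comp T N) (funct_comp N T) \<alpha>" and \<tau>: "\<And>P. P \<in> S \<Longrightarrow> \<alpha> P = \<tau> P"
    and X: "is_cplx A X"
  shows "\<alpha> X \<bullet> u (fob N X) = far N (u X)"
proof -
  let ?l = "\<lambda>X \<in> Obj D. \<alpha> X \<bullet> u (fob N X)" and ?r = "\<lambda>X \<in> Obj D. far N (u X)"
  have Nc: "is_cplx A (fob N X)" if "is_cplx A X" for X
    using functor_Obj[OF N_facts(1), of X] that by simp
  have \<alpha>H: "\<alpha> X \<in> Hom D (fob T (fob N X)) (fob N (fob T X))" if "is_cplx A X" for X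
    using nat_trans_Hom[OF \<alpha>, of X] that by simp
  have Nu: "far N (u X) \<in> Hom D (fob N X) (fob N (fob T X))" if "is_cplx A X" for X
    by (rule functor_Hom[OF N_facts(1) u_Hom[OF that]])
  have l: "nat_trans D D N (funct_comp N T) ?l"
    unfolding nat_trans_def
  proof (intro conjI ballI)
    fix m assume m: "m \<in> Arr D"
    have "D.square (far (funct_comp T N) m) (\<alpha> (Dom D m)) (\<alpha> (Cod D m)) (far (funct_comp N T) m)"
      by (rule nat_trans_square[OF category_DA functor_TN functor_NT \<alpha> m D.Dom_Obj[OF m] D.Cod_Obj[OF m]])
    from D.square_paste[OF u_square[OF functor_Hom[OF N_facts(1) D.Arr_Hom[OF m]]] this[unfolded far_comp]]
    show "?l (Cod D m) \<bullet> far N m = far (funct_comp N T) m \<bullet> ?l (Dom D m)"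
      using D.square_Cmp D.Dom_Obj[OF m] D.Cod_Obj[OF m] by simp
  qed (use D.Cmp_Hom[OF u_Hom[OF Nc] \<alpha>H] in simp_all)
  have r: "nat_trans D D N (funct_comp N T) ?r"
    unfolding nat_trans_def
  proof (intro conjI ballI)
    fix m assume m: "m \<in> Arr D"
    show "?r (Cod D m) \<bullet> far N m = far (funct_comp N T) m \<bullet> ?r (Dom D m)"
      using D.square_Cmp[OF functor_square[OF category_DA category_DA N_facts(1) u_square[OF D.Arr_Hom[OF m]]]]
        D.Dom_Obj[OF m] D.Cod_Obj[OF m] by simp
  qed (use Nu in simp_all)
  have "?l = ?r"
  proof (rule R.nat_trans_eqI[folded DA_def, OF category_DA N_facts(1) functor_NT l r])
    fix P assume P: "P \<in> S"
    then show "?l P = ?r P" using \<tau>_unit[OF P] \<tau>[OF P] S_D(1)[OF P] by simp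
  qed
  from fun_cong[OF this, of X] X show ?thesis by simp
qed

lemma identifications_compatible:
  assumes P: "P \<in> S"
  shows "far N (\<epsilon> P) \<bullet> (\<tau> P \<bullet> (inverse_arr D (left_cmp P) \<bullet> Q (koszul_proj g (\<eta> P)))) =
    right P \<bullet> Q (koszul_eta A f g P)"
proof -
  note l = D.iso_inverse[OF left_cmp_iso[OF P]] and p = D.iso_inverse[OF proj_\<eta>_iso[OF P]]
  let ?i = "inverse_arr D (left_cmp P) \<bullet> Q (koszul_proj g (\<eta> P))"
  have i: "?i \<in> Hom D (K (\<eta> P)) (fob T (fob N P))" by (rule D.Cmp_Hom[OF p(1) l(2)])
  have pi: "proj_inv P \<bullet> ?i = Idn D (K (\<eta> P))"
  proof -
    have "proj_inv P \<bullet> ?i = inverse_arr D (Q (koszul_proj g (\<eta> P))) \<bullet> (left_cmp P \<bullet> ?i)"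
      unfolding proj_inv_def by (rule D.Cmp_assoc[OF i l(1) p(2)])
    then show ?thesis unfolding D.Cmp_inverse_left'[OF left_cmp_iso[OF P] p(1)] p(3) .
  qed
  have "far N (\<epsilon> P) \<bullet> (\<tau> P \<bullet> ?i) = ((right P \<bullet> Q (koszul_eta A f g P)) \<bullet> proj_inv P) \<bullet> ?i"
    unfolding N\<epsilon>_\<tau>[OF P, symmetric] by (rule D.Cmp_assoc[OF i \<tau>_Hom[OF P] D.iso_inverse(1)[OF N\<epsilon>_iso[OF P]], symmetric])
  also have "\<dots> = (right P \<bullet> Q (koszul_eta A f g P)) \<bullet> Idn D (K (\<eta> P))"
    unfolding pi[symmetric] by (rule D.Cmp_assoc[OF i D.iso_inverse(1)[OF proj_inv_iso[OF P]] right_eta_Hom[OF P]])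
  finally show ?thesis unfolding D.Idn_right[OF right_eta_Hom[OF P]] .
qed

text \<open>
  The hypothesis on \<open>H\<^sup>*(X \<otimes>\<^sup>L A/f)\<close> is transported to \<open>H\<^sup>*(P/f)\<close> for the resolution \<open>P\<close> of \<open>X\<close>.
\<close>

lemma \<tau>_resolution_iso:
  assumes X: "is_cplx A X" and t: "\<And>i. torsionfree g (cohomology (fob (dtensor A f) X) i)"
  shows "is_iso_arr D (\<tau> (resolution A X))"
proof -
  let ?P = "resolution A X" and ?Tf = "dtensor A f :: ('a, 'b) dfunct"
  have P: "?P \<in> S" using resolution_proj_simps(3,4)[OF X] f g by (simp add: S_simps)
  interpret k: koszul_eta_complex A ?P f g
    by (rule koszul_eta_complexI[OF S_D(1)[OF P] fA gA S_D(2)[OF P]])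
  note Tf = dtensor_simps[OF f, where 'b = 'b]
  have "D.iso ?P X (Q (resolution_proj A X))"
    by (rule toD_iso[OF resolution_proj_simps(1,2)[OF X]])
  note i1 = D.iso_inverse(5)[OF functor_iso(1)[OF category_DA category_DA Tf(1) this]]
  have i2: "D.iso (fob ?Tf ?P) (tensor_cplx f ?P) (dtensor_cmp A f ?P)"
    using nat_trans_Hom[OF Tf(2), of ?P] left_derived_dtensor(2)[OF f S_D(1)[OF P] S_D(2)[OF P]] S_D(1)[OF P]
    by (simp add: D.iso_def)
  have "torsionfree g (cohomology (tensor_cplx f ?P) i)" for i
    by (rule DA_iso_torsionfree[OF D.iso_Cmp(1)[OF i1 i2] gA t])
  then show ?thesis by (intro \<tau>_iso[OF P] k.qis_koszul_eta)
qed

end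

theorem lemma5p16:
  fixes A :: "('a, 'r) ring_scheme" and f g :: 'a
  assumes "cring A" and "nonzerodivisor A f" and "nonzerodivisor A g"
  shows "\<exists>\<alpha> :: ('a, 'b) cplx \<Rightarrow> ('a, 'b) darr.
    nat_trans (DA A) (DA A)
      (funct_comp (dtensor A g) (Leta A f)) (funct_comp (Leta A f) (dtensor A g)) \<alpha> \<and>
    is_base_change A f g \<alpha> \<and>
    (\<forall>K \<in> Obj (DA A).
       (\<forall>i. torsionfree g (cohomology (fob (dtensor A f) K) i)) \<longrightarrow> is_iso_arr (DA A) (\<alpha> K))"
proof -
  interpret base_change A f g "TYPE('b)" by (rule base_change.intro) fact+
  obtain \<alpha> where \<alpha>: "nat_trans D D (funct_comp T N) (funct_comp N T) \<alpha>" "\<And>P. P \<in> S \<Longrightarrow> \<alpha> P = \<tau> P"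
    "\<And>X. is_cplx A X \<Longrightarrow> is_iso_arr D (\<tau> (resolution A X)) \<Longrightarrow> is_iso_arr D (\<alpha> X)"
    by (rule base_change_map) (rule that)
  have "far N (\<epsilon> P) \<bullet> (\<alpha> P \<bullet> (inverse_arr D (\<epsilon> (\<eta> P) \<bullet> far T (\<kappa> P)) \<bullet> Q (koszul_proj g (\<eta> P)))) =
      (far N (Q (koszul_proj g P)) \<bullet> inverse_arr D (\<kappa> (K P))) \<bullet> Q (koszul_eta A f g P)" if "P \<in> S" for P
    using identifications_compatible[OF that] unfolding \<alpha>(2)[OF that] left_cmp_def right_def .
  then have "is_base_change A f g \<alpha>"
    unfolding is_base_change_def Let_def using unit_compatible[OF \<alpha>(1,2)] by (auto simp: S_simps)
  moreover have "is_iso_arr D (\<alpha> X)"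
    if "is_cplx A X" "\<And>i. torsionfree g (cohomology (fob (dtensor A f) X) i)" for X
    by (rule \<alpha>(3)[OF that(1) \<tau>_resolution_iso[OF that]])
  ultimately show ?thesis using \<alpha>(1) by (intro exI[of _ \<alpha>]) simp
qed

end
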